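(* Assume the setting of the context, in particular that $(\mathcal D(A),A)$ is a weak generator of $(P_s)_s$, that $\Psi^1,\dots,\Psi^d\in\mathcal D(A)$ satisfy: for each $i$, $\Psi^i,A(\Psi^i)\in\mathcal L^2_{uni}$, $(\Psi^i)^2\in\mathcal D(A)$, and $\Gamma(\Psi^i,\Psi^i)$ is bounded; and that $(f,\xi)$ satisfy hypothesis (B). Then: 1. $IP(f,\xi)$ admits a unique solution $(Y,Z)\in\mathcal L^2_{uni}\times(L^2_{uni})^d$, uniqueness meaning that if $(Y,Z)$ and $(\bar Y,\bar Z)$ are two solutions then $Y$ and $\bar Y$ are identical and $Z=\bar Z$ q.s. In particular there is a unique decoupled mild solution $Y$ of the equation $A\Phi+f(\cdot,\cdot,\Phi,\Gamma(\Phi,\Psi))=0$ on $[0,T]\times\Omega$, $\Phi_T=\xi$. 2. For every $(s,\eta)$, let $(Y^{s,\eta},M^{s,\eta})$ be the solution of $BSDE^{s,\eta}(f,\xi)$ with driving martingale $N^{s,\eta}=M[\Psi]^{s,\eta}$. Then for every $(s,\eta)$, $Y_s(\eta)=Y^{s,\eta}_s$, and for each $1\le i\le d$ and every $(s,\eta)$, $Z^i=\frac{d\langle M^{s,\eta},M[\Psi^i]^{s,\eta}\rangle}{dV}$ $dV\otimes\mathbb P^{s,\eta}$-a.e.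
   Context: Let $E$ be a Polish space, $\Omega=\mathbb D(\mathbb R_+,E)$ (càdlàg paths, Skorokhod topology), $X_t(\omega)=\omega(t)$, $\mathcal F=\sigma(X_r,r\ge0)$, $\mathcal F^o_t=\sigma(X_r,r\le t)$, $\mathcal F_t=\bigcap_{u>t}\mathcal F^o_u$, $\mathbb F^o=(\mathcal F^o_t)_t$, $\mathcal{P}ro^o$ the $\mathbb F^o$-progressive $\sigma$-field, $\omega^t:=\omega(\cdot\wedge t)$. A path-dependent canonical class is a family $(\mathbb P^{s,\eta})_{(s,\eta)\in\mathbb R_+\times\Omega}$ of probabilities on $(\Omega,\mathcal F)$ with: $\mathbb P^{s,\eta}(\omega^s=\eta^s)=1$; $\eta\mapsto\mathbb P^{s,\eta}(F)$ is $\mathcal F^o_s$-measurable for $F\in\mathcal F$; and $\mathbb P^{s,\eta}(F|\mathcal F^o_t)(\omega)=\mathbb P^{t,\omega}(F)$ for $\mathbb P^{s,\eta}$-a.a. $\omega$, $t\ge s$. We assume the class is progressive ($(t,\omega)\mapsto\mathbb P^{t,\omega}(F)$ is $\mathbb F^o$-progressive for each $F$) and that $\mathbb P^{s,\eta}(F|\mathcal F_t)(\omega)=\mathbb P^{t,\omega}(F)$ $\mathbb P^{s,\eta}$-a.s. for all $t\ge s$, $F\in\mathcal F$. $P_s[\phi](\eta):=\mathbb E^{s,\eta}[\phi]$. $\mathcal F^{s,\eta}$, $\mathcal F^{s,\eta}_t$: completions by $\mathbb P^{s,\eta}$-null sets; $\mathbb F^{s,\eta}=(\mathcal F^{s,\eta}_t)$.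 Fix $T>0$ and $V:[0,T]\to\mathbb R_+$ continuous non-decreasing (processes/functions on $[0,T]$ are extended after $T$ by their value at $T$). Spaces: $\mathcal L^p(dV\otimes\mathbb P^{s,\eta})$: $(\mathcal F^{s,\eta}_t)_{t\in[s,T]}$-progressive $Y$ with $\mathbb E^{s,\eta}[\int_s^T|Y_r|^pdV_r]<\infty$; $\mathcal H^2_0(\mathbb P^{s,\eta})$: square integrable $(\mathbb P^{s,\eta},\mathbb F^{s,\eta})$-martingales vanishing on $[0,s]$; $\mathcal L^p_{uni}$: $\mathbb F^o$-progressive processes in $\mathcal L^p(dV\otimes\mathbb P^{s,\eta})$ for all $(s,\eta)\in[0,T]\times\Omega$. $C\in\mathcal{P}ro^o$ has zero potential if $\mathbb E^{s,\eta}[\int_s^T1_CdV]=0$ for all $(s,\eta)$; q.s. means outside a zero-potential set; $L^p_{uni}$ is $\mathcal L^p_{uni}$ modulo q.s. equality. MAFs: a path-dependent martingale additive functional (MAF) is a real random field $(M_{t,u})_{0\le t\le u}$ with $M_{t,u}$ $\mathcal F^o_u$-measurable and such that for each $(s,\eta)$ there is a càdlàg $(\mathbb P^{s,\eta},\mathbb F^{s,\eta})$-martingale $M^{s,\eta}$, zero on $[0,s]$ (its càdlàg version), with $M_{t,u}=M^{s,\eta}_u-M^{s,\eta}_t$ $\mathbb P^{s,\eta}$-a.s. for $s\le t\le u$. It is square integrable etc. if every $M^{s,\eta}$ is. Generator: $\mathcal D(A)$ is a linear space of $\mathbb F^o$-progressive real processes and $A$ a linear map from $\mathcal D(A)$ into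 $\mathbb F^o$-progressive processes such that for $\Phi\in\mathcal D(A)$: $\int_0^t|A\Phi_r(\omega)|dV_r<\infty$ for all $\omega,t$, and $\mathbb E^{s,\eta}[\int_s^t|A\Phi_r|dV_r]<\infty$, $\mathbb E^{s,\eta}|\Phi_t|<\infty$ for $t\ge s$. Every $\Phi\in\mathcal D(A)$ is constant after $T$ and $A\Phi=0$ on $]T,\infty[$. Weak generator: $P_s[\Phi_t](\eta)=\Phi_s(\eta)+\int_s^tP_s[A\Phi_r](\eta)dV_r$ for all $\Phi\in\mathcal D(A)$, $(s,\eta)$, $t\ge s$. Then for $\Phi\in\mathcal D(A)$, $M[\Phi]_{t,u}(\omega):=\Phi_u(\omega)-\Phi_t(\omega)-\int_t^uA\Phi_r(\omega)dV_r$ is a MAF; $M[\Phi]^{s,\eta}$ denotes its càdlàg version; $M[\Psi]=(M[\Psi^1],\dots,M[\Psi^d])$. For $\Phi,\Psi,\Phi\Psi\in\mathcal D(A)$: $\Gamma(\Phi,\Psi)=A(\Phi\Psi)-\Phi A\Psi-\Psi A\Phi$, componentwise for vectors. Hypothesis (B): $\xi$ is $\mathcal F_T$-measurable and in $L^2(\mathbb P^{s,\eta})$ for every $(s,\eta)$; $f:[0,T]\times\Omega\times\mathbb R\times\mathbb R^d\to\mathbb R$ is $\mathcal{P}ro^o\otimes\mathcal B(\mathbb R)\otimes\mathcal B(\mathbb R^d)$-measurable, $f(\cdot,\cdot,0,0)\in\mathcal L^2_{uni}$, and $|f(t,\omega,y',z')-f(t,\omega,y,z)|\le K(|y'-y|+\|z'-z\|)$.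 Angular bracket densities: if $M,N$ are square integrable MAFs with $\langle N^{s,\eta}\rangle$ absolutely continuous w.r.t. $dV$, there is an $\mathbb F^o$-progressive $k$ with $\langle M^{s,\eta},N^{s,\eta}\rangle=\int_s^{\cdot\vee s}k_rdV_r$ for all $(s,\eta)$; the notation $\frac{d\langle M^{s,\eta},N^{s,\eta}\rangle}{dV}$ denotes such a density. $BSDE^{s,\eta}(f,\xi)$ with driving $N^{s,\eta}=(N^{1,s,\eta},\dots,N^{d,s,\eta})$: find $(Y^{s,\eta},M^{s,\eta})\in\mathcal L^2(dV\otimes\mathbb P^{s,\eta})\times\mathcal H^2_0(\mathbb P^{s,\eta})$, $Y^{s,\eta}$ càdlàg, with $Y^{s,\eta}_t=\xi+\int_t^Tf(r,\cdot,Y^{s,\eta}_r,\frac{d\langle M^{s,\eta},N^{s,\eta}\rangle_r}{dV_r})dV_r-(M^{s,\eta}_T-M^{s,\eta}_t)$ on $[s,T]$ ($\mathbb P^{s,\eta}$-indistinguishability); under the hypotheses it has a unique solution. $IP(f,\xi)$: $(Y,Z)$ with $Y,Z^1,\dots,Z^d\in\mathcal L^2_{uni}$ such that for every $(s,\eta)\in[0,T]\times\Omega$: $Y_s(\eta)=P_s[\xi](\eta)+\int_s^TP_s[f(r,\cdot,Y_r,Z_r)](\eta)dV_r$ and for $1\le i\le d$, $(Y\Psi^i)_s(\eta)=P_s[\xi\Psi^i_T](\eta)-\int_s^TP_s[Z^i_r+Y_rA(\Psi^i)_r-\Psi^i_rf(r,\cdot,Y_r,Z_r)](\eta)dV_r$.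 A decoupled mild solution is a $Y$ for which some $Z$ makes $(Y,Z)$ a solution of $IP(f,\xi)$. *)

theory Defs
  imports "HOL-Analysis.Analysis" "HOL-Probability.Probability"
begin

type_synonym 'e path = "real \<Rightarrow> 'e"
type_synonym 'e proc = "real \<Rightarrow> 'e path \<Rightarrow> real"

text \<open>A path in D(R_+,E) is represented as a function on the reals that is constant
  equal to its value at 0 on the negative half-line.\<close>
definition cadlag_path :: "('e::topological_space) path \<Rightarrow> bool" where
  "cadlag_path \<omega> \<longleftrightarrow> (\<forall>t<0. \<omega> t = \<omega> 0) \<and>
     (\<forall>t\<ge>0. (\<omega> \<longlongrightarrow> \<omega> t) (at_right t) \<and> (\<exists>l. (\<omega> \<longlongrightarrow> l) (at_left t)))"

definition Omega :: "('e::topological_space) path set" where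
  "Omega = {\<omega>. cadlag_path \<omega>}"

definition FF :: "('e::topological_space) path measure" where
  "FF = sigma Omega {{\<omega>\<in>Omega. \<omega> r \<in> B} | r B. 0 \<le> r \<and> B \<in> sets borel}"

definition Fo :: "real \<Rightarrow> ('e::topological_space) path measure" where
  "Fo t = sigma Omega {{\<omega>\<in>Omega. \<omega> r \<in> B} | r B. 0 \<le> r \<and> r \<le> t \<and> B \<in> sets borel}"

definition Fp :: "real \<Rightarrow> ('e::topological_space) path measure" where
  "Fp t = sigma Omega (\<Inter>u\<in>{t<..}. sets (Fo u))"

text \<open>Progressive measurability of a real process w.r.t. a filtration G on a time set I
  (intervals starting at their minimum, e.g. [0,oo), [0,T], [s,T]).\<close>
definition progressive_on :: "real set \<Rightarrow> (real \<Rightarrow> 'a measure) \<Rightarrow> (real \<Rightarrow> 'a \<Rightarrow> real) \<Rightarrow> bool" where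
  "progressive_on I G X \<longleftrightarrow>
     (\<forall>t\<in>I. (\<lambda>(r,\<omega>). X r \<omega>) \<in> borel_measurable (restrict_space borel {r\<in>I. r \<le> t} \<Otimes>\<^sub>M G t))"

definition ProO :: "(real \<times> ('e::topological_space) path) measure" where
  "ProO = sigma ({0..} \<times> Omega)
     {C. C \<subseteq> {0..} \<times> Omega \<and>
         (\<forall>t\<ge>0. C \<inter> ({0..t} \<times> Omega) \<in> sets (restrict_space borel {0..t} \<Otimes>\<^sub>M Fo t))}"

definition canonical_class :: "(real \<Rightarrow> ('e::topological_space) path \<Rightarrow> 'e path measure) \<Rightarrow> bool" where
  "canonical_class P \<longleftrightarrow>
     (\<forall>s\<ge>0. \<forall>\<eta>\<in>Omega. prob_space (P s \<eta>) \<and> space (P s \<eta>) = Omega \<and> sets (P s \<eta>) = sets FF \<and>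
          (AE \<omega> in P s \<eta>. \<forall>r\<in>{0..s}. \<omega> r = \<eta> r)) \<and>
     (\<forall>s\<ge>0. \<forall>F\<in>sets FF. (\<lambda>\<eta>. measure (P s \<eta>) F) \<in> borel_measurable (Fo s)) \<and>
     (\<forall>s\<ge>0. \<forall>\<eta>\<in>Omega. \<forall>t\<ge>s. \<forall>F\<in>sets FF.
          AE \<omega> in P s \<eta>. real_cond_exp (P s \<eta>) (Fo t) (indicator F) \<omega> = measure (P t \<omega>) F)"

definition progressive_class :: "(real \<Rightarrow> ('e::topological_space) path \<Rightarrow> 'e path measure) \<Rightarrow> bool" where
  "progressive_class P \<longleftrightarrow>
     (\<forall>F\<in>sets FF. progressive_on {0..} Fo (\<lambda>t \<omega>. measure (P t \<omega>) F))"

definition right_cont_cond_class :: "(real \<Rightarrow> ('e::topological_space) path \<Rightarrow> 'e path measure) \<Rightarrow> bool" where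
  "right_cont_cond_class P \<longleftrightarrow>
     (\<forall>s\<ge>0. \<forall>\<eta>\<in>Omega. \<forall>t\<ge>s. \<forall>F\<in>sets FF.
          AE \<omega> in P s \<eta>. real_cond_exp (P s \<eta>) (Fp t) (indicator F) \<omega> = measure (P t \<omega>) F)"

definition Vmeas :: "real \<Rightarrow> (real \<Rightarrow> real) \<Rightarrow> real measure" where
  "Vmeas T V = interval_measure (\<lambda>t. V (max 0 (min t T)))"

definition Luni :: "(real \<Rightarrow> ('e::topological_space) path \<Rightarrow> 'e path measure) \<Rightarrow> real \<Rightarrow> (real \<Rightarrow> real)
                     \<Rightarrow> 'e proc \<Rightarrow> bool" where
  "Luni P T V X \<longleftrightarrow> progressive_on {0..T} Fo X \<and>
     (\<forall>s\<in>{0..T}. \<forall>\<eta>\<in>Omega.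
        (\<integral>\<^sup>+\<omega>. (\<integral>\<^sup>+r\<in>{s..T}. ennreal ((X r \<omega>)\<^sup>2) \<partial>Vmeas T V) \<partial>P s \<eta>) < \<infinity>)"

definition zero_potential :: "(real \<Rightarrow> ('e::topological_space) path \<Rightarrow> 'e path measure) \<Rightarrow> real \<Rightarrow> (real \<Rightarrow> real)
                     \<Rightarrow> (real \<times> 'e path) set \<Rightarrow> bool" where
  "zero_potential P T V C \<longleftrightarrow> C \<in> sets ProO \<and>
     (\<forall>s\<in>{0..T}. \<forall>\<eta>\<in>Omega.
        (\<integral>\<^sup>+\<omega>. (\<integral>\<^sup>+r\<in>{s..T}. indicator C (r,\<omega>) \<partial>Vmeas T V) \<partial>P s \<eta>) = 0)"

definition qs_eq :: "(real \<Rightarrow> ('e::topological_space) path \<Rightarrow> 'e path measure) \<Rightarrow> real \<Rightarrow> (real \<Rightarrow> real)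
                     \<Rightarrow> 'e proc \<Rightarrow> 'e proc \<Rightarrow> bool" where
  "qs_eq P T V X Y \<longleftrightarrow> (\<exists>C. zero_potential P T V C \<and>
     (\<forall>t\<in>{0..T}. \<forall>\<omega>\<in>Omega. (t,\<omega>) \<notin> C \<longrightarrow> X t \<omega> = Y t \<omega>))"

section \<open>Stochastic calculus under a fixed probability Q = P^{s,eta}\<close>

definition Fc :: "('e::topological_space) path measure \<Rightarrow> real \<Rightarrow> 'e path measure" where
  "Fc Q t = sigma Omega (sets (Fp t) \<union> null_sets (completion Q))"

definition cadlag_on :: "real set \<Rightarrow> (real \<Rightarrow> real) \<Rightarrow> bool" where
  "cadlag_on I g \<longleftrightarrow> (\<forall>t\<in>I. (g \<longlongrightarrow> g t) (at t within (I \<inter> {t<..})) \<and>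
                               (\<exists>l. (g \<longlongrightarrow> l) (at t within (I \<inter> {..<t}))))"

definition fv_on :: "real set \<Rightarrow> (real \<Rightarrow> real) \<Rightarrow> bool" where
  "fv_on I g \<longleftrightarrow> (\<exists>g1 g2. mono_on I g1 \<and> mono_on I g2 \<and> (\<forall>t\<in>I. g t = g1 t - g2 t))"

definition is_mart :: "('e::topological_space) path measure \<Rightarrow> real set \<Rightarrow> 'e proc \<Rightarrow> bool" where
  "is_mart Q I X \<longleftrightarrow>
     (\<forall>t\<in>I. integrable (completion Q) (X t) \<and> X t \<in> borel_measurable (Fc Q t)) \<and>
     (\<forall>t\<in>I. \<forall>u\<in>I. t \<le> u \<longrightarrow>
        (AE \<omega> in completion Q. real_cond_exp (completion Q) (Fc Q t) (X u) \<omega> = X t \<omega>))"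

definition is_H20 :: "('e::topological_space) path measure \<Rightarrow> real \<Rightarrow> real \<Rightarrow> 'e proc \<Rightarrow> bool" where
  "is_H20 Q s T M \<longleftrightarrow> is_mart Q {0..T} M \<and>
     (\<forall>t\<in>{0..T}. integrable (completion Q) (\<lambda>\<omega>. (M t \<omega>)\<^sup>2)) \<and>
     (AE \<omega> in completion Q. \<forall>t\<in>{0..s}. M t \<omega> = 0)"

definition Pred :: "('e::topological_space) path measure \<Rightarrow> real \<Rightarrow> real \<Rightarrow> (real \<times> 'e path) measure" where
  "Pred Q s T = sigma ({s..T} \<times> Omega)
     ({{s} \<times> F | F. F \<in> sets (Fc Q s)} \<union>
      {{a<..b} \<times> F | a b F. s \<le> a \<and> a \<le> b \<and> b \<le> T \<and> F \<in> sets (Fc Q a)})"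

definition is_angle_bracket :: "('e::topological_space) path measure \<Rightarrow> real \<Rightarrow> real
      \<Rightarrow> 'e proc \<Rightarrow> 'e proc \<Rightarrow> 'e proc \<Rightarrow> bool" where
  "is_angle_bracket Q s T M N B \<longleftrightarrow>
     (\<lambda>(t,\<omega>). B t \<omega>) \<in> borel_measurable (Pred Q s T) \<and>
     (AE \<omega> in completion Q. B s \<omega> = 0 \<and> cadlag_on {s..T} (\<lambda>t. B t \<omega>) \<and> fv_on {s..T} (\<lambda>t. B t \<omega>)) \<and>
     is_mart Q {s..T} (\<lambda>t \<omega>. M t \<omega> * N t \<omega> - B t \<omega>)"

definition is_bracket_density :: "('e::topological_space) path measure \<Rightarrow> real \<Rightarrow> real \<Rightarrow> (real \<Rightarrow> real)
      \<Rightarrow> 'e proc \<Rightarrow> 'e proc \<Rightarrow> 'e proc \<Rightarrow> bool" where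
  "is_bracket_density Q s T V M N k \<longleftrightarrow> (\<exists>B. is_angle_bracket Q s T M N B \<and>
     (AE \<omega> in completion Q. set_integrable (Vmeas T V) {s..T} (\<lambda>r. k r \<omega>) \<and>
        (\<forall>t\<in>{s..T}. B t \<omega> = (LINT r:{s..t}|Vmeas T V. k r \<omega>))))"

definition maf_version :: "('e::topological_space) path measure \<Rightarrow> real
      \<Rightarrow> (real \<Rightarrow> real \<Rightarrow> 'e path \<Rightarrow> real) \<Rightarrow> 'e proc \<Rightarrow> bool" where
  "maf_version Q s Mf X \<longleftrightarrow> is_mart Q {0..} X \<and>
     (AE \<omega> in completion Q. cadlag_on {0..} (\<lambda>t. X t \<omega>) \<and> (\<forall>t\<in>{0..s}. X t \<omega> = 0)) \<and>
     (\<forall>t u. s \<le> t \<and> t \<le> u \<longrightarrow> (AE \<omega> in completion Q. Mf t u \<omega> = X u \<omega> - X t \<omega>))"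

definition weak_generator :: "(real \<Rightarrow> ('e::topological_space) path \<Rightarrow> 'e path measure) \<Rightarrow> real \<Rightarrow> (real \<Rightarrow> real)
      \<Rightarrow> 'e proc set \<Rightarrow> ('e proc \<Rightarrow> 'e proc) \<Rightarrow> bool" where
  "weak_generator P T V DA A \<longleftrightarrow>
     (\<lambda>t \<omega>. 0) \<in> DA \<and>
     (\<forall>\<Phi>\<in>DA. \<forall>\<Psi>\<in>DA. (\<lambda>t \<omega>. \<Phi> t \<omega> + \<Psi> t \<omega>) \<in> DA \<and>
        (\<forall>t\<ge>0. \<forall>\<omega>\<in>Omega. A (\<lambda>t \<omega>. \<Phi> t \<omega> + \<Psi> t \<omega>) t \<omega> = A \<Phi> t \<omega> + A \<Psi> t \<omega>)) \<and>
     (\<forall>c::real. \<forall>\<Phi>\<in>DA. (\<lambda>t \<omega>. c * \<Phi> t \<omega>) \<in> DA \<and>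
        (\<forall>t\<ge>0. \<forall>\<omega>\<in>Omega. A (\<lambda>t \<omega>. c * \<Phi> t \<omega>) t \<omega> = c * A \<Phi> t \<omega>)) \<and>
     (\<forall>\<Phi>\<in>DA. progressive_on {0..} Fo \<Phi> \<and> progressive_on {0..} Fo (A \<Phi>)) \<and>
     (\<forall>\<Phi>\<in>DA. \<forall>\<omega>\<in>Omega. \<forall>t\<ge>0. (\<integral>\<^sup>+r\<in>{0..t}. ennreal \<bar>A \<Phi> r \<omega>\<bar> \<partial>Vmeas T V) < \<infinity>) \<and>
     (\<forall>\<Phi>\<in>DA. \<forall>s\<ge>0. \<forall>\<eta>\<in>Omega. \<forall>t\<ge>s.
        (\<integral>\<^sup>+\<omega>. (\<integral>\<^sup>+r\<in>{s..t}. ennreal \<bar>A \<Phi> r \<omega>\<bar> \<partial>Vmeas T V) \<partial>P s \<eta>) < \<infinity> \<and>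
        integrable (P s \<eta>) (\<Phi> t)) \<and>
     (\<forall>\<Phi>\<in>DA. \<forall>\<omega>\<in>Omega. \<forall>t\<ge>T. \<Phi> t \<omega> = \<Phi> T \<omega> \<and> (t > T \<longrightarrow> A \<Phi> t \<omega> = 0)) \<and>
     (\<forall>\<Phi>\<in>DA. \<forall>s\<ge>0. \<forall>\<eta>\<in>Omega. \<forall>t\<ge>s.
        (\<integral>\<omega>. \<Phi> t \<omega> \<partial>P s \<eta>) = \<Phi> s \<eta> + (LINT r:{s..t}|Vmeas T V. (\<integral>\<omega>. A \<Phi> r \<omega> \<partial>P s \<eta>)))"

definition MA :: "('e proc \<Rightarrow> 'e proc) \<Rightarrow> real \<Rightarrow> (real \<Rightarrow> real) \<Rightarrow> 'e proc
      \<Rightarrow> real \<Rightarrow> real \<Rightarrow> 'e path \<Rightarrow> real" where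
  "MA A T V \<Phi> t u \<omega> = \<Phi> u \<omega> - \<Phi> t \<omega> - (LINT r:{t..u}|Vmeas T V. A \<Phi> r \<omega>)"

definition Gamma :: "('e proc \<Rightarrow> 'e proc) \<Rightarrow> 'e proc \<Rightarrow> 'e proc \<Rightarrow> 'e proc" where
  "Gamma A \<Phi> \<Psi> = (\<lambda>t \<omega>. A (\<lambda>t \<omega>. \<Phi> t \<omega> * \<Psi> t \<omega>) t \<omega> - \<Phi> t \<omega> * A \<Psi> t \<omega> - \<Psi> t \<omega> * A \<Phi> t \<omega>)"

definition hypB :: "(real \<Rightarrow> ('e::topological_space) path \<Rightarrow> 'e path measure) \<Rightarrow> real \<Rightarrow> (real \<Rightarrow> real)
      \<Rightarrow> (real \<Rightarrow> 'e path \<Rightarrow> real \<Rightarrow> real^'d \<Rightarrow> real) \<Rightarrow> ('e path \<Rightarrow> real) \<Rightarrow> real \<Rightarrow> bool" where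
  "hypB P T V f \<xi> K \<longleftrightarrow>
     \<xi> \<in> borel_measurable (Fp T) \<and>
     (\<forall>s\<ge>0. \<forall>\<eta>\<in>Omega. integrable (P s \<eta>) \<xi> \<and> integrable (P s \<eta>) (\<lambda>\<omega>. (\<xi> \<omega>)\<^sup>2)) \<and>
     (\<lambda>((t,\<omega>),(y,z)). f t \<omega> y z)
        \<in> borel_measurable (restrict_space ProO ({0..T} \<times> Omega) \<Otimes>\<^sub>M (borel \<Otimes>\<^sub>M borel)) \<and>
     Luni P T V (\<lambda>t \<omega>. f t \<omega> 0 0) \<and>
     (\<forall>t\<in>{0..T}. \<forall>\<omega>\<in>Omega. \<forall>y y' z z'.
        \<bar>f t \<omega> y' z' - f t \<omega> y z\<bar> \<le> K * (\<bar>y' - y\<bar> + norm (z' - z)))"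

definition IP :: "(real \<Rightarrow> ('e::topological_space) path \<Rightarrow> 'e path measure) \<Rightarrow> real \<Rightarrow> (real \<Rightarrow> real)
      \<Rightarrow> ('e proc \<Rightarrow> 'e proc) \<Rightarrow> ('d \<Rightarrow> 'e proc)
      \<Rightarrow> (real \<Rightarrow> 'e path \<Rightarrow> real \<Rightarrow> real^'d \<Rightarrow> real) \<Rightarrow> ('e path \<Rightarrow> real)
      \<Rightarrow> 'e proc \<Rightarrow> ('d \<Rightarrow> 'e proc) \<Rightarrow> bool" where
  "IP P T V A \<Psi> f \<xi> Y Z \<longleftrightarrow> Luni P T V Y \<and> (\<forall>i. Luni P T V (Z i)) \<and>
     (\<forall>s\<in>{0..T}. \<forall>\<eta>\<in>Omega.
        Y s \<eta> = (\<integral>\<omega>. \<xi> \<omega> \<partial>P s \<eta>)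
                 + (LINT r:{s..T}|Vmeas T V. (\<integral>\<omega>. f r \<omega> (Y r \<omega>) (\<chi> j. Z j r \<omega>) \<partial>P s \<eta>)) \<and>
        (\<forall>i. Y s \<eta> * \<Psi> i s \<eta> = (\<integral>\<omega>. \<xi> \<omega> * \<Psi> i T \<omega> \<partial>P s \<eta>)
                 - (LINT r:{s..T}|Vmeas T V.
                      (\<integral>\<omega>. Z i r \<omega> + Y r \<omega> * A (\<Psi> i) r \<omega>
                             - \<Psi> i r \<omega> * f r \<omega> (Y r \<omega>) (\<chi> j. Z j r \<omega>) \<partial>P s \<eta>))))"

definition decoupled_mild :: "(real \<Rightarrow> ('e::topological_space) path \<Rightarrow> 'e path measure) \<Rightarrow> real \<Rightarrow> (real \<Rightarrow> real)
      \<Rightarrow> ('e proc \<Rightarrow> 'e proc) \<Rightarrow> ('d \<Rightarrow> 'e proc)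
      \<Rightarrow> (real \<Rightarrow> 'e path \<Rightarrow> real \<Rightarrow> real^'d \<Rightarrow> real) \<Rightarrow> ('e path \<Rightarrow> real) \<Rightarrow> 'e proc \<Rightarrow> bool" where
  "decoupled_mild P T V A \<Psi> f \<xi> Y \<longleftrightarrow> (\<exists>Z. IP P T V A \<Psi> f \<xi> Y Z)"

definition L2_st :: "('e::topological_space) path measure \<Rightarrow> real \<Rightarrow> real \<Rightarrow> (real \<Rightarrow> real) \<Rightarrow> 'e proc \<Rightarrow> bool" where
  "L2_st Q s T V Y \<longleftrightarrow> progressive_on {s..T} (Fc Q) Y \<and>
     (\<integral>\<^sup>+\<omega>. (\<integral>\<^sup>+r\<in>{s..T}. ennreal ((Y r \<omega>)\<^sup>2) \<partial>Vmeas T V) \<partial>completion Q) < \<infinity>"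

definition bsde_sol :: "('e::topological_space) path measure \<Rightarrow> real \<Rightarrow> real \<Rightarrow> (real \<Rightarrow> real)
      \<Rightarrow> (real \<Rightarrow> 'e path \<Rightarrow> real \<Rightarrow> real^'d \<Rightarrow> real) \<Rightarrow> ('e path \<Rightarrow> real)
      \<Rightarrow> ('d \<Rightarrow> 'e proc) \<Rightarrow> 'e proc \<Rightarrow> 'e proc \<Rightarrow> bool" where
  "bsde_sol Q s T V f \<xi> N Y M \<longleftrightarrow> L2_st Q s T V Y \<and> is_H20 Q s T M \<and>
     (AE \<omega> in completion Q. cadlag_on {s..T} (\<lambda>t. Y t \<omega>)) \<and>
     (\<exists>k. (\<forall>i. progressive_on {s..T} (Fc Q) (k i) \<and> is_bracket_density Q s T V M (N i) (k i)) \<and>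
        (AE \<omega> in completion Q. \<forall>t\<in>{s..T}.
           Y t \<omega> = \<xi> \<omega> + (LINT r:{t..T}|Vmeas T V. f r \<omega> (Y r \<omega>) (\<chi> j. k j r \<omega>))
                     - (M T \<omega> - M t \<omega>)))"

end

theory Submission
  imports Defs
begin

text \<open>
  By the Markov property, a pair \<open>(Y, Z)\<close> solves the integral equations iff under every \<open>P s \<eta>\<close> the process
  \<open>M = Y + \<integral> f(r, Y, Z) dV\<close> is a martingale with terminal value \<open>\<xi> + \<integral> f dV\<close> and \<open>Z\<^sup>i\<close> is the \<open>dV\<close>-density of the
  bracket of \<open>M\<close> with \<open>M[\<Psi>\<^sup>i]\<close>. The bracket of \<open>M[\<Psi>\<^sup>i]\<close> itself has the bounded density \<open>\<Gamma>(\<Psi>\<^sup>i, \<Psi>\<^sup>i)\<close>, so such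
  densities exist and are a.e. limits of the dyadic quotients \<open>E\<^sup>t\<^sup>,\<^sup>\<omega>[\<Delta>M \<Delta>N] / \<Delta>V\<close>. These quotients do not involve
  \<open>(s, \<eta>)\<close>, which yields one version for all initial conditions. An exponentially weighted energy estimate makes
  the map \<open>(Y, Z) \<mapsto> (Y', Z')\<close> a contraction under every \<open>P s \<eta>\<close>; Picard iteration gives existence and the same
  estimate gives uniqueness. The density occurring in a solution of the BSDE is identified with \<open>Z\<close> because a
  martingale of the form \<open>\<integral> h dV\<close> vanishes.
\<close>

text \<open>The \<open>Y\<close> of the integral equations is merely progressive, so its martingale
  part comes without cadlag paths and without a bracket process. Brackets are therefore handled
  through covariances: a density of the bracket of \<open>M\<close> and \<open>N\<close> is a
  process whose integral over \<open>[t,T]\<close> has, given time \<open>t\<close>, the same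
  conditional expectation as the product of the increments over \<open>[t,T]\<close>. Angle brackets
  proper appear only where a given BSDE solution is compared with \<open>Z\<close>. The dyadic
  quotients converge because, on the product of the clock and the path space, they form a martingale
  for the filtration of dyadic blocks; the bounded bracket density of
  \<open>M[\<Psi>\<^sup>i]\<close> supplies its L2 bound. Equalities between processes hold a.e.
  under each law, and the laws are uncountably many; exact values of \<open>Y\<close> come from its
  being an expectation under \<open>P s \<eta>\<close>. The contraction factor for squared norms is
  made 1/4, so that the Picard iterates converge pointwise a.e. and the limit can be taken by a
  \<open>lim\<close> that refers to no law.\<close>

section \<open>Integrals against a continuous Stieltjes clock\<close>

text \<open>Because \<open>W\<close> is continuous, it pushes the restriction of \<open>M\<close> to
  \<open>{s<..r}\<close> forward to Lebesgue measure on \<open>{W s<..W r}\<close>; flat stretches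
  of \<open>W\<close> carry no mass. The integral becomes that of an exponential over an interval.
  \<open>M\<close> is general because the lemma serves both \<nu> and, later, the measure with
  density \<open>|h|\<close>.\<close>

lemma Stieltjes_exp_Ioc:
 fixes W :: "real => real" and M :: "real measure"
 assumes M: "finite_measure M" "sets M = sets borel" and W_mono: "\<And>x y. x <= y ==> W x <= W y" and W_cont: "continuous_on UNIV W"
  and Ioc: "\<And>a b. a <= b ==> emeasure M {a<..b} = ennreal (W b - W a)" and a: "a \<noteq> 0" and sr: "s <= r"
 shows "(\<integral>\<^sup>+t\<in>{s<..r}. ennreal (exp (a * W t)) \<partial>M) = ennreal ((exp (a * W r) - exp (a * W s)) / a)"
proof -
 note [measurable_cong] = M(2)
 have [simp]: "space M = UNIV" using sets_eq_imp_space_eq[OF M(2)] by simp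
 have isCont_W: "isCont W x" for x using W_cont by (simp add: continuous_on_eq_continuous_at)
 have W_borel[measurable]: "W \<in> borel_measurable borel" by (rule borel_measurable_continuous_onI[OF W_cont])
 define D where "D = distr (density M (indicator {s<..r})) borel W"
 define L where "L = density lborel (indicator {W s<..W r} :: real => ennreal)"
 have D: "emeasure D {x<..} = emeasure M {t \<in> {s<..r}. x < W t}" for x
 proof -
  have [measurable]: "W -` {x<..} \<in> sets borel" using measurable_sets[OF W_borel, of "{x<..}"] by simp
  have "emeasure D {x<..} = emeasure (density M (indicator {s<..r})) (W -` {x<..})"
   unfolding D_def by (subst emeasure_distr) auto
  also have "\<dots> = emeasure M {t \<in> {s<..r}. x < W t}"
   by (subst emeasure_density) (auto simp: nn_integral_indicator[symmetric] simp del: nn_integral_indicator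
     intro!: nn_integral_cong split: split_indicator)
  finally show ?thesis .
 qed
 have L: "emeasure L {x<..} = emeasure lborel {max x (W s)<..W r}" for x
  unfolding L_def
  by (subst emeasure_density) (auto simp: nn_integral_indicator[symmetric] simp del: nn_integral_indicator
     intro!: nn_integral_cong split: split_indicator)
 have eq: "emeasure D {x<..} = emeasure L {x<..}" for x
 proof -
  consider "x < W s" | "W s <= x" "x < W r" | "W r <= x" by linarith
  then show ?thesis
  proof cases
   case 1
   then have "{t \<in> {s<..r}. x < W t} = {s<..r}"
    by (auto intro: less_le_trans[OF _ W_mono])
   with 1 show ?thesis using sr W_mono[OF sr] by (simp add: D L Ioc)
  next
   case 2
   \<comment> \<open>Since \<open>W\<close> may be flat, the level \<open>x\<close> can be attained
     on a whole interval. Its last point \<open>q\<close> is the right one: within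
     \<open>{s<..r}\<close>, \<open>x < W t\<close> holds exactly when \<open>q < t\<close>.\<close>
   define S where "S = {t \<in> {s..r}. W t <= x}"
   have S: "s \<in> S" "bdd_above S" using 2 sr by (auto simp: S_def intro!: bdd_aboveI[of _ r])
   have clS: "closed S"
   proof -
    have "S = {s..r} \<inter> (W -` {..x} \<inter> UNIV)" by (auto simp: S_def)
    then show ?thesis using continuous_closed_preimage[OF W_cont, of "{..x}"] by auto
   qed
   define q where "q = Sup S"
   have qS: "q \<in> S" unfolding q_def using S clS by (intro closed_contains_Sup) auto
   have above: "x < W t" if "q < t" "t <= r" for t
    using that cSup_upper[of t S] S qS by (force simp: q_def S_def)
   have "W q = x"
   proof -
    have "q < r" using qS 2 by (auto simp: S_def order_le_less)
    have "x <= W q"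
    proof (rule tendsto_lowerbound[of W "W q" "at_right q"])
     show "(W \<longlongrightarrow> W q) (at_right q)"
      using isCont_W[of q] by (simp add: isCont_def filterlim_at_split)
     show "\<forall>\<^sub>F t in at_right q. x <= W t"
      using \<open>q < r\<close> above by (auto simp: eventually_at_right[OF \<open>q<r\<close>] intro!: exI[of _ r] less_imp_le)
    qed auto
    with qS show ?thesis by (auto simp: S_def)
   qed
   moreover have "{t \<in> {s<..r}. x < W t} = {q<..r}"
   proof (intro set_eqI iffI)
    fix t assume "t \<in> {t \<in> {s<..r}. x < W t}"
    then show "t \<in> {q<..r}" using W_mono[of t q] \<open>W q = x\<close> by (auto simp: not_le[symmetric])
   next
    fix t assume "t \<in> {q<..r}"
    then show "t \<in> {t \<in> {s<..r}. x < W t}" using above qS by (auto simp: S_def)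
   qed
   ultimately show ?thesis using 2 qS by (simp add: D L Ioc S_def)
  next
   case 3
   then have "{t \<in> {s<..r}. x < W t} = {}" using W_mono[of _ r] by fastforce
   moreover have "{max x (W s)<..W r} = {}" using 3 by auto
   ultimately show ?thesis unfolding D L by (simp only: emeasure_empty)
  qed
 qed
 have "D = L"
 proof (rule measure_eqI_lessThan)
  fix x
  show "emeasure D {x<..} < \<infinity>"
   unfolding D by (simp only: infinity_ennreal_def less_top[symmetric] finite_measure.emeasure_finite[OF M(1)] not_False_eq_True)
 qed (use eq in \<open>auto simp: D_def L_def\<close>)
 have "(\<integral>\<^sup>+t\<in>{s<..r}. ennreal (exp (a * W t)) \<partial>M) = (\<integral>\<^sup>+x. ennreal (exp (a * x)) \<partial>D)"
  unfolding D_def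
  by (subst nn_integral_distr, simp, simp, subst nn_integral_density)
   (auto simp: mult.commute)
 also have "\<dots> = (\<integral>\<^sup>+x. ennreal (exp (a * x)) * indicator {W s..W r} x \<partial>lborel)"
 proof -
  have "(\<integral>\<^sup>+x. ennreal (exp (a * x)) \<partial>L) = (\<integral>\<^sup>+x. indicator {W s<..W r} x * ennreal (exp (a * x)) \<partial>lborel)"
   unfolding L_def by (rule nn_integral_density) simp_all
  also have "\<dots> = (\<integral>\<^sup>+x. ennreal (exp (a * x)) * indicator {W s..W r} x \<partial>lborel)"
  proof (rule nn_integral_cong_AE)
   show "AE x in lborel. indicator {W s<..W r} x * ennreal (exp (a * x)) = ennreal (exp (a * x)) * indicator {W s..W r} x"
    using AE_lborel_singleton[of "W s"] by eventually_elim (simp add: indicator_def)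
  qed
  finally show ?thesis unfolding \<open>D = L\<close> .
 qed
 also have "\<dots> = ennreal (exp (a * W r) / a - exp (a * W s) / a)"
  using a W_mono[OF sr]
  by (intro nn_integral_FTC_Icc) (auto intro!: derivative_eq_intros)
 finally show ?thesis by (simp add: diff_divide_distrib)
qed

text \<open>In the application \<open>W\<close> is \<open>V\<close> made constant before 0 and after
  \<open>T\<close>. This makes the Stieltjes measure finite on the whole line, and continuity rules
  out atoms, so closed and half-open time intervals are interchangeable.\<close>

locale clock =
 fixes W :: "real => real" and T :: real and \<nu> :: "real measure"
 assumes W_mono: "x <= y ==> W x <= W y" and W_cont: "continuous_on UNIV W"
  and T_pos: "0 < T" and W_neg: "t <= 0 ==> W t = W 0" and W_big: "T <= t ==> W t = W T"
  and nu_def: "\<nu> = interval_measure W"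
begin

lemma sets_nu[simp, measurable_cong]: "sets \<nu> = sets borel"
 and space_nu[simp]: "space \<nu> = UNIV"
 by (simp_all add: nu_def)

lemma isCont_W: "isCont W x"
 using W_cont by (simp add: continuous_on_eq_continuous_at)

lemma W_borel[measurable]: "W \<in> borel_measurable borel"
 by (rule borel_measurable_continuous_onI[OF W_cont])

lemma nu_Ioc: "a <= b ==> emeasure \<nu> {a<..b} = ennreal (W b - W a)"
 unfolding nu_def by (intro emeasure_interval_measure_Ioc W_mono)
  (auto intro: continuous_at_imp_continuous_at_within isCont_W)

lemma nu_Icc: "a <= b ==> emeasure \<nu> {a..b} = ennreal (W b - W a)"
 unfolding nu_def by (intro emeasure_interval_measure_Icc W_mono W_cont)

lemma nu_singleton[simp]: "emeasure \<nu> {a} = 0"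
 using nu_Icc[of a a] by simp

lemma nu_AE_neq: "AE x in \<nu>. x \<noteq> a"
 by (rule AE_I[of _ _ "{a}"]) auto

lemma W_bounds: "W 0 <= W t" "W t <= W T"
 by (metis W_mono W_neg linorder_linear) (metis W_mono W_big linorder_linear)

lemma nu_UNIV_le: "emeasure \<nu> UNIV <= ennreal (W T - W 0)"
proof -
 have "(\<Union>n::nat. {- real n<..real n}) = UNIV"
 proof (intro set_eqI iffI UNIV_I)
  fix x :: real
  obtain n :: nat where "\<bar>x\<bar> < real n" using reals_Archimedean2 by blast
  then show "x \<in> (\<Union>n::nat. {- real n<..real n})" by (intro UN_I[of n]) auto
 qed
 then have "emeasure \<nu> UNIV = (SUP n::nat. emeasure \<nu> {- real n<..real n})"
  by (subst SUP_emeasure_incseq) (auto simp: incseq_def)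
 also have "\<dots> <= ennreal (W T - W 0)"
 proof (rule SUP_least)
  fix n :: nat
  show "emeasure \<nu> {- real n<..real n} <= ennreal (W T - W 0)"
   using W_bounds(2)[of "real n"] W_bounds(1)[of "- real n"]
   by (subst nu_Ioc) (auto intro!: ennreal_leI)
 qed
 finally show ?thesis .
qed

sublocale nu: finite_measure \<nu>
 using nu_UNIV_le by (intro finite_measureI) (auto simp: top_unique)

lemma nu_exp_Ioc:
 assumes "a \<noteq> 0" "s <= r"
 shows "(\<integral>\<^sup>+t\<in>{s<..r}. ennreal (exp (a * W t)) \<partial>\<nu>) = ennreal ((exp (a * W r) - exp (a * W s)) / a)"
 by (rule Stieltjes_exp_Ioc[OF nu.finite_measure_axioms sets_nu W_mono W_cont nu_Ioc assms])

lemma nu_exp_Icc: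
 assumes "a \<noteq> 0" "s <= r"
 shows "(\<integral>\<^sup>+t\<in>{s..r}. ennreal (exp (a * W t)) \<partial>\<nu>) = ennreal ((exp (a * W r) - exp (a * W s)) / a)"
 unfolding nu_exp_Ioc[OF assms, symmetric]
proof (rule nn_integral_cong_AE)
 show "AE t in \<nu>. ennreal (exp (a * W t)) * indicator {s..r} t = ennreal (exp (a * W t)) * indicator {s<..r} t"
  using nu_AE_neq[of s] by eventually_elim (simp add: indicator_def)
qed

lemma nu_Fubini:
 assumes [measurable]: "(%(x, y). F x y) \<in> borel_measurable (borel \<Otimes>\<^sub>M borel)"
 shows "(\<integral>\<^sup>+x. (\<integral>\<^sup>+y. F x y \<partial>\<nu>) \<partial>\<nu>) = (\<integral>\<^sup>+y. (\<integral>\<^sup>+x. F x y \<partial>\<nu>) \<partial>\<nu>)"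
proof -
 interpret pair_sigma_finite \<nu> \<nu> ..
 show ?thesis by (rule Fubini'[symmetric]) simp
qed

section \<open>The exponentially weighted estimate\<close>

text \<open>In the application \<open>b r\<close> is the mean square of a driver at time
  \<open>r\<close>, and \<open>J t\<close> is what Cauchy-Schwarz with the factors
  \<open>exp (- \<gamma> W / 2)\<close> and \<open>exp (\<gamma> W / 2)\<close> gives for the mean
  square of its integral over \<open>[t,T]\<close>. The functions \<open>y\<close> and
  \<open>z\<close> are the mean squares of the differences of two \<open>Y\<close> and of two
  \<open>Z\<close>.\<close>

context
 fixes s \<gamma> c :: real and y z b J :: "real => ennreal"
 assumes sT: "s <= T" and \<gamma>: "0 < \<gamma>" and c: "0 <= c"
  and [measurable]: "y \<in> borel_measurable borel" "z \<in> borel_measurable borel" "b \<in> borel_measurable borel"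
  and J: "\<And>t. J t = ennreal (exp (- (\<gamma> * W t)) / \<gamma>) * (\<integral>\<^sup>+r\<in>{t..T}. ennreal (exp (\<gamma> * W r)) * b r \<partial>\<nu>)"
begin

private lemma J_measurable[measurable]: "J \<in> borel_measurable borel"
proof -
 have "(%t. \<integral>\<^sup>+r. ennreal (exp (\<gamma> * W r)) * b r * (if t <= r \<and> r <= T then 1 else 0) \<partial>\<nu>) \<in> borel_measurable borel"
  by measurable
 moreover have "(\<integral>\<^sup>+r. ennreal (exp (\<gamma> * W r)) * b r * (if t <= r \<and> r <= T then 1 else 0) \<partial>\<nu>)
   = (\<integral>\<^sup>+r\<in>{t..T}. ennreal (exp (\<gamma> * W r)) * b r \<partial>\<nu>)" for t
  by (intro nn_integral_cong) (auto split: split_indicator)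
 ultimately show ?thesis unfolding J[abs_def] by simp
qed

private lemma exp_J: "ennreal (exp (2 * \<gamma> * W t)) * J t
  = ennreal (1/\<gamma>) * (ennreal (exp (\<gamma> * W t)) * (\<integral>\<^sup>+r\<in>{t..T}. ennreal (exp (\<gamma> * W r)) * b r \<partial>\<nu>))"
proof -
 have "exp (2 * \<gamma> * W t) * (exp (- (\<gamma> * W t)) / \<gamma>) = 1/\<gamma> * exp (\<gamma> * W t)"
  by (simp add: mult_exp_exp)
 then have "ennreal (exp (2 * \<gamma> * W t)) * ennreal (exp (- (\<gamma> * W t)) / \<gamma>) = ennreal (1/\<gamma>) * ennreal (exp (\<gamma> * W t))"
  using \<gamma> by (simp only: ennreal_mult[symmetric] exp_ge_zero divide_nonneg_pos zero_le_one)
 then show ?thesis unfolding J by (simp only: mult.assoc[symmetric])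
qed

text \<open>Fubini puts the integral in \<open>t\<close> inside, where
  \<open>exp (\<gamma> W)\<close> over \<open>{s..r}\<close> integrates to at most
  \<open>exp (\<gamma> W r) / \<gamma>\<close>. This supplies the second factor
  \<open>1 / \<gamma>\<close> and the second half of the weight
  \<open>exp (2 \<gamma> W r)\<close>.\<close>

private lemma weighted_J:
 "(\<integral>\<^sup>+t\<in>{s..T}. ennreal (exp (2 * \<gamma> * W t)) * J t \<partial>\<nu>)
  <= ennreal (1 / \<gamma>^2) * (\<integral>\<^sup>+r\<in>{s..T}. ennreal (exp (2 * \<gamma> * W r)) * b r \<partial>\<nu>)"
proof -
 define e where "e t = ennreal (exp (\<gamma> * W t))" for t
 have [measurable]: "e \<in> borel_measurable borel" unfolding e_def by measurable
 have ee: "e r * e r = ennreal (exp (2 * \<gamma> * W r))" for r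
  by (simp add: e_def ennreal_mult[symmetric] exp_add[symmetric])
 have "(\<integral>\<^sup>+t\<in>{s..T}. ennreal (exp (2 * \<gamma> * W t)) * J t \<partial>\<nu>)
   = (\<integral>\<^sup>+t. \<integral>\<^sup>+r. ennreal (1/\<gamma>) * (e t * (e r * b r) * (if s <= t \<and> t <= r \<and> r <= T then 1 else 0)) \<partial>\<nu> \<partial>\<nu>)"
 proof (intro nn_integral_cong)
  fix t
  have "(\<integral>\<^sup>+r. ennreal (1/\<gamma>) * (e t * (e r * b r) * (if s <= t \<and> t <= r \<and> r <= T then 1 else 0)) \<partial>\<nu>)
    = (\<integral>\<^sup>+r. ennreal (1/\<gamma>) * indicator {s..T} t * e t * (e r * b r * indicator {t..T} r) \<partial>\<nu>)"
   by (intro nn_integral_cong) (auto split: split_indicator simp: mult.assoc)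
  also have "\<dots> = ennreal (1/\<gamma>) * indicator {s..T} t * e t * (\<integral>\<^sup>+r\<in>{t..T}. e r * b r \<partial>\<nu>)"
   by (rule nn_integral_cmult) simp
  finally show "ennreal (exp (2 * \<gamma> * W t)) * J t * indicator {s..T} t =
   (\<integral>\<^sup>+r. ennreal (1/\<gamma>) * (e t * (e r * b r) * (if s <= t \<and> t <= r \<and> r <= T then 1 else 0)) \<partial>\<nu>)"
   unfolding exp_J by (simp add: e_def mult_ac)
 qed
 also have "\<dots> = (\<integral>\<^sup>+r. \<integral>\<^sup>+t. ennreal (1/\<gamma>) * (e t * (e r * b r) * (if s <= t \<and> t <= r \<and> r <= T then 1 else 0)) \<partial>\<nu> \<partial>\<nu>)"
  by (rule nu_Fubini) simp
 also have "\<dots> <= (\<integral>\<^sup>+r. ennreal (1/\<gamma>^2) * (e r * e r * b r * indicator {s..T} r) \<partial>\<nu>)"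
 proof (intro nn_integral_mono)
  fix r
  show "(\<integral>\<^sup>+t. ennreal (1/\<gamma>) * (e t * (e r * b r) * (if s <= t \<and> t <= r \<and> r <= T then 1 else 0)) \<partial>\<nu>)
    <= ennreal (1/\<gamma>^2) * (e r * e r * b r * indicator {s..T} r)"
  proof (cases "r \<in> {s..T}")
   case True
   have "(\<integral>\<^sup>+t. ennreal (1/\<gamma>) * (e t * (e r * b r) * (if s <= t \<and> t <= r \<and> r <= T then 1 else 0)) \<partial>\<nu>)
     = (\<integral>\<^sup>+t. ennreal (1/\<gamma>) * (e r * b r) * (e t * indicator {s..r} t) \<partial>\<nu>)"
    using True by (intro nn_integral_cong) (auto split: split_indicator simp: mult_ac)
   also have "\<dots> = ennreal (1/\<gamma>) * (e r * b r) * (\<integral>\<^sup>+t\<in>{s..r}. e t \<partial>\<nu>)"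
    by (rule nn_integral_cmult) simp
   also have "(\<integral>\<^sup>+t\<in>{s..r}. e t \<partial>\<nu>) <= ennreal (1/\<gamma>) * e r"
    unfolding e_def using nu_exp_Icc[of \<gamma> s r] True \<gamma>
    by (auto simp: ennreal_mult[symmetric] intro!: ennreal_leI divide_right_mono)
   also have "ennreal (1/\<gamma>) * (e r * b r) * (ennreal (1/\<gamma>) * e r)
     = (ennreal (1/\<gamma>) * ennreal (1/\<gamma>)) * (e r * e r * b r * indicator {s..T} r)"
    using True by (simp add: mult_ac)
   also have "ennreal (1/\<gamma>) * ennreal (1/\<gamma>) = ennreal (1/\<gamma>^2)"
    using \<gamma> by (simp add: ennreal_mult[symmetric] power2_eq_square)
   finally show ?thesis by (simp add: mult_left_mono)
  next
   case False
   then have "(\<integral>\<^sup>+t. ennreal (1/\<gamma>) * (e t * (e r * b r) * (if s <= t \<and> t <= r \<and> r <= T then 1 else 0)) \<partial>\<nu>) = (\<integral>\<^sup>+t. 0 \<partial>\<nu>)"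
    by (intro nn_integral_cong) auto
   then show ?thesis by simp
  qed
 qed
 also have "\<dots> = ennreal (1 / \<gamma>^2) * (\<integral>\<^sup>+r\<in>{s..T}. ennreal (exp (2 * \<gamma> * W r)) * b r \<partial>\<nu>)"
  by (subst nn_integral_cmult) (simp_all add: ee)
 finally show ?thesis .
qed

text \<open>For \<open>y\<close> the bound holds at each time, but for \<open>z\<close> only tail
  integrals are controlled. The weight is therefore written as its value at \<open>s\<close> plus
  the integral of its derivative, which turns the weighted integral of \<open>z\<close> into tails:
  the boundary term contributes \<open>c / \<gamma>\<close>, the other one
  \<open>2 \<gamma> * c / \<gamma>^2\<close>, hence the factor 3.\<close>

lemma weighted_bound:
 assumes y: "\<And>t. t \<in> {s..T} ==> y t <= J t"
  and z: "\<And>t. t \<in> {s..T} ==> (\<integral>\<^sup>+r\<in>{t..T}. z r \<partial>\<nu>) <= ennreal c * J t"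
 shows "(\<integral>\<^sup>+r\<in>{s..T}. ennreal (exp (2 * \<gamma> * W r)) * (y r + z r) \<partial>\<nu>)
  <= ennreal (1 / \<gamma>^2 + 3 * c / \<gamma>) * (\<integral>\<^sup>+r\<in>{s..T}. ennreal (exp (2 * \<gamma> * W r)) * b r \<partial>\<nu>)"
proof -
 define e where "e t = ennreal (exp (2 * \<gamma> * W t))" for t
 have [measurable]: "e \<in> borel_measurable borel" unfolding e_def by measurable
 define Bn where "Bn = (\<integral>\<^sup>+r\<in>{s..T}. e r * b r \<partial>\<nu>)"
 have eJ: "(\<integral>\<^sup>+t\<in>{s..T}. e t * J t \<partial>\<nu>) <= ennreal (1 / \<gamma>^2) * Bn"
  using weighted_J by (simp add: e_def Bn_def)
 have ypart: "(\<integral>\<^sup>+r\<in>{s..T}. e r * y r \<partial>\<nu>) <= ennreal (1 / \<gamma>^2) * Bn"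
  by (rule order.trans[OF nn_integral_mono eJ]) (auto split: split_indicator intro!: mult_left_mono y)
 have e_split: "e r = e s + (\<integral>\<^sup>+t\<in>{s<..r}. ennreal (2*\<gamma>) * e t \<partial>\<nu>)" if "s <= r" for r
 proof -
  have "(\<integral>\<^sup>+t\<in>{s<..r}. ennreal (2*\<gamma>) * e t \<partial>\<nu>) = ennreal (2*\<gamma>) * (\<integral>\<^sup>+t\<in>{s<..r}. e t \<partial>\<nu>)"
   by (subst nn_integral_cmult[symmetric]) (auto simp: mult_ac)
  also have "\<dots> = ennreal (exp (2*\<gamma>*W r) - exp (2*\<gamma>*W s))"
   unfolding e_def using nu_exp_Ioc[of "2*\<gamma>" s r] that \<gamma> W_mono[OF that] by (simp add: ennreal_mult[symmetric])
  finally show ?thesis using \<gamma> W_mono[OF that] by (simp add: e_def ennreal_plus[symmetric] del: ennreal_plus)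
 qed
 have esJ: "e s * J s <= ennreal (1/\<gamma>) * Bn"
 proof -
  have "e s * J s = ennreal (1/\<gamma>) * (ennreal (exp (\<gamma> * W s)) * (\<integral>\<^sup>+r\<in>{s..T}. ennreal (exp (\<gamma> * W r)) * b r \<partial>\<nu>))"
   unfolding e_def by (rule exp_J)
  also have "ennreal (exp (\<gamma> * W s)) * (\<integral>\<^sup>+r\<in>{s..T}. ennreal (exp (\<gamma> * W r)) * b r \<partial>\<nu>)
    = (\<integral>\<^sup>+r. ennreal (exp (\<gamma> * W s)) * (ennreal (exp (\<gamma> * W r)) * b r * indicator {s..T} r) \<partial>\<nu>)"
   by (rule nn_integral_cmult[symmetric]) simp
  also have "\<dots> <= Bn"
   unfolding Bn_def
  proof (intro nn_integral_mono)
   fix r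
   have "ennreal (exp (\<gamma> * W s)) * ennreal (exp (\<gamma> * W r)) <= e r" if "s <= r"
    unfolding e_def using W_mono[OF that] \<gamma>
    by (simp add: ennreal_mult[symmetric] exp_add[symmetric] del: ennreal_mult'')
   then show "ennreal (exp (\<gamma> * W s)) * (ennreal (exp (\<gamma> * W r)) * b r * indicator {s..T} r) <= e r * b r * indicator {s..T} r"
    by (auto simp: mult.assoc[symmetric] intro!: mult_right_mono split: split_indicator)
  qed
  finally show ?thesis by (simp add: mult_left_mono)
 qed
 have "(\<integral>\<^sup>+r\<in>{s..T}. e r * z r \<partial>\<nu>)
   = (\<integral>\<^sup>+r. e s * (z r * indicator {s..T} r) + (\<integral>\<^sup>+t. ennreal (2*\<gamma>) * e t * z r * (if s < t \<and> t <= r \<and> r <= T then 1 else 0) \<partial>\<nu>) \<partial>\<nu>)"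
 proof (intro nn_integral_cong)
  fix r
  show "e r * z r * indicator {s..T} r = e s * (z r * indicator {s..T} r) +
    (\<integral>\<^sup>+t. ennreal (2*\<gamma>) * e t * z r * (if s < t \<and> t <= r \<and> r <= T then 1 else 0) \<partial>\<nu>)"
  proof (cases "r \<in> {s..T}")
   case True
   have "(\<integral>\<^sup>+t. ennreal (2*\<gamma>) * e t * z r * (if s < t \<and> t <= r \<and> r <= T then 1 else 0) \<partial>\<nu>)
     = (\<integral>\<^sup>+t. z r * (ennreal (2*\<gamma>) * e t * indicator {s<..r} t) \<partial>\<nu>)"
    using True by (intro nn_integral_cong) (auto split: split_indicator simp: mult_ac)
   also have "\<dots> = z r * (\<integral>\<^sup>+t\<in>{s<..r}. ennreal (2*\<gamma>) * e t \<partial>\<nu>)"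
    by (rule nn_integral_cmult) simp
   finally show ?thesis using True by (subst e_split) (auto simp: algebra_simps)
  next
   case False
   then have "(\<integral>\<^sup>+t. ennreal (2*\<gamma>) * e t * z r * (if s < t \<and> t <= r \<and> r <= T then 1 else 0) \<partial>\<nu>) = (\<integral>\<^sup>+t. 0 \<partial>\<nu>)"
    by (intro nn_integral_cong) auto
   with False show ?thesis by simp
  qed
 qed
 also have "\<dots> = e s * (\<integral>\<^sup>+r\<in>{s..T}. z r \<partial>\<nu>) +
   (\<integral>\<^sup>+r. (\<integral>\<^sup>+t. ennreal (2*\<gamma>) * e t * z r * (if s < t \<and> t <= r \<and> r <= T then 1 else 0) \<partial>\<nu>) \<partial>\<nu>)"
  by (subst nn_integral_add) (auto simp: nn_integral_cmult)
 also have "(\<integral>\<^sup>+r. (\<integral>\<^sup>+t. ennreal (2*\<gamma>) * e t * z r * (if s < t \<and> t <= r \<and> r <= T then 1 else 0) \<partial>\<nu>) \<partial>\<nu>)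
   = (\<integral>\<^sup>+t. (\<integral>\<^sup>+r. ennreal (2*\<gamma>) * e t * z r * (if s < t \<and> t <= r \<and> r <= T then 1 else 0) \<partial>\<nu>) \<partial>\<nu>)"
  by (rule nu_Fubini) simp
 also have "\<dots> <= (\<integral>\<^sup>+t. ennreal (2*\<gamma>) * ennreal c * (e t * J t * indicator {s..T} t) \<partial>\<nu>)"
 proof (intro nn_integral_mono)
  fix t
  have "(\<integral>\<^sup>+r. ennreal (2*\<gamma>) * e t * z r * (if s < t \<and> t <= r \<and> r <= T then 1 else 0) \<partial>\<nu>)
    <= (\<integral>\<^sup>+r. ennreal (2*\<gamma>) * e t * indicator {s..T} t * (z r * indicator {t..T} r) \<partial>\<nu>)"
   by (intro nn_integral_mono) (auto split: split_indicator)
  also have "\<dots> = ennreal (2*\<gamma>) * e t * indicator {s..T} t * (\<integral>\<^sup>+r\<in>{t..T}. z r \<partial>\<nu>)"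
   by (rule nn_integral_cmult) simp
  also have "\<dots> <= ennreal (2*\<gamma>) * e t * indicator {s..T} t * (ennreal c * J t)"
   by (cases "t \<in> {s..T}") (auto intro!: mult_left_mono z)
  finally show "(\<integral>\<^sup>+r. ennreal (2*\<gamma>) * e t * z r * (if s < t \<and> t <= r \<and> r <= T then 1 else 0) \<partial>\<nu>)
   <= ennreal (2*\<gamma>) * ennreal c * (e t * J t * indicator {s..T} t)"
   by (simp add: mult_ac)
 qed
 also have "\<dots> = ennreal (2*\<gamma>) * ennreal c * (\<integral>\<^sup>+t\<in>{s..T}. e t * J t \<partial>\<nu>)"
  by (rule nn_integral_cmult) simp
 also have "e s * (\<integral>\<^sup>+r\<in>{s..T}. z r \<partial>\<nu>) + ennreal (2*\<gamma>) * ennreal c * (\<integral>\<^sup>+t\<in>{s..T}. e t * J t \<partial>\<nu>)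
   <= ennreal c * (ennreal (1/\<gamma>) * Bn) + ennreal (2*\<gamma>) * ennreal c * (ennreal (1 / \<gamma>^2) * Bn)"
 proof (intro add_mono mult_left_mono eJ)
  have "e s * (\<integral>\<^sup>+r\<in>{s..T}. z r \<partial>\<nu>) <= e s * (ennreal c * J s)"
   using sT by (intro mult_left_mono z) auto
  also have "\<dots> = ennreal c * (e s * J s)" by (simp add: mult_ac)
  also have "\<dots> <= ennreal c * (ennreal (1/\<gamma>) * Bn)" by (intro mult_left_mono esJ) simp
  finally show "e s * (\<integral>\<^sup>+r\<in>{s..T}. z r \<partial>\<nu>) <= ennreal c * (ennreal (1/\<gamma>) * Bn)" .
 qed simp
 also have "\<dots> = (ennreal c * ennreal (1/\<gamma>) + ennreal (2*\<gamma>) * ennreal c * ennreal (1 / \<gamma>^2)) * Bn"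
  by (simp add: algebra_simps)
 also have "ennreal c * ennreal (1/\<gamma>) + ennreal (2*\<gamma>) * ennreal c * ennreal (1 / \<gamma>^2) = ennreal (3*c/\<gamma>)"
  using \<gamma> c by (simp add: ennreal_mult[symmetric] ennreal_plus[symmetric] power2_eq_square field_simps del: ennreal_plus ennreal_mult'')
 finally have zpart: "(\<integral>\<^sup>+r\<in>{s..T}. e r * z r \<partial>\<nu>) <= ennreal (3*c/\<gamma>) * Bn"
  by (simp add: add_left_mono)
 have "(\<integral>\<^sup>+r\<in>{s..T}. e r * (y r + z r) \<partial>\<nu>) = (\<integral>\<^sup>+r\<in>{s..T}. e r * y r \<partial>\<nu>) + (\<integral>\<^sup>+r\<in>{s..T}. e r * z r \<partial>\<nu>)"
  by (subst nn_integral_add[symmetric]) (auto simp: algebra_simps)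
 also have "\<dots> <= ennreal (1/\<gamma>^2) * Bn + ennreal (3*c/\<gamma>) * Bn"
  by (intro add_mono ypart zpart)
 also have "\<dots> = ennreal (1 / \<gamma>^2 + 3 * c / \<gamma>) * Bn"
  using \<gamma> c by (simp add: algebra_simps)
 finally show ?thesis unfolding e_def Bn_def .
qed

end

end

section \<open>Square integrable functions and L2-bounded martingale sequences\<close>

lemma integrable_mult_L2:
 fixes f g :: "'a => real"
 assumes [measurable]: "f \<in> borel_measurable M" "g \<in> borel_measurable M"
  and "integrable M (%x. (f x)^2)" "integrable M (%x. (g x)^2)"
 shows "integrable M (%x. f x * g x)"
proof (rule Bochner_Integration.integrable_bound)
 show "integrable M (%x. (f x)^2 + (g x)^2)" using assms by auto
 have "\<bar>a * b\<bar> <= a^2 + b^2" for a b :: real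
 proof -
  have "2 * \<bar>a\<bar> * \<bar>b\<bar> <= a^2 + b^2" using sum_squares_bound[of "\<bar>a\<bar>" "\<bar>b\<bar>"] by simp
  moreover have "0 <= \<bar>a\<bar> * \<bar>b\<bar>" by simp
  ultimately show ?thesis unfolding abs_mult by linarith
 qed
 then show "AE x in M. norm (f x * g x) <= norm ((f x)^2 + (g x)^2)" by auto
qed simp

lemma integrable_L2_diff:
 fixes f g :: "'a => real"
 assumes [measurable]: "f \<in> borel_measurable M" "g \<in> borel_measurable M"
  and "integrable M (%x. (f x)^2)" "integrable M (%x. (g x)^2)"
 shows "integrable M (%x. (f x - g x)^2)"
 unfolding power2_diff mult.assoc using assms integrable_mult_L2[OF assms] by auto

lemma integrable_L2_add:
 fixes f g :: "'a => real"
 assumes [measurable]: "f \<in> borel_measurable M" "g \<in> borel_measurable M"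
  and "integrable M (%x. (f x)^2)" "integrable M (%x. (g x)^2)"
 shows "integrable M (%x. (f x + g x)^2)"
 unfolding power2_sum mult.assoc using assms integrable_mult_L2[OF assms] by auto

lemma (in finite_measure) integrable_of_L2:
 fixes f :: "'a => real"
 assumes "f \<in> borel_measurable M" "integrable M (%x. (f x)^2)"
 shows "integrable M f"
 using integrable_mult_L2[of f M "%_. 1"] assms by simp

text \<open>The measure is only assumed finite because the sequence of interest lives on the product
  of the clock with a probability space. The martingale property is stated by set integrals, the
  form in which it is verified there.\<close>

locale L2_martingale_seq = finite_measure M for M :: "'a measure" +
 fixes F :: "nat => 'a measure" and X :: "nat => 'a => real" and B :: real
 assumes sub: "\<And>n. subalgebra M (F n)" and F_Suc: "\<And>n. sets (F n) \<subseteq> sets (F (Suc n))"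
  and adapted: "\<And>n. X n \<in> borel_measurable (F n)"
  and L2: "\<And>n. integrable M (%x. (X n x)^2)"
  and mart: "\<And>n A. A \<in> sets (F n) ==> (LINT x:A|M. X (Suc n) x) = (LINT x:A|M. X n x)"
  and bound: "\<And>n. (LINT x|M. (X n x)^2) <= B"
begin

lemma X_meas[measurable]: "X n \<in> borel_measurable M"
 by (rule measurable_from_subalg[OF sub adapted])

lemma X_int: "integrable M (X n)"
 by (rule integrable_of_L2[OF X_meas L2])

lemma F_mono: "m <= n ==> sets (F m) \<subseteq> sets (F n)"
 using lift_Suc_mono_le[of "%n. sets (F n)"] F_Suc by auto

lemma space_F: "space (F n) = space M"
 using sub[of n] by (simp add: subalgebra_def)

lemma adapted_le: "m <= n ==> X m \<in> borel_measurable (F n)"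
 by (rule measurable_from_subalg[OF _ adapted[of m]]) (use F_mono space_F in \<open>auto simp: subalgebra_def\<close>)

lemma mart_le:
 assumes "m <= n" "A \<in> sets (F m)"
 shows "(LINT x:A|M. X n x) = (LINT x:A|M. X m x)"
 using assms(1)
proof (induction n rule: dec_induct)
 case (step k)
 then show ?case using mart[of A k] F_mono[of m k] assms(2) by auto
qed simp

text \<open>The step from sets to square integrable functions goes through the conditional
  expectation of the increment, which is zero.\<close>

lemma orth:
 assumes mn: "m <= n" and [measurable]: "h \<in> borel_measurable (F m)"
  and h: "integrable M (%x. (h x)^2)"
 shows "(LINT x|M. h x * (X n x - X m x)) = 0"
proof -
 interpret finite_measure_subalgebra M "F m" by unfold_locales (rule sub)
 have [measurable]: "h \<in> borel_measurable M" by (rule measurable_from_subalg[OF sub]) fact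
 have ch: "AE x in M. real_cond_exp M (F m) (%x. X n x - X m x) x = 0"
 proof (rule real_cond_exp_charact)
  fix A assume A: "A \<in> sets (F m)"
  then have [measurable]: "A \<in> sets M" using sub[of m] by (auto simp: subalgebra_def)
  show "(LINT x:A|M. (X n x - X m x)) = (LINT x:A|M. 0)"
  proof -
   have "set_integrable M A (X k)" for k
    unfolding set_integrable_def by (intro integrable_mult_indicator X_int) simp
   then show ?thesis using mart_le[OF mn A] by (subst set_integral_diff) auto
  qed
 qed (auto intro: X_int)
 have "integrable M (%x. h x * (X n x - X m x))"
  by (intro integrable_mult_L2 h integrable_L2_diff L2) auto
 then have "(LINT x|M. h x * (X n x - X m x)) = (LINT x|M. h x * real_cond_exp M (F m) (%x. X n x - X m x) x)"
  by (intro real_cond_exp_intg(2)[symmetric]) auto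
 also have "\<dots> = (LINT x|M. 0)"
  using ch by (intro integral_cong_AE) auto
 finally show ?thesis by simp
qed

definition b where "b n = (LINT x|M. (X n x)^2)"

lemma pythagoras:
 assumes mn: "m <= n"
 shows "(LINT x|M. (X n x - X m x)^2) = b n - b m"
proof -
 have "(LINT x|M. (X n x)^2) = (LINT x|M. (X n x - X m x)^2 + 2 * (X m x * (X n x - X m x)) + (X m x)^2)"
  by (intro Bochner_Integration.integral_cong) (auto simp: power2_eq_square algebra_simps)
 also have "\<dots> = (LINT x|M. (X n x - X m x)^2) + 2 * (LINT x|M. X m x * (X n x - X m x)) + (LINT x|M. (X m x)^2)"
  using integrable_L2_diff[OF X_meas X_meas L2 L2, of n m] L2[of m]
   integrable_mult_L2[OF X_meas borel_measurable_diff[OF X_meas X_meas] L2 integrable_L2_diff[OF X_meas X_meas L2 L2], of m n m] by simp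
 also have "(LINT x|M. X m x * (X n x - X m x)) = 0"
  by (rule orth[OF mn adapted L2])
 finally show ?thesis by (simp add: b_def)
qed

lemma b_mono: "m <= n ==> b m <= b n"
 using pythagoras[of m n] Bochner_Integration.integral_nonneg[of M "%x. (X n x - X m x)^2"] by simp

lemma b_convergent: "\<exists>l. b \<longlonglongrightarrow> l \<and> (\<forall>n. b n <= l)"
proof -
 have "incseq b" by (auto simp: incseq_def b_mono)
 moreover have "\<And>n. b n <= B" using bound by (simp add: b_def)
 ultimately obtain l where "b \<longlonglongrightarrow> l" "\<forall>n. b n <= l" using incseq_convergent by blast
 then show ?thesis by blast
qed

definition blim where "blim = (SOME l. b \<longlonglongrightarrow> l \<and> (\<forall>n. b n <= l))"

lemma blim: "b \<longlonglongrightarrow> blim" "b n <= blim"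
 using someI_ex[OF b_convergent] by (auto simp: blim_def)

text \<open>Doob's maximal inequality: split according to the first index at which the increment exceeds \<open>c\<close>.\<close>

lemma maximal:
 assumes c: "0 < c" and mn: "m <= n"
 shows "measure M {x \<in> space M. \<exists>j\<in>{m..n}. c < \<bar>X j x - X m x\<bar>} <= (b n - b m) / c^2"
proof -
 define A where "A j = {x \<in> space M. c < \<bar>X j x - X m x\<bar> \<and> (\<forall>i\<in>{m..<j}. \<bar>X i x - X m x\<bar> <= c)}" for j
 have AF: "A j \<in> sets (F j)" if "j \<in> {m..n}" for j
 proof -
  have [measurable]: "X i \<in> borel_measurable (F j)" if "i <= j" for i by (rule adapted_le[OF that])
  have [measurable]: "X m \<in> borel_measurable (F j)" using that by auto
  have "A j = {x \<in> space (F j). c < \<bar>X j x - X m x\<bar>} \<inter> (\<Inter>i\<in>{m..<j}. {x \<in> space (F j). \<bar>X i x - X m x\<bar> <= c}) \<inter> space (F j)"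
   by (auto simp: A_def space_F)
  also have "\<dots> \<in> sets (F j)"
  proof (cases "{m..<j} = {}")
   case False
   then show ?thesis by (intro sets.Int sets.finite_INT) auto
  qed auto
  finally show ?thesis .
 qed
 have [measurable]: "A j \<in> sets M" if "j \<in> {m..n}" for j
  using AF[OF that] sub[of j] by (auto simp: subalgebra_def)
 have disj: "disjoint_family_on A {m..n}"
 proof -
  have "A i \<inter> A j = {}" if "m <= i" "i < j" for i j
   using that by (auto simp: A_def not_le[symmetric])
  then show ?thesis unfolding disjoint_family_on_def
   by (metis Int_commute atLeastAtMost_iff linorder_neqE_nat)
 qed
 have U: "{x \<in> space M. \<exists>j\<in>{m..n}. c < \<bar>X j x - X m x\<bar>} = (\<Union>j\<in>{m..n}. A j)"
 proof (intro set_eqI iffI)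
  fix x assume x: "x \<in> {x \<in> space M. \<exists>j\<in>{m..n}. c < \<bar>X j x - X m x\<bar>}"
  then obtain k where k: "m <= k" "k <= n" "c < \<bar>X k x - X m x\<bar>" by auto
  define j where "j = (LEAST j. m <= j \<and> c < \<bar>X j x - X m x\<bar>)"
  have j: "m <= j \<and> c < \<bar>X j x - X m x\<bar>" unfolding j_def by (rule LeastI[of _ k]) (use k in auto)
  have "j <= k" unfolding j_def by (rule Least_le) (use k in auto)
  have "\<bar>X i x - X m x\<bar> <= c" if "i \<in> {m..<j}" for i
   using not_less_Least[of i "%j. m <= j \<and> c < \<bar>X j x - X m x\<bar>"] that by (auto simp: j_def)
  then have "x \<in> A j" using j x by (auto simp: A_def)
  then show "x \<in> (\<Union>j\<in>{m..n}. A j)" using j \<open>j <= k\<close> k by auto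
 qed (auto simp: A_def)
 have dL2: "integrable M (%x. (X i x - X j x)^2)" for i j by (intro integrable_L2_diff L2 X_meas)
 \<comment> \<open>On \<open>A j\<close>, the square of \<open>X n - X m\<close> minus twice a cross
   term equals \<open>(X j - X m)^2 + (X n - X j)^2\<close>, which is at least \<open>c^2\<close>.
   The cross term has mean zero because \<open>h\<close>, which contains the indicator of
   \<open>A j\<close>, is known at index \<open>j\<close>.\<close>
 have one: "c^2 * measure M (A j) <= (LINT x|M. indicator (A j) x * (X n x - X m x)^2)" if j: "j \<in> {m..n}" for j
 proof -
  note [measurable] = \<open>\<And>j. j \<in> {m..n} ==> A j \<in> sets M\<close>[OF j]
  define h where "h x = indicator (A j) x * (X j x - X m x)" for x
  have hm[measurable]: "h \<in> borel_measurable (F j)"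
   unfolding h_def using AF[OF j] adapted_le[of m j] adapted[of j] j by (intro borel_measurable_times) auto
  have hM[measurable]: "h \<in> borel_measurable M" by (rule measurable_from_subalg[OF sub hm])
  have h2: "integrable M (%x. (h x)^2)"
   by (rule Bochner_Integration.integrable_bound[OF dL2[of j m]])
    (auto simp: h_def power_mult_distrib split: split_indicator)
  have o: "(LINT x|M. h x * (X n x - X j x)) = 0" by (rule orth[OF _ hm h2]) (use j in auto)
  have i1: "integrable M (%x. h x * (X n x - X j x))"
   by (intro integrable_mult_L2 h2 dL2) auto
  have i2: "integrable M (%x. indicator (A j) x * (X n x - X m x)^2)"
   by (rule Bochner_Integration.integrable_bound[OF dL2[of n m]])
     (auto split: split_indicator)
  have "c^2 * measure M (A j) = (LINT x|M. c^2 * indicator (A j) x)" by simp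
  also have "\<dots> <= (LINT x|M. indicator (A j) x * (X n x - X m x)^2 - 2 * (h x * (X n x - X j x)))"
  proof (rule integral_mono)
   show "integrable M (%x. c^2 * indicator (A j) x :: real)" by (auto simp: less_top[symmetric])
   show "integrable M (%x. indicator (A j) x * (X n x - X m x)^2 - 2 * (h x * (X n x - X j x)))"
    using i1 i2 by auto
   fix x assume "x \<in> space M"
   have "c^2 <= (X n x - X m x)^2 - 2 * ((X j x - X m x) * (X n x - X j x))" if "x \<in> A j"
   proof -
    have "c^2 <= (X j x - X m x)^2" using that c by (subst abs_le_square_iff[symmetric]) (auto simp: A_def)
    also have "\<dots> <= (X j x - X m x)^2 + (X n x - X j x)^2" by simp
    also have "\<dots> = (X n x - X m x)^2 - 2 * ((X j x - X m x) * (X n x - X j x))"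
     by (simp add: power2_eq_square algebra_simps)
    finally show ?thesis .
   qed
   then show "c^2 * indicator (A j) x <= indicator (A j) x * (X n x - X m x)^2 - 2 * (h x * (X n x - X j x))"
    by (auto simp: h_def split: split_indicator)
  qed
  also have "\<dots> = (LINT x|M. indicator (A j) x * (X n x - X m x)^2)"
   using i1 i2 o by simp
  finally show ?thesis .
 qed
 have "c^2 * measure M (\<Union>j\<in>{m..n}. A j) = (\<Sum>j\<in>{m..n}. c^2 * measure M (A j))"
  using disj by (subst finite_measure_finite_Union) (auto simp: sum_distrib_left)
 also have "\<dots> <= (\<Sum>j\<in>{m..n}. \<integral>x. indicator (A j) x * (X n x - X m x)^2 \<partial>M)"
  by (intro sum_mono one)
 also have "\<dots> = (LINT x|M. (\<Sum>j\<in>{m..n}. indicator (A j) x * (X n x - X m x)^2))"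
  by (rule Bochner_Integration.integral_sum[symmetric])
    (rule Bochner_Integration.integrable_bound[OF dL2[of n m]], auto split: split_indicator)
 also have "\<dots> <= (LINT x|M. (X n x - X m x)^2)"
 proof (rule integral_mono)
  show "integrable M (%x. \<Sum>j\<in>{m..n}. indicator (A j) x * (X n x - X m x)^2)"
   by (rule Bochner_Integration.integrable_sum)
     (rule Bochner_Integration.integrable_bound[OF dL2[of n m]], auto split: split_indicator)
  fix x
  have "(\<Sum>j\<in>{m..n}. indicator (A j) x) = (indicator (\<Union>j\<in>{m..n}. A j) x :: real)"
   using disj by (subst indicator_UN_disjoint) auto
  then show "(\<Sum>j\<in>{m..n}. indicator (A j) x * (X n x - X m x)^2) <= (X n x - X m x)^2"
   by (simp add: sum_distrib_right[symmetric] split: split_indicator)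
 qed (rule dL2)
 also have "\<dots> = b n - b m" by (rule pythagoras[OF mn])
 finally show ?thesis using c unfolding U by (simp add: pos_le_divide_eq mult.commute)
qed

text \<open>The maximal inequality bounds the measure of the set on which the sequence ever leaves
  the \<open>c\<close>-neighbourhood of \<open>X m\<close> after index \<open>m\<close> by
  \<open>(blim - b m) / c^2\<close>, which tends to zero. Countably many radii \<open>c\<close> give
  the Cauchy property.\<close>

lemma AE_Cauchy: "AE x in M. Cauchy (%n. X n x)"
proof -
 have "AE x in M. \<exists>m. \<forall>j\<ge>m. \<bar>X j x - X m x\<bar> <= 1 / Suc p" for p
 proof -
  define c where "c = 1 / real (Suc p)"
  have c: "0 < c" by (simp add: c_def)
  define S where "S m = {x \<in> space M. \<exists>j\<ge>m. c < \<bar>X j x - X m x\<bar>}" for m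
  have [measurable]: "S m \<in> sets M" for m unfolding S_def by measurable
  have Sm: "measure M (S m) <= (blim - b m) / c^2" for m
  proof (rule LIMSEQ_le_const2)
   have "(%n. measure M {x \<in> space M. \<exists>j\<in>{m..n}. c < \<bar>X j x - X m x\<bar>}) \<longlonglongrightarrow> measure M (\<Union>n. {x \<in> space M. \<exists>j\<in>{m..n}. c < \<bar>X j x - X m x\<bar>})"
    by (rule finite_Lim_measure_incseq) (auto intro!: incseq_SucI bexI)
   also have "(\<Union>n. {x \<in> space M. \<exists>j\<in>{m..n}. c < \<bar>X j x - X m x\<bar>}) = S m" unfolding S_def by (auto, metis atLeastAtMost_iff order_refl)
   finally show "(%n. measure M {x \<in> space M. \<exists>j\<in>{m..n}. c < \<bar>X j x - X m x\<bar>}) \<longlonglongrightarrow> measure M (S m)" .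
   show "\<exists>N. \<forall>n\<ge>N. measure M {x \<in> space M. \<exists>j\<in>{m..n}. c < \<bar>X j x - X m x\<bar>} <= (blim - b m) / c^2"
    by (rule exI[of _ m], intro allI impI order.trans[OF maximal[OF c]] divide_right_mono diff_right_mono blim) simp_all
  qed
  have "measure M (\<Inter>m. S m) <= (blim - b m) / c^2" for m
   by (rule order.trans[OF finite_measure_mono Sm[of m]]) auto
  moreover have "(%m. (blim - b m) / c^2) \<longlonglongrightarrow> (blim - blim) / c^2"
   using c by (intro tendsto_intros blim) auto
  ultimately have "measure M (\<Inter>m. S m) <= 0"
   by (intro LIMSEQ_le_const[of "%m. (blim - b m) / c^2" 0]) auto
  then have "emeasure M (\<Inter>m. S m) = 0" by (simp add: emeasure_eq_measure measure_le_0_iff)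
  then show ?thesis
  proof (intro AE_I[of _ _ "\<Inter>m. S m"])
   show "{x \<in> space M. \<not> (\<exists>m. \<forall>j\<ge>m. \<bar>X j x - X m x\<bar> <= 1 / Suc p)} \<subseteq> (\<Inter>m. S m)"
    unfolding S_def c_def by (auto simp: not_le)
  qed auto
 qed
 then have "AE x in M. \<forall>p. \<exists>m. \<forall>j\<ge>m. \<bar>X j x - X m x\<bar> <= 1 / Suc p" by (simp add: AE_all_countable)
 then show ?thesis
 proof eventually_elim
  case (elim x)
  show "Cauchy (%n. X n x)"
  proof (rule metric_CauchyI)
   fix e :: real assume "0 < e"
   then obtain p where p: "1 / Suc p < e / 2" using nat_approx_posE[of "e/2"] by (auto simp: inverse_eq_divide)
   obtain m where m: "\<forall>j\<ge>m. \<bar>X j x - X m x\<bar> <= 1 / Suc p" using elim by blast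
   show "\<exists>M. \<forall>i\<ge>M. \<forall>j\<ge>M. dist (X i x) (X j x) < e"
   proof (intro exI[of _ m] allI impI)
    fix i j assume "m <= i" "m <= j"
    then have "\<bar>X i x - X m x\<bar> < e/2" "\<bar>X j x - X m x\<bar> < e/2" using m p by (auto intro: le_less_trans)
    then show "dist (X i x) (X j x) < e" unfolding dist_real_def by linarith
   qed
  qed
 qed
qed

text \<open>Fatou's lemma along the a.e. convergent sequence. The first bound is the rate of
  convergence in L2, the second one the persistence of the moment bound.\<close>

lemma L2_lim:
 assumes [measurable]: "Y \<in> borel_measurable M" and Y: "AE x in M. (%n. X n x) \<longlonglongrightarrow> Y x"
 shows "(\<integral>\<^sup>+x. ennreal ((Y x - X m x)^2) \<partial>M) <= ennreal (blim - b m)" (is ?g0)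
  and "(\<integral>\<^sup>+x. ennreal ((Y x)^2) \<partial>M) <= ennreal B" (is ?g1)
proof -
 have "(\<integral>\<^sup>+x. ennreal ((Y x - X m x)^2) \<partial>M) = (\<integral>\<^sup>+x. liminf (%n. ennreal ((X n x - X m x)^2)) \<partial>M)"
  using Y
 proof (intro nn_integral_cong_AE, eventually_elim)
  case (elim x)
  then have "(%n. ennreal ((X n x - X m x)^2)) \<longlonglongrightarrow> ennreal ((Y x - X m x)^2)"
   by (intro tendsto_intros tendsto_ennrealI)
  then show ?case by (simp only: lim_imp_Liminf[OF sequentially_bot])
 qed
 also have "\<dots> <= liminf (%n. \<integral>\<^sup>+x. ennreal ((X n x - X m x)^2) \<partial>M)"
  by (rule nn_integral_liminf) simp
 also have "\<dots> <= ennreal (blim - b m)"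
 proof -
  have "liminf (%n. \<integral>\<^sup>+x. ennreal ((X n x - X m x)^2) \<partial>M) <= limsup (%n. \<integral>\<^sup>+x. ennreal ((X n x - X m x)^2) \<partial>M)"
   by (simp add: Liminf_le_Limsup)
  also have "\<dots> <= ennreal (blim - b m)"
  proof (rule Limsup_bounded, rule eventually_sequentiallyI[of m])
   fix n assume "m <= n"
   have "(\<integral>\<^sup>+x. ennreal ((X n x - X m x)^2) \<partial>M) = ennreal (b n - b m)"
    unfolding pythagoras[OF \<open>m <= n\<close>, symmetric]
    by (intro nn_integral_eq_integral integrable_L2_diff L2) auto
   also have "\<dots> <= ennreal (blim - b m)" by (intro ennreal_leI diff_right_mono blim)
   finally show "(\<integral>\<^sup>+x. ennreal ((X n x - X m x)^2) \<partial>M) <= ennreal (blim - b m)" .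
  qed
  finally show ?thesis .
 qed
 finally show ?g0 .
 have "(\<integral>\<^sup>+x. ennreal ((Y x)^2) \<partial>M) = (\<integral>\<^sup>+x. liminf (%n. ennreal ((X n x)^2)) \<partial>M)"
  using Y
 proof (intro nn_integral_cong_AE, eventually_elim)
  case (elim x)
  then have "(%n. ennreal ((X n x)^2)) \<longlonglongrightarrow> ennreal ((Y x)^2)"
   by (intro tendsto_intros tendsto_ennrealI)
  then show ?case by (simp only: lim_imp_Liminf[OF sequentially_bot])
 qed
 also have "\<dots> <= liminf (%n. \<integral>\<^sup>+x. ennreal ((X n x)^2) \<partial>M)"
  by (rule nn_integral_liminf) simp
 also have "\<dots> = liminf (%n. ennreal (b n))"
  unfolding b_def by (subst nn_integral_eq_integral[OF L2]) auto
 also have "\<dots> <= ennreal B"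
  using bound by (intro Liminf_le) (auto simp: b_def intro!: always_eventually ennreal_leI)
 finally show ?g1 .
qed

end

section \<open>Indefinite integrals against the clock\<close>

context clock
begin

lemma set_integral_split:
 fixes g :: "real => real"
 assumes g: "set_integrable \<nu> {a..b} g" and "a <= t" "t <= b"
 shows "(LINT r:{a..b}|\<nu>. g r) = (LINT r:{a..t}|\<nu>. g r) + (LINT r:{t..b}|\<nu>. g r)"
proof -
 have i: "set_integrable \<nu> {a..t} g" "set_integrable \<nu> {t..b} g"
  using assms by (auto intro: set_integrable_subset[OF g])
 have "(LINT r:{a..b}|\<nu>. g r) = (LINT r|\<nu>. indicator {a..t} r *\<^sub>R g r + indicator {t..b} r *\<^sub>R g r)"
  unfolding set_lebesgue_integral_def
 proof (rule integral_cong_AE)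
  show "AE r in \<nu>. indicator {a..b} r *\<^sub>R g r = indicator {a..t} r *\<^sub>R g r + indicator {t..b} r *\<^sub>R g r"
   using nu_AE_neq[of t] by eventually_elim (use assms in \<open>auto simp: indicator_def\<close>)
 qed (use g i in \<open>auto simp: set_integrable_def\<close>)
 also have "\<dots> = (LINT r:{a..t}|\<nu>. g r) + (LINT r:{t..b}|\<nu>. g r)"
  using i unfolding set_lebesgue_integral_def set_integrable_def by (rule Bochner_Integration.integral_add)
 finally show ?thesis .
qed

text \<open>Dominated convergence: the indicators converge off the single point \<open>t\<close>,
  which \<nu> does not charge.\<close>

lemma indefinite_integral_continuous:
 fixes g :: "real => real"
 assumes g: "set_integrable \<nu> {a..b} g"
 shows "continuous_on {a..b} (%t. LINT r:{a..t}|\<nu>. g r)"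
proof (rule continuous_on_sequentiallyI)
 fix u t assume u: "\<forall>n. u n \<in> {a..b}" "t \<in> {a..b}" "u \<longlonglongrightarrow> t"
 have gi: "integrable \<nu> (%r. indicator {a..b} r *\<^sub>R g r)" using g by (simp add: set_integrable_def)
 have m: "(%r. indicator {a..v} r *\<^sub>R g r) \<in> borel_measurable \<nu>" if "v \<in> {a..b}" for v
  using set_integrable_subset[OF g, of "{a..v}"] that by (auto simp: set_integrable_def)
 show "(%n. LINT r:{a..u n}|\<nu>. g r) \<longlonglongrightarrow> (LINT r:{a..t}|\<nu>. g r)"
  unfolding set_lebesgue_integral_def
 proof (rule integral_dominated_convergence[where w="%r. norm (indicator {a..b} r *\<^sub>R g r)"])
  show "AE r in \<nu>. (%n. indicator {a..u n} r *\<^sub>R g r) \<longlonglongrightarrow> indicator {a..t} r *\<^sub>R g r"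
   using nu_AE_neq[of t]
  proof eventually_elim
   case (elim r)
   have "\<forall>\<^sub>F n in sequentially. indicator {a..u n} r = (indicator {a..t} r :: real)"
   proof (cases "r < t")
    case True
    then have "\<forall>\<^sub>F n in sequentially. r < u n" using u(3) by (rule order_tendstoD(1)[rotated])
    then show ?thesis by eventually_elim (use True in \<open>auto simp: indicator_def\<close>)
   next
    case False
    then have "t < r" using elim by auto
    then have "\<forall>\<^sub>F n in sequentially. u n < r" using u(3) by (rule order_tendstoD(2)[rotated])
    then show ?thesis by eventually_elim (use \<open>t < r\<close> in \<open>auto simp: indicator_def\<close>)
   qed
   then have "\<forall>\<^sub>F n in sequentially. indicator {a..u n} r *\<^sub>R g r = indicator {a..t} r *\<^sub>R g r"
    by eventually_elim simp
   then show ?case by (rule tendsto_eventually)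
  qed
  show "AE r in \<nu>. norm (indicator {a..u n} r *\<^sub>R g r) <= norm (indicator {a..b} r *\<^sub>R g r)" for n
   using u(1) by (intro AE_I2) (auto simp: indicator_def dest: spec[of _ n])
 qed (use m u gi in auto)
qed

text \<open>The positive and negative parts of \<open>g\<close> are densities of two measures with
  the same finite mass on every ray \<open>{x<..}\<close>. The rays determine the measures, and
  densities are a.e. unique.\<close>

lemma zero_of_indefinite_integral_zero:
 fixes g :: "real => real"
 assumes g: "set_integrable \<nu> {a..b} g" and ab: "a <= b"
  and z: "\<And>t. t \<in> {a..b} ==> (LINT r:{a..t}|\<nu>. g r) = 0"
 shows "AE r in \<nu>. r \<in> {a..b} \<longrightarrow> g r = 0"
proof -
 define p where "p r = ennreal (indicator {a..b} r * g r)" for r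
 define q where "q r = ennreal (- (indicator {a..b} r * g r))" for r
 have gi: "integrable \<nu> (%r. indicator {a..b} r * g r)" using g by (simp add: set_integrable_def)
 have [measurable]: "p \<in> borel_measurable \<nu>" "q \<in> borel_measurable \<nu>"
  using gi unfolding p_def q_def by (auto intro!: measurable_compose[OF _ measurable_ennreal])
 have xi: "integrable \<nu> (%r. indicator {x<..} r * (indicator {a..b} r * g r))" for x
  using integrable_mult_indicator[OF _ gi, of "{x<..}"] by simp
 have x0: "(LINT r|\<nu>. indicator {x<..} r * (indicator {a..b} r * g r)) = 0" for x
 proof -
  consider "x < a" | "x \<in> {a..b}" | "b < x" by fastforce
  then show ?thesis
  proof cases
   case 1
   then have "(LINT r|\<nu>. indicator {x<..} r * (indicator {a..b} r * g r)) = (LINT r:{a..b}|\<nu>. g r)"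
    unfolding set_lebesgue_integral_def by (intro Bochner_Integration.integral_cong) (auto simp: indicator_def)
   then show ?thesis using z[of b] ab by simp
  next
   case 2
   have "(LINT r|\<nu>. indicator {x<..} r * (indicator {a..b} r * g r)) = (LINT r:{x..b}|\<nu>. g r)"
    unfolding set_lebesgue_integral_def
   proof (rule integral_cong_AE)
    show "AE r in \<nu>. indicator {x<..} r * (indicator {a..b} r * g r) = indicator {x..b} r *\<^sub>R g r"
     using nu_AE_neq[of x] by eventually_elim (use 2 in \<open>auto simp: indicator_def\<close>)
    show "(%r. indicator {x..b} r *\<^sub>R g r) \<in> borel_measurable \<nu>"
     using set_integrable_subset[OF g, of "{x..b}"] 2 by (auto simp: set_integrable_def)
   qed (use xi in auto)
   then show ?thesis using set_integral_split[OF g, of x] z[of x] z[of b] 2 by auto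
  next
   case 3
   then have "(LINT r|\<nu>. indicator {x<..} r * (indicator {a..b} r * g r)) = (LINT r|\<nu>. 0)"
    by (intro Bochner_Integration.integral_cong) (auto simp: indicator_def)
   then show ?thesis by simp
  qed
 qed
 have fin: "(\<integral>\<^sup>+r. p r * indicator {x<..} r \<partial>\<nu>) < \<infinity>" "(\<integral>\<^sup>+r. q r * indicator {x<..} r \<partial>\<nu>) < \<infinity>"
  and eq: "(\<integral>\<^sup>+r. p r * indicator {x<..} r \<partial>\<nu>) = (\<integral>\<^sup>+r. q r * indicator {x<..} r \<partial>\<nu>)" for x
 proof -
  have e: "p r * indicator {x<..} r = ennreal (indicator {x<..} r * (indicator {a..b} r * g r))"
    "q r * indicator {x<..} r = ennreal (- (indicator {x<..} r * (indicator {a..b} r * g r)))" for r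
   by (auto simp: p_def q_def indicator_def)
  have le: "p r * indicator {x<..} r <= ennreal (norm (indicator {x<..} r * (indicator {a..b} r * g r)))"
    "q r * indicator {x<..} r <= ennreal (norm (indicator {x<..} r * (indicator {a..b} r * g r)))" for r
   unfolding e by (auto intro!: ennreal_leI)
  have f: "(\<integral>\<^sup>+r. ennreal (norm (indicator {x<..} r * (indicator {a..b} r * g r))) \<partial>\<nu>) < \<infinity>"
   using xi[of x] by (simp add: integrable_iff_bounded)
  show f1: "(\<integral>\<^sup>+r. p r * indicator {x<..} r \<partial>\<nu>) < \<infinity>"
   by (rule le_less_trans[OF nn_integral_mono f]) (rule le)
  show f2: "(\<integral>\<^sup>+r. q r * indicator {x<..} r \<partial>\<nu>) < \<infinity>"
   by (rule le_less_trans[OF nn_integral_mono f]) (rule le)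
  have "enn2real (\<integral>\<^sup>+r. p r * indicator {x<..} r \<partial>\<nu>) = enn2real (\<integral>\<^sup>+r. q r * indicator {x<..} r \<partial>\<nu>)"
   using x0[of x] unfolding e real_lebesgue_integral_def[OF xi[of x]] by simp
  then show "(\<integral>\<^sup>+r. p r * indicator {x<..} r \<partial>\<nu>) = (\<integral>\<^sup>+r. q r * indicator {x<..} r \<partial>\<nu>)"
   using f1 f2 by (metis ennreal_enn2real infinity_ennreal_def)
 qed
 have "density \<nu> p = density \<nu> q"
  by (rule measure_eqI_lessThan) (auto simp: emeasure_density fin eq[symmetric] simp del: infinity_ennreal_def)
 then have "AE r in \<nu>. p r = q r"
  by (rule nu.density_unique[rotated 2]) auto
 then show ?thesis
 proof eventually_elim
  case (elim r)
  then show ?case by (cases "g r" "0::real" rule: linorder_cases) (auto simp: p_def q_def ennreal_neg)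
 qed
qed

end

section \<open>Filtered probability spaces with a clock\<close>

text \<open>\<open>Q\<close> will be the completion of one law \<open>P s \<eta>\<close>,
  \<open>G\<close> its completed filtration and \<open>s\<close> the starting time. Points of the
  space are abstract here, so each result can be instantiated at every initial condition.\<close>

locale filtered_clock = clock W T \<nu> + Q: prob_space Q
 for W T \<nu> and Q :: "'a measure" +
 fixes G :: "real => 'a measure" and s :: real
 assumes s_ge: "0 <= s" and s_le: "s <= T"
  and subG: "\<And>t. subalgebra Q (G t)" and G_mono: "\<And>t u. t <= u ==> sets (G t) \<subseteq> sets (G u)"
begin

sublocale QV: pair_sigma_finite \<nu> Q ..

lemma space_G[simp]: "space (G t) = space Q"
 using subG[of t] by (simp add: subalgebra_def)

lemma G_sets: "A \<in> sets (G t) ==> A \<in> sets Q"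
 using subG[of t] by (auto simp: subalgebra_def)

lemma G_meas: "f \<in> borel_measurable (G t) ==> f \<in> borel_measurable Q"
 by (rule measurable_from_subalg[OF subG])

lemma G_meas_mono: "f \<in> borel_measurable (G t) ==> t <= u ==> f \<in> borel_measurable (G u)"
 by (rule measurable_from_subalg[of "G u" "G t"]) (use G_mono in \<open>auto simp: subalgebra_def\<close>)

text \<open>The restriction of time is expressed by an indicator factor instead of a restricted
  space, so that all measurability statements live on the full product
  \<open>borel \<Otimes>\<^sub>M G u\<close>.\<close>

definition prog :: "(real => 'a => real) => bool" where
 "prog X \<longleftrightarrow> (\<forall>u\<in>{s..T}. (%(r, w). indicator {s..u} r * X r w) \<in> borel_measurable (borel \<Otimes>\<^sub>M G u))"

abbreviation sq where "sq t Z w \<equiv> \<integral>\<^sup>+r\<in>{t..T}. ennreal ((Z r w)^2) \<partial>\<nu>"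
abbreviation ab where "ab t u Z w \<equiv> \<integral>\<^sup>+r\<in>{t..u}. ennreal \<bar>Z r w\<bar> \<partial>\<nu>"

definition nI :: "real => real => (real => 'a => real) => 'a => real" where
 "nI t u X w = (LINT r:{t..u}|\<nu>. X r w)"

lemma progD: "prog X ==> s <= u ==> u <= T ==> (%p. indicator {s..u} (fst p) * X (fst p) (snd p)) \<in> borel_measurable (borel \<Otimes>\<^sub>M G u)"
 by (auto simp: prog_def split_beta')

lemma prog_Q: assumes "prog X" shows "(%p. indicator {s..T} (fst p) * X (fst p) (snd p)) \<in> borel_measurable (\<nu> \<Otimes>\<^sub>M Q)"
proof -
 have "subalgebra (borel \<Otimes>\<^sub>M Q) (borel \<Otimes>\<^sub>M G T)"
  unfolding subalgebra_def by (auto simp: space_pair_measure G_sets intro!: sets_pair_measure_cong dest!: G_sets)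
   (meson G_sets sets_pair_in_sets pair_measureI in_mono)
 from measurable_from_subalg[OF this progD[OF assms s_le]] show ?thesis
  by (simp cong: measurable_cong_sets)
qed

lemma prog_section: assumes "prog X" "t \<in> {s..T}" shows "X t \<in> borel_measurable (G t)"
proof -
 have "(%w. (t, w)) \<in> measurable (G t) (borel \<Otimes>\<^sub>M G t)" by simp
 from measurable_compose[OF this progD[OF assms(1), of t]] assms(2) show ?thesis by simp
qed

lemma prog_sub:
 assumes "prog X" "s <= t" "t <= u" "u <= T"
 shows "(%p. indicator {t..u} (snd p) * X (snd p) (fst p)) \<in> borel_measurable (G u \<Otimes>\<^sub>M \<nu>)"
proof -
 have "(%p. (snd p, fst p)) \<in> measurable (G u \<Otimes>\<^sub>M \<nu>) (borel \<Otimes>\<^sub>M G u)" by (simp cong: measurable_cong_sets)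
 from measurable_compose[OF this progD[OF assms(1), of u]] assms
 have [measurable]: "(%p. indicator {s..u} (snd p) * X (snd p) (fst p)) \<in> borel_measurable (G u \<Otimes>\<^sub>M \<nu>)" by simp
 have "(%p. indicator {t..u} (snd p) * (indicator {s..u} (snd p) * X (snd p) (fst p))) \<in> borel_measurable (G u \<Otimes>\<^sub>M \<nu>)"
  by measurable
 moreover have "(%p. indicator {t..u} (snd p) * (indicator {s..u} (snd p) * X (snd p) (fst p))) = (%p. indicator {t..u} (snd p) * X (snd p) (fst p))"
  using assms by (auto simp: indicator_def fun_eq_iff)
 ultimately show ?thesis by simp
qed

lemma nI_meas:
 assumes "prog X" "s <= t" "t <= u" "u <= T"
 shows "nI t u X \<in> borel_measurable (G u)"
 unfolding nI_def[abs_def] set_lebesgue_integral_def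
 using nu.borel_measurable_lebesgue_integral[of "%w r. indicator {t..u} r * X r w" "G u"] prog_sub[OF assms]
 by (simp add: split_beta')

lemma nn_meas:
 assumes "prog X" "s <= t" "t <= u" "u <= T"
 shows "(%w. \<integral>\<^sup>+r\<in>{t..u}. ennreal \<bar>X r w\<bar> \<partial>\<nu>) \<in> borel_measurable (G u)"
proof -
 note [measurable] = prog_sub[OF assms]
 have "(%w. \<integral>\<^sup>+r. ennreal \<bar>indicator {t..u} r * X r w\<bar> \<partial>\<nu>) \<in> borel_measurable (G u)"
  by (rule nu.borel_measurable_nn_integral) (simp add: split_beta')
 also have "(%w. \<integral>\<^sup>+r. ennreal \<bar>indicator {t..u} r * X r w\<bar> \<partial>\<nu>) = (%w. \<integral>\<^sup>+r\<in>{t..u}. ennreal \<bar>X r w\<bar> \<partial>\<nu>)"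
  by (intro ext nn_integral_cong) (auto simp: indicator_def)
 finally show ?thesis .
qed

lemma prog_path:
 assumes "prog X" "s <= t" "t <= u" "u <= T" "w \<in> space Q"
 shows "(%r. indicator {t..u} r * X r w) \<in> borel_measurable borel"
proof -
 have "(%r. (w, r)) \<in> measurable borel (G u \<Otimes>\<^sub>M \<nu>)" using assms by (simp cong: measurable_cong_sets)
 from measurable_compose[OF this prog_sub[OF assms(1-4)]] show ?thesis by simp
qed

lemma prog_const: "f \<in> borel_measurable (G s) ==> prog (%r. f)"
 unfolding prog_def using G_meas_mono by (auto simp: split_beta' intro!: borel_measurable_times measurable_compose[OF measurable_snd])

lemma prog_arith:
 assumes "prog X" "prog Y"
 shows "prog (%r w. X r w + Y r w)" "prog (%r w. X r w - Y r w)" "prog (%r w. X r w * Y r w)"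
proof -
 have "(%p. indicator {s..u} (fst p) * X (fst p) (snd p) + indicator {s..u} (fst p) * Y (fst p) (snd p)) \<in> borel_measurable (borel \<Otimes>\<^sub>M G u)"
  "(%p. indicator {s..u} (fst p) * X (fst p) (snd p) - indicator {s..u} (fst p) * Y (fst p) (snd p)) \<in> borel_measurable (borel \<Otimes>\<^sub>M G u)"
  "(%p. (indicator {s..u} (fst p) * X (fst p) (snd p)) * (indicator {s..u} (fst p) * Y (fst p) (snd p))) \<in> borel_measurable (borel \<Otimes>\<^sub>M G u)"
  if "u \<in> {s..T}" for u
  using progD[OF assms(1), of u] progD[OF assms(2), of u] that by auto
 moreover have "(indicator {s..u} r * x) * (indicator {s..u} r * y) = indicator {s..u} r * (x * y)" for u r x y :: real
  by (simp add: indicator_def)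
 ultimately show "prog (%r w. X r w + Y r w)" "prog (%r w. X r w - Y r w)" "prog (%r w. X r w * Y r w)"
  unfolding prog_def by (simp_all add: split_beta' distrib_left right_diff_distrib)
qed

lemma prog_abs: assumes "prog X" shows "prog (%r w. \<bar>X r w\<bar>)"
proof -
 have "(%p. \<bar>indicator {s..u} (fst p) * X (fst p) (snd p)\<bar>) \<in> borel_measurable (borel \<Otimes>\<^sub>M G u)" if "u \<in> {s..T}" for u
  using progD[OF assms, of u] that by auto
 then show ?thesis unfolding prog_def by (simp add: split_beta' abs_mult)
qed

text \<open>The hypothesis says that the conditional expectation of \<open>Z\<close> given
  \<open>G t\<close> is zero. The lemma leads from events of \<open>G t\<close> to all
  \<open>G t\<close>-measurable multipliers with integrable product.\<close>

lemma test_zero: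
 assumes Z: "integrable Q Z" "\<And>A. A \<in> sets (G t) ==> (LINT w:A|Q. Z w) = 0"
  and Y: "Y \<in> borel_measurable (G t)" and YZ: "integrable Q (%w. Y w * Z w)"
 shows "(LINT w|Q. Y w * Z w) = (0::real)"
proof -
 interpret finite_measure_subalgebra Q "G t" by unfold_locales (rule subG)
 have ch: "AE x in Q. real_cond_exp Q (G t) Z x = 0"
  by (rule real_cond_exp_charact) (use Z in auto)
 note [measurable] = G_meas[OF Y]
 have "(LINT w|Q. Y w * Z w) = (LINT x|Q. Y x * real_cond_exp Q (G t) Z x)"
  using Z(1) by (intro real_cond_exp_intg(2)[symmetric] YZ Y) auto
 also have "\<dots> = (LINT x|Q. 0)"
  using ch by (intro integral_cong_AE) auto
 finally show ?thesis by simp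
qed

lemma nI_same[simp]: "nI t t h w = 0"
proof -
 have "(LINT r|\<nu>. indicator {t} r *\<^sub>R h r w) = (LINT r|\<nu>. indicator {t} r *\<^sub>R h t w)"
  by (intro Bochner_Integration.integral_cong) (auto simp: indicator_def)
 then show ?thesis by (simp add: nI_def set_lebesgue_integral_def measure_def)
qed

lemma set_integrable_of_nn:
 assumes "prog h" "s <= t" "t <= u" "u <= T" "w \<in> space Q" "(ab t u h w) < \<infinity>"
 shows "set_integrable \<nu> {t..u} (%r. h r w)"
 unfolding set_integrable_def
proof (rule integrableI_bounded)
 show "(%r. indicator {t..u} r *\<^sub>R h r w) \<in> borel_measurable \<nu>"
  using prog_path[OF assms(1-5)] by (simp cong: measurable_cong_sets)
 have "(\<integral>\<^sup>+r. ennreal (norm (indicator {t..u} r *\<^sub>R h r w)) \<partial>\<nu>) = (ab t u h w)"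
  by (intro nn_integral_cong) (auto simp: indicator_def)
 then show "(\<integral>\<^sup>+r. ennreal (norm (indicator {t..u} r *\<^sub>R h r w)) \<partial>\<nu>) < \<infinity>" using assms by simp
qed

lemma nn_of_set_integrable:
 fixes g :: "real => real"
 assumes "set_integrable \<nu> {t..u} g"
 shows "(\<integral>\<^sup>+r\<in>{t..u}. ennreal \<bar>g r\<bar> \<partial>\<nu>) = ennreal (LINT r:{t..u}|\<nu>. \<bar>g r\<bar>)"
proof -
 have "integrable \<nu> (%r. indicator {t..u} r *\<^sub>R \<bar>g r\<bar>)"
  using set_integrable_abs[OF assms] by (simp add: set_integrable_def)
 then have "(\<integral>\<^sup>+r. ennreal (indicator {t..u} r *\<^sub>R \<bar>g r\<bar>) \<partial>\<nu>) = ennreal (LINT r:{t..u}|\<nu>. \<bar>g r\<bar>)"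
  unfolding set_lebesgue_integral_def by (intro nn_integral_eq_integral) auto
 also have "(\<integral>\<^sup>+r. ennreal (indicator {t..u} r *\<^sub>R \<bar>g r\<bar>) \<partial>\<nu>) = (\<integral>\<^sup>+r\<in>{t..u}. ennreal \<bar>g r\<bar> \<partial>\<nu>)"
  by (intro nn_integral_cong) (auto simp: indicator_def)
 finally show ?thesis .
qed

lemma nI_le_nn: "ennreal \<bar>nI t u h w\<bar> <= (ab t u h w)"
proof (cases "set_integrable \<nu> {t..u} (%r. h r w)")
 case True
 have "\<bar>nI t u h w\<bar> <= (LINT r:{t..u}|\<nu>. \<bar>h r w\<bar>)"
  unfolding nI_def set_lebesgue_integral_def
  using integral_abs_bound[of \<nu> "%r. indicator {t..u} r *\<^sub>R h r w"] by (simp add: abs_mult)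
 then show ?thesis by (simp add: nn_of_set_integrable[OF True] ennreal_leI)
next
 case False
 \<comment> \<open>On a path that is not integrable the Bochner integral takes its default value 0,
   so the bound holds for every path.\<close>
 then have "nI t u h w = 0" unfolding nI_def set_lebesgue_integral_def set_integrable_def
  by (rule not_integrable_integral_eq)
 then show ?thesis by simp
qed

end

lemma Cauchy_Schwarz_integral:
 fixes f g :: "'a => real"
 assumes [measurable]: "f \<in> borel_measurable M" "g \<in> borel_measurable M"
  and f: "integrable M (%x. (f x)^2)" and g: "integrable M (%x. (g x)^2)"
 shows "(LINT x|M. f x * g x)^2 <= (LINT x|M. (f x)^2) * (LINT x|M. (g x)^2)"
proof -
 have i: "integrable M (%x. \<bar>f x\<bar> * \<bar>g x\<bar>)"
  using integrable_mult_L2[of "%x. \<bar>f x\<bar>" M "%x. \<bar>g x\<bar>"] f g by simp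
 have "(\<integral>\<^sup>+x. ennreal \<bar>f x\<bar> * ennreal \<bar>g x\<bar> \<partial>M)^2 <= (\<integral>\<^sup>+x. (ennreal \<bar>f x\<bar>)^2 \<partial>M) * (\<integral>\<^sup>+x. (ennreal \<bar>g x\<bar>)^2 \<partial>M)"
  by (rule Cauchy_Schwarz_nn_integral) auto
 also have "(\<integral>\<^sup>+x. ennreal \<bar>f x\<bar> * ennreal \<bar>g x\<bar> \<partial>M) = ennreal (LINT x|M. \<bar>f x\<bar> * \<bar>g x\<bar>)"
  using nn_integral_eq_integral[OF i] by (simp add: ennreal_mult)
 also have "(\<integral>\<^sup>+x. (ennreal \<bar>f x\<bar>)^2 \<partial>M) = ennreal (LINT x|M. (f x)^2)"
  using nn_integral_eq_integral[OF f] by (simp add: ennreal_power)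
 also have "(\<integral>\<^sup>+x. (ennreal \<bar>g x\<bar>)^2 \<partial>M) = ennreal (LINT x|M. (g x)^2)"
  using nn_integral_eq_integral[OF g] by (simp add: ennreal_power)
 finally have "ennreal ((LINT x|M. \<bar>f x\<bar> * \<bar>g x\<bar>)^2) <= ennreal ((LINT x|M. (f x)^2) * (LINT x|M. (g x)^2))"
  by (simp add: ennreal_power ennreal_mult)
 then have "(LINT x|M. \<bar>f x\<bar> * \<bar>g x\<bar>)^2 <= (LINT x|M. (f x)^2) * (LINT x|M. (g x)^2)"
  by (subst (asm) ennreal_le_iff) auto
 moreover have "\<bar>\<integral>x. f x * g x \<partial>M\<bar> <= (LINT x|M. \<bar>f x\<bar> * \<bar>g x\<bar>)"
  using integral_abs_bound[of M "%x. f x * g x"] by (simp add: abs_mult)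
 then have "\<bar>\<integral>x. f x * g x \<partial>M\<bar>^2 <= (LINT x|M. \<bar>f x\<bar> * \<bar>g x\<bar>)^2" by (intro power_mono) auto
 ultimately show ?thesis by simp
qed

section \<open>The dyadic grid\<close>

context clock
begin

definition q :: "nat => nat => real" where "q n i = real i * T / 2 ^ n"
text \<open>The index \<open>i\<close> of the dyadic interval \<open>(q n i, q n (i + 1)]\<close>
  that contains \<open>r > 0\<close>. The interval is open on the left, so a quantity known at its
  left end is known at \<open>r\<close>. For \<open>r <= 0\<close> the conversion to naturals
  truncates to 0.\<close>

definition blk :: "nat => real => nat" where "blk n r = nat (\<lceil>r * 2 ^ n / T\<rceil> - 1)"

lemma q_simps: "q n 0 = 0" "q n (2 ^ n) = T" "q (Suc n) (2 * i) = q n i" "0 <= q n i"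
 "q n i <= q n j \<longleftrightarrow> i <= j" "q n i < q n j \<longleftrightarrow> i < j"
 using T_pos by (auto simp: q_def divide_right_mono field_simps)

lemma q_le_T: "q n i <= T \<longleftrightarrow> i <= 2 ^ n"
 using q_simps(5)[of n i "2 ^ n"] by (simp add: q_simps)

lemma blk_bounds:
 assumes "0 < r"
 shows "q n (blk n r) < r" "r <= q n (Suc (blk n r))" (is ?g1)
proof -
 define x where "x = r * 2 ^ n / T"
 have x: "0 < x" using assms T_pos by (simp add: x_def)
 then have "1 <= \<lceil>x\<rceil>" by (simp add: less_ceiling_iff one_le_ceiling)
 then have b: "real (blk n r) = of_int \<lceil>x\<rceil> - 1" by (simp add: blk_def x_def)
 have rx: "r = x * T / 2 ^ n" using T_pos by (simp add: x_def)
 have "real (blk n r) < x" using b ceiling_correct[of x] by linarith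
 then show "q n (blk n r) < r" unfolding q_def rx using T_pos by (simp add: divide_strict_right_mono)
 have "x <= real (Suc (blk n r))" using b ceiling_correct[of x] by simp
 then show ?g1 unfolding q_def rx using T_pos by (intro divide_right_mono mult_right_mono) auto
qed

lemma blk_eqI: assumes "q n i < r" "r <= q n (Suc i)" shows "blk n r = i"
proof -
 have r: "0 < r" using assms(1) q_simps(4)[of n i] by linarith
 have "q n (blk n r) < q n (Suc i)" "q n i < q n (Suc (blk n r))"
  using blk_bounds[OF r, of n] assms by linarith+
 then show ?thesis by (simp add: q_simps)
qed

lemma blk_iff: "0 < r ==> blk n r = i \<longleftrightarrow> r \<in> {q n i<..q n (Suc i)}"
 using blk_bounds[of r n] blk_eqI[of n i r] by auto

lemma blk_nonpos: "r <= 0 ==> blk n r = 0"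
proof -
 assume "r <= 0"
 then have "r * 2 ^ n / T <= 0" using T_pos by (simp add: divide_nonpos_pos mult_nonpos_nonneg)
 then have "\<lceil>r * 2 ^ n / T\<rceil> <= 0" by (simp add: ceiling_le_iff)
 then show ?thesis by (simp add: blk_def)
qed

lemma q_blk_le: "0 <= r ==> q n (blk n r) <= r"
 using blk_bounds(1)[of r n] blk_nonpos[of r n] by (cases "r = 0") (auto simp: q_simps)

text \<open>Halving the index leads from a dyadic interval to its parent; this makes the block
  filtration increase with the level.\<close>

lemma blk_Suc: assumes "0 < r" shows "blk (Suc n) r div 2 = blk n r"
proof -
 define j where "j = blk (Suc n) r"
 have j: "q (Suc n) j < r" "r <= q (Suc n) (Suc j)" using blk_bounds[OF assms, of "Suc n"] by (auto simp: j_def)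
 have "q n (j div 2) <= q (Suc n) j" "q (Suc n) (Suc j) <= q n (Suc (j div 2))"
  unfolding q_simps(3)[of n "j div 2", symmetric] q_simps(3)[of n "Suc (j div 2)", symmetric] q_simps(5) by presburger+
 then show ?thesis using j by (intro blk_eqI[symmetric]) (auto simp: j_def)
qed

lemma blk_measurable[measurable]: "blk n \<in> measurable borel (count_space UNIV)"
proof -
 have "(%r. r * 2 ^ n / T) \<in> borel_measurable borel" by simp
 then have "(%r. \<lceil>r * 2 ^ n / T\<rceil>) \<in> measurable borel (count_space UNIV)" by measurable
 then show ?thesis unfolding blk_def[abs_def]
  by (rule measurable_compose[where g="%z. nat (z - 1)"]) simp
qed

lemma blk_lt: "r <= T ==> blk n r < 2 ^ n"
 using blk_bounds(1)[of r n] q_simps(6)[of n "blk n r" "2 ^ n"] blk_nonpos[of r n]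
 by (cases "0 < r") (auto simp: q_simps)

lemma dyadic_measurable:
 fixes \<kappa> :: "nat => 'c => real"
 assumes \<kappa>: "\<And>i. \<kappa> i \<in> borel_measurable (H (q n i))"
  and H: "\<And>t u. t <= u ==> sets (H t) \<subseteq> sets (H u)" "\<And>t u. space (H t) = space (H u)" and a: "0 <= a"
 shows "(%p. indicator {a..u} (fst p) * \<kappa> (blk n (fst p)) (snd p)) \<in> borel_measurable (borel \<Otimes>\<^sub>M H u)"
proof -
 \<comment> \<open>Blocks that start after \<open>u\<close> are never met at times up to
   \<open>u\<close>. Setting their values to 0 makes all values
   \<open>H u\<close>-measurable.\<close>
 define \<kappa>' where "\<kappa>' i = (if q n i <= u then \<kappa> i else (%_. 0 :: real))" for i
 have m[measurable]: "\<kappa>' i \<in> borel_measurable (H u)" for i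
  using measurable_from_subalg[OF _ \<kappa>[of i], of "H u"] H by (auto simp: \<kappa>'_def subalgebra_def)
 have "(%p. \<kappa>' (blk n (fst p)) (snd p)) \<in> borel_measurable (borel \<Otimes>\<^sub>M H u)"
  by (rule measurable_compose_countable[of "%i p. \<kappa>' i (snd p)"]) measurable
 then have "(%p. indicator {a..u} (fst p) * \<kappa>' (blk n (fst p)) (snd p)) \<in> borel_measurable (borel \<Otimes>\<^sub>M H u)"
  by measurable
 also have "(%p. indicator {a..u} (fst p) * \<kappa>' (blk n (fst p)) (snd p)) = (%p. indicator {a..u} (fst p) * \<kappa> (blk n (fst p)) (snd p))"
 proof (rule ext)
  fix p :: "real \<times> 'c"
  show "indicator {a..u} (fst p) * \<kappa>' (blk n (fst p)) (snd p) = indicator {a..u} (fst p) * \<kappa> (blk n (fst p)) (snd p)"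
   using q_blk_le[of "fst p" n] a by (auto simp: \<kappa>'_def indicator_def)
 qed
 finally show ?thesis .
qed

lemma dyadic_lim_measurable:
 fixes \<kappa> :: "nat => nat => 'c => real"
 assumes \<kappa>: "\<And>n i. \<kappa> n i \<in> borel_measurable (H (q n i))"
  and H: "\<And>t u. t <= u ==> sets (H t) \<subseteq> sets (H u)" "\<And>t u. space (H t) = space (H u)" and a: "0 <= a"
 shows "(%p. indicator {a..u} (fst p) * lim (%n. \<kappa> n (blk n (fst p)) (snd p)) :: real) \<in> borel_measurable (borel \<Otimes>\<^sub>M H u)"
proof -
 have [measurable]: "(%p. indicator {a..u} (fst p) * \<kappa> n (blk n (fst p)) (snd p)) \<in> borel_measurable (borel \<Otimes>\<^sub>M H u)" for n
  by (rule dyadic_measurable) fact+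
 have "(%p. lim (%n. indicator {a..u} (fst p) * \<kappa> n (blk n (fst p)) (snd p))) \<in> borel_measurable (borel \<Otimes>\<^sub>M H u)"
  by measurable
 also have "(%p. lim (%n. indicator {a..u} (fst p) * \<kappa> n (blk n (fst p)) (snd p))) = (%p. indicator {a..u} (fst p) * lim (%n. \<kappa> n (blk n (fst p)) (snd p)))"
  by (auto simp: indicator_def fun_eq_iff)
 finally show ?thesis .
qed

text \<open>The index of the first grid point of level \<open>n\<close> at or after
  \<open>t\<close>. These points approximate \<open>t\<close> from the right, which carries results
  from grid points to arbitrary times.\<close>

definition up :: "real => nat => nat" where "up t n = nat \<lceil>t * 2 ^ n / T\<rceil>"

lemma up:
 assumes "0 <= t" "t <= T"
 shows "t <= q n (up t n)" "q n (up t n) <= T" "(%n. q n (up t n)) \<longlonglongrightarrow> t" (is ?g2)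
proof -
 define x where "x n = t * 2 ^ n / T" for n
 have x0: "0 <= x n" for n using assms T_pos by (simp add: x_def)
 have u: "real (up t n) = of_int \<lceil>x n\<rceil>" for n
  using x0[of n] unfolding up_def x_def[symmetric] by (simp add: ceiling_mono[of 0, simplified] of_nat_nat)
 have tx: "t = x n * T / 2 ^ n" for n using T_pos by (simp add: x_def)
 have le: "t <= q n (up t n)" for n
  unfolding q_def u by (subst tx[of n]) (use T_pos in \<open>intro divide_right_mono mult_right_mono, auto\<close>)
 show "t <= q n (up t n)" by (rule le)
 have "x n <= 2 ^ n" using assms T_pos by (simp add: x_def divide_le_eq)
 then have "\<lceil>x n\<rceil> <= 2 ^ n" by (simp add: ceiling_le_iff)
 then have "real (up t n) <= 2 ^ n" unfolding u by (metis of_int_le_iff of_int_numeral of_int_power)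
 then have "up t n <= 2 ^ n" by (metis of_nat_le_iff of_nat_numeral of_nat_power)
 then show "q n (up t n) <= T" by (simp add: q_le_T)
 have ge: "q n (up t n) <= t + T / 2 ^ n" for n
 proof -
  have "real (up t n) <= x n + 1" unfolding u by linarith
  then have "q n (up t n) <= (x n + 1) * T / 2 ^ n" unfolding q_def using T_pos by (intro divide_right_mono mult_right_mono) auto
  also have "\<dots> = t + T / 2 ^ n" unfolding tx[of n] using T_pos by (simp add: x_def field_simps)
  finally show ?thesis .
 qed
 show ?g2
 proof (rule tendsto_sandwich[of "%_. t" _ _ "%n. t + T / 2 ^ n"])
  have "(%n. t + T * (1 / 2) ^ n) \<longlonglongrightarrow> t + T * 0" by (intro tendsto_intros LIMSEQ_power_zero) auto
  then show "(%n. t + T / 2 ^ n) \<longlonglongrightarrow> t" by (simp add: power_one_over)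
 qed (use le ge in auto)
qed

end

section \<open>L2 martingales, covariances and bracket densities\<close>

context filtered_clock
begin

text \<open>A square integrable martingale on \<open>[s,T]\<close> in set-integral form. The
  conditions concern one or two times at once, so they are meaningful for a process given without
  regular paths.\<close>

definition l2m :: "(real => 'a => real) => bool" where
 "l2m M \<longleftrightarrow> (\<forall>t\<in>{s..T}. M t \<in> borel_measurable (G t) \<and> integrable Q (%w. (M t w)^2)) \<and>
   (\<forall>t u A. s <= t \<longrightarrow> t <= u \<longrightarrow> u <= T \<longrightarrow> A \<in> sets (G t) \<longrightarrow> (LINT w:A|Q. M u w) = (LINT w:A|Q. M t w))"

lemma set_integrable_of: "integrable Q f ==> A \<in> sets (G t) ==> set_integrable Q A (f :: 'a => real)"
 unfolding set_integrable_def by (intro integrable_mult_indicator G_sets)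

lemma l2m_D:
 assumes "l2m M" "t \<in> {s..T}"
 shows "M t \<in> borel_measurable (G t)" "M t \<in> borel_measurable Q" "integrable Q (%w. (M t w)^2)" "integrable Q (M t)"
proof -
 show 1: "M t \<in> borel_measurable (G t)" and 2: "integrable Q (%w. (M t w)^2)" using assms unfolding l2m_def by blast+
 show 3: "M t \<in> borel_measurable Q" by (rule G_meas[OF 1])
 show "integrable Q (M t)" by (rule Q.integrable_of_L2[OF 3 2])
qed

lemma l2m_incr:
 assumes "l2m M" "s <= t" "t <= u" "u <= T"
 shows "(%w. M u w - M t w) \<in> borel_measurable (G u)" (is ?g0) "(%w. M u w - M t w) \<in> borel_measurable Q"
  "integrable Q (%w. (M u w - M t w)^2)" "integrable Q (%w. M u w - M t w)"
  "A \<in> sets (G t) ==> (LINT w:A|Q. (M u w - M t w)) = 0"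
proof -
 have t: "t \<in> {s..T}" "u \<in> {s..T}" using assms by auto
 note a = l2m_D[OF assms(1) t(1)] and b = l2m_D[OF assms(1) t(2)]
 show ?g0
  by (rule borel_measurable_diff[OF b(1) G_meas_mono[OF a(1) assms(3)]])
 show "(%w. M u w - M t w) \<in> borel_measurable Q" "integrable Q (%w. (M u w - M t w)^2)" "integrable Q (%w. M u w - M t w)"
  by (rule borel_measurable_diff[OF b(2) a(2)], rule integrable_L2_diff[OF b(2) a(2) b(3) a(3)], rule Bochner_Integration.integrable_diff[OF b(4) a(4)])
 assume A: "A \<in> sets (G t)"
 then have "(LINT w:A|Q. M u w) = (LINT w:A|Q. M t w)" using assms unfolding l2m_def by blast
 then show "(LINT w:A|Q. (M u w - M t w)) = 0"
  using set_integrable_of[OF a(4) A] set_integrable_of[OF b(4) A] by (simp add: set_integral_diff)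
qed

lemma l2m_test:
 assumes M: "l2m M" "s <= t" "t <= u" "u <= T" and Y: "Y \<in> borel_measurable (G t)" "integrable Q (%w. (Y w)^2)"
 shows "(LINT w|Q. Y w * (M u w - M t w)) = 0" (is ?g0) "integrable Q (%w. Y w * (M u w - M t w))"
proof -
 note m = l2m_incr[OF M]
 show i: "integrable Q (%w. Y w * (M u w - M t w))"
  by (rule integrable_mult_L2[OF G_meas[OF Y(1)] m(2) Y(2) m(3)])
 show ?g0
  by (rule test_zero[OF m(4) m(5) Y(1) i])
qed

text \<open>For \<open>A\<close> ranging over \<open>G t\<close> these numbers determine the
  conditional covariance of the increments over \<open>(t,u]\<close>. They stand in for the
  increment of the bracket of \<open>M\<close> and \<open>N\<close>.\<close>

definition cov where "cov M N t u A = (LINT w:A|Q. (M u w - M t w) * (N u w - N t w))" for M N :: "real => 'a => real"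

lemma cov_integrable:
 assumes "l2m M" "l2m N" "s <= t" "t <= u" "u <= T"
 shows "integrable Q (%w. (M u w - M t w) * (N u w - N t w))"
 using l2m_incr[OF assms(1,3-5)] l2m_incr[OF assms(2,3-5)] by (intro integrable_mult_L2)

text \<open>The cross terms vanish: the earlier increment times the indicator of \<open>A\<close> is
  an admissible test function for the later increment of the other martingale.\<close>

lemma cov_split:
 assumes M: "l2m M" and N: "l2m N" and t: "s <= t" "t <= v" "v <= u" "u <= T" and A: "A \<in> sets (G t)"
 shows "cov M N t u A = cov M N t v A + cov M N v u A"
proof -
 have tv: "v <= T" "t <= u" "s <= v" using t by auto
 have Av: "A \<in> sets (G v)" using A G_mono[OF t(2)] by auto
 have cross: "(LINT w:A|Q. (X v w - X t w) * (Y u w - Y v w)) = 0" "set_integrable Q A (%w. (X v w - X t w) * (Y u w - Y v w))"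
  if X: "l2m X" and Y: "l2m Y" for X Y
 proof -
  note x = l2m_incr[OF X t(1,2) tv(1)]
  have m: "(%w. indicator A w * (X v w - X t w)) \<in> borel_measurable (G v)" using x(1) Av by simp
  have i: "integrable Q (%w. (indicator A w * (X v w - X t w))^2)"
   by (rule Bochner_Integration.integrable_bound[OF x(3)]) (use G_meas[OF m] in \<open>auto simp: indicator_def\<close>)
  show "(LINT w:A|Q. (X v w - X t w) * (Y u w - Y v w)) = 0" "set_integrable Q A (%w. (X v w - X t w) * (Y u w - Y v w))"
   using l2m_test[OF Y tv(3) t(3,4) m i] by (simp_all add: set_lebesgue_integral_def set_integrable_def mult.assoc)
 qed
 have e: "(M u w - M t w) * (N u w - N t w) = ((M v w - M t w) * (N v w - N t w) + (M u w - M v w) * (N u w - N v w)) +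
   ((M v w - M t w) * (N u w - N v w) + (N v w - N t w) * (M u w - M v w))" for w
  by (simp add: algebra_simps)
 have i: "set_integrable Q A (%w. (M v w - M t w) * (N v w - N t w))" "set_integrable Q A (%w. (M u w - M v w) * (N u w - N v w))"
  using cov_integrable[OF M N t(1,2) tv(1)] cov_integrable[OF M N tv(3) t(3,4)] A Av by (auto intro: set_integrable_of)
 show ?thesis
  unfolding cov_def e using cross[OF M N] cross[OF N M] i
  by (simp add: set_integral_add)
qed

lemma cov_nonneg: "0 <= cov M M t u A"
 unfolding cov_def set_lebesgue_integral_def by (intro Bochner_Integration.integral_nonneg) auto

lemma cov_space: "cov M N t u (space Q) = (LINT w|Q. (M u w - M t w) * (N u w - N t w))"
 unfolding cov_def set_lebesgue_integral_def by (intro Bochner_Integration.integral_cong) auto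

lemma space_in_G: "space Q \<in> sets (G t)"
 using sets.top[of "G t"] by simp

lemma incr_sq_mono:
 assumes "l2m M" "s <= t" "t <= v" "v <= T"
 shows "(LINT w|Q. (M T w - M v w)^2) <= (LINT w|Q. (M T w - M t w)^2)" "(LINT w|Q. (M v w - M t w)^2) <= (LINT w|Q. (M T w - M t w)^2)"
 using cov_split[OF assms(1) assms(1-3) assms(4) order_refl space_in_G] cov_nonneg[of M t v "space Q"] cov_nonneg[of M v T "space Q"]
 by (simp_all add: cov_space power2_eq_square)

lemma l2m_diff: assumes "l2m M" "l2m N" shows "l2m (%t w. M t w - N t w)"
proof -
 have "(LINT w:A|Q. (M u w - N u w)) = (LINT w:A|Q. (M t w - N t w))"
  if t: "s <= t" "t <= u" "u <= T" and A: "A \<in> sets (G t)" for t u A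
 proof -
  have "t \<in> {s..T}" "u \<in> {s..T}" using t by auto
  note i = this[THEN l2m_D(4)[OF assms(1)], THEN set_integrable_of[OF _ A]] this[THEN l2m_D(4)[OF assms(2)], THEN set_integrable_of[OF _ A]]
  have e: "(LINT w:A|Q. M u w) = (LINT w:A|Q. M t w)" "(LINT w:A|Q. N u w) = (LINT w:A|Q. N t w)"
   using assms t A unfolding l2m_def by blast+
  show ?thesis unfolding set_integral_diff(2)[OF i(1,3)] set_integral_diff(2)[OF i(2,4)] e ..
 qed
 then have "\<forall>t u A. s <= t \<longrightarrow> t <= u \<longrightarrow> u <= T \<longrightarrow> A \<in> sets (G t) \<longrightarrow> (LINT w:A|Q. (M u w - N u w)) = (LINT w:A|Q. (M t w - N t w))"
  by blast
 then show ?thesis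
  unfolding l2m_def[of "%t w. M t w - N t w"]
  by (intro conjI ballI borel_measurable_diff integrable_L2_diff l2m_D[OF assms(1)] l2m_D[OF assms(2)])
qed

text \<open>The integrated form of \<open>d<N> <= C d\<nu>\<close>: given \<open>G t\<close>, the
  increment of \<open>N\<close> over \<open>(t,u]\<close> has variance at most
  \<open>C * (W u - W t)\<close>.\<close>

definition brk where
 "brk N C \<longleftrightarrow> (\<forall>t u A. s <= t \<longrightarrow> t <= u \<longrightarrow> u <= T \<longrightarrow> A \<in> sets (G t) \<longrightarrow> cov N N t u A <= C * (W u - W t) * measure Q A)"

text \<open>The covariance form of the statement that \<open>Z\<close> is the \<nu>-density of the
  bracket of \<open>M\<close> and \<open>N\<close>. Intervals ending at \<open>T\<close> are enough,
  since comparing two starting times yields the others by \<open>cov_split\<close>.\<close>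

definition repr where
 "repr M N Z \<longleftrightarrow> prog Z \<and> (AE w in Q. set_integrable \<nu> {s..T} (%r. Z r w)) \<and>
   (\<forall>t\<in>{s..T}. integrable Q (nI t T Z) \<and> (\<forall>A\<in>sets (G t). (LINT w:A|Q. nI t T Z w) = cov M N t T A))"

lemma nI_split: "set_integrable \<nu> {s..T} (%r. Z r w) ==> s <= t ==> t <= T ==> nI s T Z w = nI s t Z w + nI t T Z w"
 unfolding nI_def by (rule set_integral_split)

lemma nI_diff:
 "set_integrable \<nu> {t..u} (%r. Y r w) ==> set_integrable \<nu> {t..u} (%r. Z r w) ==> nI t u (%r w. Y r w - Z r w) w = nI t u Y w - nI t u Z w"
 unfolding nI_def by (rule set_integral_diff)

lemma repr_diff:
 assumes M: "l2m M" "l2m M'" "l2m N" and r: "repr M N Z" "repr M' N Z'"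
 shows "repr (%t w. M t w - M' t w) N (%r w. Z r w - Z' r w)"
proof -
 have p: "prog Z" "prog Z'" and ai: "AE w in Q. set_integrable \<nu> {s..T} (%r. Z r w)" "AE w in Q. set_integrable \<nu> {s..T} (%r. Z' r w)"
  using r by (auto simp: repr_def)
 note pd = prog_arith(2)[OF p]
 have ad: "AE w in Q. set_integrable \<nu> {s..T} (%r. Z r w - Z' r w)"
  using ai by eventually_elim auto
 have "integrable Q (nI t T (%r w. Z r w - Z' r w)) \<and>
  (\<forall>A\<in>sets (G t). (LINT w:A|Q. nI t T (%r w. Z r w - Z' r w) w) = cov (%t w. M t w - M' t w) N t T A)" if t: "t \<in> {s..T}" for t
 proof (intro conjI ballI)
  have tt: "s <= t" "t <= T" using t by auto
  have i: "integrable Q (nI t T Z)" "integrable Q (nI t T Z')" using r t by (auto simp: repr_def)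
  have ae: "AE w in Q. nI t T (%r w. Z r w - Z' r w) w = nI t T Z w - nI t T Z' w"
   using ai
  proof eventually_elim
   case (elim w)
   then have "set_integrable \<nu> {t..T} (%r. Z r w)" "set_integrable \<nu> {t..T} (%r. Z' r w)" using t by (auto intro: set_integrable_subset)
   then show ?case by (rule nI_diff)
  qed
  have m: "nI t T (%r w. Z r w - Z' r w) \<in> borel_measurable Q"
   by (rule G_meas[OF nI_meas[OF pd]]) (use tt in auto)
  show "integrable Q (nI t T (%r w. Z r w - Z' r w))"
   by (subst integrable_cong_AE[OF m _ ae]) (use i in auto)
  fix A assume A: "A \<in> sets (G t)"
  have "(LINT w:A|Q. nI t T (%r w. Z r w - Z' r w) w) = (LINT w:A|Q. (nI t T Z w - nI t T Z' w))"
   unfolding set_lebesgue_integral_def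
   by (rule integral_cong_AE) (use ae m i G_sets[OF A] in auto)
  also have "\<dots> = cov M N t T A - cov M' N t T A"
   using r t A set_integrable_of[OF i(1) A] set_integrable_of[OF i(2) A] by (simp add: set_integral_diff repr_def)
  also have "\<dots> = cov (%t w. M t w - M' t w) N t T A"
   unfolding cov_def
   by (subst set_integral_diff(2)[symmetric])
     (use cov_integrable[OF M(1,3) tt] cov_integrable[OF M(2,3) tt] A in \<open>auto intro!: set_integrable_of simp: algebra_simps\<close>)
  finally show "(LINT w:A|Q. nI t T (%r w. Z r w - Z' r w) w) = cov (%t w. M t w - M' t w) N t T A" .
 qed
 then show ?thesis using pd ad by (simp add: repr_def)
qed

text \<open>Joint measurability without adaptedness, the natural hypothesis for Fubini. It also
  admits processes that are constant in time and equal to a variable known only later, such as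
  \<open>X u\<close> in place of \<open>X r\<close>.\<close>

definition jm :: "(real => 'a => real) => bool" where
 "jm X \<longleftrightarrow> (%p. indicator {s..T} (fst p) * X (fst p) (snd p)) \<in> borel_measurable (\<nu> \<Otimes>\<^sub>M Q)"

definition N2 :: "(real => 'a => real) => ennreal" where
 "N2 X = (\<integral>\<^sup>+w. sq s X w \<partial>Q)"

lemma jm_prog: "prog X ==> jm X"
 unfolding jm_def by (rule prog_Q)

lemma jm_arith:
 assumes "jm X" "jm Y"
 shows "jm (%r w. X r w + Y r w)" "jm (%r w. X r w - Y r w)" "jm (%r w. X r w * Y r w)"
proof -
 note [measurable] = assms[unfolded jm_def]
 have "(%p. indicator {s..T} (fst p) * X (fst p) (snd p) + indicator {s..T} (fst p) * Y (fst p) (snd p)) \<in> borel_measurable (\<nu> \<Otimes>\<^sub>M Q)"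
  "(%p. indicator {s..T} (fst p) * X (fst p) (snd p) - indicator {s..T} (fst p) * Y (fst p) (snd p)) \<in> borel_measurable (\<nu> \<Otimes>\<^sub>M Q)"
  "(%p. (indicator {s..T} (fst p) * X (fst p) (snd p)) * (indicator {s..T} (fst p) * Y (fst p) (snd p))) \<in> borel_measurable (\<nu> \<Otimes>\<^sub>M Q)"
  by measurable
 moreover have "(indicator {s..T} r * x) * (indicator {s..T} r * y) = indicator {s..T} r * (x * y)" for r x y :: real
  by (simp add: indicator_def)
 ultimately show "jm (%r w. X r w + Y r w)" "jm (%r w. X r w - Y r w)" "jm (%r w. X r w * Y r w)"
  unfolding jm_def by (simp_all add: distrib_left right_diff_distrib)
qed

lemma jm_random: "f \<in> borel_measurable Q ==> jm (%r. f)"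
 unfolding jm_def by (intro borel_measurable_times measurable_compose[OF measurable_snd]) auto

lemma jm_section: assumes "jm X" "t \<in> {s..T}" shows "X t \<in> borel_measurable Q"
proof -
 have "(%w. (t, w)) \<in> measurable Q (\<nu> \<Otimes>\<^sub>M Q)" by simp
 from measurable_compose[OF this assms(1)[unfolded jm_def]] assms(2) show ?thesis by simp
qed

lemma jm_path: assumes "jm X" "w \<in> space Q" shows "(%r. indicator {s..T} r * X r w) \<in> borel_measurable borel"
proof -
 have "(%r. (r, w)) \<in> measurable borel (\<nu> \<Otimes>\<^sub>M Q)" using assms(2) by (simp cong: measurable_cong_sets)
 from measurable_compose[OF this assms(1)[unfolded jm_def]] show ?thesis by simp
qed

lemma jm_E: assumes "jm X" "f \<in> borel_measurable borel" "f 0 = 0"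
 shows "(%p. indicator {s..T} (fst p) * f (X (fst p) (snd p)) :: ennreal) \<in> borel_measurable (\<nu> \<Otimes>\<^sub>M Q)"
proof -
 have "(%p. f (indicator {s..T} (fst p) * X (fst p) (snd p))) \<in> borel_measurable (\<nu> \<Otimes>\<^sub>M Q)"
  using measurable_compose[OF assms(1)[unfolded jm_def] assms(2)] .
 also have "(%p. f (indicator {s..T} (fst p) * X (fst p) (snd p))) = (%p. indicator {s..T} (fst p) * f (X (fst p) (snd p)))"
  using assms(3) by (auto simp: indicator_def)
 finally show ?thesis .
qed

lemma Tonelli:
 fixes F :: "real => 'a => ennreal"
 assumes F: "(%p. indicator {s..T} (fst p) * F (fst p) (snd p)) \<in> borel_measurable (\<nu> \<Otimes>\<^sub>M Q)" and t: "s <= t"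
 shows "(\<integral>\<^sup>+w. (\<integral>\<^sup>+r\<in>{t..T}. F r w \<partial>\<nu>) \<partial>Q) = (\<integral>\<^sup>+r\<in>{t..T}. (\<integral>\<^sup>+w. F r w \<partial>Q) \<partial>\<nu>)" (is ?g0)
  and "(%r. indicator {s..T} r * (\<integral>\<^sup>+w. F r w \<partial>Q)) \<in> borel_measurable borel" (is ?g1)
  and "(%w. \<integral>\<^sup>+r\<in>{t..T}. F r w \<partial>\<nu>) \<in> borel_measurable Q" (is ?g2)
proof -
 note [measurable] = F
 have "(%p. indicator {t..T} (fst p) * (indicator {s..T} (fst p) * F (fst p) (snd p))) \<in> borel_measurable (\<nu> \<Otimes>\<^sub>M Q)" by measurable
 also have "(%p. indicator {t..T} (fst p) * (indicator {s..T} (fst p) * F (fst p) (snd p))) = (%p. F (fst p) (snd p) * indicator {t..T} (fst p))"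
  using t by (auto simp: indicator_def fun_eq_iff)
 finally have m[measurable]: "(%p. F (fst p) (snd p) * indicator {t..T} (fst p)) \<in> borel_measurable (\<nu> \<Otimes>\<^sub>M Q)" .
 have sec: "F r \<in> borel_measurable Q" if "r \<in> {s..T}" for r
 proof -
  have "(%w. (r, w)) \<in> measurable Q (\<nu> \<Otimes>\<^sub>M Q)" by simp
  from measurable_compose[OF this F] that show ?thesis by simp
 qed
 have "(\<integral>\<^sup>+w. (\<integral>\<^sup>+r\<in>{t..T}. F r w \<partial>\<nu>) \<partial>Q) = (\<integral>\<^sup>+r. (\<integral>\<^sup>+w. F r w * indicator {t..T} r \<partial>Q) \<partial>\<nu>)"
  using QV.Fubini[OF m] by simp
 also have "\<dots> = (\<integral>\<^sup>+r\<in>{t..T}. (\<integral>\<^sup>+w. F r w \<partial>Q) \<partial>\<nu>)"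
  by (intro nn_integral_cong) (auto simp: indicator_def)
 finally show ?g0 .
 have "(%r. \<integral>\<^sup>+w. indicator {s..T} r * F r w \<partial>Q) \<in> borel_measurable \<nu>"
  using Q.borel_measurable_nn_integral_fst[OF F] by simp
 also have "(%r. \<integral>\<^sup>+w. indicator {s..T} r * F r w \<partial>Q) = (%r. indicator {s..T} r * (\<integral>\<^sup>+w. F r w \<partial>Q))"
  by (auto simp: indicator_def)
 finally show ?g1 by (simp cong: measurable_cong_sets)
 have "(%p. (snd p, fst p)) \<in> measurable (Q \<Otimes>\<^sub>M \<nu>) (\<nu> \<Otimes>\<^sub>M Q)" by simp
 from measurable_compose[OF this m] have "(%p. F (snd p) (fst p) * indicator {t..T} (snd p)) \<in> borel_measurable (Q \<Otimes>\<^sub>M \<nu>)" by simp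
 from nu.borel_measurable_nn_integral_fst[OF this]
 show ?g2 by simp
qed

lemma jm_integrable:
 assumes X: "jm X" and fin: "(\<integral>\<^sup>+w. ab s T X w \<partial>Q) < \<infinity>" and u: "u <= T"
 shows "integrable (\<nu> \<Otimes>\<^sub>M Q) (%p. indicator {s..u} (fst p) * X (fst p) (snd p))"
  and "(LINT r:{s..u}|\<nu>. (LINT w|Q. X r w)) = (LINT w|Q. nI s u X w)" (is ?g1)
  and "integrable Q (nI s u X)"
  and "AE w in Q. set_integrable \<nu> {s..T} (%r. X r w)" (is ?g3)
  and "AE r in \<nu>. r \<in> {s..T} \<longrightarrow> integrable Q (X r)" (is ?g4)
  and "set_integrable \<nu> {s..u} (%r. \<integral>w. X r w \<partial>Q)" (is ?g5)
  and "(LINT p|(\<nu> \<Otimes>\<^sub>M Q). indicator {s..u} (fst p) * X (fst p) (snd p)) = (LINT w|Q. nI s u X w)" (is ?g6)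
proof -
 have i: "integrable (\<nu> \<Otimes>\<^sub>M Q) (%p. indicator {s..T} (fst p) * X (fst p) (snd p))"
 proof (rule integrableI_bounded)
  show m: "(%p. indicator {s..T} (fst p) * X (fst p) (snd p)) \<in> borel_measurable (\<nu> \<Otimes>\<^sub>M Q)" using X by (simp add: jm_def)
  have "(\<integral>\<^sup>+p. ennreal (norm (indicator {s..T} (fst p) * X (fst p) (snd p))) \<partial>(\<nu> \<Otimes>\<^sub>M Q))
    = (\<integral>\<^sup>+w. (\<integral>\<^sup>+r. ennreal (norm (indicator {s..T} r * X r w)) \<partial>\<nu>) \<partial>Q)"
   using QV.nn_integral_snd[of "%p. ennreal (norm (indicator {s..T} (fst p) * X (fst p) (snd p)))"] m by simp
  also have "\<dots> = (\<integral>\<^sup>+w. ab s T X w \<partial>Q)"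
   by (intro nn_integral_cong) (auto simp: indicator_def)
  finally show "(\<integral>\<^sup>+p. ennreal (norm (indicator {s..T} (fst p) * X (fst p) (snd p))) \<partial>(\<nu> \<Otimes>\<^sub>M Q)) < \<infinity>" using fin by simp
 qed
 have "integrable (\<nu> \<Otimes>\<^sub>M Q) (%p. indicator ({s..u} \<times> space Q) p *\<^sub>R (indicator {s..T} (fst p) * X (fst p) (snd p)))"
  by (intro integrable_mult_indicator i) auto
 then show iu: "integrable (\<nu> \<Otimes>\<^sub>M Q) (%p. indicator {s..u} (fst p) * X (fst p) (snd p))"
  by (rule Bochner_Integration.integrable_cong[THEN iffD1, rotated 2])
    (use u in \<open>auto simp: space_pair_measure indicator_def\<close>)
 have e: "(LINT w|Q. indicator {s..u} r * X r w) = indicator {s..u} r *\<^sub>R (LINT w|Q. X r w)" for r by simp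
 have "(LINT r:{s..u}|\<nu>. (LINT w|Q. X r w)) = (LINT p|(\<nu> \<Otimes>\<^sub>M Q). indicator {s..u} (fst p) * X (fst p) (snd p))"
  unfolding set_lebesgue_integral_def e[symmetric] using QV.integral_fst'[OF iu] by simp
 also show ?g6
  unfolding nI_def set_lebesgue_integral_def
  using QV.integral_snd[of "%r w. indicator {s..u} r * X r w"] iu by (simp add: split_beta')
 finally show ?g1 .
 show "integrable Q (nI s u X)"
  unfolding nI_def[abs_def] set_lebesgue_integral_def
  using QV.integrable_snd[of "%r w. indicator {s..u} r * X r w"] iu by (simp add: split_beta')
 show ?g5
  unfolding set_integrable_def e[symmetric] using QV.integrable_fst'[OF iu] by simp
 have "AE r in \<nu>. integrable Q (%w. indicator {s..T} r * X r w)"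
  using QV.AE_integrable_fst'[OF i] by simp
 then show ?g4 by eventually_elim auto
 have "AE w in Q. integrable \<nu> (%r. indicator {s..T} r * X r w)"
  using QV.AE_integrable_snd[of "%r w. indicator {s..T} r * X r w"] i by (simp add: split_beta')
 then show ?g3 by (simp add: set_integrable_def)
qed

lemma nn_dominated:
 fixes \<phi> \<psi> :: "real => ennreal"
 assumes X: "jm X" and Y: "jm Y" and \<phi>: "\<phi> \<in> borel_measurable borel" "\<phi> 0 = 0" and \<psi>: "\<psi> \<in> borel_measurable borel" "\<psi> 0 = 0"
  and le: "\<And>r w. r \<in> {s..T} ==> w \<in> space Q ==> H r w <= \<phi> (X r w) + \<psi> (Y r w)"
 shows "(\<integral>\<^sup>+w. (\<integral>\<^sup>+r\<in>{s..T}. H r w \<partial>\<nu>) \<partial>Q) <= (\<integral>\<^sup>+w. (\<integral>\<^sup>+r\<in>{s..T}. \<phi> (X r w) \<partial>\<nu>) \<partial>Q) + (\<integral>\<^sup>+w. (\<integral>\<^sup>+r\<in>{s..T}. \<psi> (Y r w) \<partial>\<nu>) \<partial>Q)"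
proof -
 have m: "(%r. g (Z r w) * indicator {s..T} r) \<in> borel_measurable \<nu>" if "jm Z" "w \<in> space Q" "g \<in> borel_measurable borel" "g 0 = 0" for Z w and g :: "real => ennreal"
 proof -
  have "(%r. g (indicator {s..T} r * Z r w)) \<in> borel_measurable borel" by (rule measurable_compose[OF jm_path[OF that(1,2)] that(3)])
  also have "(%r. g (indicator {s..T} r * Z r w)) = (%r. g (Z r w) * indicator {s..T} r)" using that(4) by (auto simp: indicator_def)
  finally show ?thesis by (simp cong: measurable_cong_sets)
 qed
 have "(\<integral>\<^sup>+w. (\<integral>\<^sup>+r\<in>{s..T}. H r w \<partial>\<nu>) \<partial>Q) <= (\<integral>\<^sup>+w. (\<integral>\<^sup>+r\<in>{s..T}. \<phi> (X r w) \<partial>\<nu>) + (\<integral>\<^sup>+r\<in>{s..T}. \<psi> (Y r w) \<partial>\<nu>) \<partial>Q)"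
 proof (rule nn_integral_mono)
  fix w assume w: "w \<in> space Q"
  show "(\<integral>\<^sup>+r\<in>{s..T}. H r w \<partial>\<nu>) <= (\<integral>\<^sup>+r\<in>{s..T}. \<phi> (X r w) \<partial>\<nu>) + (\<integral>\<^sup>+r\<in>{s..T}. \<psi> (Y r w) \<partial>\<nu>)"
   unfolding nn_integral_add[OF m[OF X w \<phi>] m[OF Y w \<psi>], symmetric] using le[OF _ w] by (intro nn_integral_mono) (auto simp: indicator_def)
 qed
 also have "\<dots> = (\<integral>\<^sup>+w. (\<integral>\<^sup>+r\<in>{s..T}. \<phi> (X r w) \<partial>\<nu>) \<partial>Q) + (\<integral>\<^sup>+w. (\<integral>\<^sup>+r\<in>{s..T}. \<psi> (Y r w) \<partial>\<nu>) \<partial>Q)"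
  by (intro nn_integral_add Tonelli(3)[OF jm_E] X Y \<phi> \<psi> order_refl)
 finally show ?thesis .
qed

lemma N2_mult_finite:
 assumes X: "jm X" "N2 X < \<infinity>" and Y: "jm Y" "N2 Y < \<infinity>"
 shows "(\<integral>\<^sup>+w. (\<integral>\<^sup>+r\<in>{s..T}. ennreal \<bar>X r w * Y r w\<bar> \<partial>\<nu>) \<partial>Q) < \<infinity>"
proof -
 have "(\<integral>\<^sup>+w. (\<integral>\<^sup>+r\<in>{s..T}. ennreal \<bar>X r w * Y r w\<bar> \<partial>\<nu>) \<partial>Q) <= N2 X + N2 Y" unfolding N2_def
 proof (rule nn_dominated[OF X(1) Y(1)])
  fix r w
  have "2 * \<bar>X r w * Y r w\<bar> <= (X r w)^2 + (Y r w)^2" using sum_squares_bound[of "\<bar>X r w\<bar>" "\<bar>Y r w\<bar>"] by (simp add: abs_mult)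
  then show "ennreal \<bar>X r w * Y r w\<bar> <= ennreal ((X r w)^2) + ennreal ((Y r w)^2)"
   by (auto simp: ennreal_plus[symmetric] simp del: ennreal_plus intro!: ennreal_leI)
 qed auto
 also have "\<dots> < \<infinity>" using X(2) Y(2) by simp
 finally show ?thesis .
qed

lemma N2_cmult: assumes X: "jm X" shows "N2 (%r w. c * X r w) = ennreal (c^2) * N2 X"
proof -
 have "(\<integral>\<^sup>+r\<in>{s..T}. ennreal ((c * X r w)^2) \<partial>\<nu>) = ennreal (c^2) * (sq s X w)" if w: "w \<in> space Q" for w
 proof -
  have e: "ennreal ((c * X r w)^2) * indicator {s..T} r = ennreal (c^2) * ennreal ((indicator {s..T} r * X r w)^2)"
   "ennreal ((X r w)^2) * indicator {s..T} r = ennreal ((indicator {s..T} r * X r w)^2)" for r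
   by (auto simp: indicator_def power_mult_distrib ennreal_mult)
  show ?thesis unfolding e by (rule nn_integral_cmult) (use jm_path[OF X w] in \<open>simp cong: measurable_cong_sets\<close>)
 qed
 then have "N2 (%r w. c * X r w) = (\<integral>\<^sup>+w. ennreal (c^2) * (sq s X w) \<partial>Q)" unfolding N2_def by (rule nn_integral_cong)
 also have "\<dots> = ennreal (c^2) * N2 X" unfolding N2_def by (rule nn_integral_cmult, rule Tonelli(3)[OF jm_E[OF X]]) auto
 finally show ?thesis .
qed

lemma N2_lincomb_finite:
 assumes X: "jm X" "N2 X < \<infinity>" and Y: "jm Y" "N2 Y < \<infinity>" and le: "\<And>r w. r \<in> {s..T} ==> w \<in> space Q ==> \<bar>Z r w\<bar> <= k * (\<bar>X r w\<bar> + \<bar>Y r w\<bar>)"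
 shows "N2 Z < \<infinity>"
proof -
 have "N2 Z <= N2 (%r w. 2 * k * X r w) + N2 (%r w. 2 * k * Y r w)" unfolding N2_def
 proof (rule nn_dominated[OF X(1) Y(1), of "%x. ennreal ((2 * k * x)^2)" "%x. ennreal ((2 * k * x)^2)"])
  fix r w assume "r \<in> {s..T}" "w \<in> space Q"
  then have "\<bar>Z r w\<bar>^2 <= (k * (\<bar>X r w\<bar> + \<bar>Y r w\<bar>))^2" by (intro power_mono le) auto
  also have "\<dots> = k^2 * (\<bar>X r w\<bar> + \<bar>Y r w\<bar>)^2" by (simp add: power_mult_distrib)
  also have "\<dots> <= k^2 * (4 * ((X r w)^2 + (Y r w)^2))"
   using sum_squares_bound[of "\<bar>X r w\<bar>" "\<bar>Y r w\<bar>"] by (intro mult_left_mono) (simp_all add: power2_sum, use zero_le_power2[of "X r w"] zero_le_power2[of "Y r w"] in linarith)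
  finally have "(Z r w)^2 <= (2 * k * X r w)^2 + (2 * k * Y r w)^2" by (simp add: power_mult_distrib algebra_simps)
  then show "ennreal ((Z r w)^2) <= ennreal ((2 * k * X r w)^2) + ennreal ((2 * k * Y r w)^2)"
   by (auto simp: ennreal_plus[symmetric] simp del: ennreal_plus intro!: ennreal_leI)
 qed auto
 also have "\<dots> < \<infinity>" using X(2) Y(2) by (simp add: N2_cmult X Y ennreal_mult_less_top)
 finally show ?thesis .
qed

lemma N2_random: "f \<in> borel_measurable Q ==> integrable Q (%w. (f w)^2) ==> N2 (%r. f) < \<infinity>"
proof -
 assume [measurable]: "f \<in> borel_measurable Q" and i: "integrable Q (%w. (f w)^2)"
 have "N2 (%r. f) = (\<integral>\<^sup>+w. emeasure \<nu> {s..T} * ennreal ((f w)^2) \<partial>Q)"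
  unfolding N2_def by (subst nn_integral_cmult_indicator) (simp_all only: mult.commute sets_nu, simp)
 also have "\<dots> = emeasure \<nu> {s..T} * ennreal (LINT w|Q. (f w)^2)"
  using nn_integral_eq_integral[OF i] by (subst nn_integral_cmult) auto
 also have "\<dots> < \<infinity>"
 proof -
  have "emeasure \<nu> {s..T} < \<top>" by (simp add: less_top[symmetric])
  then show ?thesis by (simp add: ennreal_mult_less_top)
 qed
 finally show ?thesis .
qed

end

lemma sum_pairs: "(\<Sum>j\<in>{2 * a..<2 * b}. f j) = (\<Sum>i\<in>{a..<b}. f (2 * i) + f (Suc (2 * i)))" for f :: "nat => real"
proof (induction b)
 case (Suc b)
 show ?case
 proof (cases "a <= b")
  case True
  then have "{2 * a..<2 * Suc b} = insert (Suc (2 * b)) (insert (2 * b) {2 * a..<2 * b})" by auto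
  then show ?thesis using Suc True by (simp add: atLeastLessThanSuc)
 qed simp
qed simp

section \<open>Convergence of the dyadic quotients\<close>

context filtered_clock
begin

text \<open>The conditional expectation of \<open>Z\<close> given \<open>G t\<close> is nonpositive:
  the set where it is positive belongs to \<open>G t\<close> and must be null by the
  hypothesis.\<close>

lemma test_le:
 assumes Z: "integrable Q Z" "\<And>A. A \<in> sets (G t) ==> (LINT w:A|Q. Z w) <= 0"
  and Y: "Y \<in> borel_measurable (G t)" "\<And>w. 0 <= Y w" and YZ: "integrable Q (%w. Y w * Z w)"
 shows "(LINT w|Q. Y w * Z w) <= (0::real)"
proof -
 interpret finite_measure_subalgebra Q "G t" by unfold_locales (rule subG)
 define ce where "ce = real_cond_exp Q (G t) Z"
 have cem: "ce \<in> borel_measurable (G t)" and [measurable]: "ce \<in> borel_measurable Q" and cei: "integrable Q ce"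
  using Z(1) by (auto simp: ce_def intro: real_cond_exp_int)
 define A where "A = {w \<in> space Q. 0 < ce w}"
 have A: "A \<in> sets (G t)"
  using measurable_sets[OF cem, of "{0<..}"] by (simp add: A_def vimage_def Int_def conj_commute)
 have Ai: "integrable Q (%w. indicator A w * ce w)" using set_integrable_of[OF cei A] by (simp add: set_integrable_def)
 have "(LINT w|Q. indicator A w * ce w) = (LINT w:A|Q. Z w)"
  using real_cond_exp_intA[OF Z(1) A] by (simp add: ce_def set_lebesgue_integral_def)
 then have "(LINT w|Q. indicator A w * ce w) <= 0" using Z(2)[OF A] by simp
 moreover have "0 <= (LINT w|Q. indicator A w * ce w)"
  by (intro Bochner_Integration.integral_nonneg) (auto simp: A_def indicator_def)
 ultimately have "(LINT w|Q. indicator A w * ce w) = 0" by (rule antisym)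
 then have "AE w in Q. indicator A w * ce w = 0"
  by (subst (asm) integral_nonneg_eq_0_iff_AE[OF Ai]) (auto simp: A_def indicator_def)
 then have le: "AE w in Q. ce w <= 0"
  using AE_space by eventually_elim (auto simp: A_def indicator_def split: if_splits)
 note [measurable] = G_meas[OF Y(1)]
 have "(LINT w|Q. Y w * Z w) = (LINT x|Q. Y x * ce x)"
  unfolding ce_def using Z(1) by (intro real_cond_exp_intg(2)[symmetric] YZ Y) auto
 also have "\<dots> <= (LINT x|Q. 0)"
 proof (rule integral_mono_AE)
  show "integrable Q (%x. Y x * ce x)" unfolding ce_def using Z(1) by (intro real_cond_exp_intg(1) YZ Y) auto
  show "AE x in Q. Y x * ce x <= 0" using le by eventually_elim (simp add: Y mult_nonneg_nonpos)
 qed simp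
 finally show ?thesis by simp
qed

lemma cov_same[simp]: "cov M N t t A = 0"
 by (simp add: cov_def)

lemma cov_sum:
 assumes M: "l2m M" and N: "l2m N" and sj: "s <= q n j" and A: "A \<in> sets (G (q n j))" and "j <= l" "l <= 2 ^ n"
 shows "(\<Sum>i\<in>{j..<l}. cov M N (q n i) (q n (Suc i)) A) = cov M N (q n j) (q n l) A"
 using assms(5,6)
proof (induction l rule: dec_induct)
 case (step k)
 have "cov M N (q n j) (q n (Suc k)) A = cov M N (q n j) (q n k) A + cov M N (q n k) (q n (Suc k)) A"
  by (rule cov_split[OF M N sj _ _ _ A]) (use step in \<open>auto simp: q_simps q_le_T\<close>)
 then show ?case using step by (simp add: atLeastLessThanSuc)
qed simp

text \<open>On a flat stretch of the clock \<open>N\<close> has almost surely no increment. This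
  makes the value 0 consistent for a quotient whose denominator \<open>W u - W t\<close>
  vanishes.\<close>

lemma cov_zero_of_brk:
 assumes M: "l2m M" and N: "l2m N" and brkN: "brk N C" and t: "s <= t" "t <= u" "u <= T" and W0: "W u = W t" and A: "A \<in> sets (G t)"
 shows "cov M N t u A = 0"
proof -
 have "cov N N t u (space Q) <= C * (W u - W t) * measure Q (space Q)"
  using brkN t space_in_G unfolding brk_def by blast
 then have "cov N N t u (space Q) = 0" using W0 cov_nonneg[of N t u "space Q"] by simp
 then have "(LINT w|Q. (N u w - N t w)^2) = 0" by (simp add: cov_space power2_eq_square)
 then have "AE w in Q. (N u w - N t w)^2 = 0"
  by (subst (asm) integral_nonneg_eq_0_iff_AE[OF l2m_incr(3)[OF N t]]) auto
 then have ae: "AE w in Q. indicator A w *\<^sub>R ((M u w - M t w) * (N u w - N t w)) = 0" by eventually_elim simp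
 have "cov M N t u A = (LINT w|Q. 0)"
  unfolding cov_def set_lebesgue_integral_def
  by (rule integral_cong_AE[OF _ _ ae]) (use cov_integrable[OF M N t] G_sets[OF A] in auto)
 then show ?thesis by simp
qed

lemma L2_nn_finite:
 assumes Z: "prog Z" and fin: "N2 Z < \<infinity>"
 shows "(\<integral>\<^sup>+w. ab s T Z w \<partial>Q) < \<infinity>"
 using N2_mult_finite[OF jm_prog[OF Z] fin jm_random[of "%_. 1"] N2_random[of "%_. 1"]] by simp

lemma L1_facts:
 assumes Z: "prog Z" and fin: "(\<integral>\<^sup>+w. ab s T Z w \<partial>Q) < \<infinity>"
 shows "AE w in Q. set_integrable \<nu> {s..T} (%r. Z r w)" (is ?g0)
  and "integrable Q (nI s T (%r w. \<bar>Z r w\<bar>))" (is ?g1)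
  and "\<And>t u. s <= t ==> t <= u ==> u <= T ==> integrable Q (nI t u Z)"
  and "\<And>t u w. s <= t ==> u <= T ==> set_integrable \<nu> {s..T} (%r. Z r w) ==> \<bar>nI t u Z w\<bar> <= nI s T (%r w. \<bar>Z r w\<bar>) w"
proof -
 show ?g0 by (rule jm_integrable(4)[OF jm_prog[OF Z] fin order_refl])
 have i: "integrable Q (nI t u Y)" if t: "s <= t" "t <= u" "u <= T" and Y: "prog Y" "\<And>r w. \<bar>Y r w\<bar> = \<bar>Z r w\<bar>" for t u Y
 proof (rule integrableI_bounded)
  show "nI t u Y \<in> borel_measurable Q" by (rule G_meas[OF nI_meas[OF Y(1) t]])
  have "(\<integral>\<^sup>+w. ennreal (norm (nI t u Y w)) \<partial>Q) <= (\<integral>\<^sup>+w. ab s T Z w \<partial>Q)"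
  proof (rule nn_integral_mono)
   fix w
   have "ennreal (norm (nI t u Y w)) <= (ab t u Y w)" using nI_le_nn by simp
   also have "\<dots> <= (ab s T Z w)"
    unfolding Y(2) using t by (intro nn_integral_mono) (auto simp: indicator_def)
   finally show "ennreal (norm (nI t u Y w)) <= (ab s T Z w)" .
  qed
  then show "(\<integral>\<^sup>+w. ennreal (norm (nI t u Y w)) \<partial>Q) < \<infinity>" using fin by (rule le_less_trans)
 qed
 show ?g1 using i[OF _ _ _ prog_abs[OF Z]] s_le by simp
 show "integrable Q (nI t u Z)" if "s <= t" "t <= u" "u <= T" for t u using i[OF that Z] by simp
 show "\<bar>nI t u Z w\<bar> <= nI s T (%r w. \<bar>Z r w\<bar>) w" if "s <= t" "u <= T" "set_integrable \<nu> {s..T} (%r. Z r w)" for t u w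
 proof -
  have "ennreal \<bar>nI t u Z w\<bar> <= (ab t u Z w)" by (rule nI_le_nn)
  also have "\<dots> <= (ab s T Z w)"
   using that by (intro nn_integral_mono) (auto simp: indicator_def)
  also have "\<dots> = ennreal (nI s T (%r w. \<bar>Z r w\<bar>) w)" unfolding nI_def by (rule nn_of_set_integrable[OF that(3)])
  finally show ?thesis by (subst (asm) ennreal_le_iff) (auto simp: nI_def set_lebesgue_integral_def)
 qed
qed

text \<open>\<open>\<kappa> n i\<close> plays the conditional expectation of the product of
  increments over the \<open>i\<close>-th block given its left end, divided by the increment of
  \<open>W\<close>. It is a parameter because two versions are inserted later: one from
  \<open>real_cond_exp\<close> under \<open>Q\<close>, and one from the kernels, which does not
  depend on the initial condition.\<close>

context
 fixes M N :: "real => 'a => real" and \<kappa> :: "nat => nat => 'a => real" and C :: real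
 assumes M: "l2m M" and N: "l2m N" and brkN: "brk N C" and C: "0 < C"
  and \<kappa>m: "\<And>n i. \<kappa> n i \<in> borel_measurable (G (q n i))"
  and \<kappa>i: "\<And>n i. i < 2 ^ n ==> s <= q n i ==> integrable Q (\<kappa> n i)"
  and \<kappa>c: "\<And>n i A. i < 2 ^ n ==> s <= q n i ==> A \<in> sets (G (q n i)) ==>
    (W (q n (Suc i)) - W (q n i)) * (LINT w:A|Q. \<kappa> n i w) = cov M N (q n i) (q n (Suc i)) A"
  and \<kappa>z: "\<And>n i w. W (q n (Suc i)) = W (q n i) ==> \<kappa> n i w = 0"
begin

private definition dW where "dW n i = W (q n (Suc i)) - W (q n i)"

private lemma dW0: "0 <= dW n i"
 unfolding dW_def using W_mono[of "q n i" "q n (Suc i)"] by (simp add: q_simps)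

text \<open>Conditional Cauchy-Schwarz: \<open>dW * \<kappa>\<close> is the conditional mean of
  \<open>dM * dN\<close>, and that of \<open>dN^2\<close> is at most \<open>C * dW\<close>, so
  \<open>dW * \<kappa>^2\<close> is at most \<open>C\<close> times that of \<open>dM^2\<close>. As
  \<open>\<kappa>^2\<close> is not known to be integrable beforehand, \<kappa> is tested against its
  truncations, which Fatou's lemma removes at the end.\<close>

private lemma \<kappa>_L2:
 assumes i: "i < 2 ^ n" "s <= q n i"
 shows "(\<integral>\<^sup>+w. ennreal ((\<kappa> n i w)^2) \<partial>Q) * ennreal (dW n i) <= ennreal (C * cov M M (q n i) (q n (Suc i)) (space Q))"
proof (cases "dW n i = 0")
 case True
 then show ?thesis by simp
next
 case False
 define t where "t = q n i"
 define u where "u = q n (Suc i)"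
 define k where "k = \<kappa> n i"
 define d where "d = dW n i"
 have d: "0 < d" using False dW0[of n i] by (simp add: d_def)
 have tu: "s <= t" "t <= u" "u <= T" using i by (auto simp: t_def u_def q_simps q_le_T)
 define dM where "dM w = M u w - M t w" for w
 define dN where "dN w = N u w - N t w" for w
 note m = l2m_incr[OF M tu, folded dM_def] and nn = l2m_incr[OF N tu, folded dN_def]
 note [measurable] = m(2) nn(2)
 have km: "k \<in> borel_measurable (G t)" and ki: "integrable Q k" using \<kappa>m \<kappa>i[OF i] by (auto simp: k_def t_def)
 note [measurable] = G_meas[OF km]
 have mni: "integrable Q (%w. dM w * dN w)" unfolding dM_def dN_def by (rule cov_integrable[OF M N tu])
 define S where "S = (LINT w|Q. (dM w)^2)"
 have S: "cov M M t u (space Q) = S" by (simp add: cov_space S_def dM_def power2_eq_square)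
 have bdi: "integrable Q (%w. f w * g w)" if "integrable Q g" "f \<in> borel_measurable Q" "\<And>w. \<bar>f w\<bar> <= B" for f g :: "'a => real" and B
 proof (rule Bochner_Integration.integrable_bound[of Q "%w. B * g w"])
  show "AE w in Q. norm (f w * g w) <= norm (B * g w)"
  proof (rule AE_I2)
   fix w
   have "\<bar>f w\<bar> * \<bar>g w\<bar> <= \<bar>B\<bar> * \<bar>g w\<bar>" using that(3)[of w] by (intro mult_right_mono) auto
   then show "norm (f w * g w) <= norm (B * g w)" by (simp add: abs_mult)
  qed
 qed (use that in auto)
 have trunc: "d * (LINT w|Q. (if \<bar>k w\<bar> <= real p then k w else 0)^2) <= C * S" for p :: nat
 proof -
  define \<phi> where "\<phi> w = (if \<bar>k w\<bar> <= real p then k w else 0)" for w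
  have \<phi>m: "\<phi> \<in> borel_measurable (G t)" unfolding \<phi>_def using km by measurable
  note [measurable] = G_meas[OF \<phi>m]
  have \<phi>b: "\<bar>\<phi> w\<bar> <= real p" for w by (simp add: \<phi>_def)
  have \<phi>b2: "\<bar>(\<phi> w)^2\<bar> <= (real p)^2" for w using power_mono[OF \<phi>b, of w 2] by simp
  have \<phi>2i: "integrable Q (%w. (\<phi> w)^2)"
   by (rule Q.integrable_const_bound[where B="(real p)^2"]) (use \<phi>b2 in auto)
  have i1: "integrable Q (%w. \<phi> w * (dM w * dN w))" by (rule bdi[OF mni _ \<phi>b]) simp
  have i2: "integrable Q (%w. \<phi> w * k w)" by (rule bdi[OF ki _ \<phi>b]) simp
  have i3: "integrable Q (%w. (\<phi> w)^2 * (dN w)^2)" by (rule bdi[OF nn(3) _ \<phi>b2]) simp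
  have e1: "(LINT w|Q. \<phi> w * (d * k w - dM w * dN w)) = 0"
  proof (rule test_zero[where t=t])
   fix A assume A: "A \<in> sets (G t)"
   have "(LINT w:A|Q. (d * k w - dM w * dN w)) = (LINT w:A|Q. d * k w) - (LINT w:A|Q. dM w * dN w)"
    by (rule set_integral_diff) (use set_integrable_of[OF ki A] set_integrable_of[OF mni A] in auto)
   also have "\<dots> = d * (LINT w:A|Q. k w) - cov M N t u A" by (simp add: cov_def dM_def dN_def)
   also have "\<dots> = 0" using \<kappa>c[OF i, of A] A by (simp add: d_def dW_def k_def t_def u_def)
   finally show "(LINT w:A|Q. (d * k w - dM w * dN w)) = 0" .
  next
   show "integrable Q (%w. \<phi> w * (d * k w - dM w * dN w))"
    by (rule bdi[OF _ _ \<phi>b]) (use ki mni in auto)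
  qed (use ki mni \<phi>m in auto)
  have e2: "(LINT w|Q. (\<phi> w)^2 * ((dN w)^2 - C * d)) <= 0"
  proof (rule test_le[where t=t])
   fix A assume A: "A \<in> sets (G t)"
   have "(LINT w:A|Q. ((dN w)^2 - C * d)) = (LINT w:A|Q. (dN w)^2) - (LINT w:A|Q. C * d)"
    by (rule set_integral_diff) (use set_integrable_of[OF nn(3) A] set_integrable_of[OF _ A, of "%_. C * d"] in auto)
   also have "\<dots> = cov N N t u A - C * d * measure Q A"
    using G_sets[OF A] by (simp add: cov_def dN_def power2_eq_square set_lebesgue_integral_def)
   also have "\<dots> <= 0" using brkN tu A unfolding brk_def d_def dW_def t_def[symmetric] u_def[symmetric] by simp
   finally show "(LINT w:A|Q. ((dN w)^2 - C * d)) <= 0" .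
  next
   show "integrable Q (%w. (\<phi> w)^2 * ((dN w)^2 - C * d))"
    by (rule bdi[OF _ _ \<phi>b2]) (use nn(3) in auto)
  qed (use nn(3) \<phi>m in auto)
  have e2': "(LINT w|Q. (\<phi> w)^2 * (dN w)^2) <= C * d * (LINT w|Q. (\<phi> w)^2)"
   using e2 i3 \<phi>2i by (simp add: right_diff_distrib mult.commute[of _ "C * d"])
  have "d * (LINT w|Q. (\<phi> w)^2) = d * (LINT w|Q. \<phi> w * k w)"
   by (intro arg_cong2[where f="(*)"] Bochner_Integration.integral_cong) (auto simp: \<phi>_def power2_eq_square)
  also have "\<dots> = (LINT w|Q. \<phi> w * (dM w * dN w))"
   using e1 i1 i2 by (simp add: right_diff_distrib mult.left_commute[of _ d])
  \<comment> \<open>Young's inequality with these weights makes the second term at most half of the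
    left-hand side, into which it is absorbed.\<close>
  also have "\<dots> <= (LINT w|Q. C / 2 * (dM w)^2 + 1 / (2 * C) * ((\<phi> w)^2 * (dN w)^2))"
  proof (rule integral_mono[OF i1])
   show "integrable Q (%w. C / 2 * (dM w)^2 + 1 / (2 * C) * ((\<phi> w)^2 * (dN w)^2))" using m(3) i3 by auto
   fix w
   have "0 <= (C * dM w - \<phi> w * dN w)^2" by simp
   then have "2 * C * (\<phi> w * (dM w * dN w)) <= C * C * (dM w)^2 + (\<phi> w)^2 * (dN w)^2"
    by (simp add: power2_eq_square algebra_simps)
   also have "\<dots> = 2 * C * (C / 2 * (dM w)^2 + 1 / (2 * C) * ((\<phi> w)^2 * (dN w)^2))"
    using C by (simp add: field_simps)
   finally have "2 * C * (\<phi> w * (dM w * dN w)) <= 2 * C * (C / 2 * (dM w)^2 + 1 / (2 * C) * ((\<phi> w)^2 * (dN w)^2))" .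
   then show "\<phi> w * (dM w * dN w) <= C / 2 * (dM w)^2 + 1 / (2 * C) * ((\<phi> w)^2 * (dN w)^2)"
    using C by simp
  qed
  also have "\<dots> = C / 2 * S + 1 / (2 * C) * (LINT w|Q. (\<phi> w)^2 * (dN w)^2)"
   using m(3) i3 by (simp add: S_def)
  also have "\<dots> <= C / 2 * S + 1 / (2 * C) * (C * d * (LINT w|Q. (\<phi> w)^2))"
   using e2' C by (intro add_left_mono mult_left_mono) auto
  also have "\<dots> = C / 2 * S + d * (LINT w|Q. (\<phi> w)^2) / 2" using C by (simp add: field_simps)
  finally show ?thesis unfolding \<phi>_def[symmetric] by simp
 qed
 have "(\<integral>\<^sup>+w. ennreal ((k w)^2) \<partial>Q) <= (\<integral>\<^sup>+w. liminf (%p. ennreal ((if \<bar>k w\<bar> <= real p then k w else 0)^2)) \<partial>Q)"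
 proof (rule nn_integral_mono)
  fix w
  obtain p0 :: nat where p0: "\<bar>k w\<bar> <= real p0" using real_arch_simple by blast
  show "ennreal ((k w)^2) <= liminf (%p. ennreal ((if \<bar>k w\<bar> <= real p then k w else 0)^2))"
   by (rule Liminf_bounded, rule eventually_sequentiallyI[of p0]) (use p0 in auto)
 qed
 also have "\<dots> <= liminf (%p. \<integral>\<^sup>+w. ennreal ((if \<bar>k w\<bar> <= real p then k w else 0)^2) \<partial>Q)"
  by (rule nn_integral_liminf) simp
 also have "\<dots> <= ennreal (C * S / d)"
 proof (rule Liminf_le)
  have "(\<integral>\<^sup>+w. ennreal ((if \<bar>k w\<bar> <= real p then k w else 0)^2) \<partial>Q) <= ennreal (C * S / d)" for p :: nat
  proof -
   have "integrable Q (%w. (if \<bar>k w\<bar> <= real p then k w else 0)^2)"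
    by (rule Q.integrable_const_bound[where B="(real p)^2"]) (auto intro!: AE_I2 simp: abs_le_square_iff[symmetric])
   then have "(\<integral>\<^sup>+w. ennreal ((if \<bar>k w\<bar> <= real p then k w else 0)^2) \<partial>Q) = ennreal (LINT w|Q. (if \<bar>k w\<bar> <= real p then k w else 0)^2)"
    by (rule nn_integral_eq_integral) auto
   also have "\<dots> <= ennreal (C * S / d)"
    using trunc[of p] d by (intro ennreal_leI) (simp add: pos_le_divide_eq mult.commute)
   finally show ?thesis .
  qed
  then show "\<forall>\<^sub>F p in sequentially. (\<integral>\<^sup>+w. ennreal ((if \<bar>k w\<bar> <= real p then k w else 0)^2) \<partial>Q) <= ennreal (C * S / d)" by simp
 qed simp
 finally have "(\<integral>\<^sup>+w. ennreal ((k w)^2) \<partial>Q) * ennreal d <= ennreal (C * S / d) * ennreal d" by (rule mult_right_mono) simp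
 also have "\<dots> = ennreal (C * S)"
  using d C by (subst ennreal_mult[symmetric]) (auto simp: S_def)
 finally show ?thesis using S by (simp add: k_def d_def t_def u_def)
qed

text \<open>Taking \<open>lim\<close> at every point, also where the sequence diverges, makes
  \<open>K\<close> a function of the quotients alone, whatever the measure. Divergence will be
  confined to a null set.\<close>

private definition K where "K r w = lim (%n. \<kappa> n (blk n r) w)"

lemma prog_K: "prog K"
 unfolding prog_def K_def split_beta'
 by (intro ballI dyadic_lim_measurable \<kappa>m G_mono s_ge) (auto simp: )

text \<open>The starting time \<open>s\<close> may fall between grid points. With a grid point
  \<open>q m0 j0\<close> as left end of the time interval, the blocks of each level from
  \<open>m0\<close> on tile the interval exactly.\<close>

context
 fixes m0 j0 :: nat
 assumes a_ge: "s <= q m0 j0" and j0: "j0 <= 2 ^ m0"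
begin

private definition ga where "ga = q m0 j0"
private definition J where "J n = j0 * 2 ^ (n - m0)"
private definition gL where "gL = restrict_space \<nu> {ga<..T}"
private definition \<mu> where "\<mu> = gL \<Otimes>\<^sub>M Q"
private definition gX where "gX n p = \<kappa> n (blk n (fst p)) (snd p)"

private lemma a0: "0 <= ga" "s <= ga" "ga <= T"
 using a_ge j0 by (auto simp: ga_def q_simps q_le_T)

private lemma qJ: "m0 <= n ==> q n (J n) = ga"
 using T_pos by (auto simp: q_def J_def ga_def power_add dest!: le_Suc_ex)

private lemma J_le: "m0 <= n ==> J n <= 2 ^ n"
 using qJ[of n] a0(3) by (simp add: q_le_T[symmetric])

private lemma J_Suc: "m0 <= n ==> J (Suc n) = 2 * J n"
 by (simp add: J_def Suc_diff_le)

private lemma s_q: "m0 <= n ==> J n <= i ==> s <= q n i" "m0 <= n ==> J n <= i ==> ga <= q n i"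
 using qJ[of n] q_simps(5)[of n "J n" i] a0 by auto

private lemma space_gL: "space gL = {ga<..T}" by (simp add: gL_def space_restrict_space)

private lemma blk_gL[measurable]: "blk n \<in> measurable gL (count_space UNIV)"
 unfolding gL_def by (rule measurable_restrict_space1) (simp cong: measurable_cong_sets)

private lemma blk_range: "m0 <= n ==> r \<in> {ga<..T} ==> blk n r \<in> {J n..<2 ^ n}"
proof -
 assume n: "m0 <= n" and r: "r \<in> {ga<..T}"
 have "q n (J n) < q n (Suc (blk n r))" using qJ[OF n] blk_bounds(2)[of r n] r a0 by auto
 then show ?thesis using blk_lt[of r n] r by (auto simp: q_simps)
qed

private lemma fin_gL: "finite_measure gL"
 unfolding gL_def by (intro finite_measure_restrict_space nu.finite_measure_axioms) simp

private lemma block_sum: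
 fixes g :: "nat => 'b::comm_semiring_1"
 assumes n: "m0 <= n"
 shows "indicator {ga<..T} r * g (blk n r) = (\<Sum>i\<in>{J n..<2 ^ n}. g i * indicator {q n i<..q n (Suc i)} r)"
proof (cases "r \<in> {ga<..T}")
 case True
 then have r: "0 < r" using a0 by auto
 have "(\<Sum>i\<in>{J n..<2 ^ n}. g i * indicator {q n i<..q n (Suc i)} r) = (\<Sum>i\<in>{J n..<2 ^ n}. if i = blk n r then g i else 0)"
 proof (intro sum.cong refl)
  fix i
  show "g i * indicator {q n i<..q n (Suc i)} r = (if i = blk n r then g i else 0)"
   using blk_iff[OF r, of n i] by (auto simp: indicator_def)
 qed
 also have "\<dots> = g (blk n r)" using blk_range[OF n True] by simp
 finally show ?thesis using True by simp
next
 case False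
 have "r \<notin> {q n i<..q n (Suc i)}" if "i \<in> {J n..<2 ^ n}" for i
 proof -
  have "ga <= q n i" "q n (Suc i) <= T" using that s_q(2)[OF n] by (auto simp: q_le_T)
  then show ?thesis using False by auto
 qed
 then show ?thesis using False by simp
qed

private lemma blk_nn:
 assumes n: "m0 <= n"
 shows "(\<integral>\<^sup>+r. g (blk n r) \<partial>gL) = (\<Sum>i\<in>{J n..<2 ^ n}. g i * ennreal (dW n i))"
proof -
 have "(\<integral>\<^sup>+r. g (blk n r) \<partial>gL) = (\<integral>\<^sup>+r. indicator {ga<..T} r * g (blk n r) \<partial>\<nu>)"
  unfolding gL_def by (subst nn_integral_restrict_space) (auto simp: mult.commute)
 also have "\<dots> = (\<Sum>i\<in>{J n..<2 ^ n}. g i * ennreal (dW n i))"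
  unfolding block_sum[OF n] dW_def
  by (subst nn_integral_sum) (auto simp: nn_integral_cmult nu_Ioc q_simps intro!: sum.cong)
 finally show ?thesis .
qed

private lemma blk_int:
 fixes g :: "nat => real"
 assumes n: "m0 <= n"
 shows "(LINT r|gL. g (blk n r)) = (\<Sum>i\<in>{J n..<2 ^ n}. g i * dW n i)"
proof -
 have ms: "measure \<nu> {q n i<..q n (Suc i)} = dW n i" for i
  unfolding measure_def dW_def using W_mono[of "q n i" "q n (Suc i)"] by (simp add: nu_Ioc q_simps)
 have "(LINT r|gL. g (blk n r)) = (LINT r|\<nu>. indicator {ga<..T} r * g (blk n r))"
  unfolding gL_def by (subst integral_restrict_space) auto
 also have "\<dots> = (\<Sum>i\<in>{J n..<2 ^ n}. g i * dW n i)"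
  unfolding block_sum[OF n] using nu.emeasure_finite
  by (subst Bochner_Integration.integral_sum) (auto simp: ms less_top[symmetric])
 finally show ?thesis .
qed

private lemma gX_meas: "gX n \<in> borel_measurable \<mu>"
 unfolding gX_def[abs_def] \<mu>_def
 by (rule measurable_compose_countable[of "%i p. \<kappa> n i (snd p)"])
  (rule measurable_compose[OF measurable_snd G_meas[OF \<kappa>m]], rule measurable_compose[OF measurable_fst blk_gL])

private definition B where "B = C * cov M M ga T (space Q)"

private lemma space_\<mu>: "space \<mu> = {ga<..T} \<times> space Q" by (simp add: \<mu>_def space_pair_measure space_gL)

text \<open>The bounds for single blocks add up because the second moments of martingale increments
  do.\<close>

private lemma X_sq_nn:
 assumes n: "m0 <= n"
 shows "(\<integral>\<^sup>+p. ennreal ((gX n p)^2) \<partial>\<mu>) <= ennreal B"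
proof -
 have "(\<integral>\<^sup>+p. ennreal ((gX n p)^2) \<partial>\<mu>) = (\<integral>\<^sup>+r. (\<integral>\<^sup>+w. ennreal ((gX n (r, w))^2) \<partial>Q) \<partial>gL)"
  unfolding \<mu>_def by (rule Q.nn_integral_fst[symmetric]) (use gX_meas[of n] in \<open>simp add: \<mu>_def\<close>)
 also have "\<dots> = (\<integral>\<^sup>+r. (%i. \<integral>\<^sup>+w. ennreal ((\<kappa> n i w)^2) \<partial>Q) (blk n r) \<partial>gL)" by (simp add: gX_def)
 also have "\<dots> = (\<Sum>i\<in>{J n..<2 ^ n}. (\<integral>\<^sup>+w. ennreal ((\<kappa> n i w)^2) \<partial>Q) * ennreal (dW n i))"
  by (rule blk_nn[OF n])
 also have "\<dots> <= (\<Sum>i\<in>{J n..<2 ^ n}. ennreal (C * cov M M (q n i) (q n (Suc i)) (space Q)))"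
  using s_q(1)[OF n] by (intro sum_mono \<kappa>_L2) auto
 also have "\<dots> = ennreal (C * (\<Sum>i\<in>{J n..<2 ^ n}. cov M M (q n i) (q n (Suc i)) (space Q)))"
  unfolding sum_distrib_left using C by (intro sum_ennreal) (auto intro!: mult_nonneg_nonneg cov_nonneg)
 also have "(\<Sum>i\<in>{J n..<2 ^ n}. cov M M (q n i) (q n (Suc i)) (space Q)) = cov M M ga T (space Q)"
  using cov_sum[OF M M, of n "J n" "space Q" "2 ^ n"] qJ[OF n] a0 J_le[OF n] space_in_G by (simp add: q_simps)
 finally show ?thesis by (simp add: B_def)
qed

private lemma B0: "0 <= B" using C by (simp add: B_def cov_nonneg)

private lemma X_L2: "m0 <= n ==> integrable \<mu> (%p. (gX n p)^2)"
proof (rule integrableI_bounded)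
 assume n: "m0 <= n"
 show "(\<integral>\<^sup>+p. ennreal (norm ((gX n p)^2)) \<partial>\<mu>) < \<infinity>"
  using le_less_trans[OF X_sq_nn[OF n]] by simp
qed (use gX_meas[of n] in simp)

private lemma fin_\<mu>: "finite_measure \<mu>"
proof
 interpret L: finite_measure gL by (rule fin_gL)
 have "emeasure \<mu> (space \<mu>) = emeasure gL (space gL) * emeasure Q (space Q)"
  unfolding \<mu>_def space_pair_measure by (rule Q.emeasure_pair_measure_Times) auto
 then show "emeasure \<mu> (space \<mu>) \<noteq> \<infinity>" using L.emeasure_finite by (simp add: Q.emeasure_space_1)
qed

text \<open>Over the \<open>i\<close>-th block such a set has the constant section
  \<open>F i\<close>, an event known at the left end of the block. The sets arising from all such
  families already form a sigma-algebra, each member of which has this explicit form.\<close>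

private definition set_of where "set_of n F = {p \<in> {ga<..T} \<times> space Q. snd p \<in> F (blk n (fst p))}"
private definition PP where "PP n = set_of n ` {F. \<forall>i. F i \<in> sets (G (q n i))}"

private lemma PP_sigma: "sigma_algebra ({ga<..T} \<times> space Q) (PP n)"
 unfolding sigma_algebra_iff2
proof (intro conjI ballI allI impI)
 show "PP n \<subseteq> Pow ({ga<..T} \<times> space Q)" by (auto simp: PP_def set_of_def)
 show "{} \<in> PP n" unfolding PP_def by (rule image_eqI[of _ _ "%_. {}"]) (auto simp: set_of_def)
next
 fix S assume "S \<in> PP n"
 then obtain F where F: "S = set_of n F" "\<And>i. F i \<in> sets (G (q n i))" by (auto simp: PP_def)
 have c: "space Q - F i \<in> sets (G (q n i))" for i using sets.compl_sets[OF F(2)[of i]] by simp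
 show "{ga<..T} \<times> space Q - S \<in> PP n" unfolding PP_def
  by (rule image_eqI[of _ _ "%i. space Q - F i"]) (use F c in \<open>auto simp: set_of_def\<close>)
next
 fix A :: "nat => (real \<times> 'a) set" assume "range A \<subseteq> PP n"
 then have "\<forall>k. \<exists>F. A k = set_of n F \<and> (\<forall>i. F i \<in> sets (G (q n i)))"
 proof (intro allI)
  fix k
  have "A k \<in> PP n" using \<open>range A \<subseteq> PP n\<close> by auto
  then show "\<exists>F. A k = set_of n F \<and> (\<forall>i. F i \<in> sets (G (q n i)))" unfolding PP_def by blast
 qed
 then obtain F where F: "\<And>k. A k = set_of n (F k)" "\<And>k i. F k i \<in> sets (G (q n i))" by metis
 show "(\<Union>i. A i) \<in> PP n" unfolding PP_def
  by (rule image_eqI[of _ _ "%i. \<Union>k. F k i"]) (use F in \<open>auto simp: set_of_def\<close>)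
qed

private definition gF where "gF n = sigma ({ga<..T} \<times> space Q) (PP n)"

private lemma sets_FF: "sets (gF n) = PP n" and space_FF: "space (gF n) = {ga<..T} \<times> space Q"
 unfolding gF_def using sigma_algebra.sets_measure_of_eq[OF PP_sigma] sigma_algebra.space_measure_of_eq[OF PP_sigma] by auto

private lemma set_of_sets:
 assumes "\<And>i. F i \<in> sets (G (q n i))"
 shows "set_of n F \<in> sets \<mu>"
proof -
 have "set_of n F = (\<Union>i. (blk n -` {i} \<inter> space gL) \<times> F i)"
  using sets.sets_into_space[OF assms] by (auto simp: set_of_def space_gL)
 also have "\<dots> \<in> sets \<mu>" unfolding \<mu>_def
  using G_sets[OF assms] measurable_sets[OF blk_gL] by (intro sets.countable_UN'' pair_measureI) auto
 finally show ?thesis .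
qed

text \<open>On each block the integral in time contributes the increment of \<open>W\<close> by
  which the covariance was divided, so only covariances remain.\<close>

private lemma set_integral_X:
 assumes n: "m0 <= n" and F: "\<And>i. F i \<in> sets (G (q n i))"
 shows "(LINT p:set_of n F|\<mu>. gX n p) = (\<Sum>i\<in>{J n..<2 ^ n}. cov M N (q n i) (q n (Suc i)) (F i))"
proof -
 interpret L: finite_measure gL by (rule fin_gL)
 interpret LQ: pair_sigma_finite gL Q ..
 interpret m: finite_measure \<mu> by (rule fin_\<mu>)
 have "integrable \<mu> (gX n)" by (rule m.integrable_of_L2[OF gX_meas X_L2[OF n]])
 then have "integrable \<mu> (%p. indicator (set_of n F) p *\<^sub>R gX n p)"
  by (rule integrable_mult_indicator[OF set_of_sets[OF F]])
 then have "(LINT p:set_of n F|\<mu>. gX n p) = (LINT r|gL. (LINT w|Q. indicator (set_of n F) (r, w) *\<^sub>R gX n (r, w)))"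
  unfolding set_lebesgue_integral_def \<mu>_def by (rule LQ.integral_fst'[symmetric])
 also have "\<dots> = (LINT r|gL. (%i. \<integral>w\<in>F i. \<kappa> n i w \<partial>Q) (blk n r))"
  unfolding set_lebesgue_integral_def
  by (intro Bochner_Integration.integral_cong refl) (auto simp: set_of_def gX_def space_gL indicator_def)
 also have "\<dots> = (\<Sum>i\<in>{J n..<2 ^ n}. (LINT w:F i|Q. \<kappa> n i w) * dW n i)" by (rule blk_int[OF n])
 also have "\<dots> = (\<Sum>i\<in>{J n..<2 ^ n}. cov M N (q n i) (q n (Suc i)) (F i))"
  using \<kappa>c[OF _ s_q(1)[OF n] F] by (intro sum.cong refl) (auto simp: dW_def mult.commute)
 finally show ?thesis .
qed

private lemma q_div2: "q n (j div 2) <= q (Suc n) j"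
 unfolding q_simps(3)[of n "j div 2", symmetric] q_simps(5) by presburger

private lemma set_of_Suc: "set_of n F = set_of (Suc n) (%j. F (j div 2))"
 using a0 blk_Suc[of _ n] by (auto simp: set_of_def)

text \<open>Refinement splits each block into two, and by \<open>cov_split\<close> the covariance
  over the parent is the sum over its children. Together with \<open>set_integral_X\<close> this is
  the martingale property.\<close>

private lemma mart_seq: "L2_martingale_seq \<mu> (%k. gF (m0 + k)) (%k. gX (m0 + k)) B"
proof (intro L2_martingale_seq.intro fin_\<mu>, unfold_locales)
 fix n
 show "subalgebra \<mu> (gF (m0 + n))"
  unfolding subalgebra_def space_FF space_\<mu> sets_FF using set_of_sets by (auto simp: PP_def)
 show "sets (gF (m0 + n)) \<subseteq> sets (gF (m0 + Suc n))"
 proof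
  fix S assume "S \<in> sets (gF (m0 + n))"
  then obtain F where F: "S = set_of (m0 + n) F" "\<And>i. F i \<in> sets (G (q (m0 + n) i))" by (auto simp: PP_def sets_FF)
  have "F (j div 2) \<in> sets (G (q (Suc (m0 + n)) j))" for j
   using F(2)[of "j div 2"] G_mono[OF q_div2[of "m0 + n" j]] by auto
  then show "S \<in> sets (gF (m0 + Suc n))"
   unfolding sets_FF PP_def F(1) by (subst set_of_Suc) (simp del: add_Suc_right add: add_Suc_right[symmetric] image_eqI)
 qed
 show "gX (m0 + n) \<in> borel_measurable (gF (m0 + n))"
 proof (rule measurableI)
  fix S :: "real set" assume S: "S \<in> sets borel"
  have "gX (m0 + n) -` S \<inter> space (gF (m0 + n)) = set_of (m0 + n) (%i. \<kappa> (m0 + n) i -` S \<inter> space (G (q (m0 + n) i)))"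
   by (auto simp: gX_def set_of_def space_FF)
  also have "\<dots> \<in> sets (gF (m0 + n))"
   unfolding sets_FF PP_def using measurable_sets[OF \<kappa>m S] by (intro imageI) auto
  finally show "gX (m0 + n) -` S \<inter> space (gF (m0 + n)) \<in> sets (gF (m0 + n))" .
 qed simp
 show "integrable \<mu> (%x. (gX (m0 + n) x)^2)" by (rule X_L2) simp
 have "ennreal (LINT x|\<mu>. (gX (m0 + n) x)^2) <= ennreal B"
  using X_sq_nn[of "m0 + n"] nn_integral_eq_integral[OF X_L2[of "m0 + n"]] by simp
 then show "(LINT x|\<mu>. (gX (m0 + n) x)^2) <= B" using B0 by simp
 fix S assume "S \<in> sets (gF (m0 + n))"
 then obtain F where F: "S = set_of (m0 + n) F" "\<And>i. F i \<in> sets (G (q (m0 + n) i))" by (auto simp: PP_def sets_FF)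
 define l where "l = m0 + n"
 have l: "m0 <= l" "m0 <= Suc l" by (auto simp: l_def)
 note F' = F[folded l_def]
 have F2: "F (j div 2) \<in> sets (G (q (Suc l) j))" for j
  using F'(2)[of "j div 2"] G_mono[OF q_div2[of l j]] by auto
 have "(LINT x:S|\<mu>. gX (Suc l) x) = (\<Sum>j\<in>{J (Suc l)..<2 ^ Suc l}. cov M N (q (Suc l) j) (q (Suc l) (Suc j)) (F (j div 2)))"
  unfolding F'(1) set_of_Suc[of l F] by (rule set_integral_X[OF l(2) F2])
 also have "\<dots> = (\<Sum>i\<in>{J l..<2 ^ l}. cov M N (q (Suc l) (2 * i)) (q (Suc l) (Suc (2 * i))) (F i)
   + cov M N (q (Suc l) (Suc (2 * i))) (q (Suc l) (2 * Suc i)) (F i))"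
  unfolding J_Suc[OF l(1)] power_Suc sum_pairs by simp
 also have "\<dots> = (\<Sum>i\<in>{J l..<2 ^ l}. cov M N (q l i) (q l (Suc i)) (F i))"
 proof (intro sum.cong refl)
  fix i assume i: "i \<in> {J l..<2 ^ l}"
  have "cov M N (q (Suc l) (2 * i)) (q (Suc l) (2 * Suc i)) (F i) = cov M N (q (Suc l) (2 * i)) (q (Suc l) (Suc (2 * i))) (F i)
   + cov M N (q (Suc l) (Suc (2 * i))) (q (Suc l) (2 * Suc i)) (F i)"
  proof (rule cov_split[OF M N])
   show "s <= q (Suc l) (2 * i)" "F i \<in> sets (G (q (Suc l) (2 * i)))" "q (Suc l) (2 * Suc i) <= T"
    unfolding q_simps(3) using s_q(1)[OF l(1)] i F'(2) by (auto simp: q_le_T)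
  qed (auto simp: q_simps(5))
  then show "cov M N (q (Suc l) (2 * i)) (q (Suc l) (Suc (2 * i))) (F i)
   + cov M N (q (Suc l) (Suc (2 * i))) (q (Suc l) (2 * Suc i)) (F i) = cov M N (q l i) (q l (Suc i)) (F i)"
   unfolding q_simps(3) by simp
 qed
 also have "\<dots> = (LINT x:S|\<mu>. gX l x)" unfolding F'(1) by (rule set_integral_X[OF l(1) F'(2), symmetric])
 finally show "(LINT x:S|\<mu>. gX (m0 + Suc n) x) = (LINT x:S|\<mu>. gX (m0 + n) x)" by (simp add: l_def)
qed

private lemma K_meas: "(%p. K (fst p) (snd p)) \<in> borel_measurable \<mu>"
 unfolding K_def using gX_meas unfolding gX_def by (intro borel_measurable_lim_metric)

private lemma K_lim: "AE p in \<mu>. (%k. gX (m0 + k) p) \<longlonglongrightarrow> K (fst p) (snd p)"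
 using L2_martingale_seq.AE_Cauchy[OF mart_seq]
proof eventually_elim
 case (elim p)
 then have "convergent (%k. gX (m0 + k) p)" by (rule Cauchy_convergent)
 then have "convergent (%n. gX n p)"
  using convergent_ignore_initial_segment[of "%n. gX n p" m0] by (simp add: add.commute)
 then have "(%n. gX n p) \<longlonglongrightarrow> K (fst p) (snd p)"
  by (simp add: convergent_LIMSEQ_iff K_def gX_def)
 then show ?case using LIMSEQ_ignore_initial_segment[of "%n. gX n p" _ m0] by (simp add: add.commute)
qed

private lemma grid_sq: "(\<integral>\<^sup>+w. (\<integral>\<^sup>+r\<in>{ga<..T}. ennreal ((K r w)^2) \<partial>\<nu>) \<partial>Q) <= ennreal B"
proof -
 interpret L: finite_measure gL by (rule fin_gL)
 interpret LQ: pair_sigma_finite gL Q ..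
 note [measurable] = K_meas[unfolded \<mu>_def]
 have "(\<integral>\<^sup>+w. (\<integral>\<^sup>+r\<in>{ga<..T}. ennreal ((K r w)^2) \<partial>\<nu>) \<partial>Q) = (\<integral>\<^sup>+w. (\<integral>\<^sup>+r. ennreal ((K r w)^2) \<partial>gL) \<partial>Q)"
  unfolding gL_def by (subst nn_integral_restrict_space) auto
 also have "\<dots> = (\<integral>\<^sup>+p. ennreal ((K (fst p) (snd p))^2) \<partial>\<mu>)"
  unfolding \<mu>_def using LQ.nn_integral_snd[of "%p. ennreal ((K (fst p) (snd p))^2)"] by simp
 also have "\<dots> <= ennreal B"
  by (rule L2_martingale_seq.L2_lim(2)[OF mart_seq K_meas K_lim])
 finally show ?thesis .
qed

text \<open>Over the rectangle \<open>{ga<..T} \<times> A\<close> all terms of the martingale have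
  the same integral, by telescoping the covariance over the whole interval. Convergence in L2 passes
  this value on to \<open>K\<close>.\<close>

private lemma grid_id:
 assumes A: "A \<in> sets (G ga)"
 shows "(LINT w:A|Q. nI ga T K w) = cov M N ga T A" (is ?g0) "integrable Q (nI ga T K)"
proof -
 interpret L: finite_measure gL by (rule fin_gL)
 interpret LQ: pair_sigma_finite gL Q ..
 interpret m: finite_measure \<mu> by (rule fin_\<mu>)
 interpret ms: L2_martingale_seq \<mu> "%k. gF (m0 + k)" "%k. gX (m0 + k)" B by (rule mart_seq)
 define K' where "K' p = K (fst p) (snd p)" for p
 have [measurable]: "K' \<in> borel_measurable \<mu>" "gX n \<in> borel_measurable \<mu>" for n using K_meas gX_meas by (auto simp: K'_def[abs_def])
 have K2: "integrable \<mu> (%p. (K' p)^2)"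
 proof (rule integrableI_bounded)
  show "(\<integral>\<^sup>+p. ennreal (norm ((K' p)^2)) \<partial>\<mu>) < \<infinity>"
   using le_less_trans[OF L2_martingale_seq.L2_lim(2)[OF mart_seq K_meas K_lim]] by (simp add: K'_def)
 qed simp
 have Ki: "integrable \<mu> K'" by (rule m.integrable_of_L2[OF _ K2]) simp
 define S where "S = {ga<..T} \<times> A"
 have A': "A \<in> sets Q" "A \<subseteq> space Q" using G_sets[OF A] sets.sets_into_space by auto
 have S[measurable]: "S \<in> sets \<mu>" unfolding S_def \<mu>_def using A' sets.top[of gL] unfolding space_gL by (rule_tac pair_measureI) auto
 have XS: "(LINT p:S|\<mu>. gX (m0 + k) p) = cov M N ga T A" for k
 proof -
  define n where "n = m0 + k"
  have n: "m0 <= n" by (simp add: n_def)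
  \<comment> \<open>The event \<open>A\<close> is known at \<open>ga\<close>, so it may serve as
    section only over blocks that start at \<open>ga\<close> or later; these are the blocks with
    index at least \<open>J n\<close>.\<close>
  define F where "F i = (if J n <= i then A else {})" for i
  have F: "F i \<in> sets (G (q n i))" for i using A G_mono[OF s_q(2)[OF n]] by (auto simp: F_def)
  have "set_of n F = S" using blk_range[OF n] A' by (auto simp: set_of_def S_def F_def)
  then have "(LINT p:S|\<mu>. gX n p) = (\<Sum>i\<in>{J n..<2 ^ n}. cov M N (q n i) (q n (Suc i)) (F i))"
   using set_integral_X[OF n F] by simp
  also have "\<dots> = (\<Sum>i\<in>{J n..<2 ^ n}. cov M N (q n i) (q n (Suc i)) A)" by (intro sum.cong) (auto simp: F_def)
  also have "\<dots> = cov M N ga T A"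
   using cov_sum[OF M N, of n "J n" A "2 ^ n"] qJ[OF n] a0 J_le[OF n] A by (simp add: q_simps)
  finally show ?thesis by (simp add: n_def)
 qed
 have lim: "(%k. \<integral>p\<in>S. gX (m0 + k) p \<partial>\<mu>) \<longlonglongrightarrow> (LINT p:S|\<mu>. K' p)"
 proof (rule Lim_transform2[OF tendsto_const])
  have bd: "\<bar>(LINT p:S|\<mu>. K' p) - (LINT p:S|\<mu>. gX (m0 + k) p)\<bar> <= sqrt ((ms.blim - ms.b k) * measure \<mu> (space \<mu>))" for k
  proof -
   have sq: "(indicator S p)^2 = (indicator S p :: real)" for p by (simp add: indicator_def)
   have x2: "integrable \<mu> (%p. (gX (m0 + k) p)^2)" by (rule X_L2) simp
   have d2: "integrable \<mu> (%p. (K' p - gX (m0 + k) p)^2)" by (intro integrable_L2_diff K2 x2) auto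
   have "(LINT p:S|\<mu>. K' p) - (LINT p:S|\<mu>. gX (m0 + k) p) = (LINT p|\<mu>. (K' p - gX (m0 + k) p) * indicator S p)"
    using Ki ms.X_int[of k] S unfolding set_lebesgue_integral_def
    by (subst Bochner_Integration.integral_diff[symmetric])
     (auto intro!: integrable_mult_indicator simp del: real_scaleR_def, auto simp: algebra_simps)
   also have "\<bar>\<dots>\<bar>^2 <= (LINT p|\<mu>. (K' p - gX (m0 + k) p)^2) * (LINT p|\<mu>. (indicator S p)^2)"
    unfolding power2_abs by (rule Cauchy_Schwarz_integral) (use d2 m.emeasure_finite in \<open>auto simp: sq less_top[symmetric]\<close>)
   also have "\<dots> <= (ms.blim - ms.b k) * measure \<mu> (space \<mu>)"
   proof (rule mult_mono)
    have "ennreal (LINT p|\<mu>. (K' p - gX (m0 + k) p)^2) <= ennreal (ms.blim - ms.b k)"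
     using ms.L2_lim(1)[OF K_meas K_lim, of k] nn_integral_eq_integral[OF d2] by (simp add: K'_def)
    then show "(LINT p|\<mu>. (K' p - gX (m0 + k) p)^2) <= ms.blim - ms.b k" using ms.blim(2)[of k] by simp
    have "(LINT p|\<mu>. (indicator S p)^2) = measure \<mu> S" using m.emeasure_finite by (simp add: sq)
    also have "\<dots> <= measure \<mu> (space \<mu>)" by (rule m.bounded_measure)
    finally show "(LINT p|\<mu>. (indicator S p)^2) <= measure \<mu> (space \<mu>)" .
   qed (use ms.blim(2)[of k] in auto)
   finally show ?thesis by (intro real_le_rsqrt)
  qed
  have "(%k. sqrt ((ms.blim - ms.b k) * measure \<mu> (space \<mu>))) \<longlonglongrightarrow> sqrt ((ms.blim - ms.blim) * measure \<mu> (space \<mu>))"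
   by (intro tendsto_intros ms.blim)
  then have z: "(%k. sqrt ((ms.blim - ms.b k) * measure \<mu> (space \<mu>))) \<longlonglongrightarrow> 0" by simp
  show "(%k. (LINT p:S|\<mu>. K' p) - (LINT p:S|\<mu>. gX (m0 + k) p)) \<longlonglongrightarrow> 0"
   by (rule Lim_null_comparison[OF _ z]) (use bd in auto)
 qed
 have KS: "(LINT p:S|\<mu>. K' p) = cov M N ga T A"
  using LIMSEQ_unique[OF lim[unfolded XS] tendsto_const] .
 have in_eq: "(LINT r|gL. K r w) = nI ga T K w" if "w \<in> space Q" for w
 proof -
  have "(LINT r|gL. K r w) = (LINT r|\<nu>. indicator {ga<..T} r *\<^sub>R K r w)" unfolding gL_def by (subst integral_restrict_space) auto
  also have "\<dots> = nI ga T K w" unfolding nI_def set_lebesgue_integral_def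
  proof (rule integral_cong_AE)
   have m: "(%r. indicator {ga..T} r * K r w) \<in> borel_measurable borel" by (rule prog_path[OF prog_K _ _ _ that]) (use a0 in auto)
   then show "(%r. indicator {ga..T} r *\<^sub>R K r w) \<in> borel_measurable \<nu>" by (simp cong: measurable_cong_sets)
   have "(%r. indicator {ga<..T} r * (indicator {ga..T} r * K r w)) \<in> borel_measurable borel" using m by measurable
   also have "(%r. indicator {ga<..T} r * (indicator {ga..T} r * K r w)) = (%r. indicator {ga<..T} r *\<^sub>R K r w)" by (auto simp: indicator_def)
   finally show "(%r. indicator {ga<..T} r *\<^sub>R K r w) \<in> borel_measurable \<nu>" by (simp cong: measurable_cong_sets)
   show "AE r in \<nu>. indicator {ga<..T} r *\<^sub>R K r w = indicator {ga..T} r *\<^sub>R K r w"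
    using nu_AE_neq[of ga] by eventually_elim (auto simp: indicator_def)
  qed
  finally show ?thesis .
 qed
 have Ki': "integrable (gL \<Otimes>\<^sub>M Q) K'" using Ki by (simp add: \<mu>_def)
 have "integrable Q (%w. \<integral>r. K' (r, w) \<partial>gL)"
  using LQ.integrable_snd[of "%r w. K' (r, w)"] Ki' by simp
 then show "integrable Q (nI ga T K)"
  by (rule Bochner_Integration.integrable_cong[THEN iffD1, rotated 2]) (auto simp: K'_def in_eq)
 have "integrable (gL \<Otimes>\<^sub>M Q) (%p. indicator S p *\<^sub>R K' p)"
  using integrable_mult_indicator[OF S Ki] by (simp add: \<mu>_def)
 then have "(LINT p:S|\<mu>. K' p) = (LINT w|Q. (LINT r|gL. indicator S (r, w) *\<^sub>R K' (r, w)))"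
  unfolding set_lebesgue_integral_def \<mu>_def using LQ.integral_snd[of "%r w. indicator S (r, w) *\<^sub>R K' (r, w)"]
  by (simp add: split_beta')
 also have "\<dots> = (LINT w:A|Q. nI ga T K w)"
  unfolding set_lebesgue_integral_def
 proof (intro Bochner_Integration.integral_cong refl)
  fix w assume w: "w \<in> space Q"
  have "(LINT r|gL. indicator S (r, w) *\<^sub>R K' (r, w)) = (LINT r|gL. indicator A w * K r w)"
   by (intro Bochner_Integration.integral_cong refl) (auto simp: S_def indicator_def space_gL K'_def)
  then show "(LINT r|gL. indicator S (r, w) *\<^sub>R K' (r, w)) = indicator A w *\<^sub>R nI ga T K w" by (simp add: in_eq[OF w])
 qed
 finally show ?g0 using KS by simp
qed

lemmas bracket_grid_sq = grid_sq[unfolded B_def ga_def]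
 and bracket_grid_id = grid_id[unfolded ga_def]

end

private lemma K_sq_grid:
 assumes "s <= q n i" "i <= 2 ^ n"
 shows "(\<integral>\<^sup>+w. (\<integral>\<^sup>+r\<in>{q n i..T}. ennreal \<bar>K r w * K r w\<bar> \<partial>\<nu>) \<partial>Q) <= ennreal (C * (LINT w|Q. (M T w - M (q n i) w)^2))"
proof -
 have "(\<integral>\<^sup>+r\<in>{q n i..T}. ennreal \<bar>K r w * K r w\<bar> \<partial>\<nu>) = (\<integral>\<^sup>+r\<in>{q n i<..T}. ennreal ((K r w)^2) \<partial>\<nu>)" for w
 proof (rule nn_integral_cong_AE)
  show "AE r in \<nu>. ennreal \<bar>K r w * K r w\<bar> * indicator {q n i..T} r = ennreal ((K r w)^2) * indicator {q n i<..T} r"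
   using nu_AE_neq[of "q n i"] by eventually_elim (auto simp: indicator_def power2_eq_square)
 qed
 then show ?thesis using bracket_grid_sq[OF assms] by (simp add: cov_space power2_eq_square)
qed

text \<open>Grid points approach \<open>t\<close> from the right, and Fatou's lemma extends the
  bound from them to \<open>t\<close>.\<close>

private lemma K_sq:
 assumes t: "t \<in> {s..T}"
 shows "(\<integral>\<^sup>+w. sq t K w \<partial>Q) <= ennreal (C * (LINT w|Q. (M T w - M t w)^2))"
proof -
 have t0: "0 <= t" "t <= T" "s <= t" using t s_ge by auto
 define \<alpha> where "\<alpha> p = q p (up t p)" for p
 have \<alpha>: "t <= \<alpha> p" "\<alpha> p <= T" "s <= \<alpha> p" "up t p <= 2 ^ p" for p
  using up(1,2)[OF t0(1,2), of p] t0(3) by (auto simp: \<alpha>_def q_le_T)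
 have \<alpha>l: "\<alpha> \<longlonglongrightarrow> t" unfolding \<alpha>_def by (rule up(3)[OF t0(1,2)])
 have KK: "prog (%r w. K r w * K r w)" by (rule prog_arith(3)[OF prog_K prog_K])
 define f where "f p w = (\<integral>\<^sup>+r\<in>{\<alpha> p..T}. ennreal \<bar>K r w * K r w\<bar> \<partial>\<nu>)" for p w
 have fm: "f p \<in> borel_measurable Q" for p
  unfolding f_def[abs_def] by (rule measurable_from_subalg[OF subG nn_meas[OF KK]]) (use \<alpha> in auto)
 have "(\<integral>\<^sup>+w. sq t K w \<partial>Q) <= (\<integral>\<^sup>+w. liminf (%p. f p w) \<partial>Q)"
 proof (rule nn_integral_mono)
  fix w assume w: "w \<in> space Q"
  have pm[measurable]: "(%r. indicator {\<alpha> p..T} r * (K r w * K r w)) \<in> borel_measurable borel" for p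
   by (rule prog_path[OF KK _ _ _ w]) (use \<alpha> in auto)
  have "(sq t K w) <= (\<integral>\<^sup>+r. liminf (%p. ennreal \<bar>indicator {\<alpha> p..T} r * (K r w * K r w)\<bar>) \<partial>\<nu>)"
  proof (rule nn_integral_mono_AE)
   show "AE r in \<nu>. ennreal ((K r w)^2) * indicator {t..T} r <= liminf (%p. ennreal \<bar>indicator {\<alpha> p..T} r * (K r w * K r w)\<bar>)"
    using nu_AE_neq[of t]
   proof eventually_elim
    case (elim r)
    show ?case
    proof (cases "r \<in> {t..T}")
     case True
     then have "t < r" using elim by auto
     then have "\<forall>\<^sub>F p in sequentially. \<alpha> p < r" using \<alpha>l by (rule order_tendstoD(2)[rotated])
     then have "\<forall>\<^sub>F p in sequentially. ennreal ((K r w)^2) * indicator {t..T} r <= ennreal \<bar>indicator {\<alpha> p..T} r * (K r w * K r w)\<bar>"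
      by eventually_elim (use True in \<open>auto simp: indicator_def power2_eq_square\<close>)
     then show ?thesis by (rule Liminf_bounded)
    qed simp
   qed
  qed
  also have "\<dots> <= liminf (%p. \<integral>\<^sup>+r. ennreal \<bar>indicator {\<alpha> p..T} r * (K r w * K r w)\<bar> \<partial>\<nu>)"
   by (rule nn_integral_liminf) simp
  also have "(%p. \<integral>\<^sup>+r. ennreal \<bar>indicator {\<alpha> p..T} r * (K r w * K r w)\<bar> \<partial>\<nu>) = (%p. f p w)"
   unfolding f_def by (intro ext nn_integral_cong) (auto simp: indicator_def)
  finally show "(sq t K w) <= liminf (%p. f p w)" .
 qed
 also have "\<dots> <= liminf (%p. \<integral>\<^sup>+w. f p w \<partial>Q)" by (rule nn_integral_liminf[OF fm])
 also have "\<dots> <= ennreal (C * (LINT w|Q. (M T w - M t w)^2))"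
 proof (rule Liminf_le)
  have "(\<integral>\<^sup>+w. f p w \<partial>Q) <= ennreal (C * (LINT w|Q. (M T w - M t w)^2))" for p
  proof -
   have "(\<integral>\<^sup>+w. f p w \<partial>Q) <= ennreal (C * (LINT w|Q. (M T w - M (\<alpha> p) w)^2))"
    unfolding f_def \<alpha>_def by (rule K_sq_grid) (use \<alpha>[of p] in \<open>auto simp: \<alpha>_def\<close>)
   also have "\<dots> <= ennreal (C * (LINT w|Q. (M T w - M t w)^2))"
    using C by (intro ennreal_leI mult_left_mono incr_sq_mono(1)[OF M t0(3) \<alpha>(1,2)]) auto
   finally show ?thesis .
  qed
  then show "\<forall>\<^sub>F p in sequentially. (\<integral>\<^sup>+w. f p w \<partial>Q) <= ennreal (C * (LINT w|Q. (M T w - M t w)^2))" by simp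
 qed simp
 finally show ?thesis .
qed

text \<open>Again \<open>t\<close> is approached by grid points \<open>\<alpha> p\<close> from the
  right. The integrals of \<open>K\<close> converge by dominated convergence. The covariances
  converge because \<open>brk\<close> and Cauchy-Schwarz bound the covariance over
  \<open>(t, \<alpha> p]\<close> by a multiple of
  \<open>sqrt (W (\<alpha> p) - W t)\<close>.\<close>

private lemma K_repr: "repr M N K"
proof -
 have fin2: "(\<integral>\<^sup>+w. sq s K w \<partial>Q) < \<infinity>"
  using le_less_trans[OF K_sq[of s]] s_le by simp
 note L = L1_facts[OF prog_K L2_nn_finite[OF prog_K fin2[folded N2_def]]]
 have "(LINT w:A|Q. nI t T K w) = cov M N t T A" if t: "t \<in> {s..T}" and A: "A \<in> sets (G t)" for t A
 proof -
  have t0: "0 <= t" "t <= T" "s <= t" using t s_ge by auto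
  define \<alpha> where "\<alpha> p = q p (up t p)" for p
  have \<alpha>: "t <= \<alpha> p" "\<alpha> p <= T" "s <= \<alpha> p" "up t p <= 2 ^ p" for p
   using up(1,2)[OF t0(1,2), of p] t0(3) by (auto simp: \<alpha>_def q_le_T)
  have \<alpha>l: "\<alpha> \<longlonglongrightarrow> t" unfolding \<alpha>_def by (rule up(3)[OF t0(1,2)])
  have AQ: "A \<in> sets Q" by (rule G_sets[OF A])
  have nm: "nI v T K \<in> borel_measurable Q" if "s <= v" "v <= T" for v
   by (rule G_meas[OF nI_meas[OF prog_K]]) (use that in auto)
  have id: "(LINT w:A|Q. nI (\<alpha> p) T K w) = cov M N (\<alpha> p) T A" for p
   unfolding \<alpha>_def by (rule bracket_grid_id(1)) (use \<alpha>[of p] A G_mono[OF \<alpha>(1)[of p]] in \<open>auto simp: \<alpha>_def\<close>)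
  have l1: "(%p. \<integral>w\<in>A. nI (\<alpha> p) T K w \<partial>Q) \<longlonglongrightarrow> (LINT w:A|Q. nI t T K w)"
   unfolding set_lebesgue_integral_def
  proof (rule integral_dominated_convergence[OF _ _ L(2)])
   show "AE w in Q. (%p. indicator A w *\<^sub>R nI (\<alpha> p) T K w) \<longlonglongrightarrow> indicator A w *\<^sub>R nI t T K w"
    using L(1)
   proof eventually_elim
    case (elim w)
    have c: "continuous_on {s..T} (%v. nI s v K w)" unfolding nI_def by (rule indefinite_integral_continuous[OF elim])
    have "(%p. nI s (\<alpha> p) K w) \<longlonglongrightarrow> nI s t K w"
     by (rule continuous_on_tendsto_compose[OF c \<alpha>l t]) (use \<alpha> in auto)
    then have "(%p. nI s T K w - nI s (\<alpha> p) K w) \<longlonglongrightarrow> nI s T K w - nI s t K w" by (intro tendsto_intros)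
    moreover have "nI s T K w - nI s v K w = nI v T K w" if "s <= v" "v <= T" for v
     using nI_split[of K w v] elim that by simp
    ultimately have "(%p. nI (\<alpha> p) T K w) \<longlonglongrightarrow> nI t T K w" using \<alpha> t0 by simp
    then show ?case by (intro tendsto_intros)
   qed
   show "AE w in Q. norm (indicator A w *\<^sub>R nI (\<alpha> p) T K w) <= nI s T (%r w. \<bar>K r w\<bar>) w" for p
    using L(1)
   proof eventually_elim
    case (elim w)
    have "\<bar>nI (\<alpha> p) T K w\<bar> <= nI s T (%r w. \<bar>K r w\<bar>) w" by (rule L(4)[OF \<alpha>(3) order_refl elim])
    then show ?case by (auto simp: indicator_def intro: order.trans[OF abs_ge_zero])
   qed
  qed (use AQ nm \<alpha> t0 in auto)
  have l2: "(%p. cov M N (\<alpha> p) T A) \<longlonglongrightarrow> cov M N t T A"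
  proof (rule Lim_transform2[OF tendsto_const])
   have bd: "\<bar>cov M N t T A - cov M N (\<alpha> p) T A\<bar> <= sqrt ((LINT w|Q. (M T w - M t w)^2) * (C * (W (\<alpha> p) - W t)))" for p
   proof -
    have e: "cov M N t T A - cov M N (\<alpha> p) T A = cov M N t (\<alpha> p) A"
     using cov_split[OF M N t0(3) \<alpha>(1,2)[of p] order_refl A] by simp
    note m = l2m_incr[OF M t0(3) \<alpha>(1,2)] and n = l2m_incr[OF N t0(3) \<alpha>(1,2)]
    have am: "(%w. indicator A w * (M (\<alpha> p) w - M t w)) \<in> borel_measurable Q"
     using m(2)[of p] AQ by (rule_tac borel_measurable_times) auto
    have ai: "integrable Q (%w. (indicator A w * (M (\<alpha> p) w - M t w))^2)"
     by (rule Bochner_Integration.integrable_bound[OF m(3)]) (use am in \<open>auto simp: indicator_def\<close>)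
    have "cov M N t (\<alpha> p) A = (LINT w|Q. (indicator A w * (M (\<alpha> p) w - M t w)) * (N (\<alpha> p) w - N t w))"
     by (simp add: cov_def set_lebesgue_integral_def mult.assoc)
    also have "\<bar>\<dots>\<bar>^2 <= (LINT w|Q. (indicator A w * (M (\<alpha> p) w - M t w))^2) * (LINT w|Q. (N (\<alpha> p) w - N t w)^2)"
     unfolding power2_abs by (rule Cauchy_Schwarz_integral[OF am n(2) ai n(3)])
    also have "\<dots> <= (LINT w|Q. (M T w - M t w)^2) * (C * (W (\<alpha> p) - W t))"
    proof (rule mult_mono)
     have "(LINT w|Q. (indicator A w * (M (\<alpha> p) w - M t w))^2) <= (LINT w|Q. (M (\<alpha> p) w - M t w)^2)"
      by (rule integral_mono[OF ai m(3)]) (auto simp: indicator_def)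
     also have "\<dots> <= (LINT w|Q. (M T w - M t w)^2)" by (rule incr_sq_mono(2)[OF M t0(3) \<alpha>(1,2)])
     finally show "(LINT w|Q. (indicator A w * (M (\<alpha> p) w - M t w))^2) <= (LINT w|Q. (M T w - M t w)^2)" .
     have "cov N N t (\<alpha> p) (space Q) <= C * (W (\<alpha> p) - W t) * measure Q (space Q)"
      using brkN t0(3) \<alpha>(1,2) space_in_G unfolding brk_def by blast
     then show "(LINT w|Q. (N (\<alpha> p) w - N t w)^2) <= C * (W (\<alpha> p) - W t)"
      by (simp add: cov_space power2_eq_square Q.prob_space)
    qed auto
    finally show ?thesis unfolding e by (intro real_le_rsqrt) (simp add: e)
   qed
   have "(%p. W (\<alpha> p)) \<longlonglongrightarrow> W t" using isCont_tendsto_compose[OF isCont_W \<alpha>l] .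
   then have "(%p. sqrt ((LINT w|Q. (M T w - M t w)^2) * (C * (W (\<alpha> p) - W t)))) \<longlonglongrightarrow> sqrt ((LINT w|Q. (M T w - M t w)^2) * (C * (W t - W t)))"
    by (intro tendsto_intros)
   then have z: "(%p. sqrt ((LINT w|Q. (M T w - M t w)^2) * (C * (W (\<alpha> p) - W t)))) \<longlonglongrightarrow> 0" by simp
   show "(%p. cov M N t T A - cov M N (\<alpha> p) T A) \<longlonglongrightarrow> 0"
    by (rule Lim_null_comparison[OF _ z]) (use bd in auto)
  qed
  show ?thesis using LIMSEQ_unique[OF l1 l2[folded id]] .
 qed
 then show ?thesis unfolding repr_def using prog_K L by auto
qed

lemmas bracket_density_repr = K_repr[unfolded K_def[abs_def]]
 and bracket_density_sq = K_sq[unfolded K_def]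

end

section \<open>Square bounds and the product rule for time integrals\<close>

text \<open>Cauchy-Schwarz against the constant 1, whose integral is at most
  \<open>W T - W 0\<close>.\<close>

lemma nI_sq_le:
 assumes "jm g" "w \<in> space Q" "s <= t" "u <= T"
 shows "ennreal ((nI t u g w)^2) <= ennreal (W T - W 0) * (sq s g w)"
proof -
 have [measurable]: "(%r. indicator {s..T} r * g r w) \<in> borel_measurable borel" by (rule jm_path[OF assms(1,2)])
 have "ennreal ((nI t u g w)^2) = (ennreal \<bar>nI t u g w\<bar>)^2" by (simp add: ennreal_power)
 also have "\<dots> <= (ab t u g w)^2" by (rule power_mono[OF nI_le_nn]) simp
 also have "\<dots> <= (\<integral>\<^sup>+r. 1 * ennreal \<bar>indicator {s..T} r * g r w\<bar> \<partial>\<nu>)^2"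
  using assms by (intro power_mono nn_integral_mono) (auto simp: indicator_def)
 also have "\<dots> <= (\<integral>\<^sup>+r. 1^2 \<partial>\<nu>) * (\<integral>\<^sup>+r. (ennreal \<bar>indicator {s..T} r * g r w\<bar>)^2 \<partial>\<nu>)"
  by (rule Cauchy_Schwarz_nn_integral) (simp_all cong: measurable_cong_sets)
 also have "\<dots> <= ennreal (W T - W 0) * (sq s g w)"
 proof (rule mult_mono)
  show "(\<integral>\<^sup>+r. (ennreal \<bar>indicator {s..T} r * g r w\<bar>)^2 \<partial>\<nu>) <= (sq s g w)"
   by (intro nn_integral_mono) (auto simp: indicator_def ennreal_power)
 qed (use nu_UNIV_le in auto)
 finally show ?thesis .
qed

lemma jm_nI_meas: assumes g: "jm g" and t: "s <= t" "u <= T" shows "nI t u g \<in> borel_measurable Q"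
proof -
 have "(%p. (snd p, fst p)) \<in> measurable (Q \<Otimes>\<^sub>M \<nu>) (\<nu> \<Otimes>\<^sub>M Q)" by simp
 from measurable_compose[OF this g[unfolded jm_def]]
 have [measurable]: "(%p. indicator {s..T} (snd p) * g (snd p) (fst p)) \<in> borel_measurable (Q \<Otimes>\<^sub>M \<nu>)" by simp
 have "(%p. indicator {t..u} (snd p) * (indicator {s..T} (snd p) * g (snd p) (fst p))) \<in> borel_measurable (Q \<Otimes>\<^sub>M \<nu>)" by measurable
 also have "(%p. indicator {t..u} (snd p) * (indicator {s..T} (snd p) * g (snd p) (fst p))) = (%(w, r). indicator {t..u} r *\<^sub>R g r w)"
  using t by (auto simp: indicator_def fun_eq_iff)
 finally show ?thesis unfolding nI_def[abs_def] set_lebesgue_integral_def by (rule nu.borel_measurable_lebesgue_integral)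
qed

lemma nI_L2:
 assumes g: "jm g" "N2 g < \<infinity>" and t: "s <= t" "u <= T"
 shows "integrable Q (%w. (nI t u g w)^2)"
proof (rule integrableI_bounded)
 show "(%w. (nI t u g w)^2) \<in> borel_measurable Q" using jm_nI_meas[OF g(1) t] by measurable
 have "(\<integral>\<^sup>+w. ennreal (norm ((nI t u g w)^2)) \<partial>Q) <= (\<integral>\<^sup>+w. ennreal (W T - W 0) * (sq s g w) \<partial>Q)"
  using nI_sq_le[OF g(1) _ t] by (intro nn_integral_mono) simp
 also have "\<dots> = ennreal (W T - W 0) * N2 g" unfolding N2_def
  by (rule nn_integral_cmult, rule Tonelli(3)[OF jm_E[OF g(1)]]) auto
 also have "\<dots> < \<infinity>" using g(2) by (simp add: ennreal_mult_less_top)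
 finally show "(\<integral>\<^sup>+w. ennreal (norm ((nI t u g w)^2)) \<partial>Q) < \<infinity>" .
qed

text \<open>The variable upper limit is moved into the integrand as a condition, so that
  measurability of parametric integrals applies to time and point jointly.\<close>

lemma prog_nI: assumes g: "prog g" shows "prog (%r. nI s r g)"
 unfolding prog_def
proof
 fix u assume u: "u \<in> {s..T}"
 have [measurable]: "(%p. indicator {s..u} (fst p) * g (fst p) (snd p)) \<in> borel_measurable (borel \<Otimes>\<^sub>M G u)" using progD[OF g] u by auto
 have "(%x. (snd x, snd (fst x))) \<in> measurable ((borel \<Otimes>\<^sub>M G u) \<Otimes>\<^sub>M \<nu>) (borel \<Otimes>\<^sub>M G u)" by simp
 from measurable_compose[OF this \<open>_ \<in> borel_measurable (borel \<Otimes>\<^sub>M G u)\<close>]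
 have [measurable]: "(%x. indicator {s..u} (snd x) * g (snd x) (snd (fst x))) \<in> borel_measurable ((borel \<Otimes>\<^sub>M G u) \<Otimes>\<^sub>M \<nu>)" by simp
 have "(%x. if snd x <= fst (fst x) then indicator {s..u} (snd x) * g (snd x) (snd (fst x)) else 0) \<in> borel_measurable ((borel \<Otimes>\<^sub>M G u) \<Otimes>\<^sub>M \<nu>)"
  by measurable
 then have "(%p. \<integral>v. (if v <= fst p then indicator {s..u} v * g v (snd p) else 0) \<partial>\<nu>) \<in> borel_measurable (borel \<Otimes>\<^sub>M G u)"
  by (intro nu.borel_measurable_lebesgue_integral) (simp add: split_beta')
 then have "(%p. indicator {s..u} (fst p) * (LINT v|\<nu>. (if v <= fst p then indicator {s..u} v * g v (snd p) else 0))) \<in> borel_measurable (borel \<Otimes>\<^sub>M G u)"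
  by measurable
 also have "(%p. indicator {s..u} (fst p) * (LINT v|\<nu>. (if v <= fst p then indicator {s..u} v * g v (snd p) else 0))) = (%(r, w). indicator {s..u} r * nI s r g w)"
 proof (rule ext)
  fix p :: "real \<times> 'a"
  obtain r w where p: "p = (r, w)" by (cases p)
  have "(LINT v|\<nu>. (if v <= r then indicator {s..u} v * g v w else 0)) = nI s r g w" if "r \<in> {s..u}"
   unfolding nI_def set_lebesgue_integral_def
   by (intro Bochner_Integration.integral_cong) (use that in \<open>auto simp: indicator_def\<close>)
  then show "indicator {s..u} (fst p) * (LINT v|\<nu>. (if v <= fst p then indicator {s..u} v * g v (snd p) else 0)) = (case p of (r, w) => indicator {s..u} r * nI s r g w)"
   unfolding p prod.case fst_conv snd_conv by (cases "r \<in> {s..u}") simp_all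
 qed
 finally show "(%(r, w). indicator {s..u} r * nI s r g w) \<in> borel_measurable (borel \<Otimes>\<^sub>M G u)" .
qed

lemma N2_nI: assumes g: "jm g" "N2 g < \<infinity>" shows "N2 (%r. nI s r g) < \<infinity>"
proof -
 have m: "(%w. \<integral>\<^sup>+r\<in>{s..T}. ennreal ((g r w)^2) \<partial>\<nu>) \<in> borel_measurable Q"
  by (rule Tonelli(3)[OF jm_E[OF g(1)]]) auto
 have "N2 (%r. nI s r g) <= (\<integral>\<^sup>+w. emeasure \<nu> {s..T} * (ennreal (W T - W 0) * (sq s g w)) \<partial>Q)"
  unfolding N2_def
 proof (rule nn_integral_mono)
  fix w assume w: "w \<in> space Q"
  have "(\<integral>\<^sup>+r\<in>{s..T}. ennreal ((nI s r g w)^2) \<partial>\<nu>) <= (\<integral>\<^sup>+r\<in>{s..T}. ennreal (W T - W 0) * (sq s g w) \<partial>\<nu>)"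
   using nI_sq_le[OF g(1) w] by (intro nn_integral_mono) (auto simp: indicator_def)
  then show "(\<integral>\<^sup>+r\<in>{s..T}. ennreal ((nI s r g w)^2) \<partial>\<nu>) <= emeasure \<nu> {s..T} * (ennreal (W T - W 0) * (sq s g w))"
   by (subst (asm) nn_integral_cmult_indicator) (simp_all only: mult.commute sets_nu, simp)
 qed
 also have "\<dots> = emeasure \<nu> {s..T} * (ennreal (W T - W 0) * N2 g)"
  unfolding N2_def using m by (simp add: nn_integral_cmult)
 also have "\<dots> < \<infinity>"
 proof -
  have "emeasure \<nu> {s..T} < \<top>" by (simp add: less_top[symmetric])
  then show ?thesis using g(2) by (simp add: ennreal_mult_less_top)
 qed
 finally show ?thesis .
qed

text \<open>The diagonal of \<open>\<nu> \<otimes> \<nu>\<close> is null, so the square \<open>[s,u]^2\<close> is the union of its two triangles.\<close>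

lemma product_rule_path:
 fixes g h :: "real => real"
 assumes g: "set_integrable \<nu> {s..u} g" and h: "set_integrable \<nu> {s..u} h"
 shows "(LINT r:{s..u}|\<nu>. g r * (LINT v:{s..r}|\<nu>. h v) + (LINT v:{s..r}|\<nu>. g v) * h r) = (LINT r:{s..u}|\<nu>. g r) * (LINT r:{s..u}|\<nu>. h r)" (is ?g0)
  and "set_integrable \<nu> {s..u} (%r. g r * (LINT v:{s..r}|\<nu>. h v) + (LINT v:{s..r}|\<nu>. g v) * h r)" (is ?g1)
proof -
 interpret P: pair_sigma_finite \<nu> \<nu> ..
 define g' where "g' r = indicator {s..u} r * g r" for r
 define h' where "h' r = indicator {s..u} r * h r" for r
 have gi: "integrable \<nu> g'" and hi: "integrable \<nu> h'" using g h by (auto simp: set_integrable_def g'_def[abs_def] h'_def[abs_def])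
 have [measurable]: "g' \<in> borel_measurable borel" "h' \<in> borel_measurable borel"
  using gi hi by (auto dest!: borel_measurable_integrable cong: measurable_cong_sets)
 have pi: "integrable (\<nu> \<Otimes>\<^sub>M \<nu>) (%(r, v). a r * b v)" if "integrable \<nu> a" "integrable \<nu> b" for a b :: "real => real"
 proof (rule P.Fubini_integrable)
  note [measurable] = borel_measurable_integrable[OF that(1)] borel_measurable_integrable[OF that(2)]
  show "(%(r, v). a r * b v) \<in> borel_measurable (\<nu> \<Otimes>\<^sub>M \<nu>)" by measurable
  show "integrable \<nu> (%r. \<integral>v. norm (case (r, v) of (r, v) => a r * b v) \<partial>\<nu>)" using that by (simp add: abs_mult)
  show "AE r in \<nu>. integrable \<nu> (%v. case (r, v) of (r, v) => a r * b v)" using that by simp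
 qed
 define A where "A = {p :: real \<times> real. snd p <= fst p}"
 have Am: "A \<in> sets (\<nu> \<Otimes>\<^sub>M \<nu>)"
 proof -
  have "{p \<in> space (\<nu> \<Otimes>\<^sub>M \<nu>). snd p <= fst p} \<in> sets (\<nu> \<Otimes>\<^sub>M \<nu>)" by measurable
  moreover have "A = {p \<in> space (\<nu> \<Otimes>\<^sub>M \<nu>). snd p <= fst p}" by (simp add: A_def space_pair_measure)
  ultimately show ?thesis by (simp only:)
 qed
 have tri: "integrable (\<nu> \<Otimes>\<^sub>M \<nu>) (%(r, v). if v <= r then a r * b v else 0)" if "integrable \<nu> a" "integrable \<nu> b" for a b :: "real => real"
 proof -
  have "integrable (\<nu> \<Otimes>\<^sub>M \<nu>) (%p. indicator A p *\<^sub>R (case p of (r, v) => a r * b v))"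
   by (rule integrable_mult_indicator[OF Am pi[OF that]])
  also have "(%p. indicator A p *\<^sub>R (case p of (r, v) => a r * b v)) = (%(r, v). if v <= r then a r * b v else 0)"
   by (auto simp: A_def indicator_def fun_eq_iff)
  finally show ?thesis .
 qed
 have inner: "(LINT v|\<nu>. (if v <= r then a r * (indicator {s..u} v * b v) else 0)) = a r * (LINT v:{s..r}|\<nu>. b v)" if "r \<in> {s..u}" for r and a b :: "real => real"
 proof -
  have "(LINT v|\<nu>. (if v <= r then a r * (indicator {s..u} v * b v) else 0)) = (LINT v|\<nu>. a r * (indicator {s..r} v *\<^sub>R b v))"
   by (intro Bochner_Integration.integral_cong) (use that in \<open>auto simp: indicator_def\<close>)
  then show ?thesis by (simp add: set_lebesgue_integral_def)
 qed
 have one: "(LINT p|(\<nu> \<Otimes>\<^sub>M \<nu>). (case p of (r, v) => if v <= r then a r * b v else 0)) = (LINT r|\<nu>. (LINT v|\<nu>. (if v <= r then a r * b v else 0)))"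
  "integrable \<nu> (%r. \<integral>v. (if v <= r then a r * b v else 0) \<partial>\<nu>)" if "integrable \<nu> a" "integrable \<nu> b" for a b :: "real => real"
  using P.integral_fst'[OF tri[OF that]] P.integrable_fst'[OF tri[OF that]] by simp_all
 have gh: "(LINT v|\<nu>. (if v <= r then g' r * h' v else 0)) = indicator {s..u} r *\<^sub>R (g r * (LINT v:{s..r}|\<nu>. h v))" for r
  using inner[of r g h] unfolding g'_def h'_def by (cases "r \<in> {s..u}") (simp_all cong: if_cong)
 have hg: "(LINT v|\<nu>. (if v <= r then h' r * g' v else 0)) = indicator {s..u} r *\<^sub>R (h r * (LINT v:{s..r}|\<nu>. g v))" for r
  using inner[of r h g] unfolding g'_def h'_def by (cases "r \<in> {s..u}") (simp_all cong: if_cong)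
 have si: "set_integrable \<nu> {s..u} (%r. g r * (LINT v:{s..r}|\<nu>. h v))" "set_integrable \<nu> {s..u} (%r. h r * (LINT v:{s..r}|\<nu>. g v))"
  using one(2)[OF gi hi] one(2)[OF hi gi] unfolding gh hg by (simp_all add: set_integrable_def)
 show ?g1
  using set_integral_add(1)[OF si] by (simp add: mult.commute)
 have "(LINT r:{s..u}|\<nu>. g r * (LINT v:{s..r}|\<nu>. h v) + (LINT v:{s..r}|\<nu>. g v) * h r)
   = (LINT r:{s..u}|\<nu>. g r * (LINT v:{s..r}|\<nu>. h v)) + (LINT r:{s..u}|\<nu>. h r * (LINT v:{s..r}|\<nu>. g v))"
  using set_integral_add(2)[OF si] by (simp add: mult.commute)
 also have "\<dots> = (LINT p|(\<nu> \<Otimes>\<^sub>M \<nu>). (case p of (r, v) => if v <= r then g' r * h' v else 0)) + (LINT p|(\<nu> \<Otimes>\<^sub>M \<nu>). (case p of (r, v) => if v <= r then h' r * g' v else 0))"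
  unfolding one(1)[OF gi hi] one(1)[OF hi gi] gh hg set_lebesgue_integral_def ..
 also have "(LINT p|(\<nu> \<Otimes>\<^sub>M \<nu>). (case p of (r, v) => if v <= r then h' r * g' v else 0)) = (LINT p|(\<nu> \<Otimes>\<^sub>M \<nu>). (case p of (r, v) => if r <= v then g' r * h' v else 0))"
  by (subst P.integral_product_swap[symmetric])
    (use borel_measurable_integrable[OF tri[OF hi gi]] in \<open>auto intro!: Bochner_Integration.integral_cong simp: mult.commute\<close>)
 also have "(LINT p|(\<nu> \<Otimes>\<^sub>M \<nu>). (case p of (r, v) => if v <= r then g' r * h' v else 0)) + (LINT p|(\<nu> \<Otimes>\<^sub>M \<nu>). (case p of (r, v) => if r <= v then g' r * h' v else 0))
   = (LINT p|(\<nu> \<Otimes>\<^sub>M \<nu>). (case p of (r, v) => if v <= r then g' r * h' v else 0) + (case p of (r, v) => if r <= v then g' r * h' v else 0))"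
 proof (rule Bochner_Integration.integral_add[symmetric, OF tri[OF gi hi]])
  have "integrable (\<nu> \<Otimes>\<^sub>M \<nu>) (%(x, y). case (y, x) of (r, v) => if v <= r then h' r * g' v else 0)"
   by (rule P.integrable_product_swap[OF tri[OF hi gi]])
  then show "integrable (\<nu> \<Otimes>\<^sub>M \<nu>) (%(r, v). if r <= v then g' r * h' v else 0)" by (simp add: mult.commute cong: if_cong)
 qed
 also have "\<dots> = (LINT p|(\<nu> \<Otimes>\<^sub>M \<nu>). (case p of (r, v) => g' r * h' v))"
 proof (rule integral_cong_AE)
  have "AE p in \<nu> \<Otimes>\<^sub>M \<nu>. fst p \<noteq> snd p"
  proof (rule P.AE_pair_measure)
   show "{x \<in> space (\<nu> \<Otimes>\<^sub>M \<nu>). fst x \<noteq> snd x} \<in> sets (\<nu> \<Otimes>\<^sub>M \<nu>)" by measurable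
   show "AE x in \<nu>. AE y in \<nu>. fst (x, y) \<noteq> snd (x, y)"
   proof (rule AE_I2)
    fix x
    show "AE y in \<nu>. fst (x, y) \<noteq> snd (x, y)" using nu_AE_neq[of x] by eventually_elim simp
   qed
  qed
  then show "AE p in \<nu> \<Otimes>\<^sub>M \<nu>. (case p of (r, v) => if v <= r then g' r * h' v else 0) + (case p of (r, v) => if r <= v then g' r * h' v else 0) = (case p of (r, v) => g' r * h' v)"
   by eventually_elim auto
  show "(%p. (case p of (r, v) => if v <= r then g' r * h' v else 0) + (case p of (r, v) => if r <= v then g' r * h' v else 0)) \<in> borel_measurable (\<nu> \<Otimes>\<^sub>M \<nu>)"
   by measurable
  show "(%p. case p of (r, v) => g' r * h' v) \<in> borel_measurable (\<nu> \<Otimes>\<^sub>M \<nu>)" by measurable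
 qed
 also have "\<dots> = (LINT r|\<nu>. (LINT v|\<nu>. g' r * h' v))" using P.integral_fst'[OF pi[OF gi hi]] by simp
 also have "\<dots> = (LINT r:{s..u}|\<nu>. g r) * (LINT r:{s..u}|\<nu>. h r)"
  by (simp add: g'_def h'_def set_lebesgue_integral_def)
 finally show ?g0 .
qed

section \<open>Martingales that are time integrals vanish; uniqueness of bracket densities\<close>

text \<open>The measure with density \<open>|h|\<close> has no atoms, and on \<open>[s,T]\<close>
  its distribution function is the running integral of \<open>|h|\<close>. The chain rule for the
  exponential is therefore \<open>Stieltjes_exp_Ioc\<close> for this measure.\<close>

lemma path_exp_integral:
 assumes h: "prog h" and w: "w \<in> space Q" and si: "set_integrable \<nu> {s..T} (%r. h r w)" and u: "u \<in> {s..T}" and c: "0 < c"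
 shows "(\<integral>\<^sup>+r\<in>{s..u}. ennreal (exp (- c * nI s r (%r w. \<bar>h r w\<bar>) w) * \<bar>h r w\<bar>) \<partial>\<nu>) = ennreal ((1 - exp (- c * nI s u (%r w. \<bar>h r w\<bar>) w)) / c)"
proof -
 define g where "g r = indicator {s..T} r * h r w" for r
 define M where "M = density \<nu> (%r. ennreal \<bar>g r\<bar>)"
 have [measurable]: "g \<in> borel_measurable borel" unfolding g_def by (rule prog_path[OF h _ _ _ w]) (use s_le in auto)
 have gi: "integrable \<nu> g" using si by (simp add: set_integrable_def g_def[abs_def])
 have em: "emeasure M A = (\<integral>\<^sup>+r. ennreal \<bar>g r\<bar> * indicator A r \<partial>\<nu>)" if "A \<in> sets borel" for A
  unfolding M_def using that by (intro emeasure_density) (simp_all cong: measurable_cong_sets)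
 have spM: "space M = UNIV" "sets M = sets borel" by (simp_all add: M_def)
 have fin: "finite_measure M"
 proof
  have "emeasure M (space M) = (\<integral>\<^sup>+r. ennreal (norm (g r)) \<partial>\<nu>)" unfolding spM by (subst em) simp_all
  then show "emeasure M (space M) \<noteq> \<infinity>" using gi by (simp add: integrable_iff_bounded)
 qed
 interpret M: finite_borel_measure M by (intro finite_borel_measure.intro fin finite_borel_measure_axioms.intro) (simp add: spM)
 have at: "measure M {x} = 0" for x
 proof -
  have "emeasure M {x} = (\<integral>\<^sup>+r. 0 \<partial>\<nu>)" unfolding em[OF borel_singleton[OF sets.empty_sets]]
   by (rule nn_integral_cong_AE, rule AE_mp[OF nu_AE_neq[of x]]) (auto intro!: AE_I2)
  then show ?thesis by (simp add: measure_def)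
 qed
 have cont: "continuous_on UNIV (cdf M)" using M.isCont_cdf at by (simp add: continuous_on_eq_continuous_at)
 have Ioc: "emeasure M {a<..b} = ennreal (cdf M b - cdf M a)" if "a <= b" for a b
  using M.cdf_diff_eq[of a b] that by (cases "a = b") (auto simp: M.emeasure_eq_measure)
 have cdf: "cdf M t = nI s t (%r w. \<bar>h r w\<bar>) w" if t: "t \<in> {s..T}" for t
 proof -
  have st: "set_integrable \<nu> {s..t} (%r. h r w)" by (rule set_integrable_subset[OF si]) (use t in auto)
  have "emeasure M {..t} = (ab s t h w)"
   unfolding em[OF atMost_borel] using t by (intro nn_integral_cong) (auto simp: g_def indicator_def)
  also have "\<dots> = ennreal (nI s t (%r w. \<bar>h r w\<bar>) w)" unfolding nI_def by (rule nn_of_set_integrable[OF st])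
  finally show ?thesis unfolding cdf_def measure_def by (simp add: nI_def set_lebesgue_integral_def)
 qed
 have "(\<integral>\<^sup>+r\<in>{s..u}. ennreal (exp (- c * nI s r (%r w. \<bar>h r w\<bar>) w) * \<bar>h r w\<bar>) \<partial>\<nu>)
   = (\<integral>\<^sup>+r. ennreal \<bar>g r\<bar> * (ennreal (exp (- c * cdf M r)) * indicator {s<..u} r) \<partial>\<nu>)"
 proof (rule nn_integral_cong_AE, rule AE_mp[OF nu_AE_neq[of s]], intro AE_I2 impI)
  fix r assume "r \<noteq> s"
  then show "ennreal (exp (- c * nI s r (%r w. \<bar>h r w\<bar>) w) * \<bar>h r w\<bar>) * indicator {s..u} r = ennreal \<bar>g r\<bar> * (ennreal (exp (- c * cdf M r)) * indicator {s<..u} r)"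
   using u cdf[of r] by (auto simp: indicator_def g_def ennreal_mult mult.commute)
 qed
 also have "\<dots> = (\<integral>\<^sup>+r\<in>{s<..u}. ennreal (exp (- c * cdf M r)) \<partial>M)"
  unfolding M_def by (subst nn_integral_density) (use borel_measurable_continuous_onI[OF cont] in \<open>simp_all add: M_def cong: measurable_cong_sets\<close>)
 also have "\<dots> = ennreal ((exp (- c * cdf M u) - exp (- c * cdf M s)) / - c)"
  by (rule Stieltjes_exp_Ioc[OF fin spM(2) M.cdf_nondecreasing cont Ioc]) (use c u in auto)
 finally show ?thesis using cdf[OF u] cdf[of s] s_le c by (simp add: minus_divide_left)
qed

lemma prog_exp: assumes "prog X" shows "prog (%r w. exp (- X r w))"
proof -
 have "(%p. indicator {s..u} (fst p) * exp (- (indicator {s..u} (fst p) * X (fst p) (snd p)))) \<in> borel_measurable (borel \<Otimes>\<^sub>M G u)" if "u \<in> {s..T}" for u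
  using progD[OF assms, of u] that by auto
 moreover have "indicator {s..u} r * exp (- (indicator {s..u} r * x)) = indicator {s..u} r * exp (- x)" for u r x :: real by (simp add: indicator_def)
 ultimately show ?thesis unfolding prog_def by (simp add: split_beta')
qed

text \<open>With \<open>X = \<integral>h d\<nu>\<close> a martingale, \<open>a = \<integral>|h| d\<nu>\<close> and \<open>D = e\<^sup>-\<^sup>a\<close>, the process \<open>X D\<close> is bounded
 with bounded variation, and \<open>d(X D) = \<eta> d\<nu>\<close>. Computing \<open>E[X\<^sub>u (X D)\<^sub>u]\<close> once by the martingale property,
 once by the product rule, gives \<open>E[X\<^sub>u^2 D\<^sub>u] = - E[\<integral>X^2 D |h| d\<nu>] <= 0\<close>; no stopping times are needed.\<close>

lemma fv_martingale_value_zero: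
 assumes h: "prog h" and hi: "AE w in Q. set_integrable \<nu> {s..T} (%r. h r w)"
  and Xi: "\<And>t. t \<in> {s..T} ==> integrable Q (nI s t h)"
  and Xm: "\<And>t u A. s <= t ==> t <= u ==> u <= T ==> A \<in> sets (G t) ==> (LINT w:A|Q. nI s u h w) = (LINT w:A|Q. nI s t h w)"
  and u: "u \<in> {s..T}"
 shows "AE w in Q. nI s u h w = 0"
proof -
 define X where "X r = nI s r h" for r
 define a where "a r = nI s r (%r w. \<bar>h r w\<bar>)" for r
 define D where "D r w = exp (- a r w)" for r w
 define \<eta> where "\<eta> r w = D r w * h r w - X r w * D r w * \<bar>h r w\<bar>" for r w
 have u': "s <= u" "u <= T" using u by auto
 have pX: "prog X" and pa: "prog a" unfolding X_def a_def by (intro prog_nI prog_abs h)+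
 have pD: "prog D" unfolding D_def by (rule prog_exp[OF pa])
 have p\<eta>: "prog \<eta>" unfolding \<eta>_def by (intro prog_arith prog_abs pX pD h)
 have a0: "0 <= a r w" for r w unfolding a_def nI_def set_lebesgue_integral_def by (intro Bochner_Integration.integral_nonneg) auto
 have Xa: "\<bar>X r w\<bar> <= a r w" if "set_integrable \<nu> {s..T} (%r. h r w)" "r \<in> {s..T}" for r w
 proof -
  have "set_integrable \<nu> {s..r} (%r. h r w)" by (rule set_integrable_subset[OF that(1)]) (use that in auto)
  from nn_of_set_integrable[OF this] nI_le_nn[of s r h w] a0[of r w] show ?thesis by (simp add: X_def a_def nI_def)
 qed
 \<comment> \<open>Half of the exponent in \<open>D = exp (- a)\<close> is spent on polynomial
   factors in \<open>a\<close>. The other half remains as a weight under which \<open>|h|\<close>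
   has integral at most 2 by \<open>path_exp_integral\<close>. The constants 2 and 8 below arise
   here, and 10 is their sum.\<close>
 have E0: "1 + x / 2 + x * x / 8 <= exp (x / 2)" if "0 <= x" for x :: real
  using exp_lower_Taylor_quadratic[of "x / 2"] that by (auto simp: power2_eq_square)
 have E: "1 + x <= 2 * exp (x / 2)" "x^2 <= 8 * exp (x / 2)" if "0 <= x" for x :: real
  using E0[OF that] zero_le_square[of x] that unfolding power2_eq_square by linarith+
 have b\<eta>: "\<bar>\<eta> r w\<bar> <= 2 * (exp (- (1/2) * a r w) * \<bar>h r w\<bar>)" "\<bar>X r w * \<eta> r w\<bar> <= 10 * (exp (- (1/2) * a r w) * \<bar>h r w\<bar>)"
  "\<bar>X r w * D r w * h r w\<bar> <= 2 * (exp (- (1/2) * a r w) * \<bar>h r w\<bar>)"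
  if "set_integrable \<nu> {s..T} (%r. h r w)" "r \<in> {s..T}" for r w
 proof -
  note x = Xa[OF that] and y = a0[of r w]
  have DD: "D r w = exp (- (1/2) * a r w) * exp (- (a r w / 2))" "exp (a r w / 2) * exp (- (a r w / 2)) = 1"
   unfolding D_def by (simp_all add: exp_add[symmetric])
  have k: "c * D r w <= k * exp (- (1/2) * a r w)" if "c <= k * exp (a r w / 2)" for c k
  proof -
   have "c * D r w <= k * exp (a r w / 2) * D r w" by (rule mult_right_mono[OF that]) (simp add: D_def)
   also have "\<dots> = k * exp (- (1/2) * a r w)" unfolding DD(1) using DD(2) by (simp add: mult_ac)
   finally show ?thesis .
  qed
  have d: "\<bar>\<eta> r w\<bar> <= (1 + a r w) * D r w * \<bar>h r w\<bar>"
  proof -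
   have "\<bar>\<eta> r w\<bar> <= D r w * \<bar>h r w\<bar> + \<bar>X r w\<bar> * D r w * \<bar>h r w\<bar>"
    unfolding \<eta>_def using abs_triangle_ineq4[of "D r w * h r w" "X r w * D r w * \<bar>h r w\<bar>"] by (simp add: abs_mult D_def)
   also have "\<dots> <= D r w * \<bar>h r w\<bar> + a r w * D r w * \<bar>h r w\<bar>" using x by (intro add_left_mono mult_right_mono) (auto simp: D_def)
   finally show ?thesis by (simp add: algebra_simps)
  qed
  show "\<bar>\<eta> r w\<bar> <= 2 * (exp (- (1/2) * a r w) * \<bar>h r w\<bar>)"
   using order_trans[OF d mult_right_mono[OF k[OF E(1)[OF y]] abs_ge_zero]] by (simp add: mult.assoc)
  have "\<bar>X r w * \<eta> r w\<bar> <= a r w * ((1 + a r w) * D r w * \<bar>h r w\<bar>)"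
   unfolding abs_mult using x d y by (intro mult_mono) auto
  also have "\<dots> = (a r w + (a r w)^2) * D r w * \<bar>h r w\<bar>" by (simp add: power2_eq_square algebra_simps)
  also have "\<dots> <= 10 * exp (- (1/2) * a r w) * \<bar>h r w\<bar>" by (rule mult_right_mono[OF k]) (use E[OF y] in auto)
  finally show "\<bar>X r w * \<eta> r w\<bar> <= 10 * (exp (- (1/2) * a r w) * \<bar>h r w\<bar>)" by (simp add: mult.assoc)
  have "\<bar>X r w * D r w * h r w\<bar> <= a r w * D r w * \<bar>h r w\<bar>"
   unfolding abs_mult using x by (intro mult_mono) (auto simp: D_def)
  also have "\<dots> <= 2 * exp (- (1/2) * a r w) * \<bar>h r w\<bar>" by (rule mult_right_mono[OF k]) (use E(1)[OF y] in auto)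
  finally show "\<bar>X r w * D r w * h r w\<bar> <= 2 * (exp (- (1/2) * a r w) * \<bar>h r w\<bar>)" by (simp add: mult.assoc)
 qed
 have nb: "(ab s T Z w) <= ennreal (2 * k)"
  if w: "w \<in> space Q" "set_integrable \<nu> {s..T} (%r. h r w)" and k: "0 <= k"
   and Z: "\<And>r. r \<in> {s..T} ==> \<bar>Z r w\<bar> <= k * (exp (- (1/2) * a r w) * \<bar>h r w\<bar>)" for w k and Z :: "real => 'a => real"
 proof -
  have m: "(%r. indicator {s..T} r * (exp (- (1/2) * a r w) * \<bar>h r w\<bar>)) \<in> borel_measurable borel"
  proof -
   have "prog (%r w. exp (- ((1/2) * a r w)) * \<bar>h r w\<bar>)"
    by (intro prog_arith(3) prog_exp prog_abs h prog_arith(3)[OF prog_const pa]) simp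
   from prog_path[OF this order_refl s_le order_refl w(1)] show ?thesis by simp
  qed
  have "(ab s T Z w) <= (\<integral>\<^sup>+r. ennreal k * ennreal (indicator {s..T} r * (exp (- (1/2) * a r w) * \<bar>h r w\<bar>)) \<partial>\<nu>)"
   using Z k by (intro nn_integral_mono) (auto simp: indicator_def ennreal_mult[symmetric] intro!: ennreal_leI)
  also have "\<dots> = ennreal k * (\<integral>\<^sup>+r. ennreal (indicator {s..T} r * (exp (- (1/2) * a r w) * \<bar>h r w\<bar>)) \<partial>\<nu>)"
   by (rule nn_integral_cmult) (use m in \<open>simp cong: measurable_cong_sets\<close>)
  also have "(\<integral>\<^sup>+r. ennreal (indicator {s..T} r * (exp (- (1/2) * a r w) * \<bar>h r w\<bar>)) \<partial>\<nu>) = (\<integral>\<^sup>+r\<in>{s..T}. ennreal (exp (- (1/2) * a r w) * \<bar>h r w\<bar>) \<partial>\<nu>)"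
   by (intro nn_integral_cong) (auto simp: indicator_def)
  also have "\<dots> = ennreal ((1 - exp (- (1/2) * a T w)) / (1/2))"
   unfolding a_def by (rule path_exp_integral[OF h w]) (use s_le in auto)
  also have "ennreal k * \<dots> <= ennreal (2 * k)" using k by (subst ennreal_mult[symmetric]) (auto intro!: ennreal_leI simp: a0 mult_left_le algebra_simps)
  finally show ?thesis .
 qed
 have L1: "(\<integral>\<^sup>+w. ab s T Z w \<partial>Q) < \<infinity>"
  if Z: "\<And>r w. set_integrable \<nu> {s..T} (%r. h r w) ==> r \<in> {s..T} ==> \<bar>Z r w\<bar> <= \<bar>k w\<bar> * (exp (- (1/2) * a r w) * \<bar>h r w\<bar>)"
   and k: "integrable Q k" for Z and k :: "'a => real"
 proof -
  have "(\<integral>\<^sup>+w. ab s T Z w \<partial>Q) <= (\<integral>\<^sup>+w. ennreal (2 * \<bar>k w\<bar>) \<partial>Q)"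
   by (rule nn_integral_mono_AE, rule AE_mp[OF hi]) (auto intro!: AE_I2 nb Z)
  also have "\<dots> < \<infinity>" using Bochner_Integration.integrable_mult_right[OF k, of 2] unfolding integrable_iff_bounded by (simp only: real_norm_def abs_mult abs_numeral)
  finally show ?thesis .
 qed
 note [measurable] = jm_section[OF jm_prog[OF pX] u]
 have Xui: "integrable Q (X u)" unfolding X_def by (rule Xi[OF u])
 have jXu: "jm (%r. X u)" by (rule jm_random) simp
 have f1: "(\<integral>\<^sup>+w. (\<integral>\<^sup>+r\<in>{s..T}. ennreal \<bar>X u w * \<eta> r w\<bar> \<partial>\<nu>) \<partial>Q) < \<infinity>"
 proof (rule L1[of _ "%w. X u w * 2"])
  fix r w assume "set_integrable \<nu> {s..T} (%r. h r w)" "r \<in> {s..T}"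
  from mult_left_mono[OF b\<eta>(1)[OF this], of "\<bar>X u w\<bar>"] show "\<bar>X u w * \<eta> r w\<bar> <= \<bar>X u w * 2\<bar> * (exp (- (1/2) * a r w) * \<bar>h r w\<bar>)"
   by (simp add: abs_mult mult_ac)
 qed (use Xui in simp)
 have f2: "(\<integral>\<^sup>+w. (\<integral>\<^sup>+r\<in>{s..T}. ennreal \<bar>X r w * \<eta> r w\<bar> \<partial>\<nu>) \<partial>Q) < \<infinity>" by (rule L1[of _ "%_. 10"]) (use b\<eta>(2) in auto)
 have f3: "(\<integral>\<^sup>+w. (\<integral>\<^sup>+r\<in>{s..T}. ennreal \<bar>X r w * D r w * h r w\<bar> \<partial>\<nu>) \<partial>Q) < \<infinity>" by (rule L1[of _ "%_. 2"]) (use b\<eta>(3) in auto)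
 note j\<eta> = jm_prog[OF p\<eta>] and jX = jm_prog[OF pX]
 note i1 = jm_integrable[OF jm_arith(3)[OF jXu j\<eta>] f1 u'(2)] and i2 = jm_integrable[OF jm_arith(3)[OF jX j\<eta>] f2 u'(2)]
  and i3 = jm_integrable[OF jm_arith(3)[OF jm_arith(3)[OF jX jm_prog[OF pD]] jm_prog[OF h]] f3 u'(2)]
 \<comment> \<open>After Fubini this is a claim at almost every time \<open>r\<close>: since
   \<open>\<eta> r\<close> is known at \<open>r\<close>, the martingale property replaces
   \<open>X u\<close> by \<open>X r\<close>.\<close>
 have "(LINT w|Q. nI s u (%r w. X u w * \<eta> r w) w) = (LINT r:{s..u}|\<nu>. (LINT w|Q. X u w * \<eta> r w))" by (rule i1(2)[symmetric])
 also have "\<dots> = (LINT r:{s..u}|\<nu>. (LINT w|Q. X r w * \<eta> r w))"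
  unfolding set_lebesgue_integral_def
 proof (rule integral_cong_AE)
  show "AE r in \<nu>. indicator {s..u} r *\<^sub>R (LINT w|Q. X u w * \<eta> r w) = indicator {s..u} r *\<^sub>R (LINT w|Q. X r w * \<eta> r w)"
   using i1(5) i2(5)
  proof eventually_elim
   case (elim r)
   have "(LINT w|Q. X u w * \<eta> r w) = (LINT w|Q. X r w * \<eta> r w)" if r: "r \<in> {s..u}"
   proof -
    have rT: "r \<in> {s..T}" "s <= r" "r <= u" using r u' by auto
    have i: "integrable Q (%w. X u w * \<eta> r w)" "integrable Q (%w. X r w * \<eta> r w)" using elim rT by auto
    have "(LINT w|Q. \<eta> r w * (X u w - X r w)) = 0"
    proof (rule test_zero[where t=r])
     show "integrable Q (%w. X u w - X r w)" unfolding X_def using Xi[OF u] Xi[OF rT(1)] by simp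
     show "(LINT w:A|Q. (X u w - X r w)) = 0" if A: "A \<in> sets (G r)" for A
      using Xm[OF rT(2,3) u'(2) A] integrable_mult_indicator[OF G_sets[OF A] Xi[OF u]] integrable_mult_indicator[OF G_sets[OF A] Xi[OF rT(1)]]
      unfolding X_def by (subst set_integral_diff(2)) (simp_all add: set_integrable_def)
     show "\<eta> r \<in> borel_measurable (G r)" by (rule prog_section[OF p\<eta> rT(1)])
     show "integrable Q (%w. \<eta> r w * (X u w - X r w))"
      using Bochner_Integration.integrable_diff[OF i] by (simp add: algebra_simps)
    qed
    moreover have "(LINT w|Q. \<eta> r w * (X u w - X r w)) = (LINT w|Q. X u w * \<eta> r w - X r w * \<eta> r w)" by (simp add: algebra_simps)
    ultimately show ?thesis using i by simp
   qed
   then show ?case by (simp add: indicator_def)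
  qed
 qed (use i1(6) i2(6) in \<open>simp_all add: set_integrable_def\<close>)
 also have "\<dots> = (LINT w|Q. nI s u (%r w. X r w * \<eta> r w) w)" by (rule i2(2))
 finally have e: "(LINT w|Q. nI s u (%r w. X u w * \<eta> r w) w) = (LINT w|Q. nI s u (%r w. X r w * \<eta> r w) w)" .
 \<comment> \<open>The pathwise inputs. The product rule applied to \<open>X\<close> and
   \<open>D - 1 = - \<integral> D |h| d\<nu>\<close> shows that \<open>X D\<close> is the integral
   of \<eta>; applied once more to \<open>X\<close> and \<open>X D\<close> it gives the second
   identity. The final inequality is the sign of \<open>X^2 D |h|\<close>.\<close>
 have ae: "AE w in Q. (X u w)^2 * D u w = nI s u (%r w. X u w * \<eta> r w) w \<and>
   (X u w)^2 * D u w = nI s u (%r w. X r w * D r w * h r w) w + nI s u (%r w. X r w * \<eta> r w) w \<and>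
   nI s u (%r w. X r w * \<eta> r w) w <= nI s u (%r w. X r w * D r w * h r w) w"
  using hi AE_space i2(4) i3(4)
 proof eventually_elim
  case (elim w)
  note si = set_integrable_subset[OF _ _ , of \<nu> "{s..T}"]
  have sub: "{s..v} \<in> sets \<nu>" "{s..v} \<subseteq> {s..T}" if "v \<in> {s..u}" for v using that u' by auto
  have gi: "set_integrable \<nu> {s..v} (%r. D r w * \<bar>h r w\<bar>)" if v: "v \<in> {s..u}" for v
  proof (rule set_integrable_of_nn[OF prog_arith(3)[OF pD prog_abs[OF h]] order_refl])
   have "(\<integral>\<^sup>+r\<in>{s..v}. ennreal \<bar>D r w * \<bar>h r w\<bar>\<bar> \<partial>\<nu>) = ennreal ((1 - exp (- 1 * a v w)) / 1)"
    using path_exp_integral[OF h elim(2,1), of v 1] v u' by (simp add: a_def D_def abs_mult)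
   then show "(\<integral>\<^sup>+r\<in>{s..v}. ennreal \<bar>D r w * \<bar>h r w\<bar>\<bar> \<partial>\<nu>) < \<infinity>" by simp
  qed (use v u' elim in auto)
  have Dv: "D v w - 1 = (LINT r:{s..v}|\<nu>. - (D r w * \<bar>h r w\<bar>))" if v: "v \<in> {s..u}" for v
  proof -
   have "ennreal (LINT r:{s..v}|\<nu>. \<bar>D r w * \<bar>h r w\<bar>\<bar>) = ennreal (1 - D v w)"
    using path_exp_integral[OF h elim(2,1), of v 1] v u' nn_of_set_integrable[OF gi[OF v]] by (simp add: a_def D_def abs_mult)
   then have "(LINT r:{s..v}|\<nu>. \<bar>D r w * \<bar>h r w\<bar>\<bar>) = 1 - D v w"
    by (subst (asm) ennreal_inj) (auto simp: D_def a0 set_lebesgue_integral_def)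
   then show ?thesis by (simp add: D_def abs_mult set_lebesgue_integral_def)
  qed
  have hv: "set_integrable \<nu> {s..v} (%r. h r w)" if "v \<in> {s..u}" for v by (rule set_integrable_subset[OF elim(1) sub[OF that]])
  have \<eta>1: "X v w * D v w = (LINT r:{s..v}|\<nu>. \<eta> r w)" "set_integrable \<nu> {s..v} (%r. \<eta> r w)" if v: "v \<in> {s..u}" for v
  proof -
   have g': "set_integrable \<nu> {s..v} (%r. - (D r w * \<bar>h r w\<bar>))" using gi[OF v] by (simp add: set_integrable_def)
   have c: "indicator {s..v} r *\<^sub>R (h r w * (LINT r:{s..r}|\<nu>. - (D r w * \<bar>h r w\<bar>)) + (LINT r:{s..r}|\<nu>. h r w) * - (D r w * \<bar>h r w\<bar>)) = indicator {s..v} r *\<^sub>R (\<eta> r w - h r w)" for r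
    using Dv[of r] v by (cases "r \<in> {s..v}") (auto simp: \<eta>_def X_def nI_def algebra_simps)
   note p = product_rule_path[OF hv[OF v] g', unfolded set_integrable_def set_lebesgue_integral_def[of \<nu> "{s..v}"], unfolded c]
   have i: "set_integrable \<nu> {s..v} (%r. \<eta> r w - h r w)" using p(2) by (simp add: set_integrable_def)
   from set_integral_add[OF i hv[OF v]] show "set_integrable \<nu> {s..v} (%r. \<eta> r w)" by simp
   have "(LINT r:{s..v}|\<nu>. \<eta> r w - h r w) = X v w * (D v w - 1)" using p(1) Dv[OF v] by (simp add: X_def nI_def set_lebesgue_integral_def)
   then show "X v w * D v w = (LINT r:{s..v}|\<nu>. \<eta> r w)" using set_integral_add(2)[OF i hv[OF v]] by (simp add: X_def nI_def algebra_simps)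
  qed
  have uu: "u \<in> {s..u}" using u' by simp
  have 1: "(X u w)^2 * D u w = nI s u (%r w. X u w * \<eta> r w) w"
   using \<eta>1(1)[OF uu] by (simp add: nI_def power2_eq_square mult.assoc)
  have i23: "set_integrable \<nu> {s..u} (%r. X r w * \<eta> r w)" "set_integrable \<nu> {s..u} (%r. X r w * D r w * h r w)"
   by (rule set_integrable_subset[OF elim(3) sub[OF uu]], rule set_integrable_subset[OF elim(4) sub[OF uu]])
  have c2: "indicator {s..u} r *\<^sub>R (h r w * (LINT r:{s..r}|\<nu>. \<eta> r w) + (LINT r:{s..r}|\<nu>. h r w) * \<eta> r w) = indicator {s..u} r *\<^sub>R (X r w * D r w * h r w + X r w * \<eta> r w)" for r
   using \<eta>1(1)[of r] by (cases "r \<in> {s..u}") (auto simp: X_def nI_def algebra_simps)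
  have "X u w * (X u w * D u w) = (LINT r:{s..u}|\<nu>. X r w * D r w * h r w + X r w * \<eta> r w)"
   using product_rule_path(1)[OF hv[OF uu] \<eta>1(2)[OF uu], unfolded set_lebesgue_integral_def[of \<nu> "{s..u}"], unfolded c2] \<eta>1(1)[OF uu]
   by (simp add: X_def nI_def set_lebesgue_integral_def)
  then have 2: "(X u w)^2 * D u w = nI s u (%r w. X r w * D r w * h r w) w + nI s u (%r w. X r w * \<eta> r w) w"
   using set_integral_add(2)[OF i23(2,1)] by (simp add: nI_def power2_eq_square mult.assoc)
  have "X r w * \<eta> r w <= X r w * D r w * h r w" for r
  proof -
   have "0 <= (X r w)^2 * (D r w * \<bar>h r w\<bar>)" by (simp add: D_def)
   then show ?thesis by (simp add: \<eta>_def algebra_simps power2_eq_square)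
  qed
  then have "nI s u (%r w. X r w * \<eta> r w) w <= nI s u (%r w. X r w * D r w * h r w) w"
   unfolding nI_def by (intro set_integral_mono[OF i23])
  with 1 2 show ?case by blast
 qed
 have m: "(%w. (X u w)^2 * D u w) \<in> borel_measurable Q" using jm_section[OF jm_prog[OF pD] u] by measurable
 have ae1: "AE w in Q. (X u w)^2 * D u w = nI s u (%r w. X u w * \<eta> r w) w" using ae by eventually_elim blast
 have ae2: "AE w in Q. (X u w)^2 * D u w = nI s u (%r w. X r w * D r w * h r w) w + nI s u (%r w. X r w * \<eta> r w) w"
  using ae by eventually_elim blast
 have ae3: "AE w in Q. nI s u (%r w. X r w * \<eta> r w) w <= nI s u (%r w. X r w * D r w * h r w) w" using ae by eventually_elim blast
 have i: "integrable Q (%w. (X u w)^2 * D u w)"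
  by (rule iffD2[OF integrable_cong_AE[OF m borel_measurable_integrable[OF i1(3)] ae1] i1(3)])
 have "(LINT w|Q. (X u w)^2 * D u w) <= 0"
  using integral_cong_AE[OF m borel_measurable_integrable[OF i1(3)] ae1]
   integral_cong_AE[OF m borel_measurable_integrable[OF Bochner_Integration.integrable_add[OF i3(3) i2(3)]] ae2]
   integral_mono_AE[OF i2(3) i3(3) ae3] Bochner_Integration.integral_add[OF i3(3) i2(3)] e by linarith
 moreover have "0 <= (LINT w|Q. (X u w)^2 * D u w)" by (intro Bochner_Integration.integral_nonneg) (simp add: D_def)
 ultimately have "(LINT w|Q. (X u w)^2 * D u w) = 0" by simp
 then have "AE w in Q. (X u w)^2 * D u w = 0" by (subst (asm) integral_nonneg_eq_0_iff_AE[OF i]) (auto simp: D_def)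
 then show ?thesis by eventually_elim (simp add: D_def X_def)
qed

text \<open>Each fixed time has its own null set. Rational times leave a single one, continuity of
  the indefinite integral fills in the other times, and an integrand with vanishing indefinite
  integral is a.e. zero.\<close>

lemma fv_martingale_zero:
 assumes h: "prog h" and hi: "AE w in Q. set_integrable \<nu> {s..T} (%r. h r w)"
  and Xi: "\<And>t. t \<in> {s..T} ==> integrable Q (nI s t h)"
  and Xm: "\<And>t u A. s <= t ==> t <= u ==> u <= T ==> A \<in> sets (G t) ==> (LINT w:A|Q. nI s u h w) = (LINT w:A|Q. nI s t h w)"
 shows "AE w in Q. AE r in \<nu>. r \<in> {s..T} \<longrightarrow> h r w = 0"
proof -
 have X0: "AE w in Q. nI s u h w = 0" if "u \<in> {s..T}" for u
  by (rule fv_martingale_value_zero[OF h hi Xi Xm that])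
 have "AE w in Q. \<forall>q\<in>\<rat> \<inter> {s..T}. nI s q h w = 0"
  by (rule AE_ball_countable') (use X0 in simp, rule countable_subset[OF Int_lower1 countable_rat])
 moreover have "AE w in Q. nI s T h w = 0" using X0 s_le by auto
 ultimately show ?thesis using hi
 proof eventually_elim
  case (elim w)
  note XQ = elim(1) and XT = elim(2) and si = elim(3)
  have cont: "continuous_on {s..T} (%t. nI s t h w)" unfolding nI_def by (rule indefinite_integral_continuous[OF si])
  have "nI s t h w = 0" if t: "t \<in> {s..T}" for t
  proof (cases "t = T")
   case False
   then have "t < T" using t by auto
   have "\<exists>q. q \<in> \<rat> \<and> t < q \<and> q < min T (t + 1 / real (Suc k))" for k
    using Rats_dense_in_real[of t "min T (t + 1 / real (Suc k))"] \<open>t < T\<close> by auto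
   then obtain q where q: "\<And>k. q k \<in> \<rat>" "\<And>k. t < q k" "\<And>k. q k < min T (t + 1 / real (Suc k))" by metis
   have qm: "s <= q k" "q k <= T" for k using q(2,3)[of k] t by auto
   have "q \<longlonglongrightarrow> t"
   proof (rule tendsto_sandwich[of "%_. t" _ _ "%k. t + 1 / real (Suc k)"])
    show "(%k. t + 1 / real (Suc k)) \<longlonglongrightarrow> t"
     using tendsto_add[OF tendsto_const LIMSEQ_Suc[OF lim_1_over_n], of t] by simp
   qed (use q in \<open>auto intro!: always_eventually less_imp_le\<close>)
   then have "(%k. nI s (q k) h w) \<longlonglongrightarrow> nI s t h w"
    using t by (intro continuous_on_tendsto_compose[OF cont] always_eventually allI) (auto intro!: qm)
   moreover have "nI s (q k) h w = 0" for k
    using qm q(1) by (intro bspec[OF XQ]) auto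
   ultimately show ?thesis by (simp add: LIMSEQ_const_iff)
  qed (use XT in simp)
  then show "AE r in \<nu>. r \<in> {s..T} \<longrightarrow> h r w = 0"
   by (intro zero_of_indefinite_integral_zero[OF si s_le]) (auto simp: nI_def)
 qed
qed

text \<open>With zero covariance the integral of \<open>h\<close> over \<open>[t,T]\<close> has zero
  conditional expectation given \<open>G t\<close>. Hence the integral over \<open>[s,t]\<close> is
  a martingale in \<open>t\<close>, of the kind just shown to vanish.\<close>

lemma repr_zero:
 assumes "l2m N" and r: "repr (%t w. 0) N h"
 shows "AE w in Q. AE r in \<nu>. r \<in> {s..T} \<longrightarrow> h r w = 0"
proof -
 have p: "prog h" and ai: "AE w in Q. set_integrable \<nu> {s..T} (%r. h r w)" using r by (auto simp: repr_def)
 have i: "integrable Q (nI t T h)" if "t \<in> {s..T}" for t using r that by (auto simp: repr_def)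
 have z: "(LINT w:A|Q. nI t T h w) = 0" if "t \<in> {s..T}" "A \<in> sets (G t)" for t A
  using r that by (auto simp: repr_def cov_def)
 have ae: "AE w in Q. nI s t h w = nI s T h w - nI t T h w" if "t \<in> {s..T}" for t
  using ai by eventually_elim (use nI_split[of h _ t] that in auto)
 have m: "nI s t h \<in> borel_measurable Q" if "t \<in> {s..T}" for t
  by (rule G_meas[OF nI_meas[OF p]]) (use that in auto)
 have sT: "s \<in> {s..T}" using s_le by simp
 show ?thesis
 proof (rule fv_martingale_zero[OF p ai])
  fix t assume t: "t \<in> {s..T}"
  show "integrable Q (nI s t h)"
   by (subst integrable_cong_AE[OF m[OF t] _ ae[OF t]]) (use i[OF t] i[OF sT] in auto)
 next
  fix t u A assume t: "s <= t" "t <= u" "u <= T" and A: "A \<in> sets (G t)"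
  have "(LINT w:A|Q. nI s v h w) = (LINT w:A|Q. nI s T h w)" if v: "v \<in> {s..T}" "A \<in> sets (G v)" for v
  proof -
   have "(LINT w:A|Q. nI s v h w) = (LINT w:A|Q. (nI s T h w - nI v T h w))"
    unfolding set_lebesgue_integral_def
    by (rule integral_cong_AE) (use ae[OF v(1)] m[OF v(1)] i[OF v(1)] i[OF sT] G_sets[OF A] in auto)
   also have "\<dots> = (LINT w:A|Q. nI s T h w) - (LINT w:A|Q. nI v T h w)"
    by (rule set_integral_diff(2)[OF set_integrable_of[OF i[OF sT] A] set_integrable_of[OF i[OF v(1)] A]])
   finally show ?thesis using z[OF v] by simp
  qed
  from this[of u] this[of t] show "(LINT w:A|Q. nI s u h w) = (LINT w:A|Q. nI s t h w)"
   using t A G_mono[OF t(2)] by auto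
 qed
qed

lemma repr_unique:
 assumes "l2m M" "l2m N" "repr M N Z" "repr M N Z'"
 shows "AE w in Q. AE r in \<nu>. r \<in> {s..T} \<longrightarrow> Z r w = Z' r w"
proof -
 have "repr (%t w. 0) N (%r w. Z r w - Z' r w)"
  using repr_diff[OF assms(1,1,2) assms(3,4)] by simp
 from repr_zero[OF assms(2) this] show ?thesis by simp
qed

text \<open>A bound of Kunita-Watanabe type. It holds for the dyadic limit formed with conditional
  expectations under \<open>Q\<close>, and passes to \<open>Z\<close> because densities are a.e.
  unique.\<close>

theorem repr_sq_bound:
 assumes M: "l2m M" and N: "l2m N" and brkN: "brk N C" and C: "0 < C" and Z: "repr M N Z" and t: "t \<in> {s..T}"
 shows "(\<integral>\<^sup>+w. sq t Z w \<partial>Q) <= ennreal (C * (LINT w|Q. (M T w - M t w)^2))"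
proof -
 define \<kappa> where "\<kappa> n i w = real_cond_exp Q (G (q n i)) (%w. (M (q n (Suc i)) w - M (q n i) w) * (N (q n (Suc i)) w - N (q n i) w)) w
   / (W (q n (Suc i)) - W (q n i))" for n i w
 have fs: "finite_measure_subalgebra Q (G v)" for v by unfold_locales (rule subG)
 have mi: "integrable Q (%w. (M (q n (Suc i)) w - M (q n i) w) * (N (q n (Suc i)) w - N (q n i) w))" if "i < 2 ^ n" "s <= q n i" for n i
  by (rule cov_integrable[OF M N]) (use that in \<open>auto simp: q_simps q_le_T\<close>)
 have \<kappa>m: "\<kappa> n i \<in> borel_measurable (G (q n i))" for n i
  unfolding \<kappa>_def by simp
 have \<kappa>i: "integrable Q (\<kappa> n i)" if "i < 2 ^ n" "s <= q n i" for n i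
 proof -
  interpret finite_measure_subalgebra Q "G (q n i)" by (rule fs)
  show ?thesis unfolding \<kappa>_def by (intro integrable_divide real_cond_exp_int(1) mi that)
 qed
 have \<kappa>c: "(W (q n (Suc i)) - W (q n i)) * (LINT w:A|Q. \<kappa> n i w) = cov M N (q n i) (q n (Suc i)) A"
  if i: "i < 2 ^ n" "s <= q n i" and A: "A \<in> sets (G (q n i))" for n i A
 proof (cases "W (q n (Suc i)) = W (q n i)")
  case False
  interpret finite_measure_subalgebra Q "G (q n i)" by (rule fs)
  have "(W (q n (Suc i)) - W (q n i)) * (LINT w:A|Q. \<kappa> n i w) = (LINT w:A|Q. (W (q n (Suc i)) - W (q n i)) * \<kappa> n i w)" by simp
  also have "\<dots> = (LINT w:A|Q. real_cond_exp Q (G (q n i)) (%w. (M (q n (Suc i)) w - M (q n i) w) * (N (q n (Suc i)) w - N (q n i) w)) w)"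
   using False by (simp add: \<kappa>_def)
  also have "\<dots> = cov M N (q n i) (q n (Suc i)) A"
   unfolding cov_def by (rule real_cond_exp_intA[OF mi[OF i] A, symmetric])
  finally show ?thesis .
 next
  case True
  have "cov M N (q n i) (q n (Suc i)) A = 0"
   by (rule cov_zero_of_brk[OF M N brkN _ _ _ True A]) (use i in \<open>auto simp: q_simps q_le_T\<close>)
  then show ?thesis using True by simp
 qed
 have \<kappa>z: "\<kappa> n i w = 0" if "W (q n (Suc i)) = W (q n i)" for n i w using that by (simp add: \<kappa>_def)
 define K where "K r w = lim (%n. \<kappa> n (blk n r) w)" for r w
 note K = bracket_density_repr[OF M N brkN C \<kappa>m \<kappa>i \<kappa>c \<kappa>z, folded K_def] bracket_density_sq[OF M N brkN C \<kappa>m \<kappa>i \<kappa>c \<kappa>z t, folded K_def]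
 have "AE w in Q. AE r in \<nu>. r \<in> {s..T} \<longrightarrow> Z r w = K r w" by (rule repr_unique[OF M N Z K(1)])
 then have "(\<integral>\<^sup>+w. sq t Z w \<partial>Q) = (\<integral>\<^sup>+w. sq t K w \<partial>Q)"
 proof (intro nn_integral_cong_AE, eventually_elim)
  case (elim w)
  show ?case
   by (rule nn_integral_cong_AE, rule AE_mp[OF elim(2)]) (use t in \<open>auto simp: indicator_def intro!: AE_I2\<close>)
 qed
 then show ?thesis using K(2) by (rule ord_eq_le_trans)
qed

section \<open>Integration by parts in expectation\<close>

text \<open>Write \<open>Y = M' - G\<close> and \<open>X = N' - H\<close> with time integrals
  \<open>G\<close> and \<open>H\<close>, and expand. In the mean of a martingale times a time
  integral at \<open>u\<close>, the martingale property replaces the terminal value by the running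
  value under the integral; \<open>G * H\<close> obeys the pathwise product rule.\<close>

lemma integration_by_parts:
 assumes Y: "prog Y" "N2 Y < \<infinity>" and g: "prog g" "N2 g < \<infinity>" and X: "prog X" "N2 X < \<infinity>" and h: "prog h" "N2 h < \<infinity>"
  and M: "l2m (%t w. Y t w + nI s t g w)" and N: "l2m (%t w. X t w + nI s t h w)" and u: "u \<in> {s..T}"
 shows "(LINT w|Q. Y u w * X u w) - (LINT w|Q. Y s w * X s w) =
   cov (%t w. Y t w + nI s t g w) (%t w. X t w + nI s t h w) s u (space Q)
   - (LINT r:{s..u}|\<nu>. (LINT w|Q. Y r w * h r w + g r w * X r w))"
proof -
 define M' where "M' t w = Y t w + nI s t g w" for t w
 define N' where "N' t w = X t w + nI s t h w" for t w
 have lM: "l2m M'" and lN: "l2m N'" using M N by (auto simp: M'_def[abs_def] N'_def[abs_def])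
 have su: "s \<in> {s..T}" "s <= s" "s <= u" "u <= T" using u s_le by auto
 note jY = jm_prog[OF Y(1)] and jg = jm_prog[OF g(1)] and jX = jm_prog[OF X(1)] and jh = jm_prog[OF h(1)]
 have jG: "jm (%r. nI s r g)" and jH: "jm (%r. nI s r h)" using prog_nI[OF g(1)] prog_nI[OF h(1)] by (auto intro: jm_prog)
 have nG: "N2 (%r. nI s r g) < \<infinity>" and nH: "N2 (%r. nI s r h) < \<infinity>" by (rule N2_nI[OF jg g(2)], rule N2_nI[OF jh h(2)])
 have jM: "jm M'" "jm N'" unfolding M'_def[abs_def] N'_def[abs_def] using jm_arith(1)[OF jY jG] jm_arith(1)[OF jX jH] by auto
 have nM: "N2 M' < \<infinity>" "N2 N' < \<infinity>"
  by (rule N2_lincomb_finite[OF jY Y(2) jG nG, of _ 1], simp add: M'_def abs_triangle_ineq,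
    rule N2_lincomb_finite[OF jX X(2) jH nH, of _ 1], simp add: N'_def abs_triangle_ineq)
 \<comment> \<open>All terms are brought to this form because integrals over the product space can
   be added without regard to exceptional times or paths.\<close>
 define pI where "pI Z = (LINT p|(\<nu> \<Otimes>\<^sub>M Q). indicator {s..u} (fst p) * Z (fst p) (snd p))" for Z :: "real => 'a => real"
 have prod: "integrable (\<nu> \<Otimes>\<^sub>M Q) (%p. indicator {s..u} (fst p) * (A (fst p) (snd p) * B (fst p) (snd p)))"
   "(LINT r:{s..u}|\<nu>. (LINT w|Q. A r w * B r w)) = pI (%r w. A r w * B r w)"
   "(LINT w|Q. nI s u (%r w. A r w * B r w) w) = pI (%r w. A r w * B r w)"
   "AE r in \<nu>. r \<in> {s..T} \<longrightarrow> integrable Q (%w. A r w * B r w)"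
  if "jm A" "N2 A < \<infinity>" "jm B" "N2 B < \<infinity>" for A B
 proof -
  note j = jm_integrable[OF jm_arith(3)[OF that(1,3)] N2_mult_finite[OF that] su(4)]
  show "integrable (\<nu> \<Otimes>\<^sub>M Q) (%p. indicator {s..u} (fst p) * (A (fst p) (snd p) * B (fst p) (snd p)))" by (rule j(1))
  show "(LINT r:{s..u}|\<nu>. (LINT w|Q. A r w * B r w)) = pI (%r w. A r w * B r w)" unfolding pI_def j(2) j(7) ..
  show "(LINT w|Q. nI s u (%r w. A r w * B r w) w) = pI (%r w. A r w * B r w)" unfolding pI_def j(7) ..
  show "AE r in \<nu>. r \<in> {s..T} \<longrightarrow> integrable Q (%w. A r w * B r w)" by (rule j(5))
 qed
 have Mu: "M' u \<in> borel_measurable Q" "integrable Q (%w. (M' u w)^2)" and Nu: "N' u \<in> borel_measurable Q" "integrable Q (%w. (N' u w)^2)"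
  using l2m_D[OF lM u] l2m_D[OF lN u] by auto
 have Gu: "nI s u g \<in> borel_measurable Q" "integrable Q (%w. (nI s u g w)^2)" and Hu: "nI s u h \<in> borel_measurable Q" "integrable Q (%w. (nI s u h w)^2)"
  using jm_nI_meas[OF jg su(2,4)] nI_L2[OF jg g(2) su(2,4)] jm_nI_meas[OF jh su(2,4)] nI_L2[OF jh h(2) su(2,4)] by auto
 have mult: "(LINT w|Q. L u w * nI s u k w) = pI (%r w. L r w * k r w)"
  if L: "l2m L" "jm L" "N2 L < \<infinity>" and k: "prog k" "N2 k < \<infinity>" for L k
 proof -
  note jk = jm_prog[OF k(1)]
  note Lu = l2m_D[OF L(1) u]
  have jLu: "jm (%r. L u)" "N2 (%r. L u) < \<infinity>" using jm_random[OF Lu(2)] N2_random[OF Lu(2,3)] by auto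
  have "(LINT w|Q. L u w * nI s u k w) = (LINT w|Q. nI s u (%r w. L u w * k r w) w)"
   by (simp add: nI_def)
  also have "\<dots> = (LINT r:{s..u}|\<nu>. (LINT w|Q. L u w * k r w))"
   using prod(2,3)[OF jLu jk k(2)] by simp
  also have "\<dots> = (LINT r:{s..u}|\<nu>. (LINT w|Q. L r w * k r w))"
   unfolding set_lebesgue_integral_def
  proof (rule integral_cong_AE)
   show "(%r. indicator {s..u} r *\<^sub>R (LINT w|Q. L u w * k r w)) \<in> borel_measurable \<nu>"
    "(%r. indicator {s..u} r *\<^sub>R (LINT w|Q. L r w * k r w)) \<in> borel_measurable \<nu>"
    using jm_integrable(6)[OF jm_arith(3)[OF jLu(1) jk] N2_mult_finite[OF jLu jk k(2)] su(4)]
     jm_integrable(6)[OF jm_arith(3)[OF L(2) jk] N2_mult_finite[OF L(2,3) jk k(2)] su(4)]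
    by (auto simp: set_integrable_def)
   have "AE r in \<nu>. r \<in> {s..T} \<longrightarrow> integrable Q (%w. k r w * k r w)" by (rule prod(4)[OF jk k(2) jk k(2)])
   then show "AE r in \<nu>. indicator {s..u} r *\<^sub>R (LINT w|Q. L u w * k r w) = indicator {s..u} r *\<^sub>R (LINT w|Q. L r w * k r w)"
   proof eventually_elim
    case (elim r)
    have "(LINT w|Q. L u w * k r w) = (LINT w|Q. L r w * k r w)" if r: "r \<in> {s..u}"
    proof -
     have rT: "r \<in> {s..T}" "s <= r" "r <= u" using r su by auto
     have k2: "integrable Q (%w. (k r w)^2)" using elim rT by (simp add: power2_eq_square)
     have km: "k r \<in> borel_measurable (G r)" by (rule prog_section[OF k(1) rT(1)])
     note t = l2m_test[OF L(1) rT(2,3) su(4) km k2]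
     have i: "integrable Q (%w. k r w * L r w)"
      by (rule integrable_mult_L2[OF G_meas[OF km] l2m_D(2)[OF L(1) rT(1)] k2 l2m_D(3)[OF L(1) rT(1)]])
     have "(LINT w|Q. L u w * k r w) = (LINT w|Q. k r w * (L u w - L r w) + k r w * L r w)"
      by (simp add: algebra_simps)
     also have "\<dots> = (LINT w|Q. k r w * L r w)" using t i by simp
     finally show ?thesis by (simp add: mult.commute)
    qed
    then show ?case by (simp add: indicator_def)
   qed
  qed
  also have "\<dots> = pI (%r w. L r w * k r w)" by (rule prod(2)[OF L(2,3) jk k(2)])
  finally show ?thesis .
 qed
 have GH: "(LINT w|Q. nI s u g w * nI s u h w) = pI (%r w. g r w * nI s r h w) + pI (%r w. nI s r g w * h r w)"
 proof -
  have "AE w in Q. set_integrable \<nu> {s..T} (%r. g r w)" "AE w in Q. set_integrable \<nu> {s..T} (%r. h r w)"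
   using L1_facts(1)[OF g(1) L2_nn_finite[OF g]] L1_facts(1)[OF h(1) L2_nn_finite[OF h]] by auto
  then have "AE w in Q. nI s u g w * nI s u h w = nI s u (%r w. g r w * nI s r h w + nI s r g w * h r w) w"
  proof eventually_elim
   case (elim w)
   have "set_integrable \<nu> {s..u} (%r. g r w)" "set_integrable \<nu> {s..u} (%r. h r w)"
    using elim su by (auto intro: set_integrable_subset)
   from product_rule_path(1)[OF this] show ?case by (simp add: nI_def)
  qed
  then have "(LINT w|Q. nI s u g w * nI s u h w) = (LINT w|Q. nI s u (%r w. g r w * nI s r h w + nI s r g w * h r w) w)"
   by (intro integral_cong_AE)
    (use Gu Hu jm_nI_meas[OF jm_arith(1)[OF jm_arith(3)[OF jg jH] jm_arith(3)[OF jG jh]] su(2,4)] in auto)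
  also have "\<dots> = (LINT p|(\<nu> \<Otimes>\<^sub>M Q). indicator {s..u} (fst p) * (g (fst p) (snd p) * nI s (fst p) h (snd p) + nI s (fst p) g (snd p) * h (fst p) (snd p)))"
  proof -
   let ?Z = "%r w. g r w * nI s r h w + nI s r g w * h r w"
   have i: "integrable (\<nu> \<Otimes>\<^sub>M Q) (%p. indicator {s..u} (fst p) * ?Z (fst p) (snd p))"
    using Bochner_Integration.integrable_add[OF prod(1)[OF jg g(2) jH nH] prod(1)[OF jG nG jh h(2)]] by (simp add: distrib_left)
   show ?thesis unfolding nI_def[of s u ?Z] set_lebesgue_integral_def
    using QV.integral_snd[of "%r w. indicator {s..u} r * ?Z r w"] i by (simp add: split_beta')
  qed
  also have "\<dots> = pI (%r w. g r w * nI s r h w) + pI (%r w. nI s r g w * h r w)"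
   unfolding pI_def distrib_left
   by (rule Bochner_Integration.integral_add[OF prod(1)[OF jg g(2) jH nH] prod(1)[OF jG nG jh h(2)]])
  finally show ?thesis .
 qed
 have i4: "integrable Q (%w. M' u w * N' u w)" "integrable Q (%w. M' u w * nI s u h w)"
  "integrable Q (%w. N' u w * nI s u g w)" "integrable Q (%w. nI s u g w * nI s u h w)"
  using Mu Nu Gu Hu by (auto intro!: integrable_mult_L2)
 have "(LINT w|Q. Y u w * X u w) = (LINT w|Q. ((M' u w * N' u w - M' u w * nI s u h w) - N' u w * nI s u g w) + nI s u g w * nI s u h w)"
  by (intro Bochner_Integration.integral_cong) (auto simp: M'_def N'_def algebra_simps)
 also have "\<dots> = (LINT w|Q. M' u w * N' u w) - pI (%r w. M' r w * h r w) - pI (%r w. N' r w * g r w)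
   + (pI (%r w. g r w * nI s r h w) + pI (%r w. nI s r g w * h r w))"
  using i4 mult[OF lM jM(1) nM(1) h] mult[OF lN jM(2) nM(2) g] GH by simp
 also have "pI (%r w. M' r w * h r w) = pI (%r w. Y r w * h r w) + pI (%r w. nI s r g w * h r w)"
  unfolding pI_def M'_def distrib_left distrib_right
  by (rule Bochner_Integration.integral_add[OF prod(1)[OF jY Y(2) jh h(2)] prod(1)[OF jG nG jh h(2)]])
 also have "pI (%r w. N' r w * g r w) = pI (%r w. g r w * X r w) + pI (%r w. g r w * nI s r h w)"
 proof -
  have "pI (%r w. N' r w * g r w) = (LINT p|(\<nu> \<Otimes>\<^sub>M Q). indicator {s..u} (fst p) * (g (fst p) (snd p) * X (fst p) (snd p)) + indicator {s..u} (fst p) * (g (fst p) (snd p) * nI s (fst p) h (snd p)))"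
   unfolding pI_def N'_def by (simp add: algebra_simps)
  also have "\<dots> = pI (%r w. g r w * X r w) + pI (%r w. g r w * nI s r h w)"
   unfolding pI_def by (rule Bochner_Integration.integral_add[OF prod(1)[OF jg g(2) jX X(2)] prod(1)[OF jg g(2) jH nH]])
  finally show ?thesis .
 qed
 finally have 1: "(LINT w|Q. Y u w * X u w) = (LINT w|Q. M' u w * N' u w) - (pI (%r w. Y r w * h r w) + pI (%r w. g r w * X r w))"
  by simp
 have 2: "pI (%r w. Y r w * h r w) + pI (%r w. g r w * X r w) = (LINT r:{s..u}|\<nu>. (LINT w|Q. Y r w * h r w + g r w * X r w))"
 proof -
  let ?Z = "%r w. Y r w * h r w + g r w * X r w"
  have i: "integrable (\<nu> \<Otimes>\<^sub>M Q) (%p. indicator {s..u} (fst p) * ?Z (fst p) (snd p))"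
   using Bochner_Integration.integrable_add[OF prod(1)[OF jY Y(2) jh h(2)] prod(1)[OF jg g(2) jX X(2)]] by (simp add: distrib_left)
  have e: "(LINT w|Q. indicator {s..u} r * ?Z r w) = indicator {s..u} r *\<^sub>R (LINT w|Q. ?Z r w)" for r by simp
  have "pI (%r w. Y r w * h r w) + pI (%r w. g r w * X r w) = (LINT p|(\<nu> \<Otimes>\<^sub>M Q). indicator {s..u} (fst p) * ?Z (fst p) (snd p))"
   unfolding pI_def distrib_left by (rule Bochner_Integration.integral_add[symmetric, OF prod(1)[OF jY Y(2) jh h(2)] prod(1)[OF jg g(2) jX X(2)]])
  also have "\<dots> = (LINT r:{s..u}|\<nu>. (LINT w|Q. ?Z r w))"
   unfolding set_lebesgue_integral_def e[symmetric] using QV.integral_fst'[OF i] by simp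
  finally show ?thesis .
 qed
 have 3: "cov M' N' s u (space Q) = (LINT w|Q. M' u w * N' u w) - (LINT w|Q. Y s w * X s w)"
 proof -
  note Ms = l2m_D[OF lM su(1)] and Ns = l2m_D[OF lN su(1)]
  note t1 = l2m_test[OF lM su(2,3,4) Ns(1,3)] and t2 = l2m_test[OF lN su(2,3,4) Ms(1,3)]
  have i: "integrable Q (%w. M' s w * N' s w)" using Ms Ns by (auto intro!: integrable_mult_L2)
  have "cov M' N' s u (space Q) = (LINT w|Q. ((M' u w * N' u w - N' s w * (M' u w - M' s w)) - M' s w * (N' u w - N' s w)) - M' s w * N' s w)"
   unfolding cov_space by (intro Bochner_Integration.integral_cong) (auto simp: algebra_simps)
  also have "\<dots> = (LINT w|Q. M' u w * N' u w) - (LINT w|Q. M' s w * N' s w)"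
   using i4(1) t1 t2 i by simp
  finally show ?thesis by (simp add: M'_def N'_def)
 qed
 show ?thesis using 1 2 3 unfolding M'_def[abs_def] N'_def[abs_def] by simp
qed

section \<open>The weighted norm and the a priori estimate\<close>

text \<open>The square of a norm equivalent to the unweighted one; a large \<gamma> in the weight is
  what makes the solution map a contraction.\<close>

definition wn :: "real => (real => 'a => real) => ennreal" where
 "wn \<gamma> X = (\<integral>\<^sup>+w. (\<integral>\<^sup>+r\<in>{s..T}. ennreal (exp (2 * \<gamma> * W r)) * ennreal ((X r w)^2) \<partial>\<nu>) \<partial>Q)"

lemma jm_wt: "jm X ==> (%p. indicator {s..T} (fst p) * (ennreal (exp (a * W (fst p))) * ennreal ((X (fst p) (snd p))^2))) \<in> borel_measurable (\<nu> \<Otimes>\<^sub>M Q)"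
proof -
 assume "jm X"
 from jm_E[OF this, of "%x. ennreal (x^2)"]
 have [measurable]: "(%p. indicator {s..T} (fst p) * ennreal ((X (fst p) (snd p))^2)) \<in> borel_measurable (\<nu> \<Otimes>\<^sub>M Q)" by simp
 have "(%p. ennreal (exp (a * W (fst p))) * (indicator {s..T} (fst p) * ennreal ((X (fst p) (snd p))^2))) \<in> borel_measurable (\<nu> \<Otimes>\<^sub>M Q)"
  by measurable
 then show ?thesis by (simp add: mult_ac)
qed

text \<open>As \<open>dY t\<close> is known at \<open>t\<close>, it is orthogonal to
  \<open>dM T - dM t\<close>, so their mean squares add up to that of the integral of
  \<open>dg\<close> over \<open>[t,T]\<close>. This identity controls \<open>dY\<close> at each time
  and, through the bracket bound, the tails of \<open>dZ\<close>, as \<open>weighted_bound\<close>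
  requires. The second estimate keeps \<open>t\<close> fixed because the values of two solutions at
  the initial time have to be compared.\<close>

theorem bsde_contraction:
 fixes dZ :: "'i => real => 'a => real"
 assumes fin: "finite I" and \<gamma>: "0 < \<gamma>" and C: "0 < C"
  and dY: "prog dY" and dM: "l2m dM" and dg: "jm dg" "N2 dg < \<infinity>"
  and eq: "\<And>t. t \<in> {s..T} ==> AE w in Q. dY t w = nI t T dg w - (dM T w - dM t w)"
  and dZ: "\<And>i. i \<in> I ==> jm (dZ i)"
   "\<And>i t. i \<in> I ==> t \<in> {s..T} ==> (\<integral>\<^sup>+w. (sq t (dZ i) w) \<partial>Q) <= ennreal (C * (LINT w|Q. (dM T w - dM t w)^2))"
 shows "wn \<gamma> dY + (\<Sum>i\<in>I. wn \<gamma> (dZ i)) <= ennreal (1 / \<gamma>^2 + 3 * (real (card I) * C) / \<gamma>) * wn \<gamma> dg" (is ?g0)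
  and "\<And>t. t \<in> {s..T} ==> (\<integral>\<^sup>+w. ennreal ((dY t w)^2) \<partial>Q) <= ennreal (W T - W 0) * N2 dg"
proof -
 note jY = jm_prog[OF dY]
 define y where "y r = indicator {s..T} r * (\<integral>\<^sup>+w. ennreal ((dY r w)^2) \<partial>Q)" for r
 define z where "z i r = indicator {s..T} r * (\<integral>\<^sup>+w. ennreal ((dZ i r w)^2) \<partial>Q)" for i r
 define b where "b r = indicator {s..T} r * (\<integral>\<^sup>+w. ennreal ((dg r w)^2) \<partial>Q)" for r
 have sqE: "(%p. indicator {s..T} (fst p) * ennreal ((X (fst p) (snd p))^2)) \<in> borel_measurable (\<nu> \<Otimes>\<^sub>M Q)" if "jm X" for X
  using jm_E[OF that, of "%x. ennreal (x^2)"] by simp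
 have [measurable]: "y \<in> borel_measurable borel" "b \<in> borel_measurable borel"
  unfolding y_def b_def using Tonelli(2)[OF sqE[OF jY] order_refl] Tonelli(2)[OF sqE[OF dg(1)] order_refl] by auto
 have zm[measurable]: "z i \<in> borel_measurable borel" if "i \<in> I" for i
  unfolding z_def using Tonelli(2)[OF sqE[OF dZ(1)[OF that]] order_refl] by auto
 define J where "J t = ennreal (exp (- (\<gamma> * W t)) / \<gamma>) * (\<integral>\<^sup>+r\<in>{t..T}. ennreal (exp (\<gamma> * W r)) * b r \<partial>\<nu>)" for t
 define E where "E t = (LINT w|Q. (nI t T dg w)^2)" for t
 have nm: "nI t T dg \<in> borel_measurable Q" "integrable Q (%w. (nI t T dg w)^2)" if "t \<in> {s..T}" for t
  using jm_nI_meas[OF dg(1)] nI_L2[OF dg] that by auto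
 have energy: "integrable Q (%w. (dY t w)^2) \<and> (LINT w|Q. (dY t w)^2) + (LINT w|Q. (dM T w - dM t w)^2) = E t" if t: "t \<in> {s..T}" for t
 proof -
  have tt: "s <= t" "t <= T" "T <= T" using t by auto
  have Ym: "dY t \<in> borel_measurable (G t)" by (rule prog_section[OF dY t])
  note [measurable] = G_meas[OF Ym] nm(1)[OF t] l2m_incr(2)[OF dM tt]
  have d2: "integrable Q (%w. (nI t T dg w - (dM T w - dM t w))^2)"
   by (rule integrable_L2_diff[OF nm(1)[OF t] l2m_incr(2)[OF dM tt] nm(2)[OF t] l2m_incr(3)[OF dM tt]])
  have ae2: "AE w in Q. (dY t w)^2 = (nI t T dg w - (dM T w - dM t w))^2" using eq[OF t] by eventually_elim simp
  have Y2: "integrable Q (%w. (dY t w)^2)"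
   by (subst integrable_cong_AE[OF _ _ ae2]) (use d2 in auto)
  note o = l2m_test[OF dM tt Ym Y2]
  have "E t = (LINT w|Q. ((dY t w)^2 + (dM T w - dM t w)^2) + 2 * (dY t w * (dM T w - dM t w)))"
   unfolding E_def
  proof (rule integral_cong_AE)
   show "AE w in Q. (nI t T dg w)^2 = ((dY t w)^2 + (dM T w - dM t w)^2) + 2 * (dY t w * (dM T w - dM t w))"
    using eq[OF t]
   proof eventually_elim
    case (elim w)
    then have "nI t T dg w = dY t w + (dM T w - dM t w)" by simp
    then show ?case by (simp add: power2_sum)
   qed
  qed auto
  also have "\<dots> = (LINT w|Q. (dY t w)^2) + (LINT w|Q. (dM T w - dM t w)^2)"
   using Y2 l2m_incr(3)[OF dM tt] o by simp
  finally show ?thesis using Y2 by simp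
 qed
 have EJ: "ennreal (E t) <= J t" if t: "t \<in> {s..T}" for t
 proof -
  have tt: "s <= t" "t <= T" using t by auto
  have "ennreal (E t) = (\<integral>\<^sup>+w. ennreal ((nI t T dg w)^2) \<partial>Q)"
   unfolding E_def by (rule nn_integral_eq_integral[symmetric]) (use nm[OF t] in auto)
  also have "\<dots> <= (\<integral>\<^sup>+w. ennreal (exp (- (\<gamma> * W t)) / \<gamma>) * (\<integral>\<^sup>+r\<in>{t..T}. ennreal (exp (\<gamma> * W r)) * ennreal ((dg r w)^2) \<partial>\<nu>) \<partial>Q)"
  proof (rule nn_integral_mono)
   fix w assume w: "w \<in> space Q"
   note [measurable] = jm_path[OF dg(1) w]
   let ?f = "%r. ennreal (exp (- (\<gamma> / 2 * W r))) * indicator {t..T} r"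
   let ?h = "%r. ennreal (exp (\<gamma> / 2 * W r)) * ennreal \<bar>indicator {s..T} r * dg r w\<bar> * indicator {t..T} r"
   have "ennreal ((nI t T dg w)^2) = (ennreal \<bar>nI t T dg w\<bar>)^2" by (simp add: ennreal_power)
   also have "\<dots> <= (ab t T dg w)^2" by (rule power_mono[OF nI_le_nn]) simp
   also have "(ab t T dg w) = (\<integral>\<^sup>+r. ?f r * ?h r \<partial>\<nu>)"
   proof (rule nn_integral_cong)
    fix r
    have "ennreal (exp (- (\<gamma> / 2 * W r))) * (ennreal (exp (\<gamma> / 2 * W r)) * x) = x" for x
     by (simp add: mult.assoc[symmetric] ennreal_mult[symmetric] exp_add[symmetric])
    then show "ennreal \<bar>dg r w\<bar> * indicator {t..T} r = ?f r * ?h r" using tt by (auto simp: indicator_def)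
   qed
   also have "(\<integral>\<^sup>+r. ?f r * ?h r \<partial>\<nu>)^2 <= (\<integral>\<^sup>+r. (?f r)^2 \<partial>\<nu>) * (\<integral>\<^sup>+r. (?h r)^2 \<partial>\<nu>)"
    by (rule Cauchy_Schwarz_nn_integral) (simp_all cong: measurable_cong_sets)
   also have "\<dots> <= ennreal (exp (- (\<gamma> * W t)) / \<gamma>) * (\<integral>\<^sup>+r\<in>{t..T}. ennreal (exp (\<gamma> * W r)) * ennreal ((dg r w)^2) \<partial>\<nu>)"
   proof (rule mult_mono)
    have "(\<integral>\<^sup>+r. (?f r)^2 \<partial>\<nu>) = (\<integral>\<^sup>+r\<in>{t..T}. ennreal (exp (- \<gamma> * W r)) \<partial>\<nu>)"
     by (intro nn_integral_cong) (auto simp: indicator_def ennreal_power exp_double[symmetric])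
    also have "\<dots> = ennreal ((exp (- \<gamma> * W T) - exp (- \<gamma> * W t)) / (- \<gamma>))" using \<gamma> tt by (intro nu_exp_Icc) auto
    also have "\<dots> <= ennreal (exp (- (\<gamma> * W t)) / \<gamma>)" using \<gamma> by (intro ennreal_leI) (simp add: field_simps)
    finally show "(\<integral>\<^sup>+r. (?f r)^2 \<partial>\<nu>) <= ennreal (exp (- (\<gamma> * W t)) / \<gamma>)" .
    show "(\<integral>\<^sup>+r. (?h r)^2 \<partial>\<nu>) <= (\<integral>\<^sup>+r\<in>{t..T}. ennreal (exp (\<gamma> * W r)) * ennreal ((dg r w)^2) \<partial>\<nu>)"
     using tt by (intro nn_integral_mono)
      (auto simp: indicator_def ennreal_power power_mult_distrib exp_double[symmetric])
   qed auto
   finally show "ennreal ((nI t T dg w)^2) <= ennreal (exp (- (\<gamma> * W t)) / \<gamma>) * (\<integral>\<^sup>+r\<in>{t..T}. ennreal (exp (\<gamma> * W r)) * ennreal ((dg r w)^2) \<partial>\<nu>)" .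
  qed
  also have "\<dots> = ennreal (exp (- (\<gamma> * W t)) / \<gamma>) * (\<integral>\<^sup>+w. (\<integral>\<^sup>+r\<in>{t..T}. ennreal (exp (\<gamma> * W r)) * ennreal ((dg r w)^2) \<partial>\<nu>) \<partial>Q)"
   by (rule nn_integral_cmult, rule Tonelli(3)[OF jm_wt[OF dg(1)] tt(1)])
  also have "(\<integral>\<^sup>+w. (\<integral>\<^sup>+r\<in>{t..T}. ennreal (exp (\<gamma> * W r)) * ennreal ((dg r w)^2) \<partial>\<nu>) \<partial>Q)
    = (\<integral>\<^sup>+r\<in>{t..T}. (\<integral>\<^sup>+w. ennreal (exp (\<gamma> * W r)) * ennreal ((dg r w)^2) \<partial>Q) \<partial>\<nu>)"
   by (rule Tonelli(1)[OF jm_wt[OF dg(1)] tt(1)])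
  also have "\<dots> = (\<integral>\<^sup>+r\<in>{t..T}. ennreal (exp (\<gamma> * W r)) * b r \<partial>\<nu>)"
  proof (rule nn_integral_cong)
   fix r
   have "(\<integral>\<^sup>+w. ennreal (exp (\<gamma> * W r)) * ennreal ((dg r w)^2) \<partial>Q) = ennreal (exp (\<gamma> * W r)) * b r" if "r \<in> {s..T}"
    using that jm_section[OF dg(1) that] by (subst nn_integral_cmult) (auto simp: b_def)
   then show "(\<integral>\<^sup>+w. ennreal (exp (\<gamma> * W r)) * ennreal ((dg r w)^2) \<partial>Q) * indicator {t..T} r = ennreal (exp (\<gamma> * W r)) * b r * indicator {t..T} r"
    using tt by (auto simp: indicator_def)
  qed
  finally show ?thesis unfolding J_def .
 qed
 have nnY: "(\<integral>\<^sup>+w. ennreal ((dY t w)^2) \<partial>Q) <= ennreal (E t)" if t: "t \<in> {s..T}" for t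
 proof -
  have "(\<integral>\<^sup>+w. ennreal ((dY t w)^2) \<partial>Q) = ennreal (LINT w|Q. (dY t w)^2)"
   using energy[OF t] by (intro nn_integral_eq_integral) auto
  also have "\<dots> <= ennreal (E t)"
  proof (rule ennreal_leI)
   have "0 <= (LINT w|Q. (dM T w - dM t w)^2)" by simp
   then show "(LINT w|Q. (dY t w)^2) <= E t" using energy[OF t] by linarith
  qed
  finally show ?thesis .
 qed
 have bound: "(\<integral>\<^sup>+r\<in>{s..T}. ennreal (exp (2 * \<gamma> * W r)) * (y r + (\<Sum>i\<in>I. z i r)) \<partial>\<nu>)
  <= ennreal (1 / \<gamma>^2 + 3 * (real (card I) * C) / \<gamma>) * (\<integral>\<^sup>+r\<in>{s..T}. ennreal (exp (2 * \<gamma> * W r)) * b r \<partial>\<nu>)"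
 proof (rule weighted_bound[where J=J])
  show "s <= T" by (rule s_le)
  show "0 < \<gamma>" "0 <= real (card I) * C" using \<gamma> C by auto
  show "(%r. \<Sum>i\<in>I. z i r) \<in> borel_measurable borel" using zm by (intro borel_measurable_sum) auto
  show "y t <= J t" if t: "t \<in> {s..T}" for t
   using order.trans[OF nnY[OF t] EJ[OF t]] t by (simp add: y_def)
  show "(\<integral>\<^sup>+r\<in>{t..T}. (\<Sum>i\<in>I. z i r) \<partial>\<nu>) <= ennreal (real (card I) * C) * J t" if t: "t \<in> {s..T}" for t
  proof -
   have tt: "s <= t" using t by auto
   have "(\<integral>\<^sup>+r\<in>{t..T}. (\<Sum>i\<in>I. z i r) \<partial>\<nu>) = (\<Sum>i\<in>I. \<integral>\<^sup>+r\<in>{t..T}. z i r \<partial>\<nu>)"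
    unfolding sum_distrib_right by (rule nn_integral_sum) (use zm in \<open>auto cong: measurable_cong_sets\<close>)
   also have "\<dots> <= (\<Sum>i\<in>I. ennreal C * J t)"
   proof (rule sum_mono)
    fix i assume i: "i \<in> I"
    have "(\<integral>\<^sup>+r\<in>{t..T}. z i r \<partial>\<nu>) = (\<integral>\<^sup>+r\<in>{t..T}. (\<integral>\<^sup>+w. ennreal ((dZ i r w)^2) \<partial>Q) \<partial>\<nu>)"
     using tt by (intro nn_integral_cong) (auto simp: z_def indicator_def)
    also have "\<dots> = (\<integral>\<^sup>+w. (sq t (dZ i) w) \<partial>Q)"
     by (rule Tonelli(1)[OF sqE[OF dZ(1)[OF i]] tt, symmetric])
    also have "\<dots> <= ennreal (C * (LINT w|Q. (dM T w - dM t w)^2))" by (rule dZ(2)[OF i t])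
    also have "\<dots> <= ennreal (C * E t)"
    proof (intro ennreal_leI mult_left_mono)
     have "0 <= (LINT w|Q. (dY t w)^2)" by simp
     then show "(LINT w|Q. (dM T w - dM t w)^2) <= E t" using energy[OF t] by linarith
    qed (use C in auto)
    also have "\<dots> = ennreal C * ennreal (E t)" using C by (intro ennreal_mult) (auto simp: E_def)
    also have "\<dots> <= ennreal C * J t" by (intro mult_left_mono EJ t) simp
    finally show "(\<integral>\<^sup>+r\<in>{t..T}. z i r \<partial>\<nu>) <= ennreal C * J t" .
   qed
   also have "\<dots> = ennreal (real (card I) * C) * J t"
    using C by (simp add: ennreal_mult ennreal_of_nat_eq_real_of_nat mult.assoc)
   finally show ?thesis .
  qed
 qed (simp_all add: J_def)
 have swap: "(\<integral>\<^sup>+r\<in>{s..T}. ennreal (exp (2 * \<gamma> * W r)) * (indicator {s..T} r * (\<integral>\<^sup>+w. ennreal ((X r w)^2) \<partial>Q)) \<partial>\<nu>) = wn \<gamma> X" if "jm X" for X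
 proof -
  have "wn \<gamma> X = (\<integral>\<^sup>+r\<in>{s..T}. (\<integral>\<^sup>+w. ennreal (exp (2 * \<gamma> * W r)) * ennreal ((X r w)^2) \<partial>Q) \<partial>\<nu>)"
   unfolding wn_def by (rule Tonelli(1)[OF jm_wt[OF that] order_refl])
  also have "\<dots> = (\<integral>\<^sup>+r\<in>{s..T}. ennreal (exp (2 * \<gamma> * W r)) * (indicator {s..T} r * (\<integral>\<^sup>+w. ennreal ((X r w)^2) \<partial>Q)) \<partial>\<nu>)"
  proof (rule nn_integral_cong)
   fix r
   have "(\<integral>\<^sup>+w. ennreal (exp (2 * \<gamma> * W r)) * ennreal ((X r w)^2) \<partial>Q) = ennreal (exp (2 * \<gamma> * W r)) * (\<integral>\<^sup>+w. ennreal ((X r w)^2) \<partial>Q)" if "r \<in> {s..T}"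
    using jm_section[OF \<open>jm X\<close> that] by (intro nn_integral_cmult) auto
   then show "(\<integral>\<^sup>+w. ennreal (exp (2 * \<gamma> * W r)) * ennreal ((X r w)^2) \<partial>Q) * indicator {s..T} r = ennreal (exp (2 * \<gamma> * W r)) * (indicator {s..T} r * (\<integral>\<^sup>+w. ennreal ((X r w)^2) \<partial>Q)) * indicator {s..T} r"
    by (auto simp: indicator_def)
  qed
  finally show ?thesis by simp
 qed
 have "wn \<gamma> dY + (\<Sum>i\<in>I. wn \<gamma> (dZ i)) = (\<integral>\<^sup>+r\<in>{s..T}. ennreal (exp (2 * \<gamma> * W r)) * y r \<partial>\<nu>) + (\<Sum>i\<in>I. \<integral>\<^sup>+r\<in>{s..T}. ennreal (exp (2 * \<gamma> * W r)) * z i r \<partial>\<nu>)"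
  unfolding y_def z_def using swap[OF jY] swap[OF dZ(1)] by simp
 also have "(\<Sum>i\<in>I. \<integral>\<^sup>+r\<in>{s..T}. ennreal (exp (2 * \<gamma> * W r)) * z i r \<partial>\<nu>) = (\<integral>\<^sup>+r. (\<Sum>i\<in>I. ennreal (exp (2 * \<gamma> * W r)) * z i r * indicator {s..T} r) \<partial>\<nu>)"
  by (rule nn_integral_sum[symmetric]) (use zm in \<open>auto cong: measurable_cong_sets\<close>)
 also have "(\<integral>\<^sup>+r\<in>{s..T}. ennreal (exp (2 * \<gamma> * W r)) * y r \<partial>\<nu>) + (\<integral>\<^sup>+r. (\<Sum>i\<in>I. ennreal (exp (2 * \<gamma> * W r)) * z i r * indicator {s..T} r) \<partial>\<nu>)
   = (\<integral>\<^sup>+r\<in>{s..T}. ennreal (exp (2 * \<gamma> * W r)) * (y r + (\<Sum>i\<in>I. z i r)) \<partial>\<nu>)"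
  by (subst nn_integral_add[symmetric])
    (use zm in \<open>auto cong: measurable_cong_sets simp: distrib_left distrib_right sum_distrib_left sum_distrib_right\<close>)
 also have "\<dots> <= ennreal (1 / \<gamma>^2 + 3 * (real (card I) * C) / \<gamma>) * wn \<gamma> dg"
  using bound swap[OF dg(1)] by (simp add: b_def)
 finally show ?g0 .
 fix t assume t: "t \<in> {s..T}"
 have "(\<integral>\<^sup>+w. ennreal ((dY t w)^2) \<partial>Q) <= (\<integral>\<^sup>+w. ennreal ((nI t T dg w)^2) \<partial>Q)"
  using nnY[OF t] nn_integral_eq_integral[OF nm(2)[OF t]] by (simp add: E_def)
 also have "\<dots> <= (\<integral>\<^sup>+w. ennreal (W T - W 0) * (sq s dg w) \<partial>Q)"
  using nI_sq_le[OF dg(1)] t by (intro nn_integral_mono) auto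
 also have "\<dots> = ennreal (W T - W 0) * N2 dg" unfolding N2_def
  by (rule nn_integral_cmult, rule Tonelli(3)[OF sqE[OF dg(1)] order_refl])
 finally show "(\<integral>\<^sup>+w. ennreal ((dY t w)^2) \<partial>Q) <= ennreal (W T - W 0) * N2 dg" .
qed

end

section \<open>Progressive measurability and the canonical filtrations\<close>

lemma measurable_indicator_restrict:
 fixes X :: "real => 'a => real"
 assumes A: "A \<in> sets borel"
 shows "(%(r, w). X r w) \<in> borel_measurable (restrict_space borel A \<Otimes>\<^sub>M N) \<longleftrightarrow>
     (%p. indicator A (fst p) * X (fst p) (snd p)) \<in> borel_measurable (borel \<Otimes>\<^sub>M N)"
proof
 assume X: "(%(r, w). X r w) \<in> borel_measurable (restrict_space borel A \<Otimes>\<^sub>M N)"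
 let ?R = "restrict_space (borel \<Otimes>\<^sub>M N) {p. fst p \<in> A}"
 have "fst \<in> measurable ?R borel" "snd \<in> measurable ?R N" by (auto intro: measurable_restrict_space1)
 then have "(%p. (fst p, snd p)) \<in> measurable ?R (restrict_space borel A \<Otimes>\<^sub>M N)"
  by (intro measurable_Pair measurable_restrict_space2) (auto simp: space_restrict_space)
 from measurable_compose[OF this X] have "(%p. X (fst p) (snd p)) \<in> borel_measurable ?R" by (simp add: split_beta')
 moreover have "{x \<in> space (borel \<Otimes>\<^sub>M N). fst x \<in> A} \<in> sets (borel \<Otimes>\<^sub>M N)" using A by measurable
 ultimately have "(%p. if fst p \<in> A then X (fst p) (snd p) else 0) \<in> borel_measurable (borel \<Otimes>\<^sub>M N)"
  by (subst measurable_If_restrict_space_iff) auto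
 then show "(%p. indicator A (fst p) * X (fst p) (snd p)) \<in> borel_measurable (borel \<Otimes>\<^sub>M N)"
  by (rule measurable_cong[THEN iffD1, rotated]) (auto simp: indicator_def)
next
 assume X: "(%p. indicator A (fst p) * X (fst p) (snd p)) \<in> borel_measurable (borel \<Otimes>\<^sub>M N)"
 have "(%p. (fst p, snd p)) \<in> measurable (restrict_space borel A \<Otimes>\<^sub>M N) (borel \<Otimes>\<^sub>M N)"
  by (intro measurable_Pair measurable_snd measurable_compose[OF measurable_fst]) (auto intro: measurable_restrict_space1)
 from measurable_compose[OF this X]
 show "(%(r, w). X r w) \<in> borel_measurable (restrict_space borel A \<Otimes>\<^sub>M N)"
  by (rule measurable_cong[THEN iffD1, rotated]) (auto simp: space_pair_measure space_restrict_space)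
qed

lemma progressive_on_Icc_iff:
 "progressive_on {a..b} G X \<longleftrightarrow> (\<forall>u\<in>{a..b}. (%p. indicator {a..u} (fst p) * X (fst p) (snd p)) \<in> borel_measurable (borel \<Otimes>\<^sub>M G u))"
proof -
 have "{r \<in> {a..b}. r <= u} = {a..u}" if "u \<in> {a..b}" for u using that by auto
 then show ?thesis unfolding progressive_on_def by (simp add: measurable_indicator_restrict)
qed

lemma progressive_on_atLeast_iff:
 "progressive_on {a..} G X \<longleftrightarrow> (\<forall>u\<in>{a..}. (%p. indicator {a..u} (fst p) * X (fst p) (snd p)) \<in> borel_measurable (borel \<Otimes>\<^sub>M G u))"
proof -
 have "{r \<in> {a..}. r <= u} = {a..u}" for u by auto
 then show ?thesis unfolding progressive_on_def by (simp add: measurable_indicator_restrict)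
qed

lemma space_Fo[simp]: "space (Fo t) = Omega" and space_FF[simp]: "space FF = Omega" and space_Fp[simp]: "space (Fp t) = Omega"
 and space_Fc[simp]: "space (Fc Q t) = Omega"
 by (simp_all add: Fo_def FF_def Fp_def Fc_def space_measure_of_conv)

lemma sets_Fo: "sets (Fo t) = sigma_sets Omega {{w\<in>Omega. w r \<in> B} | r B. 0 <= r \<and> r <= t \<and> B \<in> sets borel}"
 unfolding Fo_def by (rule sets_measure_of) auto

lemma sets_FF: "sets FF = sigma_sets Omega {{w\<in>Omega. w r \<in> B} | r B. 0 <= r \<and> B \<in> sets borel}"
 unfolding FF_def by (rule sets_measure_of) auto

lemma Fo_mono: "t <= u ==> sets (Fo t) \<subseteq> sets (Fo u)"
 unfolding sets_Fo by (rule sigma_sets_mono') (fastforce intro: order.trans)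

lemma Fo_FF: "sets (Fo t) \<subseteq> sets FF"
 unfolding sets_Fo sets_FF by (rule sigma_sets_mono') auto

lemma sets_Fp: "sets (Fp t :: 'a::topological_space path measure) = sigma_sets Omega (\<Inter>u\<in>{t<..}. sets (Fo u))"
proof -
 have "(\<Inter>u\<in>{t<..}. sets (Fo u :: 'a path measure)) \<subseteq> Pow Omega"
 proof
  fix A assume "A \<in> (\<Inter>u\<in>{t<..}. sets (Fo u :: 'a path measure))"
  then have "A \<in> sets (Fo (t + 1))" by auto
  from sets.sets_into_space[OF this] show "A \<in> Pow Omega" by simp
 qed
 then show ?thesis unfolding Fp_def by (rule sets_measure_of)
qed

lemma Fp_Fo: "t < u ==> sets (Fp t) \<subseteq> sets (Fo u)"
 unfolding sets_Fp using sets.sigma_sets_subset[of "\<Inter>u\<in>{t<..}. sets (Fo u)" "Fo u"] by auto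

lemma Fo_Fp: "sets (Fo t) \<subseteq> sets (Fp t)"
proof
 fix A assume "A \<in> sets (Fo t :: 'a path measure)"
 then have "A \<in> (\<Inter>u\<in>{t<..}. sets (Fo u))" by (auto intro: subsetD[OF Fo_mono] less_imp_le)
 then show "A \<in> sets (Fp t)" unfolding sets_Fp by (rule sigma_sets.Basic)
qed

lemma Fp_FF: "sets (Fp t) \<subseteq> sets FF"
 using Fp_Fo[of t "t + 1"] Fo_FF[of "t + 1"] by auto

lemma Fp_mono: assumes "t <= u" shows "sets (Fp t) \<subseteq> sets (Fp u)"
proof -
 have "(\<Inter>v\<in>{t<..}. sets (Fo v)) \<subseteq> (\<Inter>v\<in>{u<..}. sets (Fo v))" using assms by auto
 then show ?thesis unfolding sets_Fp by (rule sigma_sets_mono')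
qed

text \<open>The sets whose membership depends only on the path up to \<open>t\<close> are closed
  under complements and countable unions and include the generators.\<close>

lemma Fo_determined:
 assumes "F \<in> sets (Fo t)" "w \<in> Omega" "w' \<in> Omega" "\<forall>r\<in>{0..t}. w r = w' r"
 shows "w \<in> F \<longleftrightarrow> w' \<in> F"
 using assms(1) unfolding sets_Fo by induction (use assms in auto)

lemma Fo_function_determined:
 fixes \<psi> :: "_ => real"
 assumes "\<psi> \<in> borel_measurable (Fo t)" "w \<in> Omega" "w' \<in> Omega" "\<forall>r\<in>{0..t}. w r = w' r"
 shows "\<psi> w = \<psi> w'"
proof -
 have "\<psi> -` {\<psi> w'} \<inter> space (Fo t) \<in> sets (Fo t)" by (rule measurable_sets[OF assms(1)]) simp
 from Fo_determined[OF this assms(2-4)] assms(2,3) show ?thesis by simp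
qed

lemma meas_Fo_FF: "f \<in> borel_measurable (Fo t) ==> f \<in> borel_measurable FF"
 by (rule measurable_from_subalg[of FF "Fo t"]) (use Fo_FF in \<open>auto simp: subalgebra_def\<close>)

lemma meas_Fp_FF: "f \<in> borel_measurable (Fp t) ==> f \<in> borel_measurable FF"
 by (rule measurable_from_subalg[of FF "Fp t"]) (use Fp_FF in \<open>auto simp: subalgebra_def\<close>)

section \<open>The canonical class and its Markov property\<close>

locale pd_class =
 fixes P :: "real => ('e::polish_space) path => 'e path measure" and T :: real and V :: "real => real"
 assumes T0: "0 < T" and V_cont: "continuous_on {0..T} V" and V_mono: "mono_on {0..T} V"
  and canon: "canonical_class P" and progr: "progressive_class P" and rcc: "right_cont_cond_class P"
begin

definition W :: "real => real" where "W t = V (max 0 (min t T))"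
abbreviation \<nu> :: "real measure" where "\<nu> \<equiv> Vmeas T V"
abbreviation Pc where "Pc s \<eta> \<equiv> completion (P s \<eta>)"

sublocale clock W T \<nu>
proof
 show "W x <= W y" if "x <= y" for x y
  unfolding W_def using that T0 by (intro mono_onD[OF V_mono]) auto
 have "continuous_on UNIV (V \<circ> (%t. max 0 (min t T)))"
  by (rule continuous_on_compose2[OF V_cont, of UNIV "%t. max 0 (min t T)", unfolded o_def[symmetric]] | rule continuous_on_compose)
    (use T0 in \<open>auto intro!: continuous_intros continuous_on_subset[OF V_cont]\<close>)
 then show "continuous_on UNIV W" unfolding W_def[abs_def] by (simp add: o_def)
 show "0 < T" by (rule T0)
 show "W t = W 0" if "t <= 0" for t using that T0 by (simp add: W_def)
 show "W t = W T" if "T <= t" for t using that T0 by (simp add: W_def)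
 show "\<nu> = interval_measure W" by (simp add: Vmeas_def W_def[abs_def])
qed

lemma P_prob: assumes "0 <= s" "\<eta> \<in> Omega"
 shows "prob_space (P s \<eta>)" "space (P s \<eta>) = Omega" "sets (P s \<eta>) = sets FF"
  "AE w in P s \<eta>. \<forall>r\<in>{0..s}. w r = \<eta> r"
 using canon assms unfolding canonical_class_def by blast+

lemma meas_P: assumes "0 <= s" "\<eta> \<in> Omega" shows "measurable (P s \<eta>) N = measurable FF N"
 using P_prob[OF assms] by (intro measurable_cong_sets) auto

lemma P_emeasure: assumes "0 <= s" "\<eta> \<in> Omega" shows "emeasure (P s \<eta>) A = ennreal (measure (P s \<eta>) A)"
proof -
 interpret prob_space "P s \<eta>" by (rule P_prob[OF assms])
 show ?thesis by (rule emeasure_eq_measure)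
qed

lemma P_kernel: assumes "0 <= t" shows "P t \<in> measurable (Fo t) (subprob_algebra FF)"
proof (rule measurable_subprob_algebra)
 fix A :: "'e path set" assume A: "A \<in> sets FF"
 have "(%\<eta>. measure (P t \<eta>) A) \<in> borel_measurable (Fo t)" using canon assms A unfolding canonical_class_def by blast
 then have "(%\<eta>. ennreal (measure (P t \<eta>) A)) \<in> borel_measurable (Fo t)" by measurable
 then show "(%\<eta>. emeasure (P t \<eta>) A) \<in> borel_measurable (Fo t)"
  by (rule measurable_cong[THEN iffD1, rotated]) (simp add: P_emeasure assms)
qed (use P_prob[OF assms] in \<open>auto intro: prob_space_imp_subprob_space\<close>)

lemma P_kernel_FF: assumes "0 <= t" shows "P t \<in> measurable FF (subprob_algebra FF)"
 by (rule measurable_from_subalg[OF _ P_kernel[OF assms]]) (use Fo_FF in \<open>auto simp: subalgebra_def\<close>)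

text \<open>This is where progressivity of the class enters: expectations under \<open>P r w\<close>
  become measurable in time and path jointly.\<close>

lemma P_kernel_joint: assumes "0 <= u"
 shows "(%p. P (fst p) (snd p)) \<in> measurable (restrict_space borel {0..u} \<Otimes>\<^sub>M Fo u) (subprob_algebra FF)"
proof (rule measurable_subprob_algebra)
 fix A :: "'e path set" assume A: "A \<in> sets FF"
 have e: "{r \<in> {0..}. r <= u} = {0..u}" by auto
 have "u \<in> {0..}" using assms by simp
 from bspec[OF bspec[OF progr[unfolded progressive_class_def] A, unfolded progressive_on_def] this]
 have "(%(r, w). measure (P r w) A) \<in> borel_measurable (restrict_space borel {0..u} \<Otimes>\<^sub>M Fo u)"
  unfolding e .
 then have "(%p. ennreal (measure (P (fst p) (snd p)) A)) \<in> borel_measurable (restrict_space borel {0..u} \<Otimes>\<^sub>M Fo u)"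
  by (simp add: split_beta')
 then show "(%p. emeasure (P (fst p) (snd p)) A) \<in> borel_measurable (restrict_space borel {0..u} \<Otimes>\<^sub>M Fo u)"
 proof (rule measurable_cong[THEN iffD1, rotated])
  fix p :: "real \<times> 'e path" assume "p \<in> space (restrict_space borel {0..u} \<Otimes>\<^sub>M Fo u)"
  then have "0 <= fst p" "snd p \<in> Omega" by (auto simp: space_pair_measure space_restrict_space)
  then show "ennreal (measure (P (fst p) (snd p)) A) = emeasure (P (fst p) (snd p)) A" by (simp add: P_emeasure)
 qed
next
 fix p :: "real \<times> 'e path" assume "p \<in> space (restrict_space borel {0..u} \<Otimes>\<^sub>M Fo u)"
 then have p: "0 <= fst p" "snd p \<in> Omega" by (auto simp: space_pair_measure space_restrict_space)
 show "subprob_space (P (fst p) (snd p))" using P_prob(1)[OF p] by (rule prob_space_imp_subprob_space)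
 show "sets (P (fst p) (snd p)) = sets FF" by (rule P_prob(3)[OF p])
qed

lemma sub_Fp: assumes "0 <= s" "\<eta> \<in> Omega" shows "subalgebra (P s \<eta>) (Fp t)"
 using P_prob[OF assms] Fp_FF by (auto simp: subalgebra_def)

text \<open>The Markov property for the filtration \<open>Fp\<close>, as an identity of measures:
  restarting the law at time \<open>t\<close> does not change it, also after restriction to an event
  known at \<open>t\<close>. In this form it applies to all nonnegative functions at once.\<close>

lemma Markov_bind:
 assumes s: "0 <= s" "\<eta> \<in> Omega" "s <= t" and F: "F \<in> sets (Fp t)"
 shows "density (P s \<eta>) (indicator F) \<bind> P t = density (P s \<eta>) (indicator F)"
proof -
 let ?Q = "P s \<eta>" and ?D = "density (P s \<eta>) (indicator F)"
 interpret Q: prob_space ?Q by (rule P_prob[OF s(1,2)])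
 have FQ: "F \<in> sets ?Q" "F \<in> sets FF" using F Fp_FF P_prob(3)[OF s(1,2)] by auto
 have sD: "sets ?D = sets FF" "space ?D = Omega" using P_prob[OF s(1,2)] by auto
 have k: "P t \<in> measurable ?D (subprob_algebra FF)"
  unfolding measurable_cong_sets[OF sD(1) refl] by (rule P_kernel_FF) (use s in simp)
 have ne: "space ?D \<noteq> {}" using Q.not_empty by simp
 interpret S: finite_measure_subalgebra ?Q "Fp t" by unfold_locales (rule sub_Fp[OF s(1,2)])
 show ?thesis
 proof (rule measure_eqI)
  show "sets (?D \<bind> P t) = sets ?D" using sets_bind[OF sets_kernel[OF k] ne] sD by auto
  fix A assume "A \<in> sets (?D \<bind> P t)"
  then have A: "A \<in> sets FF" using sets_bind[OF sets_kernel[OF k] ne] by auto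
  then have AQ: "A \<in> sets ?Q" using P_prob(3)[OF s(1,2)] by auto
  have mm: "(%w. measure (P t w) A) \<in> borel_measurable ?Q"
   using measurable_compose[OF P_kernel_FF measurable_measure_subprob_algebra[OF A]] s by (simp add: meas_P)
  have ce: "AE w in ?Q. real_cond_exp ?Q (Fp t) (indicator A) w = measure (P t w) A"
   using rcc s A unfolding right_cont_cond_class_def by blast
  have Ai: "integrable ?Q (indicator A :: _ => real)" using AQ by (auto simp: less_top[symmetric])
  have "emeasure (?D \<bind> P t) A = (\<integral>\<^sup>+w. emeasure (P t w) A \<partial>?D)" by (rule emeasure_bind[OF ne k A])
  also have "\<dots> = (\<integral>\<^sup>+w. indicator F w * emeasure (P t w) A \<partial>?Q)"
  proof (rule nn_integral_density)
   show "(%w. emeasure (P t w) A) \<in> borel_measurable ?Q"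
    unfolding meas_P[OF s(1,2)]
    by (rule measurable_compose[OF P_kernel_FF measurable_emeasure_subprob_algebra[OF A]]) (use s in simp)
  qed (use FQ in auto)
  also have "\<dots> = (\<integral>\<^sup>+w. ennreal (indicator F w * measure (P t w) A) \<partial>?Q)"
   using s by (intro nn_integral_cong) (auto simp: P_emeasure P_prob(2) indicator_def)
  also have "\<dots> = ennreal (LINT w|?Q. indicator F w * measure (P t w) A)"
  proof (rule nn_integral_eq_integral)
   show "integrable ?Q (%w. indicator F w * measure (P t w) A)"
   proof (rule Q.integrable_const_bound[where B=1])
    show "AE w in ?Q. norm (indicator F w * measure (P t w) A) <= 1"
    proof (rule AE_I2)
     fix w assume "w \<in> space ?Q"
     then interpret Pt: prob_space "P t w" using s P_prob(2)[OF s(1,2)] by (intro P_prob) auto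
     show "norm (indicator F w * measure (P t w) A) <= 1" by (auto simp: indicator_def)
    qed
   qed (use mm FQ in auto)
  qed simp
  also have "(LINT w|?Q. indicator F w * measure (P t w) A) = (LINT w:F|?Q. real_cond_exp ?Q (Fp t) (indicator A) w)"
   unfolding set_lebesgue_integral_def
   by (rule integral_cong_AE) (use mm FQ ce in auto)
  also have "\<dots> = (LINT w:F|?Q. indicator A w)" by (rule S.real_cond_exp_intA[OF Ai F, symmetric])
  also have "ennreal \<dots> = emeasure ?D A"
  proof -
   have "(LINT w:F|?Q. indicator A w) = measure ?Q (F \<inter> A)"
    unfolding set_lebesgue_integral_def using FQ AQ by (simp add: indicator_inter_arith[symmetric])
   moreover have "emeasure ?D A = (\<integral>\<^sup>+w. indicator (F \<inter> A) w \<partial>?Q)"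
   proof -
    have "emeasure ?D A = (\<integral>\<^sup>+w. indicator F w * indicator A w \<partial>?Q)"
     by (rule emeasure_density) (use FQ AQ in auto)
    then show ?thesis by (simp only: indicator_inter_arith)
   qed
   moreover have "\<dots> = emeasure ?Q (F \<inter> A)" using FQ AQ by (intro nn_integral_indicator) auto
   ultimately show ?thesis by (simp add: Q.emeasure_eq_measure)
  qed
  finally show "emeasure (?D \<bind> P t) A = emeasure ?D A" .
 qed
qed

lemma Markov_nn:
 assumes s: "0 <= s" "\<eta> \<in> Omega" "s <= t" and F: "F \<in> sets (Fp t)" and \<phi>: "\<phi> \<in> borel_measurable FF"
 shows "(\<integral>\<^sup>+w. indicator F w * (\<integral>\<^sup>+w'. \<phi> w' \<partial>P t w) \<partial>P s \<eta>) = (\<integral>\<^sup>+w. indicator F w * \<phi> w \<partial>P s \<eta>)" (is ?g0)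
  and "(%w. \<integral>\<^sup>+w'. \<phi> w' \<partial>P t w) \<in> borel_measurable (Fo t)" (is ?g1)
proof -
 let ?D = "density (P s \<eta>) (indicator F)"
 have FQ: "F \<in> sets (P s \<eta>)" "F \<in> sets FF" using F Fp_FF P_prob(3)[OF s(1,2)] by auto
 have sD: "sets ?D = sets FF" using P_prob[OF s(1,2)] by auto
 have k: "P t \<in> measurable ?D (subprob_algebra FF)"
  unfolding measurable_cong_sets[OF sD refl] by (rule P_kernel_FF) (use s in simp)
 have m: "(%w. \<integral>\<^sup>+w'. \<phi> w' \<partial>P t w) \<in> borel_measurable FF"
  using measurable_compose[OF P_kernel_FF nn_integral_measurable_subprob_algebra[OF \<phi>]] s by simp
 show ?g1
  using measurable_compose[OF P_kernel nn_integral_measurable_subprob_algebra[OF \<phi>]] s by simp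
 have "(\<integral>\<^sup>+w. indicator F w * (\<integral>\<^sup>+w'. \<phi> w' \<partial>P t w) \<partial>P s \<eta>) = (\<integral>\<^sup>+w. (\<integral>\<^sup>+w'. \<phi> w' \<partial>P t w) \<partial>?D)"
  using m FQ s by (intro nn_integral_density[symmetric]) (auto simp: meas_P)
 also have "\<dots> = (\<integral>\<^sup>+w. \<phi> w \<partial>(?D \<bind> P t))" by (rule nn_integral_bind[OF \<phi> k, symmetric])
 also have "\<dots> = (\<integral>\<^sup>+w. \<phi> w \<partial>?D)" unfolding Markov_bind[OF s F] ..
 also have "\<dots> = (\<integral>\<^sup>+w. indicator F w * \<phi> w \<partial>P s \<eta>)"
  using \<phi> FQ s by (intro nn_integral_density) (auto simp: meas_P)
 finally show ?g0 .
qed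

text \<open>Positive and negative parts are treated separately. Integrability under every
  \<open>P t w\<close> makes the inner integral a genuine difference of two finite parts at each
  path.\<close>

lemma Markov_real:
 fixes \<phi> :: "'e path => real"
 assumes s: "0 <= s" "\<eta> \<in> Omega" "s <= t" and F: "F \<in> sets (Fp t)" and \<phi>: "\<phi> \<in> borel_measurable FF"
  and i: "integrable (P s \<eta>) \<phi>" and it: "\<And>w. w \<in> Omega ==> integrable (P t w) \<phi>"
 shows "(%w. \<integral>w'. \<phi> w' \<partial>P t w) \<in> borel_measurable (Fo t)" (is ?g0)
  and "integrable (P s \<eta>) (%w. \<integral>w'. \<phi> w' \<partial>P t w)" (is ?g1)
  and "(LINT w:F|P s \<eta>. (LINT w'|P t w. \<phi> w')) = (LINT w:F|P s \<eta>. \<phi> w)" (is ?g2)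
proof -
 define p where "p w = (\<integral>\<^sup>+w'. ennreal (\<phi> w') \<partial>P t w)" for w
 define n where "n w = (\<integral>\<^sup>+w'. ennreal (- \<phi> w') \<partial>P t w)" for w
 have m: "(%w. ennreal (\<phi> w)) \<in> borel_measurable FF" "(%w. ennreal (- \<phi> w)) \<in> borel_measurable FF" using \<phi> by auto
 have pm: "p \<in> borel_measurable (Fo t)" "n \<in> borel_measurable (Fo t)"
  unfolding p_def[abs_def] n_def[abs_def] by (rule Markov_nn(2)[OF s F m(1)], rule Markov_nn(2)[OF s F m(2)])
 have pn: "(LINT w'|P t w. \<phi> w') = enn2real (p w) - enn2real (n w)" if "w \<in> Omega" for w
  unfolding p_def n_def by (rule real_lebesgue_integral_def[OF it[OF that]])
 have fin: "p w < \<infinity>" "n w < \<infinity>" if "w \<in> Omega" for w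
  using it[OF that] unfolding p_def n_def real_integrable_def by (auto simp: less_top)
 show ?g0
  using pm by (subst measurable_cong[OF pn]) auto
 have pF: "p \<in> borel_measurable (P s \<eta>)" "n \<in> borel_measurable (P s \<eta>)"
  using pm[THEN measurable_from_subalg[rotated], of FF] Fo_FF s by (auto simp: meas_P subalgebra_def)
 have \<phi>P: "\<phi> \<in> borel_measurable (P s \<eta>)" using \<phi> s by (simp add: meas_P)
 have spP: "space (P s \<eta>) = Omega" by (rule P_prob[OF s(1,2)])
 have "Omega \<in> sets (Fp t)" using sets.top[of "Fp t"] by simp
 note tot = Markov_nn(1)[OF s this m(1)] Markov_nn(1)[OF s this m(2)]
 have totp: "(\<integral>\<^sup>+w. p w \<partial>P s \<eta>) = (\<integral>\<^sup>+w. ennreal (\<phi> w) \<partial>P s \<eta>)" "(\<integral>\<^sup>+w. n w \<partial>P s \<eta>) = (\<integral>\<^sup>+w. ennreal (- \<phi> w) \<partial>P s \<eta>)"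
  using tot unfolding p_def n_def by (auto simp: spP cong: nn_integral_cong_simp)
 have ip: "integrable (P s \<eta>) (%w. enn2real (p w))" "integrable (P s \<eta>) (%w. enn2real (n w))"
 proof -
  have "(\<integral>\<^sup>+w. ennreal (norm (enn2real (p w))) \<partial>P s \<eta>) = (\<integral>\<^sup>+w. p w \<partial>P s \<eta>)" "(\<integral>\<^sup>+w. ennreal (norm (enn2real (n w))) \<partial>P s \<eta>) = (\<integral>\<^sup>+w. n w \<partial>P s \<eta>)"
   using fin by (auto intro!: nn_integral_cong simp: spP)
  moreover have "(\<integral>\<^sup>+w. ennreal (\<phi> w) \<partial>P s \<eta>) < \<infinity>" "(\<integral>\<^sup>+w. ennreal (- \<phi> w) \<partial>P s \<eta>) < \<infinity>"
   using i unfolding real_integrable_def by (auto simp: less_top)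
  ultimately show "integrable (P s \<eta>) (%w. enn2real (p w))" "integrable (P s \<eta>) (%w. enn2real (n w))"
   using pF totp by (auto intro!: integrableI_bounded)
 qed
 show ?g1
  by (subst Bochner_Integration.integrable_cong[OF refl pn]) (use ip in \<open>auto simp: spP\<close>)
 have FQ: "F \<in> sets (P s \<eta>)" "F \<in> sets FF" using F Fp_FF P_prob(3)[OF s(1,2)] by auto
 have setI: "set_integrable (P s \<eta>) F f" if "integrable (P s \<eta>) f" for f :: "_ => real"
  unfolding set_integrable_def by (rule integrable_mult_indicator[OF FQ(1) that])
 have part: "(LINT w:F|P s \<eta>. enn2real (\<integral>\<^sup>+w'. ennreal (\<psi> w') \<partial>P t w)) = (LINT w:F|P s \<eta>. max 0 (\<psi> w))"
  if \<psi>: "\<psi> \<in> borel_measurable FF" "\<And>w. w \<in> Omega ==> (\<integral>\<^sup>+w'. ennreal (\<psi> w') \<partial>P t w) < \<infinity>" for \<psi>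
 proof -
  have mm: "(%w. \<integral>\<^sup>+w'. ennreal (\<psi> w') \<partial>P t w) \<in> borel_measurable (P s \<eta>)"
   using Markov_nn(2)[OF s F, of "%w. ennreal (\<psi> w)"] \<psi>(1) measurable_from_subalg[of FF "Fo t"] Fo_FF s by (auto simp: meas_P subalgebra_def)
  have "(LINT w:F|P s \<eta>. enn2real (\<integral>\<^sup>+w'. ennreal (\<psi> w') \<partial>P t w)) = enn2real (\<integral>\<^sup>+w. ennreal (indicator F w * enn2real (\<integral>\<^sup>+w'. ennreal (\<psi> w') \<partial>P t w)) \<partial>P s \<eta>)"
   unfolding set_lebesgue_integral_def using mm FQ by (subst integral_eq_nn_integral) auto
  also have "(\<integral>\<^sup>+w. ennreal (indicator F w * enn2real (\<integral>\<^sup>+w'. ennreal (\<psi> w') \<partial>P t w)) \<partial>P s \<eta>) = (\<integral>\<^sup>+w. indicator F w * (\<integral>\<^sup>+w'. ennreal (\<psi> w') \<partial>P t w) \<partial>P s \<eta>)"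
   using \<psi>(2) by (intro nn_integral_cong) (auto simp: indicator_def spP)
  also have "\<dots> = (\<integral>\<^sup>+w. indicator F w * ennreal (\<psi> w) \<partial>P s \<eta>)"
   by (rule Markov_nn(1)[OF s F]) (use \<psi>(1) in auto)
  also have "\<dots> = (\<integral>\<^sup>+w. ennreal (indicator F w * max 0 (\<psi> w)) \<partial>P s \<eta>)"
   by (intro nn_integral_cong) (auto simp: indicator_def max_def ennreal_neg)
  also have "enn2real \<dots> = (LINT w:F|P s \<eta>. max 0 (\<psi> w))"
   unfolding set_lebesgue_integral_def using \<psi>(1) FQ s by (subst integral_eq_nn_integral) (auto simp: meas_P)
  finally show ?thesis .
 qed
 have "(LINT w:F|P s \<eta>. (LINT w'|P t w. \<phi> w')) = (LINT w:F|P s \<eta>. (enn2real (p w) - enn2real (n w)))"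
  unfolding set_lebesgue_integral_def by (intro Bochner_Integration.integral_cong) (auto simp: pn spP)
 also have "\<dots> = (LINT w:F|P s \<eta>. enn2real (p w)) - (LINT w:F|P s \<eta>. enn2real (n w))"
  by (rule set_integral_diff(2)[OF setI[OF ip(1)] setI[OF ip(2)]])
 also have "\<dots> = (LINT w:F|P s \<eta>. max 0 (\<phi> w)) - (LINT w:F|P s \<eta>. max 0 (- \<phi> w))"
  unfolding p_def n_def using part[of \<phi>] part[of "%w. - \<phi> w"] \<phi> fin by (simp add: p_def n_def)
 also have "\<dots> = (LINT w:F|P s \<eta>. (max 0 (\<phi> w) - max 0 (- \<phi> w)))"
  using i by (intro set_integral_diff(2)[symmetric] setI) auto
 also have "\<dots> = (LINT w:F|P s \<eta>. \<phi> w)"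
  unfolding set_lebesgue_integral_def by (intro Bochner_Integration.integral_cong) (auto simp: max_def)
 finally show ?g2 .
qed

text \<open>\<open>P t \<eta>\<close> is concentrated on paths that agree with \<eta> up to
  \<open>t\<close>, and \<psi> sees nothing else of the path.\<close>

lemma AE_determined:
 fixes \<psi> :: "'e path => real"
 assumes "0 <= t" "\<eta> \<in> Omega" "\<psi> \<in> borel_measurable (Fo t)"
 shows "AE w in P t \<eta>. \<psi> w = \<psi> \<eta>"
 using P_prob(4)[OF assms(1,2)] AE_space
 by eventually_elim (rule Fo_function_determined[OF assms(3)], auto simp: P_prob assms)

lemma sets_Fc: assumes "0 <= s" "\<eta> \<in> Omega"
 shows "sets (Fc (P s \<eta>) t) = sigma_sets Omega (sets (Fp t) \<union> null_sets (Pc s \<eta>))"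
proof -
 have "sets (Fp t) \<union> null_sets (Pc s \<eta>) \<subseteq> Pow Omega"
  using sets.sets_into_space[of _ "Fp t"] sets.sets_into_space[of _ "Pc s \<eta>"] P_prob(2)[OF assms]
  by (auto simp: null_sets_def)
 then show ?thesis unfolding Fc_def by (rule sets_measure_of)
qed

lemma filtered: assumes s: "s \<in> {0..T}" "\<eta> \<in> Omega"
 shows "filtered_clock W T \<nu> (Pc s \<eta>) (Fc (P s \<eta>)) s"
proof -
 have s0: "0 <= s" using s by simp
 interpret Q: prob_space "P s \<eta>" by (rule P_prob[OF s0 s(2)])
 have pc: "prob_space (Pc s \<eta>)" by (rule prob_spaceI) (simp add: Q.emeasure_space_1)
 show ?thesis
 proof (intro filtered_clock.intro filtered_clock_axioms.intro pc clock_axioms)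
  show "0 <= s" "s <= T" using s by auto
  show "subalgebra (Pc s \<eta>) (Fc (P s \<eta>) t)" for t
  proof -
   have "sets (Fp t) \<union> null_sets (Pc s \<eta>) \<subseteq> sets (Pc s \<eta>)"
    using Fp_FF P_prob(3)[OF s0 s(2)] by (auto simp: null_sets_def)
   from sets.sigma_sets_subset[OF this] show ?thesis
    unfolding subalgebra_def sets_Fc[OF s0 s(2)] by (simp add: P_prob[OF s0 s(2)])
  qed
  show "sets (Fc (P s \<eta>) t) \<subseteq> sets (Fc (P s \<eta>) u)" if "t <= u" for t u
   unfolding sets_Fc[OF s0 s(2)] using Fp_mono[OF that] by (intro sigma_sets_mono') auto
 qed
qed

lemma Fp_Fc: assumes "0 <= s" "\<eta> \<in> Omega" shows "sets (Fp t) \<subseteq> sets (Fc (P s \<eta>) t)"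
 unfolding sets_Fc[OF assms] by (auto intro: sigma_sets.Basic)

lemma meas_Fo_Fc: assumes "0 <= s" "\<eta> \<in> Omega" "f \<in> borel_measurable (Fo t)" shows "f \<in> borel_measurable (Fc (P s \<eta>) t)"
 by (rule measurable_from_subalg[OF _ assms(3)]) (use Fp_Fc[OF assms(1,2)] Fo_Fp in \<open>auto simp: subalgebra_def\<close>)

lemma progressive_prog:
 assumes s: "s \<in> {0..T}" "\<eta> \<in> Omega" and X: "progressive_on {0..T} Fo X"
 shows "filtered_clock.prog T (Fc (P s \<eta>)) s X"
proof -
 interpret F: filtered_clock W T \<nu> "Pc s \<eta>" "Fc (P s \<eta>)" s by (rule filtered[OF s])
 show ?thesis unfolding F.prog_def split_beta'
 proof
  fix u assume u: "u \<in> {s..T}"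
  have sub: "subalgebra (borel \<Otimes>\<^sub>M Fc (P s \<eta>) u) ((borel :: real measure) \<Otimes>\<^sub>M Fo u)"
  proof -
   have "sets (Fo u) \<subseteq> sets (Fc (P s \<eta>) u)" using Fp_Fc[of s \<eta> u] Fo_Fp[of u] s by auto
   then have "sets ((borel :: real measure) \<Otimes>\<^sub>M Fo u) \<subseteq> sets (borel \<Otimes>\<^sub>M Fc (P s \<eta>) u)"
    by (intro sets_pair_in_sets) auto
   then show ?thesis by (simp add: subalgebra_def space_pair_measure)
  qed
  have "(%p. indicator {0..u} (fst p) * X (fst p) (snd p)) \<in> borel_measurable (borel \<Otimes>\<^sub>M Fo u)"
   using X u s unfolding progressive_on_Icc_iff by auto
  from measurable_from_subalg[OF sub this]
  have [measurable]: "(%p. indicator {0..u} (fst p) * X (fst p) (snd p)) \<in> borel_measurable (borel \<Otimes>\<^sub>M Fc (P s \<eta>) u)" .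
  have "(%p. indicator {s..u} (fst p) * (indicator {0..u} (fst p) * X (fst p) (snd p))) \<in> borel_measurable (borel \<Otimes>\<^sub>M Fc (P s \<eta>) u)" by measurable
  also have "(%p. indicator {s..u} (fst p) * (indicator {0..u} (fst p) * X (fst p) (snd p))) = (%p. indicator {s..u} (fst p) * X (fst p) (snd p))"
   using s by (auto simp: indicator_def fun_eq_iff)
  finally show "(%p. indicator {s..u} (fst p) * X (fst p) (snd p)) \<in> borel_measurable (borel \<Otimes>\<^sub>M Fc (P s \<eta>) u)" .
 qed
qed

text \<open>The sets that agree almost surely with a member of \<open>Fp t\<close> form a
  sigma-algebra containing the null sets. This carries the Markov property over to the completed
  filtration.\<close>

lemma Fc_approx:
 assumes s: "0 <= s" "\<eta> \<in> Omega" and A: "A \<in> sets (Fc (P s \<eta>) t)"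
 shows "\<exists>A'\<in>sets (Fp t). AE w in Pc s \<eta>. w \<in> A \<longleftrightarrow> w \<in> A'"
 using A unfolding sets_Fc[OF s]
proof induction
 case (Basic a)
 then show ?case
 proof
  assume "a \<in> null_sets (Pc s \<eta>)"
  then have "AE w in Pc s \<eta>. w \<notin> a" by (rule AE_not_in)
  then show ?thesis by (intro bexI[of _ "{}"]) auto
 qed auto
next
 case Empty
 then show ?case by (intro bexI[of _ "{}"]) auto
next
 case (Compl a)
 then obtain A' where A': "A' \<in> sets (Fp t)" "AE w in Pc s \<eta>. w \<in> a \<longleftrightarrow> w \<in> A'" by blast
 have "Omega - A' \<in> sets (Fp t)" using sets.compl_sets[OF A'(1)] by simp
 moreover have "AE w in Pc s \<eta>. w \<in> Omega - a \<longleftrightarrow> w \<in> Omega - A'"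
  using A'(2) by eventually_elim auto
 ultimately show ?case by blast
next
 case (Union a)
 then obtain A' where A': "\<And>i. A' i \<in> sets (Fp t)" "\<And>i. AE w in Pc s \<eta>. w \<in> a i \<longleftrightarrow> w \<in> A' i" by metis
 have "AE w in Pc s \<eta>. \<forall>i. w \<in> a i \<longleftrightarrow> w \<in> A' i" using A'(2) by (simp add: AE_all_countable)
 then have "AE w in Pc s \<eta>. w \<in> (\<Union>i. a i) \<longleftrightarrow> w \<in> (\<Union>i. A' i)" by eventually_elim auto
 then show ?case using A'(1) by (intro bexI[of _ "\<Union>i. A' i"]) auto
qed

lemma Markov_Fc:
 fixes \<phi> :: "'e path => real"
 assumes s: "s \<in> {0..T}" "\<eta> \<in> Omega" "s <= t" and A: "A \<in> sets (Fc (P s \<eta>) t)" and \<phi>: "\<phi> \<in> borel_measurable FF"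
  and i: "integrable (P s \<eta>) \<phi>" and it: "\<And>w. w \<in> Omega ==> integrable (P t w) \<phi>"
 shows "(LINT w:A|Pc s \<eta>. \<phi> w) = (LINT w:A|Pc s \<eta>. (LINT w'|P t w. \<phi> w'))"
proof -
 interpret F: filtered_clock W T \<nu> "Pc s \<eta>" "Fc (P s \<eta>)" s by (rule filtered[OF s(1,2)])
 have s0: "0 <= s" using s by simp
 obtain A' where A': "A' \<in> sets (Fp t)" "AE w in Pc s \<eta>. w \<in> A \<longleftrightarrow> w \<in> A'" using Fc_approx[OF s0 s(2) A] by blast
 have A'Q: "A' \<in> sets (P s \<eta>)" using A'(1) Fp_FF P_prob(3)[OF s0 s(2)] by auto
 have red: "(LINT w:A|Pc s \<eta>. f w) = (LINT w:A'|P s \<eta>. f w)" if f: "f \<in> borel_measurable (P s \<eta>)" for f :: "_ => real"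
 proof -
  have fc: "f \<in> borel_measurable (Pc s \<eta>)" using f by (rule measurable_completion)
  have "(LINT w:A|Pc s \<eta>. f w) = (LINT w:A'|Pc s \<eta>. f w)"
   unfolding set_lebesgue_integral_def
  proof (rule integral_cong_AE)
   show "AE w in Pc s \<eta>. indicator A w *\<^sub>R f w = indicator A' w *\<^sub>R f w"
    using A'(2) by eventually_elim (auto simp: indicator_def)
  qed (use F.G_sets[OF A] sets_completionI_sets[OF A'Q] fc in auto)
  also have "\<dots> = (LINT w:A'|P s \<eta>. f w)"
   unfolding set_lebesgue_integral_def by (rule integral_completion) (use f A'Q in auto)
  finally show ?thesis .
 qed
 note M = Markov_real[OF s0 s(2,3) A'(1) \<phi> i it]
 have "(LINT w:A|Pc s \<eta>. \<phi> w) = (LINT w:A'|P s \<eta>. \<phi> w)" by (rule red) (use i in auto)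
 also have "\<dots> = (LINT w:A'|P s \<eta>. (LINT w'|P t w. \<phi> w'))" using M(3) by simp
 also have "\<dots> = (LINT w:A|Pc s \<eta>. (LINT w'|P t w. \<phi> w'))"
  by (rule red[symmetric]) (use M(2) in auto)
 finally show ?thesis .
qed

section \<open>Martingale pairs and bracket densities valid for all initial conditions\<close>

definition Mm :: "real => 'e proc => 'e proc => 'e proc" where
 "Mm s Y g t w = Y t w + (LINT r:{s..t}|\<nu>. g r w)"

text \<open>The increment of \<open>Mm\<close>, written so that the starting time \<open>s\<close>
  does not occur. The two agree on paths along which \<open>g\<close> is integrable, hence almost
  surely.\<close>

definition dM :: "'e proc => 'e proc => real => real => 'e path => real" where
 "dM Y g t u w = Y u w - Y t w + (LINT r:{t..u}|\<nu>. g r w)"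

text \<open>The conditional covariance of the increments given time \<open>t\<close>, evaluated
  through the kernel. It is defined at every \<open>(t, w)\<close> and refers to no initial
  condition \<open>(s, \<eta>)\<close>.\<close>

definition Ecov :: "'e proc => 'e proc => 'e proc => 'e proc => real => real => 'e path => real" where
 "Ecov Y g X h t u w = (LINT w'|P t w. dM Y g t u w' * dM X h t u w')"

text \<open>\<open>Y\<close> has drift \<open>- g\<close> under every law of the class. The
  mean-value identity is required at each \<open>(t, w)\<close>; by the Markov property it becomes
  the martingale property of \<open>Mm s Y g\<close> under each \<open>P s \<eta>\<close>.\<close>

definition mp :: "'e proc => 'e proc => bool" where
 "mp Y g \<longleftrightarrow> Luni P T V Y \<and> Luni P T V g \<and> (\<forall>t\<in>{0..T}. \<forall>u\<in>{t..T}. \<forall>w\<in>Omega.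
   integrable (P t w) (%w'. (Y u w')^2) \<and> (LINT w'|P t w. Y u w' + (LINT r:{t..u}|\<nu>. g r w')) = Y t w)"

abbreviation rep where
 "rep s \<eta> M N Z \<equiv> filtered_clock.repr T \<nu> (Pc s \<eta>) (Fc (P s \<eta>)) s M N Z"

lemma integral_comp:
 fixes f :: "'e path => real"
 assumes "0 <= s" "\<eta> \<in> Omega" "f \<in> borel_measurable FF"
 shows "(LINT w|Pc s \<eta>. f w) = (LINT w|P s \<eta>. f w)" "integrable (Pc s \<eta>) f \<longleftrightarrow> integrable (P s \<eta>) f"
 using assms by (auto intro!: integral_completion integrable_completion simp: meas_P)

lemma Luni_D:
 assumes X: "Luni P T V X" and s: "s \<in> {0..T}" "\<eta> \<in> Omega"
 shows "filtered_clock.prog T (Fc (P s \<eta>)) s X" "filtered_clock.N2 T \<nu> (Pc s \<eta>) s X < \<infinity>"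
  "filtered_clock.jm T \<nu> (Pc s \<eta>) s X"
proof -
 interpret F: filtered_clock W T \<nu> "Pc s \<eta>" "Fc (P s \<eta>)" s by (rule filtered[OF s])
 show p: "F.prog X" using X by (intro progressive_prog[OF s]) (simp add: Luni_def)
 show "F.N2 X < \<infinity>" using X s by (simp add: Luni_def F.N2_def nn_integral_completion)
 show "F.jm X" by (rule F.jm_prog[OF p])
qed

lemma progressive_sec:
 assumes X: "progressive_on {0..T} Fo X" and t: "t \<in> {0..T}" shows "X t \<in> borel_measurable (Fo t)"
proof -
 have "(%p. indicator {0..t} (fst p) * X (fst p) (snd p)) \<in> borel_measurable (borel \<Otimes>\<^sub>M Fo t)"
  using X t unfolding progressive_on_Icc_iff by auto
 moreover have "(%w. (t, w)) \<in> measurable (Fo t) (borel \<Otimes>\<^sub>M Fo t)" by simp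
 ultimately have "(%w. indicator {0..t} (fst (t, w)) * X (fst (t, w)) (snd (t, w))) \<in> borel_measurable (Fo t)"
  by (rule measurable_compose[rotated])
 then show ?thesis using t by simp
qed

lemma progressive_int_meas:
 assumes X: "progressive_on {0..T} Fo X" and t: "0 <= t" "t <= u" "u <= T" shows "(%w. LINT r:{t..u}|\<nu>. X r w) \<in> borel_measurable (Fo u)"
proof -
 have "(%p. indicator {0..u} (fst p) * X (fst p) (snd p)) \<in> borel_measurable (borel \<Otimes>\<^sub>M Fo u)"
  using X t unfolding progressive_on_Icc_iff by auto
 moreover have "(%p. (snd p, fst p)) \<in> measurable (Fo u \<Otimes>\<^sub>M \<nu>) (borel \<Otimes>\<^sub>M Fo u)" by (simp cong: measurable_cong_sets)
 ultimately have "(%p. indicator {0..u} (fst (snd p, fst p)) * X (fst (snd p, fst p)) (snd (snd p, fst p))) \<in> borel_measurable (Fo u \<Otimes>\<^sub>M \<nu>)"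
  by (rule measurable_compose[rotated])
 then have [measurable]: "(%p. indicator {0..u} (snd p) * X (snd p) (fst p)) \<in> borel_measurable (Fo u \<Otimes>\<^sub>M \<nu>)" by simp
 have "(%p. indicator {t..u} (snd p) * (indicator {0..u} (snd p) * X (snd p) (fst p))) \<in> borel_measurable (Fo u \<Otimes>\<^sub>M \<nu>)" by measurable
 also have "(%p. indicator {t..u} (snd p) * (indicator {0..u} (snd p) * X (snd p) (fst p))) = (%(w, r). indicator {t..u} r *\<^sub>R X r w)"
  using t by (auto simp: indicator_def fun_eq_iff)
 finally show ?thesis unfolding set_lebesgue_integral_def by (rule nu.borel_measurable_lebesgue_integral)
qed

lemma Luni_progressive: "Luni P T V X ==> progressive_on {0..T} Fo X"
 by (simp add: Luni_def)

lemmas Luni_sec = progressive_sec[OF Luni_progressive]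
lemmas Luni_int_meas = progressive_int_meas[OF Luni_progressive]

lemma Luni_int_L2:
 assumes X: "Luni P T V X" and s: "s \<in> {0..T}" "\<eta> \<in> Omega" and t: "s <= t" "t <= u" "u <= T"
 shows "integrable (P s \<eta>) (%w. (LINT r:{t..u}|\<nu>. X r w)^2)"
proof -
 interpret F: filtered_clock W T \<nu> "Pc s \<eta>" "Fc (P s \<eta>)" s by (rule filtered[OF s])
 have m: "(%w. LINT r:{t..u}|\<nu>. X r w) \<in> borel_measurable FF"
  by (rule meas_Fo_FF[OF Luni_int_meas[OF X]]) (use s t in auto)
 have "integrable (Pc s \<eta>) (%w. (F.nI t u X w)^2)"
  by (rule F.nI_L2[OF Luni_D(3,2)[OF X s] t(1,3)])
 then show ?thesis unfolding F.nI_def using m s by (subst (asm) integral_comp(2)) auto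
qed

lemma Luni_AE:
 assumes X: "Luni P T V X" and s: "s \<in> {0..T}" "\<eta> \<in> Omega"
 shows "AE w in Pc s \<eta>. set_integrable \<nu> {s..T} (%r. X r w)" "AE w in P s \<eta>. set_integrable \<nu> {s..T} (%r. X r w)" (is ?g1)
proof -
 interpret F: filtered_clock W T \<nu> "Pc s \<eta>" "Fc (P s \<eta>)" s by (rule filtered[OF s])
 note d = Luni_D[OF X s]
 show 1: "AE w in Pc s \<eta>. set_integrable \<nu> {s..T} (%r. X r w)"
  by (rule F.L1_facts(1)[OF d(1) F.L2_nn_finite[OF d(1,2)]])
 then show ?g1 by (simp add: AE_completion_iff)
qed

lemma mp_D:
 assumes "mp Y g"
 shows "Luni P T V Y" "Luni P T V g"
  "\<And>t u w. t \<in> {0..T} ==> t <= u ==> u <= T ==> w \<in> Omega ==> integrable (P t w) (%w'. (Y u w')^2)"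
  "\<And>t u w. t \<in> {0..T} ==> t <= u ==> u <= T ==> w \<in> Omega ==> (LINT w'|P t w. Y u w' + (LINT r:{t..u}|\<nu>. g r w')) = Y t w"
 using assms by (auto simp: mp_def)

lemma mp_meas:
 assumes "mp Y g" "0 <= t" "t <= u" "u <= T"
 shows "dM Y g t u \<in> borel_measurable FF" (is ?g0) "Y u \<in> borel_measurable FF" "(%w. LINT r:{t..u}|\<nu>. g r w) \<in> borel_measurable FF"
proof -
 have 1: "Y v \<in> borel_measurable FF" if "v \<in> {0..T}" for v using meas_Fo_FF[OF Luni_sec[OF mp_D(1)[OF assms(1)] that]] .
 have 2: "(%w. LINT r:{t..u}|\<nu>. g r w) \<in> borel_measurable FF"
  by (rule meas_Fo_FF[OF Luni_int_meas[OF mp_D(2)[OF assms(1)] assms(2-4)]])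
 show ?g0 unfolding dM_def[abs_def]
  by (intro borel_measurable_add borel_measurable_diff 1 2) (use assms in auto)
 show "Y u \<in> borel_measurable FF" "(%w. LINT r:{t..u}|\<nu>. g r w) \<in> borel_measurable FF" using 1 2 assms by auto
qed

lemma mp_L2:
 assumes m: "mp Y g" and s: "s \<in> {0..T}" "\<eta> \<in> Omega" and t: "s <= t" "t <= u" "u <= T"
 shows "integrable (P s \<eta>) (%w. (dM Y g t u w)^2)" (is ?g0) "integrable (P s \<eta>) (%w. (Y u w + (LINT r:{t..u}|\<nu>. g r w))^2)" (is ?g1)
proof -
 have Ym: "Y v \<in> borel_measurable (P s \<eta>)" if "v \<in> {0..T}" for v
  using meas_Fo_FF[OF Luni_sec[OF mp_D(1)[OF m] that]] s by (simp add: meas_P)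
 have Gm: "(%w. LINT r:{t..u}|\<nu>. g r w) \<in> borel_measurable (P s \<eta>)" using mp_meas(3)[OF m _ t(2,3)] s t by (simp add: meas_P)
 have Y2: "integrable (P s \<eta>) (%w. (Y v w)^2)" if "s <= v" "v <= T" for v by (rule mp_D(3)[OF m s(1) that s(2)])
 have G2: "integrable (P s \<eta>) (%w. (LINT r:{t..u}|\<nu>. g r w)^2)" by (rule Luni_int_L2[OF mp_D(2)[OF m] s t])
 have v: "u \<in> {0..T}" "t \<in> {0..T}" "s <= u" "t <= T" using s t by auto
 show ?g0 unfolding dM_def
  by (intro integrable_L2_add integrable_L2_diff Y2 G2 Ym Gm borel_measurable_diff v t)
 show ?g1
  by (intro integrable_L2_add Y2 G2 Ym Gm v t)
qed

lemma Mm_incr_AE: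
 assumes m: "mp Y g" and s: "s \<in> {0..T}" "\<eta> \<in> Omega" and t: "s <= t" "t <= u" "u <= T"
 shows "AE w in Pc s \<eta>. Mm s Y g u w - Mm s Y g t w = dM Y g t u w"
 using Luni_AE(1)[OF mp_D(2)[OF m] s]
proof eventually_elim
 case (elim w)
 have "set_integrable \<nu> {s..u} (%r. g r w)" by (rule set_integrable_subset[OF elim]) (use t in auto)
 from set_integral_split[OF this t(1,2)] show ?case by (simp add: Mm_def dM_def)
qed

lemma P_finite: "0 <= s ==> \<eta> \<in> Omega ==> finite_measure (P s \<eta>)"
 using P_prob(1) by (simp add: prob_space_def)

lemma mp_l2m:
 assumes m: "mp Y g" and s: "s \<in> {0..T}" "\<eta> \<in> Omega"
 shows "filtered_clock.l2m T (Pc s \<eta>) (Fc (P s \<eta>)) s (Mm s Y g)"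
proof -
 interpret F: filtered_clock W T \<nu> "Pc s \<eta>" "Fc (P s \<eta>)" s by (rule filtered[OF s])
 have s0: "0 <= s" using s by simp
 have Mmm: "Mm s Y g t \<in> borel_measurable (Fo t)" if "t \<in> {s..T}" for t
  unfolding Mm_def[abs_def] using Luni_sec[OF mp_D(1)[OF m], of t] Luni_int_meas[OF mp_D(2)[OF m] s0, of t] that s by auto
 have L2: "integrable (Pc s \<eta>) (%w. (Mm s Y g t w)^2)" if t: "t \<in> {s..T}" for t
 proof -
  have "(%w. (Mm s Y g t w)^2) \<in> borel_measurable FF" using meas_Fo_FF[OF Mmm[OF t]] by measurable
  then show ?thesis using mp_L2(2)[OF m s order_refl, of t] t s0 s(2) by (subst integral_comp(2)) (auto simp: Mm_def)
 qed
 have Li: "integrable (Pc s \<eta>) (Mm s Y g t)" if t: "t \<in> {s..T}" for t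
  by (rule F.Q.integrable_of_L2[OF F.G_meas[OF meas_Fo_Fc[OF s0 s(2) Mmm[OF t]]] L2[OF t]])
 have mart: "(LINT w:A|Pc s \<eta>. Mm s Y g u w) = (LINT w:A|Pc s \<eta>. Mm s Y g t w)"
  if t: "s <= t" "t <= u" "u <= T" and A: "A \<in> sets (Fc (P s \<eta>) t)" for t u A
 proof -
  define \<phi> where "\<phi> w = Y u w + (LINT r:{t..u}|\<nu>. g r w)" for w
  have tt: "t \<in> {0..T}" "t <= t" "0 <= t" "t \<in> {s..T}" "u \<in> {s..T}" using t s by auto
  have \<phi>m: "\<phi> \<in> borel_measurable FF" unfolding \<phi>_def using mp_meas(2,3)[OF m tt(3) t(2,3)] by auto
  have \<phi>i: "integrable (P t' w) \<phi>" if "t' \<in> {0..T}" "t' <= t" "w \<in> Omega" for t' w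
  proof -
   interpret finite_measure "P t' w" by (rule P_finite) (use that in auto)
   show ?thesis by (rule integrable_of_L2) (use \<phi>m that mp_L2(2)[OF m that(1,3,2) t(2,3)] in \<open>auto simp: meas_P \<phi>_def\<close>)
  qed
  have Yt: "Y t \<in> borel_measurable FF" using mp_meas(2)[OF m, of t t] tt by auto
  have Yti: "integrable (Pc s \<eta>) (Y t)"
  proof -
   interpret finite_measure "P s \<eta>" by (rule P_finite[OF s0 s(2)])
   have "integrable (P s \<eta>) (Y t)" by (rule integrable_of_L2) (use Yt mp_D(3)[OF m s(1) t(1) _ s(2)] tt s0 s(2) in \<open>auto simp: meas_P\<close>)
   then show ?thesis using integral_comp(2)[OF s0 s(2) Yt] by simp
  qed
  have \<phi>c: "integrable (Pc s \<eta>) \<phi>" using \<phi>i[OF s(1) t(1) s(2)] integral_comp(2)[OF s0 s(2) \<phi>m] by simp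
  have "(LINT w:A|Pc s \<eta>. \<phi> w) = (LINT w:A|Pc s \<eta>. (LINT w'|P t w. \<phi> w'))"
   by (rule Markov_Fc[OF s t(1) A \<phi>m \<phi>i[OF s(1) t(1) s(2)] \<phi>i[OF tt(1,2)]])
  also have "\<dots> = (LINT w:A|Pc s \<eta>. Y t w)"
   unfolding set_lebesgue_integral_def
   by (intro Bochner_Integration.integral_cong refl) (use mp_D(4)[OF m tt(1) t(2,3)] P_prob(2)[OF s0 s(2)] in \<open>auto simp: \<phi>_def[abs_def]\<close>)
  finally have e: "(LINT w:A|Pc s \<eta>. \<phi> w) = (LINT w:A|Pc s \<eta>. Y t w)" .
  have "(LINT w:A|Pc s \<eta>. (Mm s Y g u w - Mm s Y g t w)) = (LINT w:A|Pc s \<eta>. (\<phi> w - Y t w))"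
   unfolding set_lebesgue_integral_def
  proof (rule integral_cong_AE)
   show "AE w in Pc s \<eta>. indicator A w *\<^sub>R (Mm s Y g u w - Mm s Y g t w) = indicator A w *\<^sub>R (\<phi> w - Y t w)"
    using Mm_incr_AE[OF m s t] by eventually_elim (simp add: \<phi>_def dM_def)
  qed (use Li[OF tt(4)] Li[OF tt(5)] \<phi>c Yti F.G_sets[OF A] in auto)
  also have "\<dots> = 0" using e F.set_integrable_of[OF \<phi>c A] F.set_integrable_of[OF Yti A] by (simp add: set_integral_diff)
  finally show ?thesis using F.set_integrable_of[OF Li[OF tt(5)] A] F.set_integrable_of[OF Li[OF tt(4)] A] by (simp add: set_integral_diff)
 qed
 show ?thesis unfolding F.l2m_def
  by (intro conjI ballI allI impI meas_Fo_Fc[OF s0 s(2)] Mmm L2 mart)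
qed

lemma Ecov_props:
 assumes Y: "mp Y g" and X: "mp X h" and t: "0 <= t" "t <= u" "u <= T"
 shows "Ecov Y g X h t u \<in> borel_measurable (Fo t)"
  and "\<And>s \<eta> A. s \<in> {0..T} ==> \<eta> \<in> Omega ==> s <= t ==> A \<in> sets (Fc (P s \<eta>) t) ==>
   filtered_clock.cov (Pc s \<eta>) (Mm s Y g) (Mm s X h) t u A = (LINT w:A|Pc s \<eta>. Ecov Y g X h t u w)"
  and "\<And>s \<eta>. s \<in> {0..T} ==> \<eta> \<in> Omega ==> s <= t ==> integrable (Pc s \<eta>) (Ecov Y g X h t u)"
  and "\<And>\<eta>. \<eta> \<in> Omega ==> Ecov Y g X h t u \<eta> = filtered_clock.cov (Pc t \<eta>) (Mm t Y g) (Mm t X h) t u Omega"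
proof -
 define \<phi> where "\<phi> w = dM Y g t u w * dM X h t u w" for w
 have tT: "t \<in> {0..T}" using t by auto
 have \<phi>m: "\<phi> \<in> borel_measurable FF" unfolding \<phi>_def[abs_def] using mp_meas(1)[OF Y t] mp_meas(1)[OF X t] by measurable
 have \<phi>i: "integrable (P s \<eta>) \<phi>" if "s \<in> {0..T}" "\<eta> \<in> Omega" "s <= t" for s \<eta>
  unfolding \<phi>_def using mp_meas(1)[OF Y t] mp_meas(1)[OF X t] mp_L2(1)[OF Y that t(2,3)] mp_L2(1)[OF X that t(2,3)] that
  by (intro integrable_mult_L2) (auto simp: meas_P)
 have EE: "Ecov Y g X h t u = (%w. \<integral>w'. \<phi> w' \<partial>P t w)" by (simp add: Ecov_def[abs_def] \<phi>_def)
 have top: "Omega \<in> sets (Fp t)" using sets.top[of "Fp t"] by simp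
 have mr: "Ecov Y g X h t u \<in> borel_measurable (Fo t)" "integrable (P s \<eta>) (Ecov Y g X h t u)" if s: "s \<in> {0..T}" "\<eta> \<in> Omega" "s <= t" for s \<eta>
  unfolding EE using Markov_real(1,2)[OF _ s(2,3) top \<phi>m \<phi>i[OF s] \<phi>i[OF tT _ order_refl]] s by auto
 show Em: "Ecov Y g X h t u \<in> borel_measurable (Fo t)"
 proof -
  \<comment> \<open>The fact \<open>mr\<close> can only be instantiated at some element of
    \<open>Omega\<close>; a constant path is one.\<close>
  have "(%_. undefined) \<in> (Omega :: 'e path set)" by (auto simp: Omega_def cadlag_path_def intro!: exI tendsto_const)
  then show ?thesis using mr(1)[OF tT _ order_refl] by blast
 qed
 show int: "integrable (Pc s \<eta>) (Ecov Y g X h t u)" if s: "s \<in> {0..T}" "\<eta> \<in> Omega" "s <= t" for s \<eta>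
  using mr(2)[OF s] integral_comp(2)[OF _ s(2) meas_Fo_FF[OF Em], of s] s by simp
 have cov: "filtered_clock.cov (Pc s \<eta>) (Mm s Y g) (Mm s X h) t u A = (LINT w:A|Pc s \<eta>. \<phi> w)"
  if s: "s \<in> {0..T}" "\<eta> \<in> Omega" "s <= t" and A: "A \<in> sets (Pc s \<eta>)" for s \<eta> A
 proof -
  interpret F: filtered_clock W T \<nu> "Pc s \<eta>" "Fc (P s \<eta>)" s by (rule filtered[OF s(1,2)])
  note lY = F.l2m_incr(2)[OF mp_l2m[OF Y s(1,2)] s(3) t(2,3)] and lX = F.l2m_incr(2)[OF mp_l2m[OF X s(1,2)] s(3) t(2,3)]
  show ?thesis unfolding F.cov_def set_lebesgue_integral_def
  proof (rule integral_cong_AE)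
   show "AE w in Pc s \<eta>. indicator A w *\<^sub>R ((Mm s Y g u w - Mm s Y g t w) * (Mm s X h u w - Mm s X h t w)) = indicator A w *\<^sub>R \<phi> w"
    using Mm_incr_AE[OF Y s t(2,3)] Mm_incr_AE[OF X s t(2,3)] by eventually_elim (simp add: \<phi>_def)
   show "(%w. indicator A w *\<^sub>R \<phi> w) \<in> borel_measurable (Pc s \<eta>)"
    by (intro borel_measurable_scaleR borel_measurable_indicator A measurable_completion) (use \<phi>m s in \<open>simp add: meas_P\<close>)
  qed (use A lY lX in auto)
 qed
 show "filtered_clock.cov (Pc s \<eta>) (Mm s Y g) (Mm s X h) t u A = (LINT w:A|Pc s \<eta>. Ecov Y g X h t u w)"
  if s: "s \<in> {0..T}" "\<eta> \<in> Omega" "s <= t" and A: "A \<in> sets (Fc (P s \<eta>) t)" for s \<eta> A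
 proof -
  interpret F: filtered_clock W T \<nu> "Pc s \<eta>" "Fc (P s \<eta>)" s by (rule filtered[OF s(1,2)])
  show ?thesis unfolding cov[OF s F.G_sets[OF A]] EE
   by (rule Markov_Fc[OF s A \<phi>m \<phi>i[OF s] \<phi>i[OF tT _ order_refl]])
 qed
 show "Ecov Y g X h t u \<eta> = filtered_clock.cov (Pc t \<eta>) (Mm t Y g) (Mm t X h) t u Omega" if e: "\<eta> \<in> Omega" for \<eta>
 proof -
  have "Omega \<in> sets (Pc t \<eta>)" using sets.top[of "P t \<eta>"] P_prob(2)[OF t(1) e] by auto
  from cov[OF tT e order_refl this]
  have "filtered_clock.cov (Pc t \<eta>) (Mm t Y g) (Mm t X h) t u Omega = (LINT w:Omega|Pc t \<eta>. \<phi> w)" .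
  also have "\<dots> = (LINT w|Pc t \<eta>. \<phi> w)"
   unfolding set_lebesgue_integral_def by (intro Bochner_Integration.integral_cong) (auto simp: P_prob(2)[OF t(1) e])
  also have "\<dots> = Ecov Y g X h t u \<eta>" unfolding EE by (rule integral_comp(1)[OF t(1) e \<phi>m])
  finally show ?thesis by simp
 qed
qed

lemma mp_brk:
 assumes X: "mp X h" and b: "\<And>t u w. 0 <= t ==> t <= u ==> u <= T ==> w \<in> Omega ==> Ecov X h X h t u w <= C * (W u - W t)"
  and s: "s \<in> {0..T}" "\<eta> \<in> Omega"
 shows "filtered_clock.brk W T (Pc s \<eta>) (Fc (P s \<eta>)) s (Mm s X h) C"
proof -
 interpret F: filtered_clock W T \<nu> "Pc s \<eta>" "Fc (P s \<eta>)" s by (rule filtered[OF s])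
 show ?thesis unfolding F.brk_def
 proof (intro allI impI)
  fix t u A assume t: "s <= t" "t <= u" "u <= T" and A: "A \<in> sets (Fc (P s \<eta>) t)"
  have t0: "0 <= t" using s t by simp
  have "F.cov (Mm s X h) (Mm s X h) t u A = (LINT w:A|Pc s \<eta>. Ecov X h X h t u w)"
   by (rule Ecov_props(2)[OF X X t0 t(2,3) s t(1) A])
  also have "\<dots> <= (LINT w:A|Pc s \<eta>. C * (W u - W t))"
  proof (rule set_integral_mono)
   show "set_integrable (Pc s \<eta>) A (Ecov X h X h t u)"
    by (rule F.set_integrable_of[OF Ecov_props(3)[OF X X t0 t(2,3) s t(1)] A])
   show "set_integrable (Pc s \<eta>) A (%w. C * (W u - W t))" by (rule F.set_integrable_of[OF _ A]) simp
   show "Ecov X h X h t u w <= C * (W u - W t)" if "w \<in> A" for w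
    using b[OF t0 t(2,3)] that sets.sets_into_space[OF A] by auto
  qed
  also have "\<dots> = C * (W u - W t) * measure (Pc s \<eta>) A"
   using F.G_sets[OF A] sets.sets_into_space[OF F.G_sets[OF A]] by (simp add: set_lebesgue_integral_def Int_absorb2)
  finally show "F.cov (Mm s X h) (Mm s X h) t u A <= C * (W u - W t) * measure (Pc s \<eta>) A" .
 qed
qed

text \<open>The quotients are formed from \<open>Ecov\<close>, so they are functions of the path
  alone. Under each \<open>P s \<eta>\<close> they are versions of the conditional quotients, and
  therefore their pointwise \<open>lim\<close> is a density for all initial conditions
  simultaneously.\<close>

lemma universal_density:
 assumes Y: "mp Y g" and X: "mp X h" and C: "0 < C"
  and b: "\<And>t u w. 0 <= t ==> t <= u ==> u <= T ==> w \<in> Omega ==> Ecov X h X h t u w <= C * (W u - W t)"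
 shows "\<exists>Z. Luni P T V Z \<and> (\<forall>s\<in>{0..T}. \<forall>\<eta>\<in>Omega. rep s \<eta> (Mm s Y g) (Mm s X h) Z)"
proof -
 define \<kappa> where "\<kappa> n i w = (if i < 2 ^ n then Ecov Y g X h (q n i) (q n (Suc i)) w / (W (q n (Suc i)) - W (q n i)) else 0)" for n i w
 define Z where "Z r w = lim (%n. \<kappa> n (blk n r) w)" for r w
 have qs: "0 <= q n i" "q n i <= q n (Suc i)" "q n (Suc i) <= T" if "i < 2 ^ n" for n i
  using that by (auto simp: q_simps q_le_T)
 have \<kappa>m: "\<kappa> n i \<in> borel_measurable (Fo (q n i))" for n i
  unfolding \<kappa>_def[abs_def] using Ecov_props(1)[OF Y X qs] by (cases "i < 2 ^ n") auto
 have prg: "progressive_on {0..T} Fo Z"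
  unfolding progressive_on_Icc_iff Z_def
  by (intro ballI dyadic_lim_measurable \<kappa>m Fo_mono) auto
 have key: "rep s \<eta> (Mm s Y g) (Mm s X h) Z \<and> (\<integral>\<^sup>+w. (\<integral>\<^sup>+r\<in>{s..T}. ennreal ((Z r w)^2) \<partial>\<nu>) \<partial>P s \<eta>) < \<infinity>"
  if s: "s \<in> {0..T}" "\<eta> \<in> Omega" for s \<eta>
 proof -
  interpret F: filtered_clock W T \<nu> "Pc s \<eta>" "Fc (P s \<eta>)" s by (rule filtered[OF s])
  have s0: "0 <= s" using s by simp
  note lY = mp_l2m[OF Y s] and lX = mp_l2m[OF X s] and bk = mp_brk[OF X b s]
  have k1: "\<kappa> n i \<in> borel_measurable (Fc (P s \<eta>) (q n i))" for n i by (rule meas_Fo_Fc[OF s0 s(2) \<kappa>m])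
  have k2: "integrable (Pc s \<eta>) (\<kappa> n i)" if "i < 2 ^ n" "s <= q n i" for n i
   unfolding \<kappa>_def[abs_def] using Ecov_props(3)[OF Y X qs[OF that(1)] s that(2)] that(1) by simp
  \<comment> \<open>Division by zero yields 0, which is the value required on flat blocks.\<close>
  have k4: "\<kappa> n i w = 0" if "W (q n (Suc i)) = W (q n i)" for n i w using that by (simp add: \<kappa>_def)
  have k3: "(W (q n (Suc i)) - W (q n i)) * (LINT w:A|Pc s \<eta>. \<kappa> n i w) = F.cov (Mm s Y g) (Mm s X h) (q n i) (q n (Suc i)) A"
   if i: "i < 2 ^ n" "s <= q n i" and A: "A \<in> sets (Fc (P s \<eta>) (q n i))" for n i A
  proof (cases "W (q n (Suc i)) = W (q n i)")
   case False
   have "(W (q n (Suc i)) - W (q n i)) * (LINT w:A|Pc s \<eta>. \<kappa> n i w) = (LINT w:A|Pc s \<eta>. (W (q n (Suc i)) - W (q n i)) * \<kappa> n i w)" by simp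
   also have "\<dots> = (LINT w:A|Pc s \<eta>. Ecov Y g X h (q n i) (q n (Suc i)) w)" using False i by (simp add: \<kappa>_def)
   also have "\<dots> = F.cov (Mm s Y g) (Mm s X h) (q n i) (q n (Suc i)) A"
    by (rule Ecov_props(2)[OF Y X qs[OF i(1)] s i(2) A, symmetric])
   finally show ?thesis .
  next
   case True
   have "F.cov (Mm s Y g) (Mm s X h) (q n i) (q n (Suc i)) A = 0"
    by (rule F.cov_zero_of_brk[OF lY lX bk _ _ _ True A]) (use i qs in auto)
   then show ?thesis using True by simp
  qed
  note R = F.bracket_density_repr[OF lY lX bk C k1 k2 k3 k4]
  have "rep s \<eta> (Mm s Y g) (Mm s X h) Z" unfolding Z_def[abs_def] using R .
  moreover have "s \<in> {s..T}" using s by simp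
  note sq = F.bracket_density_sq[OF lY lX bk C k1 k2 k3 k4 this]
  have "(\<integral>\<^sup>+w. (\<integral>\<^sup>+r\<in>{s..T}. ennreal ((Z r w)^2) \<partial>\<nu>) \<partial>Pc s \<eta>) < \<infinity>"
   unfolding Z_def by (rule le_less_trans[OF sq]; (assumption | metis ennreal_less_top infinity_ennreal_def))
  ultimately show ?thesis by (simp add: nn_integral_completion)
 qed
 show ?thesis using prg key by (intro exI[of _ Z]) (auto simp: Luni_def)
qed

lemma P_Fubini:
 assumes Z: "progressive_on {0..T} Fo Z" and t: "t \<in> {0..T}" "w \<in> Omega" and u: "t <= u" "u <= T"
  and fin: "(\<integral>\<^sup>+w'. (\<integral>\<^sup>+r\<in>{t..T}. ennreal \<bar>Z r w'\<bar> \<partial>\<nu>) \<partial>P t w) < \<infinity>"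
 shows "(LINT r:{t..u}|\<nu>. (LINT w'|P t w. Z r w')) = (LINT w'|P t w. (LINT r:{t..u}|\<nu>. Z r w'))" (is ?g0)
  and "integrable (P t w) (%w'. LINT r:{t..u}|\<nu>. Z r w')" (is ?g1)
  and "AE r in \<nu>. r \<in> {t..T} \<longrightarrow> integrable (P t w) (Z r)" (is ?g2)
  and "set_integrable \<nu> {t..u} (%r. \<integral>w'. Z r w' \<partial>P t w)" (is ?g3)
proof -
 interpret F: filtered_clock W T \<nu> "Pc t w" "Fc (P t w)" t by (rule filtered[OF t])
 have t0: "0 <= t" using t by simp
 have L1: "(\<integral>\<^sup>+w'. (\<integral>\<^sup>+r\<in>{t..T}. ennreal \<bar>Z r w'\<bar> \<partial>\<nu>) \<partial>Pc t w) < \<infinity>"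
  using fin by (simp add: nn_integral_completion)
 note j = F.jm_integrable[OF F.jm_prog[OF progressive_prog[OF t Z]] L1 u(2)]
 have sec: "Z r \<in> borel_measurable FF" if "r \<in> {t..T}" for r using meas_Fo_FF[OF progressive_sec[OF Z, of r]] that t0 by auto
 have m: "(%w'. LINT r:{t..u}|\<nu>. Z r w') \<in> borel_measurable FF" by (rule meas_Fo_FF[OF progressive_int_meas[OF Z]]) (use t u in auto)
 show ?g1
  using j(3) integral_comp(2)[OF t0 t(2) m] by (simp add: F.nI_def[abs_def])
 show ?g2
  using j(5) by eventually_elim (use integral_comp(2)[OF t0 t(2) sec] in auto)
 have e: "indicator {t..u} r *\<^sub>R (LINT w'|P t w. Z r w') = indicator {t..u} r *\<^sub>R (LINT w'|Pc t w. Z r w')" for r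
  using integral_comp(1)[OF t0 t(2) sec[of r]] u by (auto simp: indicator_def)
 show ?g3 using j(6) unfolding set_integrable_def e .
 have "(LINT r:{t..u}|\<nu>. (LINT w'|P t w. Z r w')) = (LINT r:{t..u}|\<nu>. (LINT w'|Pc t w. Z r w'))"
  unfolding set_lebesgue_integral_def e ..
 also have "\<dots> = (LINT w'|Pc t w. F.nI t u Z w')" by (rule j(2))
 also have "\<dots> = (LINT w'|P t w. (LINT r:{t..u}|\<nu>. Z r w'))" unfolding F.nI_def by (rule integral_comp(1)[OF t0 t(2) m])
 finally show ?g0 .
qed

lemma Luni_L1:
 assumes Z: "Luni P T V Z" and t: "t \<in> {0..T}" "w \<in> Omega"
 shows "(\<integral>\<^sup>+w'. (\<integral>\<^sup>+r\<in>{t..T}. ennreal \<bar>Z r w'\<bar> \<partial>\<nu>) \<partial>P t w) < \<infinity>"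
proof -
 interpret F: filtered_clock W T \<nu> "Pc t w" "Fc (P t w)" t by (rule filtered[OF t])
 have "(\<integral>\<^sup>+w'. (\<integral>\<^sup>+r\<in>{t..T}. ennreal \<bar>Z r w'\<bar> \<partial>\<nu>) \<partial>Pc t w) < \<infinity>"
  by (rule F.L2_nn_finite[OF Luni_D(1,2)[OF Z t]])
 then show ?thesis by (simp add: nn_integral_completion)
qed

lemma Luni_L1_mult:
 assumes Z: "Luni P T V X" "Luni P T V Y" and t: "t \<in> {0..T}" "w \<in> Omega"
 shows "(\<integral>\<^sup>+w'. (\<integral>\<^sup>+r\<in>{t..T}. ennreal \<bar>X r w' * Y r w'\<bar> \<partial>\<nu>) \<partial>P t w) < \<infinity>"
proof -
 interpret F: filtered_clock W T \<nu> "Pc t w" "Fc (P t w)" t by (rule filtered[OF t])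
 from F.N2_mult_finite[OF Luni_D(3,2)[OF Z(1) t] Luni_D(3,2)[OF Z(2) t]]
 show ?thesis by (simp add: nn_integral_completion)
qed

lemmas Luni_Fubini = P_Fubini(1,2)[OF Luni_progressive _ _ _ _ Luni_L1]

text \<open>From left to right, take \<open>(t, w)\<close> itself as initial condition and the whole
  space as event. From right to left, the Markov property inserts the pointwise identity into
  expectations under \<open>P s \<eta>\<close>. The right-hand side has the shape of the integral
  equations.\<close>

lemma rep_iff_identity:
 assumes Y: "mp Y g" and X: "mp X h" and Z: "Luni P T V Z"
 shows "(\<forall>s\<in>{0..T}. \<forall>\<eta>\<in>Omega. rep s \<eta> (Mm s Y g) (Mm s X h) Z) \<longleftrightarrow>
   (\<forall>t\<in>{0..T}. \<forall>w\<in>Omega. (LINT r:{t..T}|\<nu>. (LINT w'|P t w. Z r w')) = Ecov Y g X h t T w)"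
proof (intro iffI ballI)
 fix t and w :: "'e path" assume r: "\<forall>s\<in>{0..T}. \<forall>\<eta>\<in>Omega. rep s \<eta> (Mm s Y g) (Mm s X h) Z" and t: "t \<in> {0..T}" "w \<in> Omega"
 interpret F: filtered_clock W T \<nu> "Pc t w" "Fc (P t w)" t by (rule filtered[OF t])
 have t0: "0 <= t" "t <= T" using t by auto
 have sp: "space (Pc t w) = Omega" using P_prob(2)[OF t0(1) t(2)] by simp
 have m: "(%w'. LINT r:{t..T}|\<nu>. Z r w') \<in> borel_measurable FF" by (rule meas_Fo_FF[OF Luni_int_meas[OF Z]]) (use t in auto)
 have top: "Omega \<in> sets (Fc (P t w) t)" using F.space_in_G[of t] sp by simp
 have "F.repr (Mm t Y g) (Mm t X h) Z" using r t by blast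
 then have "(LINT w':Omega|Pc t w. F.nI t T Z w') = F.cov (Mm t Y g) (Mm t X h) t T Omega"
  unfolding F.repr_def using top t0 by auto
 also have "\<dots> = Ecov Y g X h t T w" by (rule Ecov_props(4)[OF Y X t0 order_refl t(2), symmetric])
 also have "(LINT w':Omega|Pc t w. F.nI t T Z w') = (LINT w'|Pc t w. F.nI t T Z w')"
  unfolding set_lebesgue_integral_def by (intro Bochner_Integration.integral_cong refl) (use sp in auto)
 also have "\<dots> = (LINT w'|P t w. (LINT r:{t..T}|\<nu>. Z r w'))" unfolding F.nI_def by (rule integral_comp(1)[OF t0(1) t(2) m])
 finally show "(LINT r:{t..T}|\<nu>. (LINT w'|P t w. Z r w')) = Ecov Y g X h t T w" unfolding Luni_Fubini(1)[OF Z t t0(2) order_refl Z t] by simp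
next
 fix s and \<eta> :: "'e path" assume id: "\<forall>t\<in>{0..T}. \<forall>w\<in>Omega. (LINT r:{t..T}|\<nu>. (LINT w'|P t w. Z r w')) = Ecov Y g X h t T w"
  and s: "s \<in> {0..T}" "\<eta> \<in> Omega"
 interpret F: filtered_clock W T \<nu> "Pc s \<eta>" "Fc (P s \<eta>)" s by (rule filtered[OF s])
 have s0: "0 <= s" using s by simp
 note d = Luni_D[OF Z s]
 have L1: "(\<integral>\<^sup>+w'. (\<integral>\<^sup>+r\<in>{s..T}. ennreal \<bar>Z r w'\<bar> \<partial>\<nu>) \<partial>Pc s \<eta>) < \<infinity>"
  by (rule F.L2_nn_finite[OF d(1,2)])
 note L = F.L1_facts[OF d(1) L1]
 have "(LINT w:A|Pc s \<eta>. F.nI t T Z w) = F.cov (Mm s Y g) (Mm s X h) t T A" if t: "t \<in> {s..T}" and A: "A \<in> sets (Fc (P s \<eta>) t)" for t A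
 proof -
  have tt: "0 <= t" "s <= t" "t <= T" "t \<in> {0..T}" using t s by auto
  have m: "(%w'. LINT r:{t..T}|\<nu>. Z r w') \<in> borel_measurable FF" by (rule meas_Fo_FF[OF Luni_int_meas[OF Z]]) (use tt in auto)
  have i: "integrable (P s \<eta>) (%w'. LINT r:{t..T}|\<nu>. Z r w')"
   using L(3)[OF tt(2,3) order_refl] integral_comp(2)[OF s0 s(2) m] by (simp add: F.nI_def[abs_def])
  have "(LINT w:A|Pc s \<eta>. F.nI t T Z w) = (LINT w:A|Pc s \<eta>. (LINT w'|P t w. (LINT r:{t..T}|\<nu>. Z r w')))"
   unfolding F.nI_def by (rule Markov_Fc[OF s tt(2) A m i Luni_Fubini(2)[OF Z tt(4) _ tt(3) order_refl Z tt(4)]])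
  also have "\<dots> = (LINT w:A|Pc s \<eta>. Ecov Y g X h t T w)"
   unfolding set_lebesgue_integral_def
  proof (intro Bochner_Integration.integral_cong refl)
   fix w assume "w \<in> space (Pc s \<eta>)"
   then have "w \<in> Omega" using P_prob(2)[OF s0 s(2)] by simp
   then show "indicator A w *\<^sub>R (LINT w'|P t w. (LINT r|\<nu>. indicator {t..T} r *\<^sub>R Z r w')) = indicator A w *\<^sub>R Ecov Y g X h t T w"
    using id tt(4) Luni_Fubini(1)[OF Z tt(4) _ tt(3) order_refl Z tt(4), of w] by (simp add: set_lebesgue_integral_def)
  qed
  also have "\<dots> = F.cov (Mm s Y g) (Mm s X h) t T A" by (rule Ecov_props(2)[OF Y X tt(1,3) order_refl s tt(2) A, symmetric])
  finally show ?thesis .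
 qed
 then show "rep s \<eta> (Mm s Y g) (Mm s X h) Z" unfolding F.repr_def using d(1) L by auto
qed

end

lemma progressive_on_arith:
 assumes "progressive_on I G X" "progressive_on I G Y"
 shows "progressive_on I G (%t w. X t w + Y t w)" "progressive_on I G (%t w. X t w - Y t w)"
  "progressive_on I G (%t w. X t w * Y t w)"
 using assms unfolding progressive_on_def split_beta'
 by (auto intro!: borel_measurable_add borel_measurable_diff borel_measurable_times)

lemma progressive_on_const: "progressive_on I G (%t w. c)"
 by (simp add: progressive_on_def split_beta')

lemma progressive_on_cong:
 assumes X: "progressive_on I G X" and e: "\<And>t u w. t \<in> I ==> w \<in> space (G u) ==> Y t w = X t w"
 shows "progressive_on I G Y"
 unfolding progressive_on_def
proof
 fix t assume "t \<in> I"
 then have "(%(r, w). X r w) \<in> borel_measurable (restrict_space borel {r \<in> I. r <= t} \<Otimes>\<^sub>M G t)"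
  using X unfolding progressive_on_def by blast
 then show "(%(r, w). Y r w) \<in> borel_measurable (restrict_space borel {r \<in> I. r <= t} \<Otimes>\<^sub>M G t)"
  by (rule measurable_cong[THEN iffD1, rotated]) (auto simp: space_pair_measure space_restrict_space e)
qed

context pd_class
begin

lemma Luni_I:
 assumes X: "progressive_on {0..T} Fo X"
  and N: "\<And>s \<eta>. s \<in> {0..T} ==> \<eta> \<in> Omega ==> filtered_clock.N2 T \<nu> (Pc s \<eta>) s X < \<infinity>"
 shows "Luni P T V X"
 unfolding Luni_def
proof (intro conjI X ballI)
 fix s and \<eta> :: "'e path" assume s: "s \<in> {0..T}" "\<eta> \<in> Omega"
 interpret F: filtered_clock W T \<nu> "Pc s \<eta>" "Fc (P s \<eta>)" s by (rule filtered[OF s])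
 show "(\<integral>\<^sup>+w. (\<integral>\<^sup>+r\<in>{s..T}. ennreal ((X r w)^2) \<partial>\<nu>) \<partial>P s \<eta>) < \<infinity>"
  using N[OF s] by (simp add: F.N2_def nn_integral_completion)
qed

lemma Luni_dominated:
 assumes Z: "progressive_on {0..T} Fo Z" and X: "Luni P T V X" and Y: "Luni P T V Y"
  and le: "\<And>r w. r \<in> {0..T} ==> w \<in> Omega ==> \<bar>Z r w\<bar> <= k * (\<bar>X r w\<bar> + \<bar>Y r w\<bar>)"
 shows "Luni P T V Z"
proof (rule Luni_I[OF Z])
 fix s and \<eta> :: "'e path" assume s: "s \<in> {0..T}" "\<eta> \<in> Omega"
 interpret F: filtered_clock W T \<nu> "Pc s \<eta>" "Fc (P s \<eta>)" s by (rule filtered[OF s])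
 show "F.N2 Z < \<infinity>"
 proof (rule F.N2_lincomb_finite[OF Luni_D(3,2)[OF X s] Luni_D(3,2)[OF Y s]])
  fix r w assume "r \<in> {s..T}" "w \<in> space (Pc s \<eta>)"
  then show "\<bar>Z r w\<bar> <= k * (\<bar>X r w\<bar> + \<bar>Y r w\<bar>)" using s P_prob(2)[of s \<eta>] by (intro le) auto
 qed
qed

lemma Luni_lin:
 assumes X: "Luni P T V X" and Y: "Luni P T V Y"
 shows "Luni P T V (%r w. a * X r w + b * Y r w)"
proof (rule Luni_dominated[OF _ X Y])
 show "progressive_on {0..T} Fo (%r w. a * X r w + b * Y r w)"
  by (intro progressive_on_arith progressive_on_const Luni_progressive X Y)
 fix r w
 have "\<bar>a * X r w + b * Y r w\<bar> <= \<bar>a\<bar> * \<bar>X r w\<bar> + \<bar>b\<bar> * \<bar>Y r w\<bar>" by (metis abs_mult abs_triangle_ineq)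
 also have "\<dots> <= max \<bar>a\<bar> \<bar>b\<bar> * \<bar>X r w\<bar> + max \<bar>a\<bar> \<bar>b\<bar> * \<bar>Y r w\<bar>" by (intro add_mono mult_right_mono) auto
 finally show "\<bar>a * X r w + b * Y r w\<bar> <= max \<bar>a\<bar> \<bar>b\<bar> * (\<bar>X r w\<bar> + \<bar>Y r w\<bar>)" by (simp add: distrib_left)
qed

lemma Luni_cong:
 assumes X: "Luni P T V X" and e: "\<And>t w. t \<in> {0..T} ==> w \<in> Omega ==> Y t w = X t w"
 shows "Luni P T V Y"
 by (rule Luni_dominated[OF progressive_on_cong[OF Luni_progressive[OF X]] X X, where k=1]) (auto simp: e)

lemma mp_cong:
 assumes m: "mp Y g" and e: "\<And>t w. t \<in> {0..T} ==> w \<in> Omega ==> Y' t w = Y t w"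
 shows "mp Y' g"
 unfolding mp_def
proof (intro conjI ballI)
 show "Luni P T V Y'" by (rule Luni_cong[OF mp_D(1)[OF m] e])
 show "Luni P T V g" by (rule mp_D(2)[OF m])
 fix t u and w :: "'e path" assume t: "t \<in> {0..T}" "u \<in> {t..T}" "w \<in> Omega"
 then have u: "t <= u" "u <= T" and t0: "0 <= t" by auto
 have eq: "Y' u w' = Y u w'" if "w' \<in> space (P t w)" for w' using that P_prob(2)[OF t0 t(3)] u t0 by (intro e) auto
 have "integrable (P t w) (%w'. (Y' u w')^2) \<longleftrightarrow> integrable (P t w) (%w'. (Y u w')^2)"
  by (intro Bochner_Integration.integrable_cong refl) (simp add: eq)
 then show "integrable (P t w) (%w'. (Y' u w')^2)" using mp_D(3)[OF m t(1) u t(3)] by simp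
 have "(LINT w'|P t w. Y' u w' + (LINT r:{t..u}|\<nu>. g r w')) = (LINT w'|P t w. Y u w' + (LINT r:{t..u}|\<nu>. g r w'))"
  by (intro Bochner_Integration.integral_cong refl) (simp add: eq)
 also have "\<dots> = Y t w" by (rule mp_D(4)[OF m t(1) u t(3)])
 finally show "(LINT w'|P t w. Y' u w' + (LINT r:{t..u}|\<nu>. g r w')) = Y' t w" using e[OF t(1,3)] by simp
qed

text \<open>Integration by parts under \<open>P t w\<close>, where the product of the initial values
  is almost surely the constant \<open>Y t w * X t w\<close>.\<close>

lemma Ecov_by_parts:
 assumes Y: "mp Y g" and X: "mp X h" and t: "t \<in> {0..T}" "w \<in> Omega" and u: "t <= u" "u <= T"
 shows "Ecov Y g X h t u w = (LINT w'|P t w. Y u w' * X u w') - Y t w * X t w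
   + (LINT r:{t..u}|\<nu>. (LINT w'|P t w. Y r w' * h r w' + g r w' * X r w'))"
proof -
 interpret F: filtered_clock W T \<nu> "Pc t w" "Fc (P t w)" t by (rule filtered[OF t])
 have t0: "0 <= t" using t by simp
 have sp: "space (Pc t w) = Omega" using P_prob(2)[OF t0 t(2)] by simp
 note LY = mp_D(1)[OF Y] and Lg = mp_D(2)[OF Y] and LX = mp_D(1)[OF X] and Lh = mp_D(2)[OF X]
 have Me: "Mm t Z k = (%t' w. Z t' w + F.nI t t' k w)" for Z k by (simp add: Mm_def[abs_def] F.nI_def)
 have sec: "Z r \<in> borel_measurable FF" if "Luni P T V Z" "r \<in> {t..u}" for Z r
  using meas_Fo_FF[OF Luni_sec[OF that(1), of r]] that(2) t0 u by auto
 have m: "(%w'. Y r w' * X r w') \<in> borel_measurable FF" "(%w'. Y r w' * h r w' + g r w' * X r w') \<in> borel_measurable FF"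
  if "r \<in> {t..u}" for r
  using sec[OF LY that] sec[OF LX that] sec[OF Lg that] sec[OF Lh that] by measurable
 have "(LINT w'|Pc t w. Y u w' * X u w') - (LINT w'|Pc t w. Y t w' * X t w') =
   F.cov (Mm t Y g) (Mm t X h) t u Omega - (LINT r:{t..u}|\<nu>. (LINT w'|Pc t w. Y r w' * h r w' + g r w' * X r w'))"
  unfolding Me sp[symmetric]
  by (rule F.integration_by_parts[OF Luni_D(1,2)[OF LY t] Luni_D(1,2)[OF Lg t] Luni_D(1,2)[OF LX t] Luni_D(1,2)[OF Lh t]
   mp_l2m[OF Y t, unfolded Me] mp_l2m[OF X t, unfolded Me]]) (use u in auto)
 moreover have "F.cov (Mm t Y g) (Mm t X h) t u Omega = Ecov Y g X h t u w" by (rule Ecov_props(4)[OF Y X t0 u t(2), symmetric])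
 moreover have "(LINT w'|Pc t w. Y u w' * X u w') = (LINT w'|P t w. Y u w' * X u w')"
  by (rule integral_comp(1)[OF t0 t(2) m(1)]) (use u in auto)
 moreover have "(LINT w'|Pc t w. Y t w' * X t w') = Y t w * X t w"
 proof -
  interpret Pt: prob_space "P t w" by (rule P_prob[OF t0 t(2)])
  have mt: "(%w'. Y t w' * X t w') \<in> borel_measurable (Fo t)" using Luni_sec[OF LY t(1)] Luni_sec[OF LX t(1)] by measurable
  have "(LINT w'|Pc t w. Y t w' * X t w') = (LINT w'|P t w. Y t w' * X t w')"
   by (rule integral_comp(1)[OF t0 t(2) m(1)]) (use u in auto)
  also have "\<dots> = (LINT w'|P t w. Y t w * X t w)"
   by (rule integral_cong_AE) (use AE_determined[OF t0 t(2) mt] m(1)[of t] u t0 t(2) in \<open>auto simp: meas_P\<close>)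
  finally show ?thesis by (simp add: Pt.prob_space)
 qed
 moreover have "(LINT r:{t..u}|\<nu>. (LINT w'|Pc t w. Y r w' * h r w' + g r w' * X r w')) =
   (LINT r:{t..u}|\<nu>. (LINT w'|P t w. Y r w' * h r w' + g r w' * X r w'))"
  unfolding set_lebesgue_integral_def
 proof (intro Bochner_Integration.integral_cong refl)
  fix r
  show "indicator {t..u} r *\<^sub>R (LINT w'|Pc t w. Y r w' * h r w' + g r w' * X r w') =
    indicator {t..u} r *\<^sub>R (LINT w'|P t w. Y r w' * h r w' + g r w' * X r w')"
   using integral_comp(1)[OF t0 t(2) m(2)[of r]] by (cases "r \<in> {t..u}") auto
 qed
 ultimately show ?thesis by simp
qed

end

section \<open>The linear equation with a given driver\<close>

locale pd_terminal = pd_class P T V for P :: "real => ('e::polish_space) path => 'e path measure" and T V +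
 fixes \<xi> :: "'e path => real"
 assumes xi_meas: "\<xi> \<in> borel_measurable (Fp T)"
  and xi_L2: "\<And>s \<eta>. 0 <= s ==> \<eta> \<in> Omega ==> integrable (P s \<eta>) (%w. (\<xi> w)^2)"
begin

definition Xi :: "'e proc => 'e proc" where
 "Xi g s w = \<xi> w + (LINT r:{s..T}|\<nu>. g r w)"

text \<open>The solution of the equation whose driver \<open>g\<close> is a given process. Being an
  expectation under \<open>P s \<eta>\<close>, it has a definite value at every
  \<open>(s, \<eta>)\<close>.\<close>

definition Yg :: "'e proc => 'e proc" where
 "Yg g s \<eta> = (LINT w|P s \<eta>. Xi g s w)"

lemma Xi_meas: assumes "Luni P T V g" "t \<in> {0..T}" shows "Xi g t \<in> borel_measurable FF"
 unfolding Xi_def[abs_def] using meas_Fo_FF[OF Luni_int_meas[OF assms(1), of t T]] meas_Fp_FF[OF xi_meas] assms(2) by auto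

lemma Xi_L2:
 assumes g: "Luni P T V g" and s: "s \<in> {0..T}" "\<eta> \<in> Omega" and t: "s <= t" "t <= T"
 shows "integrable (P s \<eta>) (%w. (Xi g t w)^2)" "integrable (P s \<eta>) (Xi g t)" (is ?g1)
proof -
 interpret finite_measure "P s \<eta>" by (rule P_finite) (use s in auto)
 have s0: "0 <= s" using s by simp
 have 1: "\<xi> \<in> borel_measurable (P s \<eta>)" using meas_Fp_FF[OF xi_meas] s0 s(2) by (simp add: meas_P)
 have 2: "(%w. LINT r:{t..T}|\<nu>. g r w) \<in> borel_measurable (P s \<eta>)"
  using meas_Fo_FF[OF Luni_int_meas[OF g, of t T]] s0 s(2) t by (simp add: meas_P)
 show i: "integrable (P s \<eta>) (%w. (Xi g t w)^2)"
  unfolding Xi_def by (intro integrable_L2_add 1 2 xi_L2 Luni_int_L2[OF g s] s0 s t order_refl)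
 show ?g1
  by (rule integrable_of_L2[OF _ i]) (use Xi_meas[OF g, of t] s0 s t in \<open>auto simp: meas_P\<close>)
qed

lemma Xi_sq_bound:
 assumes g: "Luni P T V g" and s: "s \<in> {0..T}" "\<eta> \<in> Omega" and t: "s <= t" "t <= T"
 shows "(\<integral>\<^sup>+w. ennreal ((Xi g t w)^2) \<partial>P s \<eta>) <=
  2 * (\<integral>\<^sup>+w. ennreal ((\<xi> w)^2) \<partial>P s \<eta>) + 2 * (ennreal (W T - W 0) * filtered_clock.N2 T \<nu> (Pc s \<eta>) s g)"
proof -
 interpret F: filtered_clock W T \<nu> "Pc s \<eta>" "Fc (P s \<eta>)" s by (rule filtered[OF s])
 have s0: "0 <= s" using s by simp
 note gj = Luni_D(3)[OF g s]
 have m1: "(%w. ennreal ((\<xi> w)^2)) \<in> borel_measurable (Pc s \<eta>)"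
  using meas_Fp_FF[OF xi_meas] s0 s(2) by (intro measurable_completion) (auto simp: meas_P)
 have m2: "(%w. \<integral>\<^sup>+r\<in>{s..T}. ennreal ((g r w)^2) \<partial>\<nu>) \<in> borel_measurable (Pc s \<eta>)"
  by (rule F.Tonelli(3)[OF F.jm_E[OF gj]]) auto
 have "(\<integral>\<^sup>+w. ennreal ((Xi g t w)^2) \<partial>P s \<eta>) = (\<integral>\<^sup>+w. ennreal ((Xi g t w)^2) \<partial>Pc s \<eta>)"
  by (simp add: nn_integral_completion)
 also have "\<dots> <= (\<integral>\<^sup>+w. 2 * ennreal ((\<xi> w)^2) + 2 * (ennreal (W T - W 0) * (\<integral>\<^sup>+r\<in>{s..T}. ennreal ((g r w)^2) \<partial>\<nu>)) \<partial>Pc s \<eta>)"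
 proof (rule nn_integral_mono)
  fix w assume w: "w \<in> space (Pc s \<eta>)"
  have "(Xi g t w)^2 <= 2 * (\<xi> w)^2 + 2 * (F.nI t T g w)^2"
   using zero_le_power2[of "\<xi> w - F.nI t T g w"] unfolding Xi_def F.nI_def by (simp add: power2_eq_square algebra_simps)
  then have "ennreal ((Xi g t w)^2) <= ennreal (2 * (\<xi> w)^2 + 2 * (F.nI t T g w)^2)" by (rule ennreal_leI)
  also have "\<dots> = 2 * ennreal ((\<xi> w)^2) + 2 * ennreal ((F.nI t T g w)^2)" by (simp add: ennreal_mult ennreal_plus)
  also have "\<dots> <= 2 * ennreal ((\<xi> w)^2) + 2 * (ennreal (W T - W 0) * (\<integral>\<^sup>+r\<in>{s..T}. ennreal ((g r w)^2) \<partial>\<nu>))"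
   by (intro add_left_mono mult_left_mono F.nI_sq_le[OF gj w t(1) order_refl]) simp
  finally show "ennreal ((Xi g t w)^2) <= 2 * ennreal ((\<xi> w)^2) + 2 * (ennreal (W T - W 0) * (\<integral>\<^sup>+r\<in>{s..T}. ennreal ((g r w)^2) \<partial>\<nu>))" .
 qed
 also have "\<dots> = 2 * (\<integral>\<^sup>+w. ennreal ((\<xi> w)^2) \<partial>Pc s \<eta>) + 2 * (ennreal (W T - W 0) * F.N2 g)"
  unfolding F.N2_def using m1 m2 by (subst nn_integral_add) (auto simp: nn_integral_cmult)
 finally show ?thesis by (simp add: nn_integral_completion)
qed

lemma Yg_progressive: assumes g: "Luni P T V g" shows "progressive_on {0..T} Fo (Yg g)"
 unfolding progressive_on_def
proof
 fix u assume u: "u \<in> {0..T}"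
 have us: "{r \<in> {0..T}. r <= u} = {0..u}" using u by auto
 define M where "M = restrict_space (borel :: real measure) {0..u} \<Otimes>\<^sub>M (Fo u :: 'e path measure)"
 \<comment> \<open>The lower limit of integration becomes a parameter of the integrand, so that the
   kernel can be integrated jointly in time and path.\<close>
 define X where "X a w = \<xi> w + (LINT v|\<nu>. (if a <= v then indicator {0..T} v * g v w else 0))" for a w
 have Xe: "X a w = Xi g a w" if "0 <= a" for a w
  unfolding X_def Xi_def set_lebesgue_integral_def using that
  by (intro arg_cong2[where f="(+)"] refl Bochner_Integration.integral_cong) (auto simp: indicator_def)
 have [measurable]: "fst \<in> borel_measurable M"
  unfolding M_def by (rule measurable_compose[OF measurable_fst]) (rule measurable_restrict_space1, simp)
 have id: "(%w. w) \<in> measurable FF (Fo T :: 'e path measure)"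
 proof (rule measurableI)
  fix A assume A: "A \<in> sets (Fo T :: 'e path measure)"
  then have "(%w. w) -` A \<inter> space FF = A" using sets.sets_into_space[OF A] by auto
  then show "(%w. w) -` A \<inter> space FF \<in> sets FF" using subsetD[OF Fo_FF A] by simp
 qed simp
 have g0: "(%p. indicator {0..T} (fst p) * g (fst p) (snd p)) \<in> borel_measurable (borel \<Otimes>\<^sub>M Fo T)"
  using Luni_progressive[OF g] T0 unfolding progressive_on_Icc_iff by auto
 have "(%x. snd (fst x)) \<in> measurable ((M \<Otimes>\<^sub>M FF) \<Otimes>\<^sub>M \<nu>) (Fo T :: 'e path measure)"
  by (rule measurable_compose[OF measurable_compose[OF measurable_fst measurable_snd] id])
 then have "(%x. (snd x, snd (fst x))) \<in> measurable ((M \<Otimes>\<^sub>M FF) \<Otimes>\<^sub>M \<nu>) (borel \<Otimes>\<^sub>M (Fo T :: 'e path measure))"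
  by (intro measurable_Pair) simp_all
 from measurable_compose[OF this g0]
 have [measurable]: "(%x. indicator {0..T} (snd x) * g (snd x) (snd (fst x))) \<in> borel_measurable ((M \<Otimes>\<^sub>M FF) \<Otimes>\<^sub>M \<nu>)" by simp
 have "(%x. if fst (fst (fst x)) <= snd x then indicator {0..T} (snd x) * g (snd x) (snd (fst x)) else 0) \<in> borel_measurable ((M \<Otimes>\<^sub>M FF) \<Otimes>\<^sub>M \<nu>)"
  by measurable
 then have "(%y. \<integral>v. (if fst (fst y) <= v then indicator {0..T} v * g v (snd y) else 0) \<partial>\<nu>) \<in> borel_measurable (M \<Otimes>\<^sub>M FF)"
  by (intro nu.borel_measurable_lebesgue_integral) (simp add: split_beta')
 moreover have "(%y. \<xi> (snd y)) \<in> borel_measurable (M \<Otimes>\<^sub>M FF)" by (rule measurable_compose[OF measurable_snd meas_Fp_FF[OF xi_meas]])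
 ultimately have Xm: "(%y. X (fst (fst y)) (snd y)) \<in> borel_measurable (M \<Otimes>\<^sub>M FF)" unfolding X_def by (intro borel_measurable_add)
 have k: "(%p. P (fst p) (snd p)) \<in> measurable M (subprob_algebra FF)" unfolding M_def by (rule P_kernel_joint) (use u in simp)
 have "(%p. \<integral>\<^sup>+w'. ennreal (X (fst p) w') \<partial>P (fst p) (snd p)) \<in> borel_measurable M"
  by (rule nn_integral_measurable_subprob_algebra2[OF _ k]) (use Xm in \<open>simp add: split_beta'\<close>)
 moreover have "(%p. \<integral>\<^sup>+w'. ennreal (- X (fst p) w') \<partial>P (fst p) (snd p)) \<in> borel_measurable M"
  by (rule nn_integral_measurable_subprob_algebra2[OF _ k]) (use Xm in \<open>simp add: split_beta'\<close>)
 ultimately have "(%p. enn2real (\<integral>\<^sup>+w'. ennreal (X (fst p) w') \<partial>P (fst p) (snd p)) - enn2real (\<integral>\<^sup>+w'. ennreal (- X (fst p) w') \<partial>P (fst p) (snd p))) \<in> borel_measurable M"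
  by measurable
 then have "(%(r, w). Yg g r w) \<in> borel_measurable M"
 proof (rule measurable_cong[THEN iffD1, rotated])
  fix p assume "p \<in> space M"
  then have p: "fst p \<in> {0..u}" "snd p \<in> Omega" by (auto simp: M_def space_pair_measure space_restrict_space)
  then have "integrable (P (fst p) (snd p)) (X (fst p))"
   using Xi_L2(2)[OF g _ p(2), of "fst p" "fst p"] u by (simp add: ext[OF Xe])
  from real_lebesgue_integral_def[OF this] show "enn2real (\<integral>\<^sup>+w'. ennreal (X (fst p) w') \<partial>P (fst p) (snd p)) - enn2real (\<integral>\<^sup>+w'. ennreal (- X (fst p) w') \<partial>P (fst p) (snd p)) = (case p of (r, w) => Yg g r w)"
   using p by (simp add: Yg_def split_beta' ext[OF Xe])
 qed
 then show "(%(r, w). Yg g r w) \<in> borel_measurable (restrict_space borel {r \<in> {0..T}. r <= u} \<Otimes>\<^sub>M Fo u)" unfolding us M_def .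
qed

text \<open>Jensen's inequality under each \<open>P t w\<close>, followed by the Markov
  property.\<close>

lemma Yg_sq:
 assumes g: "Luni P T V g" and s: "s \<in> {0..T}" "\<eta> \<in> Omega" and t: "s <= t" "t <= T"
 shows "(\<integral>\<^sup>+w. ennreal ((Yg g t w)^2) \<partial>P s \<eta>) <= (\<integral>\<^sup>+w. ennreal ((Xi g t w)^2) \<partial>P s \<eta>)"
proof -
 have s0: "0 <= s" and tT: "t \<in> {0..T}" "0 <= t" using s t by auto
 have top: "Omega \<in> sets (Fp t)" using sets.top[of "Fp t"] by simp
 have J: "ennreal ((Yg g t w)^2) <= (\<integral>\<^sup>+w'. ennreal ((Xi g t w')^2) \<partial>P t w)" if w: "w \<in> Omega" for w
 proof -
  interpret Pt: prob_space "P t w" by (rule P_prob[OF tT(2) w])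
  have m: "Xi g t \<in> borel_measurable (P t w)" using Xi_meas[OF g tT(1)] tT w by (simp add: meas_P)
  note i = Xi_L2(1)[OF g tT(1) w order_refl t(2)]
  have "(Yg g t w)^2 <= (LINT w'|P t w. (Xi g t w')^2)"
   using Cauchy_Schwarz_integral[OF m, of "%_. 1"] i by (simp add: Yg_def Pt.prob_space)
  then show ?thesis using nn_integral_eq_integral[OF i] by (simp add: ennreal_leI)
 qed
 have m2: "(%w. ennreal ((Xi g t w)^2)) \<in> borel_measurable FF" using Xi_meas[OF g tT(1)] by measurable
 have "(\<integral>\<^sup>+w. ennreal ((Yg g t w)^2) \<partial>P s \<eta>) <= (\<integral>\<^sup>+w. indicator Omega w * (\<integral>\<^sup>+w'. ennreal ((Xi g t w')^2) \<partial>P t w) \<partial>P s \<eta>)"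
  by (rule nn_integral_mono) (use J P_prob(2)[OF s0 s(2)] in \<open>auto simp: indicator_def\<close>)
 also have "\<dots> = (\<integral>\<^sup>+w. indicator Omega w * ennreal ((Xi g t w)^2) \<partial>P s \<eta>)" by (rule Markov_nn(1)[OF s0 s(2) t(1) top m2])
 also have "\<dots> = (\<integral>\<^sup>+w. ennreal ((Xi g t w)^2) \<partial>P s \<eta>)"
  by (rule nn_integral_cong) (use P_prob(2)[OF s0 s(2)] in \<open>auto simp: indicator_def\<close>)
 finally show ?thesis .
qed

lemma Yg_Luni: assumes g: "Luni P T V g" shows "Luni P T V (Yg g)"
proof (rule Luni_I[OF Yg_progressive[OF g]])
 fix s and \<eta> :: "'e path" assume s: "s \<in> {0..T}" "\<eta> \<in> Omega"
 interpret F: filtered_clock W T \<nu> "Pc s \<eta>" "Fc (P s \<eta>)" s by (rule filtered[OF s])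
 have s0: "0 <= s" using s by simp
 define B where "B = 2 * (\<integral>\<^sup>+w. ennreal ((\<xi> w)^2) \<partial>P s \<eta>) + 2 * (ennreal (W T - W 0) * F.N2 g)"
 have "B < \<infinity>" unfolding B_def using Luni_D(2)[OF g s] nn_integral_eq_integral[OF xi_L2[OF s0 s(2)]]
  by (simp add: ennreal_mult_less_top)
 have "F.N2 (Yg g) = (\<integral>\<^sup>+r\<in>{s..T}. (\<integral>\<^sup>+w. ennreal ((Yg g r w)^2) \<partial>Pc s \<eta>) \<partial>\<nu>)"
  unfolding F.N2_def by (rule F.Tonelli(1)[OF F.jm_E[OF F.jm_prog[OF progressive_prog[OF s Yg_progressive[OF g]]]] order_refl]) auto
 also have "\<dots> <= (\<integral>\<^sup>+r\<in>{s..T}. B \<partial>\<nu>)"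
 proof (rule nn_integral_mono)
  fix r
  have "(\<integral>\<^sup>+w. ennreal ((Yg g r w)^2) \<partial>Pc s \<eta>) <= B" if "r \<in> {s..T}"
   using order_trans[OF Yg_sq[OF g s, of r] Xi_sq_bound[OF g s, of r]] that by (simp add: B_def nn_integral_completion)
  then show "(\<integral>\<^sup>+w. ennreal ((Yg g r w)^2) \<partial>Pc s \<eta>) * indicator {s..T} r <= B * indicator {s..T} r"
   by (auto simp: indicator_def)
 qed
 also have "\<dots> = B * emeasure \<nu> {s..T}" by (rule nn_integral_cmult_indicator) simp
 also have "\<dots> < \<infinity>"
 proof -
  have "emeasure \<nu> {s..T} < \<top>" by (simp add: less_top[symmetric])
  then show ?thesis using \<open>B < \<infinity>\<close> by (simp add: ennreal_mult_less_top)
 qed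
 finally show "F.N2 (Yg g) < \<infinity>" .
qed

text \<open>The tower property: replacing the terminal quantity by its conditional mean at
  \<open>u\<close> does not change its mean under \<open>P t w\<close>.\<close>

lemma mp_Yg: assumes g: "Luni P T V g" shows "mp (Yg g) g"
 unfolding mp_def
proof (intro conjI ballI g Yg_Luni)
 fix t u and w :: "'e path" assume t: "t \<in> {0..T}" "u \<in> {t..T}" "w \<in> Omega"
 then have u: "t <= u" "u <= T" "u \<in> {0..T}" "0 <= u" and t0: "0 <= t" by auto
 have Ym: "Yg g u \<in> borel_measurable (P t w)" using meas_Fo_FF[OF progressive_sec[OF Yg_progressive[OF g] u(3)]] t0 t(3) by (simp add: meas_P)
 show "integrable (P t w) (%w'. (Yg g u w')^2)"
 proof (rule integrableI_bounded)
  show "(%w'. (Yg g u w')^2) \<in> borel_measurable (P t w)" using Ym by measurable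
  have "(\<integral>\<^sup>+w'. ennreal (norm ((Yg g u w')^2)) \<partial>P t w) <= (\<integral>\<^sup>+w'. ennreal ((Xi g u w')^2) \<partial>P t w)"
   using Yg_sq[OF g t(1,3) u(1,2)] by simp
  also have "\<dots> < \<infinity>" using nn_integral_eq_integral[OF Xi_L2(1)[OF g t(1,3) u(1,2)]] by simp
  finally show "(\<integral>\<^sup>+w'. ennreal (norm ((Yg g u w')^2)) \<partial>P t w) < \<infinity>" .
 qed
 have top: "Omega \<in> sets (Fp u)" using sets.top[of "Fp u"] by simp
 note Mk = Markov_real[OF t0 t(3) u(1) top Xi_meas[OF g u(3)] Xi_L2(2)[OF g t(1,3) u(1,2)] Xi_L2(2)[OF g u(3) _ order_refl u(2)]]
 have full: "(LINT w':Omega|P t w. h w') = (LINT w'|P t w. h w')" for h :: "'e path => real"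
  unfolding set_lebesgue_integral_def by (intro Bochner_Integration.integral_cong refl) (use P_prob(2)[OF t0 t(3)] in auto)
 have Yi: "integrable (P t w) (Yg g u)" unfolding Yg_def[abs_def] by (rule Mk(2))
 have gi: "integrable (P t w) (%w'. LINT r:{t..u}|\<nu>. g r w')" by (rule Luni_Fubini(2)[OF g t(1,3) u(1,2) g t(1,3)])
 have "(LINT w'|P t w. Yg g u w' + (LINT r:{t..u}|\<nu>. g r w')) = (LINT w'|P t w. Yg g u w') + (LINT w'|P t w. (LINT r:{t..u}|\<nu>. g r w'))"
  by (rule Bochner_Integration.integral_add[OF Yi gi])
 also have "(LINT w'|P t w. Yg g u w') = (LINT w'|P t w. Xi g u w')" unfolding Yg_def using Mk(3) unfolding full .
 also have "\<dots> + (LINT w'|P t w. (LINT r:{t..u}|\<nu>. g r w')) = (LINT w'|P t w. Xi g u w' + (LINT r:{t..u}|\<nu>. g r w'))"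
  by (rule Bochner_Integration.integral_add[OF Xi_L2(2)[OF g t(1,3) u(1,2)] gi, symmetric])
 also have "\<dots> = (LINT w'|P t w. Xi g t w')"
 proof (rule integral_cong_AE)
  show "(%w'. Xi g u w' + (LINT r:{t..u}|\<nu>. g r w')) \<in> borel_measurable (P t w)"
   using Xi_L2(2)[OF g t(1,3) u(1,2)] gi by auto
  show "Xi g t \<in> borel_measurable (P t w)" using Xi_meas[OF g t(1)] t0 t(3) by (simp add: meas_P)
  show "AE w' in P t w. Xi g u w' + (LINT r:{t..u}|\<nu>. g r w') = Xi g t w'"
   using Luni_AE(2)[OF g t(1,3)] by eventually_elim (use set_integral_split[OF _ u(1,2)] in \<open>simp add: Xi_def\<close>)
 qed
 finally show "(LINT w'|P t w. Yg g u w' + (LINT r:{t..u}|\<nu>. g r w')) = Yg g t w" by (simp add: Yg_def)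
qed

text \<open>\<xi> is measurable for \<open>Fp T\<close> only, so it may depend on the path
  immediately after \<open>T\<close>, and \<open>AE_determined\<close> does not cover it. The
  equality comes from the Markov property for the right-continuous filtration: the difference of
  both sides is measurable for \<open>Fc (P s \<eta>) T\<close> and has zero integral over each
  event there, so it is orthogonal to itself.\<close>

lemma Yg_terminal:
 assumes g: "Luni P T V g" and s: "s \<in> {0..T}" "\<eta> \<in> Omega"
 shows "AE w in Pc s \<eta>. Yg g T w = \<xi> w"
proof -
 interpret F: filtered_clock W T \<nu> "Pc s \<eta>" "Fc (P s \<eta>)" s by (rule filtered[OF s])
 have s0: "0 <= s" "s <= T" "T \<in> {0..T}" "0 <= T" using s by auto
 have "(LINT r:{T..T}|\<nu>. g r w) = 0" for w by (rule F.nI_same[unfolded F.nI_def])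
 then have XT: "Xi g T = \<xi>" by (simp only: Xi_def[abs_def] add_0_right)
 define D where "D w = Yg g T w - \<xi> w" for w
 note Mk = Markov_Fc[OF s s0(2) _ Xi_meas[OF g s0(3)] Xi_L2(2)[OF g s s0(2) order_refl] Xi_L2(2)[OF g s0(3) _ order_refl order_refl]]
 have Ym: "Yg g T \<in> borel_measurable (Fo T)" by (rule progressive_sec[OF Yg_progressive[OF g] s0(3)])
 have Yi: "integrable (Pc s \<eta>) (%w. (Yg g T w)^2)"
  using mp_D(3)[OF mp_Yg[OF g] s(1) s0(2) order_refl s(2)] meas_Fo_FF[OF Ym] by (subst integral_comp(2)[OF s0(1) s(2)]) auto
 have xim: "\<xi> \<in> borel_measurable FF" by (rule meas_Fp_FF[OF xi_meas])
 have xi2: "integrable (Pc s \<eta>) (%w. (\<xi> w)^2)"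
  using xi_L2[OF s0(1) s(2)] xim by (subst integral_comp(2)[OF s0(1) s(2)]) auto
 have Ymc: "Yg g T \<in> borel_measurable (Fc (P s \<eta>) T)" by (rule meas_Fo_Fc[OF s0(1) s(2) Ym])
 have ximc: "\<xi> \<in> borel_measurable (Fc (P s \<eta>) T)"
  by (rule measurable_from_subalg[OF _ xi_meas]) (use Fp_Fc[OF s0(1) s(2)] in \<open>auto simp: subalgebra_def\<close>)
 have Dm: "D \<in> borel_measurable (Fc (P s \<eta>) T)" unfolding D_def[abs_def] using Ymc ximc by measurable
 have D2: "integrable (Pc s \<eta>) (%w. (D w)^2)" unfolding D_def
  by (rule integrable_L2_diff[OF F.G_meas[OF Ymc] F.G_meas[OF ximc] Yi xi2])
 have Di: "integrable (Pc s \<eta>) D" by (rule F.Q.integrable_of_L2[OF F.G_meas[OF Dm] D2])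
 have i1: "integrable (Pc s \<eta>) (Yg g T)" by (rule F.Q.integrable_of_L2[OF F.G_meas[OF Ymc] Yi])
 have i2: "integrable (Pc s \<eta>) \<xi>" by (rule F.Q.integrable_of_L2[OF F.G_meas[OF ximc] xi2])
 have z: "(LINT w:A|Pc s \<eta>. D w) = 0" if A: "A \<in> sets (Fc (P s \<eta>) T)" for A
 proof -
  have "(LINT w:A|Pc s \<eta>. \<xi> w) = (LINT w:A|Pc s \<eta>. Yg g T w)"
   using Mk[OF A] unfolding XT Yg_def .
  then show ?thesis unfolding D_def using F.set_integrable_of[OF i1 A] F.set_integrable_of[OF i2 A] by (simp add: set_integral_diff)
 qed
 have "(LINT w|Pc s \<eta>. D w * D w) = 0"
  by (rule F.test_zero[OF Di z Dm]) (use D2 in \<open>auto simp: power2_eq_square\<close>)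
 then have "AE w in Pc s \<eta>. (D w)^2 = 0"
  by (subst integral_nonneg_eq_0_iff_AE[symmetric, OF D2]) (auto simp: power2_eq_square)
 then show ?thesis by eventually_elim (simp add: D_def)
qed

end

context pd_class
begin

lemma L1_dominated:
 assumes X: "progressive_on {0..T} Fo X" and Y: "progressive_on {0..T} Fo Y" and t: "t \<in> {0..T}" "w \<in> Omega"
  and fX: "(\<integral>\<^sup>+w'. (\<integral>\<^sup>+r\<in>{t..T}. ennreal \<bar>X r w'\<bar> \<partial>\<nu>) \<partial>P t w) < \<infinity>"
  and fY: "(\<integral>\<^sup>+w'. (\<integral>\<^sup>+r\<in>{t..T}. ennreal \<bar>Y r w'\<bar> \<partial>\<nu>) \<partial>P t w) < \<infinity>"
  and le: "\<And>r w. \<bar>Z r w\<bar> <= \<bar>X r w\<bar> + \<bar>Y r w\<bar>"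
 shows "(\<integral>\<^sup>+w'. (\<integral>\<^sup>+r\<in>{t..T}. ennreal \<bar>Z r w'\<bar> \<partial>\<nu>) \<partial>P t w) < \<infinity>"
proof -
 interpret F: filtered_clock W T \<nu> "Pc t w" "Fc (P t w)" t by (rule filtered[OF t])
 from F.nn_dominated[OF F.jm_prog[OF progressive_prog[OF t X]] F.jm_prog[OF progressive_prog[OF t Y]], of "%x. ennreal \<bar>x\<bar>" "%x. ennreal \<bar>x\<bar>" "%r w. ennreal \<bar>Z r w\<bar>"]
 have "(\<integral>\<^sup>+w'. (\<integral>\<^sup>+r\<in>{t..T}. ennreal \<bar>Z r w'\<bar> \<partial>\<nu>) \<partial>P t w) <= (\<integral>\<^sup>+w'. (\<integral>\<^sup>+r\<in>{t..T}. ennreal \<bar>X r w'\<bar> \<partial>\<nu>) \<partial>P t w) + (\<integral>\<^sup>+w'. (\<integral>\<^sup>+r\<in>{t..T}. ennreal \<bar>Y r w'\<bar> \<partial>\<nu>) \<partial>P t w)"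
  using le by (simp add: nn_integral_completion ennreal_plus[symmetric] ennreal_leI del: ennreal_plus)
 also have "\<dots> < \<infinity>" using fX fY by simp
 finally show ?thesis .
qed

text \<open>The inner expectation is linear only at those times at which both terms are integrable,
  which are almost all; elsewhere it may be the default value 0.\<close>

lemma P_Fubini_diff:
 assumes X: "progressive_on {0..T} Fo X" and Y: "progressive_on {0..T} Fo Y" and t: "t \<in> {0..T}" "w \<in> Omega" and u: "t <= u" "u <= T"
  and fX: "(\<integral>\<^sup>+w'. (\<integral>\<^sup>+r\<in>{t..T}. ennreal \<bar>X r w'\<bar> \<partial>\<nu>) \<partial>P t w) < \<infinity>"
  and fY: "(\<integral>\<^sup>+w'. (\<integral>\<^sup>+r\<in>{t..T}. ennreal \<bar>Y r w'\<bar> \<partial>\<nu>) \<partial>P t w) < \<infinity>"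
 shows "(LINT r:{t..u}|\<nu>. (LINT w'|P t w. X r w' - Y r w')) = (LINT r:{t..u}|\<nu>. (LINT w'|P t w. X r w')) - (LINT r:{t..u}|\<nu>. (LINT w'|P t w. Y r w'))"
proof -
 note x = P_Fubini(3,4)[OF X t u fX] and y = P_Fubini(3,4)[OF Y t u fY]
 have "(\<integral>\<^sup>+w'. (\<integral>\<^sup>+r\<in>{t..T}. ennreal \<bar>X r w' - Y r w'\<bar> \<partial>\<nu>) \<partial>P t w) < \<infinity>"
  by (rule L1_dominated[OF X Y t fX fY]) (rule abs_triangle_ineq4)
 note d = P_Fubini(4)[OF progressive_on_arith(2)[OF X Y] t u this]
 have "(LINT r:{t..u}|\<nu>. (LINT w'|P t w. X r w' - Y r w')) = (LINT r:{t..u}|\<nu>. (LINT w'|P t w. X r w') - (LINT w'|P t w. Y r w'))"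
  unfolding set_lebesgue_integral_def
 proof (rule integral_cong_AE)
  show "(%r. indicator {t..u} r *\<^sub>R (LINT w'|P t w. X r w' - Y r w')) \<in> borel_measurable \<nu>"
   using d unfolding set_integrable_def by (rule borel_measurable_integrable)
  show "(%r. indicator {t..u} r *\<^sub>R ((LINT w'|P t w. X r w') - (LINT w'|P t w. Y r w'))) \<in> borel_measurable \<nu>"
   using set_integral_diff(1)[OF x(2) y(2)] unfolding set_integrable_def by (rule borel_measurable_integrable)
  show "AE r in \<nu>. indicator {t..u} r *\<^sub>R (LINT w'|P t w. X r w' - Y r w') = indicator {t..u} r *\<^sub>R ((LINT w'|P t w. X r w') - (LINT w'|P t w. Y r w'))"
   using x(1) y(1) by eventually_elim (use u in \<open>auto simp: indicator_def\<close>)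
 qed
 also have "\<dots> = (LINT r:{t..u}|\<nu>. (LINT w'|P t w. X r w')) - (LINT r:{t..u}|\<nu>. (LINT w'|P t w. Y r w'))"
  by (rule set_integral_diff(2)[OF x(2) y(2)])
 finally show ?thesis .
qed

lemma measure_nu_Icc: "t <= u ==> measure \<nu> {t..u} = W u - W t"
 using nu_Icc[of t u] W_mono[of t u] by (simp add: measure_def)

end

section \<open>The generator and the integral equations\<close>

locale pd_bsde = pd_terminal P T V \<xi> for P :: "real => ('e::polish_space) path => 'e path measure" and T V \<xi> +
 fixes DA :: "'e proc set" and A :: "'e proc => 'e proc" and \<Psi> :: "'d::finite => 'e proc"
  and f :: "real => 'e path => real => real^'d => real" and K :: real
 assumes wg: "weak_generator P T V DA A"
  and Psi_DA: "\<Psi> i \<in> DA" and Psi_Luni: "Luni P T V (\<Psi> i)" and A_Psi_Luni: "Luni P T V (A (\<Psi> i))"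
  and Psi_sq: "(%t w. \<Psi> i t w * \<Psi> i t w) \<in> DA"
  and Gamma_bounded: "\<exists>C. \<forall>t\<ge>0. \<forall>w\<in>Omega. \<bar>Gamma A (\<Psi> i) (\<Psi> i) t w\<bar> <= C"
  and hB: "hypB P T V f \<xi> K"
begin

lemma wg_D:
 assumes "\<Phi> \<in> DA"
 shows "progressive_on {0..} Fo \<Phi>" "progressive_on {0..} Fo (A \<Phi>)"
  "\<And>s \<eta> t. 0 <= s ==> \<eta> \<in> Omega ==> s <= t ==> (\<integral>\<^sup>+w. (\<integral>\<^sup>+r\<in>{s..t}. ennreal \<bar>A \<Phi> r w\<bar> \<partial>\<nu>) \<partial>P s \<eta>) < \<infinity>"
  "\<And>s \<eta> t. 0 <= s ==> \<eta> \<in> Omega ==> s <= t ==> integrable (P s \<eta>) (\<Phi> t)"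
  "\<And>s \<eta> t. 0 <= s ==> \<eta> \<in> Omega ==> s <= t ==> (LINT w|P s \<eta>. \<Phi> t w) = \<Phi> s \<eta> + (LINT r:{s..t}|\<nu>. (LINT w|P s \<eta>. A \<Phi> r w))"
 using wg assms unfolding weak_generator_def by blast+

text \<open>The sign brings the generator identity into the form \<open>mp\<close>, in which a drift
  is compensated by adding the integral.\<close>

definition h :: "'d => 'e proc" where "h i r w = - A (\<Psi> i) r w"

lemma h_Luni: "Luni P T V (h i)"
 using Luni_lin[OF A_Psi_Luni A_Psi_Luni, of "-1" i 0 i] by (simp add: h_def[abs_def])

lemma Psi_mp: "mp (\<Psi> i) (h i)"
 unfolding mp_def
proof (intro conjI ballI Psi_Luni h_Luni)
 fix t u and w :: "'e path" assume t: "t \<in> {0..T}" "u \<in> {t..T}" "w \<in> Omega"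
 then have u: "t <= u" "u <= T" and t0: "0 <= t" by auto
 show "integrable (P t w) (%w'. (\<Psi> i u w')^2)"
  using wg_D(4)[OF Psi_sq t0 t(3) u(1)] by (simp add: power2_eq_square)
 note F = Luni_Fubini[OF A_Psi_Luni t(1,3) u A_Psi_Luni t(1,3), of i]
 have "(LINT w'|P t w. \<Psi> i u w' + (LINT r:{t..u}|\<nu>. h i r w')) = (LINT w'|P t w. \<Psi> i u w' - (LINT r:{t..u}|\<nu>. A (\<Psi> i) r w'))"
  by (simp add: h_def set_lebesgue_integral_def)
 also have "\<dots> = (LINT w'|P t w. \<Psi> i u w') - (LINT w'|P t w. (LINT r:{t..u}|\<nu>. A (\<Psi> i) r w'))"
  by (rule Bochner_Integration.integral_diff[OF wg_D(4)[OF Psi_DA t0 t(3) u(1)] F(2)])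
 also have "\<dots> = \<Psi> i t w" using wg_D(5)[OF Psi_DA t0 t(3) u(1), of i] F(1) by simp
 finally show "(LINT w'|P t w. \<Psi> i u w' + (LINT r:{t..u}|\<nu>. h i r w')) = \<Psi> i t w" .
qed

text \<open>The bracket of \<open>M[\<Psi>\<^sup>i]\<close> has density \<open>\<Gamma>(\<Psi>\<^sup>i, \<Psi>\<^sup>i)\<close>.\<close>

lemma Psi_Ecov_le:
 assumes C: "\<forall>t\<ge>0. \<forall>w\<in>Omega. \<bar>Gamma A (\<Psi> i) (\<Psi> i) t w\<bar> <= C"
  and t: "0 <= t" "t <= u" "u <= T" and w: "w \<in> Omega"
 shows "Ecov (\<Psi> i) (h i) (\<Psi> i) (h i) t u w <= C * (W u - W t)"
proof -
 interpret Pt: prob_space "P t w" by (rule P_prob[OF t(1) w])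
 have tT: "t \<in> {0..T}" using t by simp
 define X where "X = A (%t w. \<Psi> i t w * \<Psi> i t w)"
 define B where "B r w = \<Psi> i r w * h i r w + h i r w * \<Psi> i r w" for r w
 have pX: "progressive_on {0..T} Fo X"
  using wg_D(2)[OF Psi_sq[of i]] unfolding X_def progressive_on_atLeast_iff progressive_on_Icc_iff by auto
 have pB: "progressive_on {0..T} Fo B"
  unfolding B_def by (intro progressive_on_arith Luni_progressive Psi_Luni h_Luni)
 have L2h: "Luni P T V (%r w. 2 * h i r w)" using Luni_lin[OF h_Luni h_Luni, of 1 i 1 i] by simp
 have "B r w' = \<Psi> i r w' * (2 * h i r w')" for r w' by (simp add: B_def)
 then have fB: "(\<integral>\<^sup>+w'. (\<integral>\<^sup>+r\<in>{t..T}. ennreal \<bar>B r w'\<bar> \<partial>\<nu>) \<partial>P t w) < \<infinity>"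
  using Luni_L1_mult[OF Psi_Luni L2h tT w, of i] by simp
 have fX: "(\<integral>\<^sup>+w'. (\<integral>\<^sup>+r\<in>{t..T}. ennreal \<bar>X r w'\<bar> \<partial>\<nu>) \<partial>P t w) < \<infinity>"
  unfolding X_def by (rule wg_D(3)[OF Psi_sq t(1) w]) (use t in simp)
 note x = P_Fubini(3,4)[OF pX tT w t(2,3) fX] and b = P_Fubini(3,4)[OF pB tT w t(2,3) fB]
 have "Ecov (\<Psi> i) (h i) (\<Psi> i) (h i) t u w = (LINT r:{t..u}|\<nu>. (LINT w'|P t w. X r w')) + (LINT r:{t..u}|\<nu>. (LINT w'|P t w. B r w'))"
  using Ecov_by_parts[OF Psi_mp Psi_mp tT w t(2,3), of i i] wg_D(5)[OF Psi_sq t(1) w t(2), of i] by (simp add: X_def B_def)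
 also have "\<dots> = (LINT r:{t..u}|\<nu>. (LINT w'|P t w. X r w') + (LINT w'|P t w. B r w'))"
  by (rule set_integral_add(2)[OF x(2) b(2), symmetric])
 also have "\<dots> <= (LINT r:{t..u}|\<nu>. C)"
 proof (rule set_integral_mono_AE)
  show "set_integrable \<nu> {t..u} (%r. (LINT w'|P t w. X r w') + (LINT w'|P t w. B r w'))" by (rule set_integral_add(1)[OF x(2) b(2)])
  show "set_integrable \<nu> {t..u} (%r. C)" unfolding set_integrable_def by (simp add: less_top[symmetric])
  show "AE r\<in>{t..u} in \<nu>. (LINT w'|P t w. X r w') + (LINT w'|P t w. B r w') <= C"
   using x(1) b(1)
  proof eventually_elim
   case (elim r)
   show ?case
   proof
    assume r: "r \<in> {t..u}"
    then have i: "integrable (P t w) (X r)" "integrable (P t w) (B r)" using elim t by auto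
    have "(LINT w'|P t w. X r w') + (LINT w'|P t w. B r w') = (LINT w'|P t w. X r w' + B r w')" using i by simp
    also have "\<dots> <= (LINT w'|P t w. C)"
    proof (rule integral_mono)
     fix w' assume "w' \<in> space (P t w)"
     then have "\<bar>Gamma A (\<Psi> i) (\<Psi> i) r w'\<bar> <= C" using C r t P_prob(2)[OF t(1) w] by auto
     then show "X r w' + B r w' <= C" by (simp add: Gamma_def X_def B_def h_def)
    qed (use i in auto)
    finally show "(LINT w'|P t w. X r w') + (LINT w'|P t w. B r w') <= C" by (simp add: Pt.prob_space)
   qed
  qed
 qed
 also have "\<dots> = C * (W u - W t)" using measure_nu_Icc[OF t(2)] by (simp add: set_lebesgue_integral_def)
 finally show ?thesis .
qed

lemma Psi_bound: "\<exists>C>0. \<forall>i t u w. 0 <= t \<longrightarrow> t <= u \<longrightarrow> u <= T \<longrightarrow> w \<in> Omega \<longrightarrow> Ecov (\<Psi> i) (h i) (\<Psi> i) (h i) t u w <= C * (W u - W t)"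
proof -
 obtain c where c: "\<And>i. \<forall>t\<ge>0. \<forall>w\<in>Omega. \<bar>Gamma A (\<Psi> i) (\<Psi> i) t w\<bar> <= c i" using Gamma_bounded by metis
 \<comment> \<open>The bounds are summed to be uniform over the finite index type; the summand 1
   ensures positivity.\<close>
 define C where "C = 1 + (\<Sum>i\<in>UNIV. \<bar>c i\<bar>)"
 have "0 < C" unfolding C_def by (intro add_pos_nonneg sum_nonneg) auto
 moreover have "Ecov (\<Psi> i) (h i) (\<Psi> i) (h i) t u w <= C * (W u - W t)" if "0 <= t" "t <= u" "u <= T" "w \<in> Omega" for i t u w
 proof -
  have "c i <= C" unfolding C_def using member_le_sum[of i UNIV "%i. \<bar>c i\<bar>"] by auto
  then have "c i * (W u - W t) <= C * (W u - W t)" using W_mono[OF that(2)] by (intro mult_right_mono) auto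
  with Psi_Ecov_le[OF c that, of i] show ?thesis by simp
 qed
 ultimately show ?thesis by blast
qed

definition C0 :: real where
 "C0 = (SOME C. 0 < C \<and> (\<forall>i t u w. 0 <= t \<longrightarrow> t <= u \<longrightarrow> u <= T \<longrightarrow> w \<in> Omega \<longrightarrow> Ecov (\<Psi> i) (h i) (\<Psi> i) (h i) t u w <= C * (W u - W t)))"

lemma C0: "0 < C0" "0 <= t ==> t <= u ==> u <= T ==> w \<in> Omega ==> Ecov (\<Psi> i) (h i) (\<Psi> i) (h i) t u w <= C0 * (W u - W t)"
 using someI_ex[OF Psi_bound, folded C0_def] by blast+

text \<open>\<open>H\<close> may be any sigma-algebra above \<open>Fo u\<close>. It is
  \<open>Fo u\<close> itself when progressivity is proved, and the completed law when the driver of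
  a given BSDE solution is considered.\<close>

lemma f_measurable:
 fixes H :: "'e path measure"
 assumes H: "space H = Omega" "sets (Fo u) \<subseteq> sets H" and u: "0 <= a" "a <= u" "u <= T"
  and Y: "(%(r, w). Y r w) \<in> borel_measurable (restrict_space borel {a..u} \<Otimes>\<^sub>M H)"
  and Z: "\<And>j. (%(r, w). Z j r w) \<in> borel_measurable (restrict_space borel {a..u} \<Otimes>\<^sub>M H)"
 shows "(%(r, w). f r w (Y r w) (\<chi> j. Z j r w)) \<in> borel_measurable (restrict_space borel {a..u} \<Otimes>\<^sub>M H)"
proof -
 let ?N = "restrict_space (borel :: real measure) {a..u} \<Otimes>\<^sub>M H"
 have sN: "space ?N = {a..u} \<times> Omega" by (auto simp: space_pair_measure space_restrict_space H)
 have idH: "(%w. w) \<in> measurable H (Fo u)"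
 proof (rule measurableI)
  fix B assume B: "B \<in> sets (Fo u :: 'e path measure)"
  then have "(%w. w) -` B \<inter> space H = B" using sets.sets_into_space[OF B] H by auto
  then show "(%w. w) -` B \<inter> space H \<in> sets H" using B H by auto
 qed (simp add: H)
 have idR: "(%r. r) \<in> measurable (restrict_space (borel :: real measure) {a..u}) (restrict_space borel {0..u})"
  by (intro measurable_restrict_space2 measurable_restrict_space1) (use u in \<open>auto simp: space_restrict_space\<close>)
 have id1: "(%p. (fst p, snd p)) \<in> measurable ?N (restrict_space borel {0..u} \<Otimes>\<^sub>M Fo u)"
  by (intro measurable_Pair measurable_compose[OF measurable_fst idR] measurable_compose[OF measurable_snd idH])
 have idP: "(%p. p) \<in> measurable ?N ProO"
  unfolding ProO_def
 proof (rule measurable_measure_of)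
  fix C :: "(real \<times> 'e path) set"
  assume "C \<in> {C. C \<subseteq> {0..} \<times> Omega \<and> (\<forall>t\<ge>0. C \<inter> {0..t} \<times> Omega \<in> sets (restrict_space borel {0..t} \<Otimes>\<^sub>M Fo t))}"
  then have "C \<inter> {0..u} \<times> Omega \<in> sets (restrict_space borel {0..u} \<Otimes>\<^sub>M Fo u)" using u by auto
  from measurable_sets[OF id1 this] have "(%p. (fst p, snd p)) -` (C \<inter> {0..u} \<times> Omega) \<inter> space ?N \<in> sets ?N" .
  also have "(%p. (fst p, snd p)) -` (C \<inter> {0..u} \<times> Omega) \<inter> space ?N = (%p. p) -` C \<inter> space ?N" using u unfolding sN by auto
  finally show "(%p. p) -` C \<inter> space ?N \<in> sets ?N" .
 qed (use u in \<open>auto simp: sN\<close>)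
 have idT: "(%p. p) \<in> measurable ?N (restrict_space ProO ({0..T} \<times> Omega))"
  by (rule measurable_restrict_space2[OF _ idP]) (use u sN in auto)
 have vec: "(%p. \<chi> j. Z j (fst p) (snd p)) \<in> borel_measurable ?N"
  by (subst borel_measurable_euclidean_space) (use Z in \<open>auto simp: Basis_vec_def inner_axis split_beta'\<close>)
 have Y': "(%p. Y (fst p) (snd p)) \<in> borel_measurable ?N" using Y by (simp add: split_beta')
 have fm: "(%((t,w),(y,z)). f t w y z) \<in> borel_measurable (restrict_space ProO ({0..T} \<times> Omega) \<Otimes>\<^sub>M (borel \<Otimes>\<^sub>M borel))"
  using hB unfolding hypB_def by blast
 from measurable_compose[OF measurable_Pair[OF idT measurable_Pair[OF Y' vec]] fm] show ?thesis by (simp add: split_beta')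
qed

lemma f_lipschitz:
 assumes "t \<in> {0..T}" "w \<in> Omega"
 shows "(f t w y z - f t w y' z')^2 <= 2 * K^2 * ((y - y')^2 + (\<Sum>j\<in>UNIV. (z $ j - z' $ j)^2))"
proof -
 have "\<bar>f t w y z - f t w y' z'\<bar> <= K * (\<bar>y - y'\<bar> + norm (z - z'))" using hB assms unfolding hypB_def by blast
 then have "\<bar>f t w y z - f t w y' z'\<bar>^2 <= (K * (\<bar>y - y'\<bar> + norm (z - z')))^2" by (rule power_mono) simp
 also have "\<dots> = K^2 * (\<bar>y - y'\<bar> + norm (z - z'))^2" by (simp add: power_mult_distrib)
 also have "\<dots> <= K^2 * (2 * (\<bar>y - y'\<bar>^2 + (norm (z - z'))^2))"
  using zero_le_power2[of "\<bar>y - y'\<bar> - norm (z - z')"] by (intro mult_left_mono) (auto simp: power2_eq_square algebra_simps)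
 also have "(norm (z - z'))^2 = (\<Sum>j\<in>UNIV. (z $ j - z' $ j)^2)"
  unfolding norm_vec_def L2_set_def by (simp add: sum_nonneg)
 finally show ?thesis by (simp add: algebra_simps)
qed

definition Fd :: "'e proc => ('d => 'e proc) => 'e proc" where
 "Fd Y Z r w = f r w (Y r w) (\<chi> j. Z j r w)"

lemma Fd_lipschitz:
 "t \<in> {0..T} ==> w \<in> Omega ==> (Fd Y Z t w - Fd Y' Z' t w)^2 <= 2 * K^2 * ((Y t w - Y' t w)^2 + (\<Sum>j\<in>UNIV. (Z j t w - Z' j t w)^2))"
 unfolding Fd_def using f_lipschitz[of t w "Y t w" "\<chi> j. Z j t w" "Y' t w" "\<chi> j. Z' j t w"] by simp

lemma Luni_zero: "Luni P T V (%r w. 0)"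
 using Luni_lin[OF Psi_Luni Psi_Luni, of 0 _ 0] by simp

lemma Luni_sum_abs:
 assumes "finite J" "\<And>j. j \<in> J ==> Luni P T V (Z j)"
 shows "Luni P T V (%r w. \<Sum>j\<in>J. \<bar>Z j r w\<bar>)"
 using assms
proof (induction rule: finite_induct)
 case empty
 then show ?case using Luni_zero by simp
next
 case (insert j J)
 have z: "Luni P T V (Z j)" and S: "Luni P T V (%r w. \<Sum>j\<in>J. \<bar>Z j r w\<bar>)" using insert by auto
 have "progressive_on {0..T} Fo (%r w. \<bar>Z j r w\<bar>)"
  using Luni_progressive[OF z] unfolding progressive_on_def split_beta' by auto
 then have "Luni P T V (%r w. \<bar>Z j r w\<bar> + (\<Sum>j\<in>J. \<bar>Z j r w\<bar>))"
  by (intro Luni_dominated[OF progressive_on_arith(1)[OF _ Luni_progressive[OF S]] z S, where k=1]) auto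
 then show ?case using insert by simp
qed

text \<open>Measurability comes from composition, square integrability from the linear growth that
  the Lipschitz bound implies around \<open>(0, 0)\<close>.\<close>

lemma Fd_Luni:
 assumes Y: "Luni P T V Y" and Z: "\<And>j. Luni P T V (Z j)"
 shows "Luni P T V (Fd Y Z)"
proof -
 have S: "Luni P T V (%r w. \<Sum>j\<in>UNIV. \<bar>Z j r w\<bar>)" by (rule Luni_sum_abs) (use Z in auto)
 have "progressive_on {0..T} Fo (%r w. \<bar>Y r w\<bar> + (\<Sum>j\<in>UNIV. \<bar>Z j r w\<bar>))"
  by (rule progressive_on_arith(1)[OF _ Luni_progressive[OF S]])
   (use Luni_progressive[OF Y] in \<open>auto simp: progressive_on_def split_beta'\<close>)
 then have R: "Luni P T V (%r w. \<bar>Y r w\<bar> + (\<Sum>j\<in>UNIV. \<bar>Z j r w\<bar>))"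
  by (rule Luni_dominated[OF _ Y S, where k=1]) auto
 have f0: "Luni P T V (%t w. f t w 0 0)" using hB unfolding hypB_def by blast
 show ?thesis
 proof (rule Luni_dominated[OF _ f0 R, where k="1 + \<bar>K\<bar>"])
  show "progressive_on {0..T} Fo (Fd Y Z)"
   unfolding progressive_on_def
  proof
   fix u assume u: "u \<in> {0..T}"
   then have us: "{r \<in> {0..T}. r <= u} = {0..u}" by auto
   show "(%(r, w). Fd Y Z r w) \<in> borel_measurable (restrict_space borel {r \<in> {0..T}. r <= u} \<Otimes>\<^sub>M Fo u)"
    unfolding us Fd_def
   proof (rule f_measurable)
    show "(%(r, w). Y r w) \<in> borel_measurable (restrict_space borel {0..u} \<Otimes>\<^sub>M Fo u)"
     using Luni_progressive[OF Y] u unfolding progressive_on_def us[symmetric] by blast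
    show "(%(r, w). Z j r w) \<in> borel_measurable (restrict_space borel {0..u} \<Otimes>\<^sub>M Fo u)" for j
     using Luni_progressive[OF Z] u unfolding progressive_on_def us[symmetric] by blast
   qed (use u in auto)
  qed
  fix r and w :: "'e path" assume r: "r \<in> {0..T}" "w \<in> Omega"
  define y where "y = \<bar>Y r w\<bar> + (\<Sum>j\<in>UNIV. \<bar>Z j r w\<bar>)"
  have y0: "0 <= y" unfolding y_def by (simp add: sum_nonneg)
  have "norm (\<chi> j. Z j r w) <= (\<Sum>j\<in>UNIV. \<bar>Z j r w\<bar>)" using norm_le_l1_cart[of "\<chi> j. Z j r w"] by simp
  then have n: "\<bar>Y r w\<bar> + norm (\<chi> j. Z j r w) <= y" by (simp add: y_def)
  have "\<bar>f r w (Y r w) (\<chi> j. Z j r w) - f r w 0 0\<bar> <= K * (\<bar>Y r w - 0\<bar> + norm ((\<chi> j. Z j r w) - 0))"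
   using hB r unfolding hypB_def by blast
  also have "\<dots> <= \<bar>K\<bar> * (\<bar>Y r w\<bar> + norm (\<chi> j. Z j r w))" by (simp add: mult_right_mono)
  also have "\<dots> <= \<bar>K\<bar> * y" using n by (intro mult_left_mono) auto
  finally have "\<bar>Fd Y Z r w\<bar> <= \<bar>f r w 0 0\<bar> + \<bar>K\<bar> * y" unfolding Fd_def by linarith
  also have "\<dots> <= (1 + \<bar>K\<bar>) * (\<bar>f r w 0 0\<bar> + y)" using y0 by (simp add: algebra_simps)
  finally show "\<bar>Fd Y Z r w\<bar> <= (1 + \<bar>K\<bar>) * (\<bar>f r w 0 0\<bar> + \<bar>\<bar>Y r w\<bar> + (\<Sum>j\<in>UNIV. \<bar>Z j r w\<bar>)\<bar>)" using y0 by (simp add: y_def)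
 qed
qed

lemma Yg_eq:
 assumes g: "Luni P T V g" and s: "s \<in> {0..T}" "\<eta> \<in> Omega"
 shows "Yg g s \<eta> = (LINT w|P s \<eta>. \<xi> w) + (LINT r:{s..T}|\<nu>. (LINT w|P s \<eta>. g r w))"
proof -
 have sT: "s <= T" "0 <= s" using s by auto
 note F = Luni_Fubini[OF g s sT(1) order_refl g s]
 have xi: "integrable (P s \<eta>) \<xi>" using hB s sT unfolding hypB_def by blast
 show ?thesis unfolding F(1) Yg_def Xi_def by (rule Bochner_Integration.integral_add[OF xi F(2)])
qed

text \<open>By the first equation \<open>Y\<close> is \<open>Yg\<close> of its own driver; hence it
  forms a martingale pair with the driver and equals \<xi> at \<open>T\<close> almost surely.
  Integration by parts against \<open>\<Psi> i\<close> then rewrites the second equation as the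
  equality of the time integral of \<open>E[Z i]\<close> with \<open>Ecov\<close>, which
  \<open>rep_iff_identity\<close> identifies with the bracket condition.\<close>

lemma IP_iff:
 "IP P T V A \<Psi> f \<xi> Y Z \<longleftrightarrow> Luni P T V Y \<and> (\<forall>i. Luni P T V (Z i)) \<and> (\<forall>s\<in>{0..T}. \<forall>\<eta>\<in>Omega. Y s \<eta> = Yg (Fd Y Z) s \<eta>) \<and>
   (\<forall>i. \<forall>s\<in>{0..T}. \<forall>\<eta>\<in>Omega. rep s \<eta> (Mm s Y (Fd Y Z)) (Mm s (\<Psi> i) (h i)) (Z i))"
proof (cases "Luni P T V Y \<and> (\<forall>i. Luni P T V (Z i))")
 case False
 then show ?thesis unfolding IP_def by blast
next
 case True
 then have Y: "Luni P T V Y" and Z: "\<And>i. Luni P T V (Z i)" by auto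
 define g where "g = Fd Y Z"
 have g: "Luni P T V g" unfolding g_def by (rule Fd_Luni[OF Y Z])
 have g': "f r w (Y r w) (\<chi> j. Z j r w) = g r w" for r w by (simp add: g_def Fd_def)
 have key: "(Y s \<eta> * \<Psi> i s \<eta> = (LINT w|P s \<eta>. \<xi> w * \<Psi> i T w)
         - (LINT r:{s..T}|\<nu>. (LINT w|P s \<eta>. Z i r w + Y r w * A (\<Psi> i) r w - \<Psi> i r w * g r w))) \<longleftrightarrow>
    (LINT r:{s..T}|\<nu>. (LINT w|P s \<eta>. Z i r w)) = Ecov Y g (\<Psi> i) (h i) s T \<eta>"
  if e: "\<forall>s\<in>{0..T}. \<forall>\<eta>\<in>Omega. Y s \<eta> = Yg g s \<eta>" and s: "s \<in> {0..T}" "\<eta> \<in> Omega" for i s \<eta>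
 proof -
  have sT: "s <= T" "0 <= s" "T \<in> {0..T}" using s by auto
  have mY: "mp Y g" by (rule mp_cong[OF mp_Yg[OF g]]) (use e in auto)
  define Q where "Q r w = Y r w * h i r w + g r w * \<Psi> i r w" for r w
  have p: "progressive_on {0..T} Fo (%r w. Y r w * h i r w)" "progressive_on {0..T} Fo (%r w. g r w * \<Psi> i r w)"
   by (intro progressive_on_arith Luni_progressive Y g h_Luni Psi_Luni)+
  have pQ: "progressive_on {0..T} Fo Q" unfolding Q_def by (rule progressive_on_arith(1)[OF p])
  have fQ: "(\<integral>\<^sup>+w'. (\<integral>\<^sup>+r\<in>{s..T}. ennreal \<bar>Q r w'\<bar> \<partial>\<nu>) \<partial>P s \<eta>) < \<infinity>"
   by (rule L1_dominated[OF p s Luni_L1_mult[OF Y h_Luni s] Luni_L1_mult[OF g Psi_Luni s]]) (auto simp: Q_def)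
  have "(LINT r:{s..T}|\<nu>. (LINT w|P s \<eta>. Z i r w + Y r w * A (\<Psi> i) r w - \<Psi> i r w * g r w)) = (LINT r:{s..T}|\<nu>. (LINT w|P s \<eta>. Z i r w - Q r w))"
   by (simp add: Q_def h_def algebra_simps)
  also have "\<dots> = (LINT r:{s..T}|\<nu>. (LINT w|P s \<eta>. Z i r w)) - (LINT r:{s..T}|\<nu>. (LINT w|P s \<eta>. Q r w))"
   by (rule P_Fubini_diff[OF Luni_progressive[OF Z] pQ s sT(1) order_refl Luni_L1[OF Z s] fQ])
  finally have 1: "(LINT r:{s..T}|\<nu>. (LINT w|P s \<eta>. Z i r w + Y r w * A (\<Psi> i) r w - \<Psi> i r w * g r w)) = (LINT r:{s..T}|\<nu>. (LINT w|P s \<eta>. Z i r w)) - (LINT r:{s..T}|\<nu>. (LINT w|P s \<eta>. Q r w))" .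
  have "(LINT w|P s \<eta>. Y T w * \<Psi> i T w) = (LINT w|P s \<eta>. \<xi> w * \<Psi> i T w)"
  proof (rule integral_cong_AE)
   have "AE w in P s \<eta>. Yg g T w = \<xi> w" using Yg_terminal[OF g s] by (simp add: AE_completion_iff)
   then show "AE w in P s \<eta>. Y T w * \<Psi> i T w = \<xi> w * \<Psi> i T w"
    using AE_space by eventually_elim (use e sT(3) P_prob(2)[OF sT(2) s(2)] in auto)
   show "(%w. Y T w * \<Psi> i T w) \<in> borel_measurable (P s \<eta>)" "(%w. \<xi> w * \<Psi> i T w) \<in> borel_measurable (P s \<eta>)"
    unfolding meas_P[OF sT(2) s(2)] by (intro borel_measurable_times meas_Fo_FF[OF Luni_sec[OF _ sT(3)]] meas_Fp_FF[OF xi_meas] Y Psi_Luni)+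
  qed
  then have 2: "Ecov Y g (\<Psi> i) (h i) s T \<eta> = (LINT w|P s \<eta>. \<xi> w * \<Psi> i T w) - Y s \<eta> * \<Psi> i s \<eta> + (LINT r:{s..T}|\<nu>. (LINT w|P s \<eta>. Q r w))"
   using Ecov_by_parts[OF mY Psi_mp s sT(1) order_refl, of i] by (simp add: Q_def)
  show ?thesis unfolding 1 2 by auto
 qed
 have mY: "mp Y g" if "\<forall>s\<in>{0..T}. \<forall>\<eta>\<in>Omega. Y s \<eta> = Yg g s \<eta>" by (rule mp_cong[OF mp_Yg[OF g]]) (use that in auto)
 have "IP P T V A \<Psi> f \<xi> Y Z \<longleftrightarrow> (\<forall>s\<in>{0..T}. \<forall>\<eta>\<in>Omega. Y s \<eta> = Yg g s \<eta>) \<and>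
   (\<forall>i. \<forall>s\<in>{0..T}. \<forall>\<eta>\<in>Omega. Y s \<eta> * \<Psi> i s \<eta> = (LINT w|P s \<eta>. \<xi> w * \<Psi> i T w)
         - (LINT r:{s..T}|\<nu>. (LINT w|P s \<eta>. Z i r w + Y r w * A (\<Psi> i) r w - \<Psi> i r w * g r w)))"
 proof -
  have "(\<forall>s\<in>{0..T}. \<forall>\<eta>\<in>Omega. Y s \<eta> = Yg g s \<eta>) \<longleftrightarrow> (\<forall>s\<in>{0..T}. \<forall>\<eta>\<in>Omega. Y s \<eta> = (LINT w|P s \<eta>. \<xi> w) + (LINT r:{s..T}|\<nu>. (LINT w|P s \<eta>. g r w)))"
   by (intro ball_cong refl) (simp add: Yg_eq[OF g])
  then show ?thesis unfolding IP_def g' using Y Z by blast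
 qed
 also have "\<dots> \<longleftrightarrow> (\<forall>s\<in>{0..T}. \<forall>\<eta>\<in>Omega. Y s \<eta> = Yg g s \<eta>) \<and>
   (\<forall>i. \<forall>s\<in>{0..T}. \<forall>\<eta>\<in>Omega. (LINT r:{s..T}|\<nu>. (LINT w|P s \<eta>. Z i r w)) = Ecov Y g (\<Psi> i) (h i) s T \<eta>)"
  using key by blast
 also have "\<dots> \<longleftrightarrow> (\<forall>s\<in>{0..T}. \<forall>\<eta>\<in>Omega. Y s \<eta> = Yg g s \<eta>) \<and>
   (\<forall>i. \<forall>s\<in>{0..T}. \<forall>\<eta>\<in>Omega. rep s \<eta> (Mm s Y g) (Mm s (\<Psi> i) (h i)) (Z i))"
  using rep_iff_identity[OF mY Psi_mp Z] by blast
 finally show ?thesis using Y Z unfolding g_def by blast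
qed

end

section \<open>Pointwise limits in the weighted norm\<close>

text \<open>If the right-hand side is infinite, there is nothing to show; this includes every
  divergent sequence, for which \<open>lim\<close> is arbitrary. Otherwise the increments are
  summable because \<open>|d k|\<close> is at most \<open>(1/2)^k + 2^k (d k)^2\<close>, and
  Cauchy-Schwarz with the weights \<open>(1/2)^k\<close> and \<open>2^k\<close> gives the bound. The
  factor 2 is the geometric sum.\<close>

lemma lim_sq_le_weighted_increments:
 fixes x :: "nat => real"
 shows "ennreal ((lim x - x n)^2) <= 2 * (\<Sum>k. ennreal (2 ^ k) * ennreal ((x (Suc (n + k)) - x (n + k))^2))"
proof -
 define d where "d k = x (Suc (n + k)) - x (n + k)" for k
 define a where "a k = 2 ^ k * (d k)^2" for k
 have ea: "ennreal (2 ^ k) * ennreal ((x (Suc (n + k)) - x (n + k))^2) = ennreal (a k)" for k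
  by (simp add: a_def d_def ennreal_mult)
 have a0: "0 <= a k" for k by (simp add: a_def)
 show ?thesis
 proof (cases "(\<Sum>k. ennreal (a k)) = \<top>")
  case True
  then show ?thesis unfolding ea by (simp add: ennreal_mult_top)
 next
  case False
  have sa: "summable a" by (rule summable_suminf_not_top[OF a0 False])
  have sg: "summable (%k. (1/2::real) ^ k)" by (simp add: summable_geometric)
  have half: "(1/2::real) ^ k * 2 ^ k = 1" for k by (simp add: power_mult_distrib[symmetric])
  have le: "norm (d k) <= (1/2) ^ k + a k" for k
  proof -
   have "0 <= (1/2) ^ k * (2 ^ k * \<bar>d k\<bar> - 1)^2" by simp
   also have "\<dots> = ((1/2) ^ k * 2 ^ k) * (2 ^ k * (d k)^2) - 2 * ((1/2) ^ k * 2 ^ k) * \<bar>d k\<bar> + (1/2) ^ k"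
    by (simp add: power2_eq_square algebra_simps)
   finally have "2 * \<bar>d k\<bar> <= a k + (1/2) ^ k" unfolding half by (simp add: a_def)
   then show ?thesis by simp
  qed
  have sd: "summable d" by (rule summable_comparison_test'[OF summable_add[OF sg sa], of 0]) (rule le)
  have tel: "x (n + m) - x n = (\<Sum>k<m. d k)" for m by (induction m) (auto simp: d_def)
  have "(%m. x n + (\<Sum>k<m. d k)) \<longlonglongrightarrow> x n + suminf d" by (intro tendsto_add tendsto_const summable_LIMSEQ sd)
  then have "(%m. x (m + n)) \<longlonglongrightarrow> x n + suminf d" unfolding tel[symmetric] by (simp add: add.commute)
  then have "x \<longlonglongrightarrow> x n + suminf d" by (rule LIMSEQ_offset)
  then have l: "lim x - x n = suminf d" by (simp add: limI)
  have "(\<Sum>k<m. d k)^2 <= 2 * suminf a" for m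
  proof -
   define b where "b k = sqrt ((1/2) ^ k)" for k
   define c where "c k = sqrt (2 ^ k) * d k" for k
   have "b k * c k = d k" for k unfolding b_def c_def by (simp add: mult.assoc[symmetric] real_sqrt_mult[symmetric] half del: power_one_over)
   then have "(\<Sum>k<m. d k)^2 = (\<Sum>k<m. b k * c k)^2" by simp
   also have "\<dots> <= (\<Sum>k<m. (b k)^2) * (\<Sum>k<m. (c k)^2)" by (rule Cauchy_Schwarz_ineq_sum)
   also have "\<dots> = (\<Sum>k<m. (1/2) ^ k) * (\<Sum>k<m. a k)" by (simp add: b_def c_def a_def power_mult_distrib)
   also have "\<dots> <= (\<Sum>k. (1/2) ^ k) * suminf a"
    by (intro mult_mono sum_le_suminf sg sa sum_nonneg suminf_nonneg a0) auto
   also have "(\<Sum>k. (1/2::real) ^ k) = 2" by (simp add: suminf_geometric)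
   finally show ?thesis .
  qed
  then have "(suminf d)^2 <= 2 * suminf a"
   by (intro LIMSEQ_le_const2[OF tendsto_power[OF summable_LIMSEQ[OF sd]]]) auto
  then have "ennreal ((lim x - x n)^2) <= ennreal (2 * suminf a)" unfolding l by (rule ennreal_leI)
  also have "\<dots> = 2 * (\<Sum>k. ennreal (a k))" using suminf_nonneg[OF sa a0] by (simp add: ennreal_mult suminf_ennreal2[OF a0 sa])
  finally show ?thesis unfolding ea .
 qed
qed

context filtered_clock
begin

lemma wn_prod:
 assumes "jm X"
 shows "wn \<gamma> X = (\<integral>\<^sup>+p. indicator {s..T} (fst p) * (ennreal (exp (2 * \<gamma> * W (fst p))) * ennreal ((X (fst p) (snd p))^2)) \<partial>(\<nu> \<Otimes>\<^sub>M Q))"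
proof -
 have "(%(r, w). indicator {s..T} r * (ennreal (exp (2 * \<gamma> * W r)) * ennreal ((X r w)^2))) \<in> borel_measurable (\<nu> \<Otimes>\<^sub>M Q)"
  using jm_wt[OF assms, of "2 * \<gamma>"] by (simp add: split_beta')
 from QV.nn_integral_snd[OF this] show ?thesis unfolding wn_def by (simp add: split_beta' mult_ac)
qed

lemma N2_wn: "N2 X = wn 0 X"
 by (simp add: N2_def wn_def)

lemma wn_le_cmult:
 assumes X: "jm X" and \<gamma>: "0 <= \<gamma>" "0 <= \<gamma>'"
 shows "wn \<gamma> X <= ennreal (exp (2 * \<gamma> * W T - 2 * \<gamma>' * W 0)) * wn \<gamma>' X"
proof -
 have "wn \<gamma> X <= (\<integral>\<^sup>+p. ennreal (exp (2 * \<gamma> * W T - 2 * \<gamma>' * W 0)) * (indicator {s..T} (fst p) * (ennreal (exp (2 * \<gamma>' * W (fst p))) * ennreal ((X (fst p) (snd p))^2))) \<partial>(\<nu> \<Otimes>\<^sub>M Q))"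
  unfolding wn_prod[OF X]
 proof (rule nn_integral_mono)
  fix p :: "real \<times> 'a"
  have "2 * \<gamma> * W (fst p) <= 2 * \<gamma> * W T" "2 * \<gamma>' * W 0 <= 2 * \<gamma>' * W (fst p)" using W_bounds[of "fst p"] \<gamma> by (auto intro!: mult_left_mono)
  then have "exp (2 * \<gamma> * W (fst p)) <= exp (2 * \<gamma> * W T - 2 * \<gamma>' * W 0) * exp (2 * \<gamma>' * W (fst p))" by (simp add: exp_add[symmetric])
  then have "ennreal (exp (2 * \<gamma> * W (fst p))) <= ennreal (exp (2 * \<gamma> * W T - 2 * \<gamma>' * W 0)) * ennreal (exp (2 * \<gamma>' * W (fst p)))"
   by (subst ennreal_mult[symmetric]) (auto intro!: ennreal_leI)
  then have "ennreal (exp (2 * \<gamma> * W (fst p))) * ennreal ((X (fst p) (snd p))^2) <= (ennreal (exp (2 * \<gamma> * W T - 2 * \<gamma>' * W 0)) * ennreal (exp (2 * \<gamma>' * W (fst p)))) * ennreal ((X (fst p) (snd p))^2)"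
   by (rule mult_right_mono) simp
  then show "indicator {s..T} (fst p) * (ennreal (exp (2 * \<gamma> * W (fst p))) * ennreal ((X (fst p) (snd p))^2))
   <= ennreal (exp (2 * \<gamma> * W T - 2 * \<gamma>' * W 0)) * (indicator {s..T} (fst p) * (ennreal (exp (2 * \<gamma>' * W (fst p))) * ennreal ((X (fst p) (snd p))^2)))"
   by (auto simp: indicator_def mult.assoc)
 qed
 also have "\<dots> = ennreal (exp (2 * \<gamma> * W T - 2 * \<gamma>' * W 0)) * wn \<gamma>' X"
  unfolding wn_prod[OF X] by (rule nn_integral_cmult[OF jm_wt[OF X]])
 finally show ?thesis .
qed

lemma wn_finite_iff: "jm X ==> 0 <= \<gamma> ==> wn \<gamma> X < \<infinity> \<longleftrightarrow> N2 X < \<infinity>"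
 using wn_le_cmult[of X \<gamma> 0] wn_le_cmult[of X 0 \<gamma>] unfolding N2_wn
 by (auto simp: ennreal_mult_less_top elim!: order.strict_trans1)

lemma wn_zero:
 assumes X: "jm X" and z: "wn \<gamma> X = 0"
 shows "AE w in Q. AE r in \<nu>. r \<in> {s..T} \<longrightarrow> X r w = 0"
proof -
 have "AE w in Q. (\<integral>\<^sup>+r\<in>{s..T}. ennreal (exp (2 * \<gamma> * W r)) * ennreal ((X r w)^2) \<partial>\<nu>) = 0"
  using z Tonelli(3)[OF jm_wt[OF X, of "2 * \<gamma>"] order_refl] unfolding wn_def by (subst (asm) nn_integral_0_iff_AE) auto
 then show ?thesis using AE_space
 proof eventually_elim
  case (elim w)
  have [measurable]: "(%r. indicator {s..T} r * X r w) \<in> borel_measurable \<nu>" using jm_path[OF X elim(2)] by (simp cong: measurable_cong_sets)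
  have e: "ennreal (exp (2 * \<gamma> * W r)) * ennreal ((X r w)^2) * indicator {s..T} r = ennreal (exp (2 * \<gamma> * W r)) * ennreal ((indicator {s..T} r * X r w)^2)" for r
   by (auto simp: indicator_def)
  have "AE r in \<nu>. ennreal (exp (2 * \<gamma> * W r)) * ennreal ((indicator {s..T} r * X r w)^2) = 0"
   using elim(1) unfolding e by (subst (asm) nn_integral_0_iff_AE) auto
  then show ?case by eventually_elim (auto simp: indicator_def)
 qed
qed

lemma wn_lipschitz:
 assumes fin: "finite I" and g: "jm g" and Y: "jm Y" and Z: "\<And>i. i \<in> I ==> jm (Z i)" and L: "0 <= L"
  and lip: "\<And>r w. r \<in> {s..T} ==> w \<in> space Q ==> (g r w)^2 <= L * ((Y r w)^2 + (\<Sum>i\<in>I. (Z i r w)^2))"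
 shows "wn \<gamma> g <= ennreal L * (wn \<gamma> Y + (\<Sum>i\<in>I. wn \<gamma> (Z i)))"
proof -
 define wt where "wt X p = (indicator {s..T} (fst p) * (ennreal (exp (2 * \<gamma> * W (fst p))) * ennreal ((X (fst p) (snd p))^2)) :: ennreal)" for X :: "real => 'a => real" and p
 have m: "wt X \<in> borel_measurable (\<nu> \<Otimes>\<^sub>M Q)" "wn \<gamma> X = (\<integral>\<^sup>+p. wt X p \<partial>(\<nu> \<Otimes>\<^sub>M Q))" if "jm X" for X
  using jm_wt[OF that, of "2 * \<gamma>"] wn_prod[OF that] by (auto simp: wt_def[abs_def])
 have "wn \<gamma> g <= (\<integral>\<^sup>+p. ennreal L * (wt Y p + (\<Sum>i\<in>I. wt (Z i) p)) \<partial>(\<nu> \<Otimes>\<^sub>M Q))"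
  unfolding m(2)[OF g]
 proof (rule nn_integral_mono)
  fix p assume p: "p \<in> space (\<nu> \<Otimes>\<^sub>M Q)"
  show "wt g p <= ennreal L * (wt Y p + (\<Sum>i\<in>I. wt (Z i) p))"
  proof (cases "fst p \<in> {s..T}")
   case True
   let ?r = "fst p" and ?w = "snd p"
   have "(g ?r ?w)^2 <= L * ((Y ?r ?w)^2 + (\<Sum>i\<in>I. (Z i ?r ?w)^2))" by (rule lip[OF True]) (use p in \<open>auto simp: space_pair_measure\<close>)
   then have "exp (2 * \<gamma> * W ?r) * (g ?r ?w)^2 <= exp (2 * \<gamma> * W ?r) * (L * ((Y ?r ?w)^2 + (\<Sum>i\<in>I. (Z i ?r ?w)^2)))"
    by (rule mult_left_mono) simp
   then have "ennreal (exp (2 * \<gamma> * W ?r) * (g ?r ?w)^2) <= ennreal (L * (exp (2 * \<gamma> * W ?r) * (Y ?r ?w)^2 + (\<Sum>i\<in>I. exp (2 * \<gamma> * W ?r) * (Z i ?r ?w)^2)))"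
    by (intro ennreal_leI) (simp only: sum_distrib_left[symmetric] distrib_left[symmetric] mult.left_commute[of L])
   also have "\<dots> = ennreal L * (ennreal (exp (2 * \<gamma> * W ?r) * (Y ?r ?w)^2) + (\<Sum>i\<in>I. ennreal (exp (2 * \<gamma> * W ?r) * (Z i ?r ?w)^2)))"
    using L by (subst ennreal_mult) (auto simp: sum_nonneg ennreal_plus sum_ennreal)
   finally show ?thesis using True by (simp add: wt_def ennreal_mult)
  qed (simp add: wt_def)
 qed
 also have "\<dots> = ennreal L * ((\<integral>\<^sup>+p. wt Y p \<partial>(\<nu> \<Otimes>\<^sub>M Q)) + (\<Sum>i\<in>I. \<integral>\<^sup>+p. wt (Z i) p \<partial>(\<nu> \<Otimes>\<^sub>M Q)))"
  using m(1)[OF Y] m(1)[OF Z] by (simp add: nn_integral_cmult nn_integral_add nn_integral_sum)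
 also have "\<dots> = ennreal L * (wn \<gamma> Y + (\<Sum>i\<in>I. wn \<gamma> (Z i)))"
  using m(2)[OF Y] m(2)[OF Z] by simp
 finally show ?thesis .
qed

lemma wn_triangle:
 assumes "jm X" "jm Y" "jm Z"
 shows "wn \<gamma> (%r w. X r w - Y r w) <= 2 * (wn \<gamma> (%r w. X r w - Z r w) + wn \<gamma> (%r w. Y r w - Z r w))"
proof -
 have "wn \<gamma> (%r w. X r w - Y r w) <= ennreal 2 * (wn \<gamma> (%r w. X r w - Z r w) + (\<Sum>i\<in>{()}. wn \<gamma> (%r w. Y r w - Z r w)))"
 proof (rule wn_lipschitz)
  fix r w
  show "(X r w - Y r w)^2 <= 2 * ((X r w - Z r w)^2 + (\<Sum>i\<in>{()}. (Y r w - Z r w)^2))"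
   using zero_le_power2[of "(X r w - Z r w) + (Y r w - Z r w)"] by (simp add: power2_eq_square algebra_simps)
 qed (use assms jm_arith in auto)
 then show ?thesis by simp
qed

text \<open>The decay \<open>(1/4)^n\<close> of squared increments beats the weights
  \<open>2^k\<close> of the pointwise bound: what remains is a geometric series of ratio 1/2 and sum
  2, which with the factor 2 of that bound makes \<open>4 * D\<close>.\<close>

lemma wn_lim:
 assumes X: "\<And>n. jm (X n)" and l: "jm (%r w. lim (%n. X n r w))"
  and d: "\<And>n. wn \<gamma> (%r w. X (Suc n) r w - X n r w) <= ennreal ((1/4) ^ n) * D"
 shows "wn \<gamma> (%r w. lim (%n. X n r w) - X n r w) <= ennreal ((1/4) ^ n) * (4 * D)"
proof -
 define wt where "wt X p = (indicator {s..T} (fst p) * (ennreal (exp (2 * \<gamma> * W (fst p))) * ennreal ((X (fst p) (snd p))^2)) :: ennreal)" for X :: "real => 'a => real" and p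
 have m: "wt X \<in> borel_measurable (\<nu> \<Otimes>\<^sub>M Q)" "wn \<gamma> X = (\<integral>\<^sup>+p. wt X p \<partial>(\<nu> \<Otimes>\<^sub>M Q))" if "jm X" for X
  using jm_wt[OF that, of "2 * \<gamma>"] wn_prod[OF that] by (auto simp: wt_def[abs_def])
 define \<delta> where "\<delta> k = (%r w. X (Suc k) r w - X k r w)" for k
 have \<delta>j: "jm (\<delta> k)" for k unfolding \<delta>_def by (rule jm_arith(2)[OF X X])
 note [measurable] = m(1)[OF \<delta>j]
 have "wn \<gamma> (%r w. lim (%n. X n r w) - X n r w) <= (\<integral>\<^sup>+p. 2 * (\<Sum>k. ennreal (2 ^ k) * wt (\<delta> (n + k)) p) \<partial>(\<nu> \<Otimes>\<^sub>M Q))"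
  unfolding m(2)[OF jm_arith(2)[OF l X]]
 proof (rule nn_integral_mono)
  fix p :: "real \<times> 'a"
  let ?c = "indicator {s..T} (fst p) * ennreal (exp (2 * \<gamma> * W (fst p)))"
  have "wt (%r w. lim (%n. X n r w) - X n r w) p = ?c * ennreal ((lim (%n. X n (fst p) (snd p)) - X n (fst p) (snd p))^2)"
   by (simp add: wt_def mult_ac)
  also have "\<dots> <= ?c * (2 * (\<Sum>k. ennreal (2 ^ k) * ennreal ((X (Suc (n + k)) (fst p) (snd p) - X (n + k) (fst p) (snd p))^2)))"
   by (intro mult_left_mono lim_sq_le_weighted_increments) simp
  also have "\<dots> = 2 * (\<Sum>k. ?c * (ennreal (2 ^ k) * ennreal ((X (Suc (n + k)) (fst p) (snd p) - X (n + k) (fst p) (snd p))^2)))"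
   by (subst ennreal_suminf_cmult) (rule mult.left_commute)
  also have "\<dots> = 2 * (\<Sum>k. ennreal (2 ^ k) * wt (\<delta> (n + k)) p)" by (simp add: wt_def \<delta>_def mult_ac)
  finally show "wt (%r w. lim (%n. X n r w) - X n r w) p <= 2 * (\<Sum>k. ennreal (2 ^ k) * wt (\<delta> (n + k)) p)" .
 qed
 also have "\<dots> = 2 * (\<Sum>k. ennreal (2 ^ k) * wn \<gamma> (\<delta> (n + k)))"
  by (simp add: nn_integral_cmult nn_integral_suminf m(2)[OF \<delta>j])
 also have "\<dots> <= 2 * (\<Sum>k. ennreal ((1/2) ^ k) * (ennreal ((1/4) ^ n) * D))"
 proof (intro mult_left_mono suminf_le)
  fix k
  have "ennreal (2 ^ k) * wn \<gamma> (\<delta> (n + k)) <= ennreal (2 ^ k) * (ennreal ((1/4) ^ (n + k)) * D)"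
   unfolding \<delta>_def by (intro mult_left_mono d) simp
  also have "\<dots> = ennreal (2 ^ k * (1/4) ^ (n + k)) * D" by (subst ennreal_mult) (auto simp: mult.assoc)
  also have "(2::real) ^ k * (1/4) ^ (n + k) = (1/2) ^ k * (1/4) ^ n"
   by (simp add: power_add power_mult_distrib[symmetric] mult.left_commute)
  also have "ennreal ((1/2) ^ k * (1/4) ^ n) * D = ennreal ((1/2) ^ k) * (ennreal ((1/4) ^ n) * D)" by (subst ennreal_mult) (auto simp: mult.assoc)
  finally show "ennreal (2 ^ k) * wn \<gamma> (\<delta> (n + k)) <= ennreal ((1/2) ^ k) * (ennreal ((1/4) ^ n) * D)" .
 qed auto
 also have "(\<Sum>k. ennreal ((1/2) ^ k) * (ennreal ((1/4) ^ n) * D)) = (\<Sum>k. ennreal ((1/2) ^ k)) * (ennreal ((1/4) ^ n) * D)"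
  by (rule ennreal_suminf_multc)
 also have "(\<Sum>k. ennreal ((1/2) ^ k)) = 2"
  by (subst suminf_ennreal2) (auto simp: summable_geometric suminf_geometric)
 also have "2 * (2 * (ennreal ((1/4) ^ n) * D)) = ennreal ((1/4) ^ n) * (4 * D)"
  by (simp only: mult_ac) (simp add: mult.assoc[symmetric])
 finally show ?thesis .
qed

lemma nI_AE_cong:
 assumes X: "jm X" and Y: "jm Y" and e: "AE w in Q. AE r in \<nu>. r \<in> {s..T} \<longrightarrow> X r w = Y r w"
 shows "AE w in Q. \<forall>t u. s <= t \<longrightarrow> u <= T \<longrightarrow> nI t u X w = nI t u Y w \<and> (set_integrable \<nu> {t..u} (%r. X r w) \<longleftrightarrow> set_integrable \<nu> {t..u} (%r. Y r w))"
 using e AE_space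
proof eventually_elim
 case (elim w)
 show ?case
 proof (intro allI impI)
  fix t u assume t: "s <= t" "u <= T"
  have m: "(%r. indicator {t..u} r *\<^sub>R Z r w) \<in> borel_measurable \<nu>" if "jm Z" for Z
  proof -
   have [measurable]: "(%r. indicator {s..T} r * Z r w) \<in> borel_measurable \<nu>" using jm_path[OF that elim(2)] by (simp cong: measurable_cong_sets)
   have "(%r. indicator {t..u} r * (indicator {s..T} r * Z r w)) \<in> borel_measurable \<nu>" by measurable
   also have "(%r. indicator {t..u} r * (indicator {s..T} r * Z r w)) = (%r. indicator {t..u} r *\<^sub>R Z r w)" using t by (auto simp: indicator_def)
   finally show ?thesis .
  qed
  have a: "AE r in \<nu>. indicator {t..u} r *\<^sub>R X r w = indicator {t..u} r *\<^sub>R Y r w"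
   using elim(1) by eventually_elim (use t in \<open>auto simp: indicator_def\<close>)
  show "nI t u X w = nI t u Y w \<and> (set_integrable \<nu> {t..u} (%r. X r w) \<longleftrightarrow> set_integrable \<nu> {t..u} (%r. Y r w))"
   unfolding nI_def set_lebesgue_integral_def set_integrable_def
   using integral_cong_AE[OF m[OF X] m[OF Y] a] integrable_cong_AE[OF m[OF X] m[OF Y] a] by simp
 qed
qed

text \<open>\<open>repr\<close> sees only increments ending at \<open>T\<close>, each up to a null
  set. This permits an a.e. change of the driver and the exchange of \<open>Mm\<close> for a cadlag
  version.\<close>

lemma repr_cong:
 assumes l: "l2m M" "l2m N" "l2m M'" "l2m N'"
  and M: "\<And>t. t \<in> {s..T} ==> AE w in Q. M T w - M t w = M' T w - M' t w"
  and N: "\<And>t. t \<in> {s..T} ==> AE w in Q. N T w - N t w = N' T w - N' t w"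
  and r: "repr M N Z"
 shows "repr M' N' Z"
proof -
 have "cov M N t T A = cov M' N' t T A" if t: "t \<in> {s..T}" and A: "A \<in> sets (G t)" for t A
  unfolding cov_def set_lebesgue_integral_def
 proof (rule integral_cong_AE)
  have t': "s <= t" "t <= T" "T <= T" using t by auto
  show "(%w. indicator A w *\<^sub>R ((M T w - M t w) * (N T w - N t w))) \<in> borel_measurable Q"
   using cov_integrable[OF l(1,2) t'] G_sets[OF A] by auto
  show "(%w. indicator A w *\<^sub>R ((M' T w - M' t w) * (N' T w - N' t w))) \<in> borel_measurable Q"
   using cov_integrable[OF l(3,4) t'] G_sets[OF A] by auto
  show "AE w in Q. indicator A w *\<^sub>R ((M T w - M t w) * (N T w - N t w)) = indicator A w *\<^sub>R ((M' T w - M' t w) * (N' T w - N' t w))"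
   using M[OF t] N[OF t] by eventually_elim simp
 qed
 then show ?thesis using r unfolding repr_def by simp
qed

end

section \<open>The contraction under one law\<close>

context pd_bsde
begin

text \<open>A BSDE whose driver is frozen into a process \<open>g\<close> and whose bracket
  condition has the form \<open>rep\<close>. Solutions of the integral equations, Picard iterates
  and solutions of a given BSDE are all instances, so one estimate serves existence, uniqueness and
  representation.\<close>

definition bs :: "real => 'e path => 'e proc => 'e proc => 'e proc => ('d => 'e proc) => bool" where
 "bs s \<eta> Y M g Z \<longleftrightarrow> filtered_clock.prog T (Fc (P s \<eta>)) s Y \<and> filtered_clock.l2m T (Pc s \<eta>) (Fc (P s \<eta>)) s M \<and>
   filtered_clock.jm T \<nu> (Pc s \<eta>) s g \<and> filtered_clock.N2 T \<nu> (Pc s \<eta>) s g < \<infinity> \<and>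
   (\<forall>t\<in>{s..T}. AE w in Pc s \<eta>. Y t w = \<xi> w + (LINT r:{t..T}|\<nu>. g r w) - (M T w - M t w)) \<and>
   (\<forall>i. rep s \<eta> M (Mm s (\<Psi> i) (h i)) (Z i))"

lemma bs_contraction:
 assumes s: "s \<in> {0..T}" "\<eta> \<in> Omega" and 1: "bs s \<eta> Y M g Z" and 2: "bs s \<eta> Y' M' g' Z'" and \<gamma>: "0 < \<gamma>"
 shows "filtered_clock.wn W T \<nu> (Pc s \<eta>) s \<gamma> (%r w. Y r w - Y' r w)
   + (\<Sum>i\<in>UNIV. filtered_clock.wn W T \<nu> (Pc s \<eta>) s \<gamma> (%r w. Z i r w - Z' i r w))
   <= ennreal (1 / \<gamma>^2 + 3 * (real CARD('d) * C0) / \<gamma>) * filtered_clock.wn W T \<nu> (Pc s \<eta>) s \<gamma> (%r w. g r w - g' r w)"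
  and "t \<in> {s..T} ==> (\<integral>\<^sup>+w. ennreal ((Y t w - Y' t w)^2) \<partial>Pc s \<eta>) <= ennreal (W T - W 0) * filtered_clock.N2 T \<nu> (Pc s \<eta>) s (%r w. g r w - g' r w)"
proof -
 interpret F: filtered_clock W T \<nu> "Pc s \<eta>" "Fc (P s \<eta>)" s by (rule filtered[OF s])
 have a: "F.prog Y" "F.l2m M" "F.jm g" "F.N2 g < \<infinity>" "\<And>t. t \<in> {s..T} ==> AE w in Pc s \<eta>. Y t w = \<xi> w + (LINT r:{t..T}|\<nu>. g r w) - (M T w - M t w)"
   "\<And>i. F.repr M (Mm s (\<Psi> i) (h i)) (Z i)" using 1 unfolding bs_def by blast+
 have b: "F.prog Y'" "F.l2m M'" "F.jm g'" "F.N2 g' < \<infinity>" "\<And>t. t \<in> {s..T} ==> AE w in Pc s \<eta>. Y' t w = \<xi> w + (LINT r:{t..T}|\<nu>. g' r w) - (M' T w - M' t w)"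
   "\<And>i. F.repr M' (Mm s (\<Psi> i) (h i)) (Z' i)" using 2 unfolding bs_def by blast+
 have set_int: "AE w in Pc s \<eta>. set_integrable \<nu> {s..T} (%r. k r w)" if k: "F.jm k" "F.N2 k < \<infinity>" for k
 proof (rule F.jm_integrable(4)[OF k(1) _ order_refl])
  have o: "F.jm (%r w. 1)" "F.N2 (%r w. 1) < \<infinity>" using F.jm_random[of "%_. 1"] F.N2_random[of "%_. 1"] by auto
  show "(\<integral>\<^sup>+w. (\<integral>\<^sup>+r\<in>{s..T}. ennreal \<bar>k r w\<bar> \<partial>\<nu>) \<partial>Pc s \<eta>) < \<infinity>" using F.N2_mult_finite[OF k o] by simp
 qed
 note dr = F.repr_diff[OF a(2) b(2) mp_l2m[OF Psi_mp s] a(6) b(6)]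
 note dl = F.l2m_diff[OF a(2) b(2)]
 have dgj: "F.jm (%r w. g r w - g' r w)" by (rule F.jm_arith(2)[OF a(3) b(3)])
 have dgN: "F.N2 (%r w. g r w - g' r w) < \<infinity>"
  by (rule F.N2_lincomb_finite[OF a(3,4) b(3,4), where k=1]) (use abs_triangle_ineq4 in auto)
 have eq: "AE w in Pc s \<eta>. Y t w - Y' t w = F.nI t T (%r w. g r w - g' r w) w - ((M T w - M' T w) - (M t w - M' t w))"
  if t: "t \<in> {s..T}" for t
  using a(5)[OF t] b(5)[OF t] set_int[OF a(3,4)] set_int[OF b(3,4)]
 proof eventually_elim
  case (elim w)
  have "set_integrable \<nu> {t..T} (%r. g r w)" "set_integrable \<nu> {t..T} (%r. g' r w)"
   by (rule set_integrable_subset[OF elim(3)], use t in auto)[1] (rule set_integrable_subset[OF elim(4)], use t in auto)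
  from F.nI_diff[of t T g w g', OF this] show ?case using elim(1,2) by (simp add: F.nI_def)
 qed
 note R = F.bsde_contraction[where I=UNIV, OF finite \<gamma> C0(1) F.prog_arith(2)[OF a(1) b(1)] dl dgj dgN eq,
   of "%i r w. Z i r w - Z' i r w"]
 have j: "F.jm (%r w. Z i r w - Z' i r w)" for i
  by (rule F.jm_prog) (use dr[of i] in \<open>simp add: F.repr_def\<close>)
 have q: "(\<integral>\<^sup>+w. (\<integral>\<^sup>+r\<in>{t..T}. ennreal ((Z i r w - Z' i r w)^2) \<partial>\<nu>) \<partial>Pc s \<eta>)
   <= ennreal (C0 * (LINT w|Pc s \<eta>. ((M T w - M' T w) - (M t w - M' t w))^2))" if "t \<in> {s..T}" for i t
  by (rule F.repr_sq_bound[OF dl mp_l2m[OF Psi_mp s] mp_brk[OF Psi_mp C0(2) s] C0(1) dr that])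
 from R(1)[OF _ j q]
 show "F.wn \<gamma> (%r w. Y r w - Y' r w) + (\<Sum>i\<in>UNIV. F.wn \<gamma> (%r w. Z i r w - Z' i r w))
   <= ennreal (1 / \<gamma>^2 + 3 * (real CARD('d) * C0) / \<gamma>) * F.wn \<gamma> (%r w. g r w - g' r w)" by simp
 show "(\<integral>\<^sup>+w. ennreal ((Y t w - Y' t w)^2) \<partial>Pc s \<eta>) <= ennreal (W T - W 0) * F.N2 (%r w. g r w - g' r w)" if "t \<in> {s..T}"
  by (rule R(2)[OF _ j q that]) auto
qed

text \<open>The target 1/4 for squared norms, rather than just some factor below 1, matches the
  decay assumed in \<open>wn_lim\<close>.\<close>

lemma gamma_ex: "\<exists>\<gamma>>0. (1 / \<gamma>^2 + 3 * (real CARD('d) * C0) / \<gamma>) * (2 * K^2) <= 1 / 4"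
proof -
 define c where "c = 3 * (real CARD('d) * C0)"
 \<comment> \<open>As \<gamma> is at least 1, \<open>1 / \<gamma>^2\<close> is at most
   \<open>1 / \<gamma>\<close>, so the factor is at most
   \<open>2 * K^2 * (1 + c) / \<gamma>\<close>; four times this numerator is the second summand
   here.\<close>
 define \<gamma> where "\<gamma> = 1 + 8 * K^2 * (1 + c)"
 have c0: "0 <= c" unfolding c_def using C0(1) by simp
 have g1: "1 <= \<gamma>" unfolding \<gamma>_def using c0 by simp
 have "1 / \<gamma>^2 <= 1 / \<gamma>" using g1 by (intro divide_left_mono) (auto simp: power2_eq_square)
 then have "1 / \<gamma>^2 + c / \<gamma> <= (1 + c) / \<gamma>" by (simp add: add_divide_distrib)
 then have "(1 / \<gamma>^2 + c / \<gamma>) * (2 * K^2) <= (1 + c) / \<gamma> * (2 * K^2)" by (rule mult_right_mono) simp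
 also have "\<dots> = (2 * K^2 * (1 + c)) / \<gamma>" by simp
 also have "\<dots> <= 1 / 4" using g1 by (simp add: divide_le_eq) (simp add: \<gamma>_def)
 finally show ?thesis using g1 unfolding c_def by (intro exI[of _ \<gamma>]) auto
qed

definition \<gamma> :: real where "\<gamma> = (SOME \<gamma>. 0 < \<gamma> \<and> (1 / \<gamma>^2 + 3 * (real CARD('d) * C0) / \<gamma>) * (2 * K^2) <= 1 / 4)"

lemma gamma: "0 < \<gamma>" "(1 / \<gamma>^2 + 3 * (real CARD('d) * C0) / \<gamma>) * (2 * K^2) <= 1 / 4"
 using someI_ex[OF gamma_ex, folded \<gamma>_def] by blast+

definition dist2 :: "real => 'e path => 'e proc => ('d => 'e proc) => 'e proc => ('d => 'e proc) => ennreal" where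
 "dist2 s \<eta> Y Z Y' Z' = filtered_clock.wn W T \<nu> (Pc s \<eta>) s \<gamma> (%r w. Y r w - Y' r w)
   + (\<Sum>i\<in>UNIV. filtered_clock.wn W T \<nu> (Pc s \<eta>) s \<gamma> (%r w. Z i r w - Z' i r w))"

text \<open>The pairs \<open>(y, z)\<close> and \<open>(y', z')\<close> are those at which the
  drivers were frozen. They are the solutions themselves for uniqueness, and the preceding iterates
  for the Picard scheme.\<close>

lemma dist2_quarter:
 assumes s: "s \<in> {0..T}" "\<eta> \<in> Omega" and 1: "bs s \<eta> Y M g Z" and 2: "bs s \<eta> Y' M' g' Z'"
  and U: "filtered_clock.jm T \<nu> (Pc s \<eta>) s (%r w. y r w - y' r w)"
   "\<And>i. filtered_clock.jm T \<nu> (Pc s \<eta>) s (%r w. z i r w - z' i r w)"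
  and lip: "\<And>r w. r \<in> {s..T} ==> w \<in> Omega ==> (g r w - g' r w)^2 <= 2 * K^2 * ((y r w - y' r w)^2 + (\<Sum>i\<in>UNIV. (z i r w - z' i r w)^2))"
 shows "dist2 s \<eta> Y Z Y' Z' <= ennreal (1/4) * dist2 s \<eta> y z y' z'" (is ?g0)
  and "filtered_clock.wn W T \<nu> (Pc s \<eta>) s \<gamma> (%r w. g r w - g' r w) <= ennreal (2 * K^2) * dist2 s \<eta> y z y' z'"
proof -
 interpret F: filtered_clock W T \<nu> "Pc s \<eta>" "Fc (P s \<eta>)" s by (rule filtered[OF s])
 let ?c = "1 / \<gamma>^2 + 3 * (real CARD('d) * C0) / \<gamma>"
 have sp: "space (Pc s \<eta>) = Omega" using P_prob(2)[of s \<eta>] s by simp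
 have gj: "F.jm (%r w. g r w - g' r w)" using 1 2 unfolding bs_def by (intro F.jm_arith(2)) blast+
 show l: "F.wn \<gamma> (%r w. g r w - g' r w) <= ennreal (2 * K^2) * dist2 s \<eta> y z y' z'"
  unfolding dist2_def by (rule F.wn_lipschitz[OF finite gj U]) (use lip sp in auto)
 have c0: "0 <= ?c" using gamma(1) C0(1) by simp
 have "dist2 s \<eta> Y Z Y' Z' <= ennreal ?c * F.wn \<gamma> (%r w. g r w - g' r w)"
  unfolding dist2_def by (rule bs_contraction(1)[OF s 1 2 gamma(1)])
 also have "\<dots> <= ennreal ?c * (ennreal (2 * K^2) * dist2 s \<eta> y z y' z')" by (intro mult_left_mono l) simp
 also have "\<dots> = ennreal (?c * (2 * K^2)) * dist2 s \<eta> y z y' z'" using c0 by (simp add: ennreal_mult mult.assoc)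
 also have "\<dots> <= ennreal (1/4) * dist2 s \<eta> y z y' z'" by (intro mult_right_mono ennreal_leI gamma(2)) simp
 finally show ?g0 .
qed

end

lemma ennreal_zero_of_geometric:
 fixes x E :: ennreal
 assumes "E < \<infinity>" and le: "\<And>n. x <= ennreal ((1/4) ^ n) * E"
 shows "x = 0"
proof -
 obtain e where e: "E = ennreal e" "0 <= e" using assms(1) by (cases E) auto
 have "(%n. (1/4::real) ^ n * e) \<longlonglongrightarrow> 0 * e" by (intro tendsto_mult tendsto_const LIMSEQ_realpow_zero) auto
 from tendsto_ennrealI[OF this] have "(%n. ennreal ((1/4) ^ n * e)) \<longlonglongrightarrow> 0" by simp
 then have "x <= 0" by (rule LIMSEQ_le_const) (use le e in \<open>auto simp: ennreal_mult\<close>)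
 then show ?thesis by simp
qed

lemma ennreal_quarter_Suc: "ennreal (1/4) * (ennreal ((1/4) ^ n) * x) = ennreal ((1/4) ^ Suc n) * x"
proof -
 have "ennreal ((1/4) ^ Suc n) = ennreal (1/4) * ennreal ((1/4) ^ n)" unfolding power_Suc by (rule ennreal_mult) auto
 then show ?thesis by (simp only: mult.assoc)
qed

text \<open>Infinity satisfies the inequality too, whence the finiteness assumption.\<close>

lemma ennreal_zero_of_quarter: "x < \<infinity> ==> x <= ennreal (1/4) * x ==> x = 0"
proof -
 assume fin: "x < \<infinity>" and le: "x <= ennreal (1/4) * x"
 have "x <= ennreal ((1/4) ^ n) * x" for n
 proof (induction n)
  case (Suc n)
  have "x <= ennreal (1/4) * x" by (rule le)
  also have "\<dots> <= ennreal (1/4) * (ennreal ((1/4) ^ n) * x)" by (intro mult_left_mono Suc) simp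
  also have "\<dots> = ennreal ((1/4) ^ Suc n) * x" by (rule ennreal_quarter_Suc)
  finally show ?case .
 qed simp
 then show "x = 0" by (rule ennreal_zero_of_geometric[OF fin])
qed

lemma progressive_on_lim:
 assumes "\<And>n::nat. progressive_on I G (X n)"
 shows "progressive_on I G (%r w. lim (%n. X n r w))"
 using assms unfolding progressive_on_def split_beta' by (auto intro!: borel_measurable_lim_metric)

section \<open>Uniqueness and Picard iteration\<close>

context pd_bsde
begin

text \<open>The equation is the definition of \<open>Mm\<close> rearranged, once \<open>Y T\<close>
  is replaced by \<xi> almost surely.\<close>

lemma mk_bs:
 assumes g: "Luni P T V g" and e: "\<And>s \<eta>. s \<in> {0..T} ==> \<eta> \<in> Omega ==> Y s \<eta> = Yg g s \<eta>"
  and s: "s \<in> {0..T}" "\<eta> \<in> Omega" and Z: "\<And>i. rep s \<eta> (Mm s Y g) (Mm s (\<Psi> i) (h i)) (Z i)"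
 shows "bs s \<eta> Y (Mm s Y g) g Z"
proof -
 have m: "mp Y g" by (rule mp_cong[OF mp_Yg[OF g] e])
 have "AE w in Pc s \<eta>. Y t w = \<xi> w + (LINT r:{t..T}|\<nu>. g r w) - (Mm s Y g T w - Mm s Y g t w)" if t: "t \<in> {s..T}" for t
 proof -
  have tt: "s <= t" "t <= T" "T \<in> {0..T}" "0 <= s" using t s by auto
  show ?thesis using Mm_incr_AE[OF m s tt(1,2) order_refl] Yg_terminal[OF g s] AE_space[of "Pc s \<eta>"]
  proof eventually_elim
   case (elim w)
   have "Y T w = \<xi> w" using e[OF tt(3), of w] elim(2,3) P_prob(2)[OF tt(4) s(2)] by simp
   then show ?case using elim(1) by (simp add: dM_def)
  qed
 qed
 then show ?thesis unfolding bs_def using Luni_D[OF mp_D(1)[OF m] s] Luni_D[OF g s] mp_l2m[OF m s] Z by blast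
qed

lemma IP_bs:
 assumes "IP P T V A \<Psi> f \<xi> Y Z" and s: "s \<in> {0..T}" "\<eta> \<in> Omega"
 shows "bs s \<eta> Y (Mm s Y (Fd Y Z)) (Fd Y Z) Z"
 using assms unfolding IP_iff by (intro mk_bs Fd_Luni) auto

lemma sel_ex:
 assumes g: "Luni P T V g"
 shows "\<exists>Z. (\<forall>i. Luni P T V (Z i)) \<and> (\<forall>i. \<forall>s\<in>{0..T}. \<forall>\<eta>\<in>Omega. rep s \<eta> (Mm s (Yg g) g) (Mm s (\<Psi> i) (h i)) (Z i))"
proof -
 have "\<forall>i. \<exists>Z. Luni P T V Z \<and> (\<forall>s\<in>{0..T}. \<forall>\<eta>\<in>Omega. rep s \<eta> (Mm s (Yg g) g) (Mm s (\<Psi> i) (h i)) Z)"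
  by (intro allI universal_density[OF mp_Yg[OF g] Psi_mp C0])
 from choice[OF this] show ?thesis by blast
qed

text \<open>Densities are determined only up to null sets under every law, so the iteration needs
  one fixed choice; \<open>universal_density\<close> allows a choice that serves all initial
  conditions.\<close>

definition sel :: "'e proc => 'd => 'e proc" where
 "sel g = (SOME Z. (\<forall>i. Luni P T V (Z i)) \<and> (\<forall>i. \<forall>s\<in>{0..T}. \<forall>\<eta>\<in>Omega. rep s \<eta> (Mm s (Yg g) g) (Mm s (\<Psi> i) (h i)) (Z i)))"

lemma sel:
 assumes "Luni P T V g"
 shows "Luni P T V (sel g i)" "s \<in> {0..T} ==> \<eta> \<in> Omega ==> rep s \<eta> (Mm s (Yg g) g) (Mm s (\<Psi> i) (h i)) (sel g i)"
 using someI_ex[OF sel_ex[OF assms], folded sel_def] by blast+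

lemma sel_bs: "Luni P T V g ==> s \<in> {0..T} ==> \<eta> \<in> Omega ==> bs s \<eta> (Yg g) (Mm s (Yg g) g) g (sel g)"
 by (intro mk_bs sel refl)

lemma dist2_zero:
 assumes s: "s \<in> {0..T}" "\<eta> \<in> Omega" and z: "dist2 s \<eta> Y Z Y' Z' = 0"
  and U: "filtered_clock.jm T \<nu> (Pc s \<eta>) s (%r w. Y r w - Y' r w)"
   "\<And>i. filtered_clock.jm T \<nu> (Pc s \<eta>) s (%r w. Z i r w - Z' i r w)"
 shows "AE w in Pc s \<eta>. AE r in \<nu>. r \<in> {s..T} \<longrightarrow> Y r w = Y' r w" (is ?g0)
  "AE w in Pc s \<eta>. AE r in \<nu>. r \<in> {s..T} \<longrightarrow> Z i r w = Z' i r w"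
proof -
 interpret F: filtered_clock W T \<nu> "Pc s \<eta>" "Fc (P s \<eta>)" s by (rule filtered[OF s])
 have "F.wn \<gamma> (%r w. Y r w - Y' r w) = 0" "F.wn \<gamma> (%r w. Z i r w - Z' i r w) = 0" using z unfolding dist2_def by auto
 from F.wn_zero[OF U(1) this(1)] F.wn_zero[OF U(2) this(2)]
 show ?g0
  "AE w in Pc s \<eta>. AE r in \<nu>. r \<in> {s..T} \<longrightarrow> Z i r w = Z' i r w" by auto
qed

lemma dist2_finite:
 assumes s: "s \<in> {0..T}" "\<eta> \<in> Omega"
  and "filtered_clock.jm T \<nu> (Pc s \<eta>) s Y" "filtered_clock.N2 T \<nu> (Pc s \<eta>) s Y < \<infinity>"
  and "filtered_clock.jm T \<nu> (Pc s \<eta>) s Y'" "filtered_clock.N2 T \<nu> (Pc s \<eta>) s Y' < \<infinity>"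
  and "\<And>i. filtered_clock.jm T \<nu> (Pc s \<eta>) s (Z i)" "\<And>i. filtered_clock.N2 T \<nu> (Pc s \<eta>) s (Z i) < \<infinity>"
  and "\<And>i. filtered_clock.jm T \<nu> (Pc s \<eta>) s (Z' i)" "\<And>i. filtered_clock.N2 T \<nu> (Pc s \<eta>) s (Z' i) < \<infinity>"
 shows "dist2 s \<eta> Y Z Y' Z' < \<infinity>"
proof -
 interpret F: filtered_clock W T \<nu> "Pc s \<eta>" "Fc (P s \<eta>)" s by (rule filtered[OF s])
 have fin: "F.wn \<gamma> (%r w. A r w - B r w) < \<infinity>" if "F.jm A" "F.N2 A < \<infinity>" "F.jm B" "F.N2 B < \<infinity>" for A B
 proof -
  have "F.N2 (%r w. A r w - B r w) < \<infinity>" by (rule F.N2_lincomb_finite[OF that, where k=1]) (use abs_triangle_ineq4 in auto)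
  then show ?thesis using F.wn_finite_iff[OF F.jm_arith(2)[OF that(1,3)]] gamma(1) by simp
 qed
 have "(\<Sum>i\<in>UNIV. F.wn \<gamma> (%r w. Z i r w - Z' i r w)) < \<infinity>" using fin[OF assms(7-10)] by simp
 then show ?thesis unfolding dist2_def using fin[OF assms(3-6)] by simp
qed

text \<open>An a.e. equality of drivers under \<open>P s \<eta>\<close> becomes an exact equality at
  \<open>(s, \<eta>)\<close>, because \<open>Yg\<close> is an expectation under this law. This is
  how \<open>Y\<close> is identified at every point and not merely quasi-surely.\<close>

lemma Yg_AE_cong:
 assumes g: "Luni P T V g" and g': "Luni P T V g'" and s: "s \<in> {0..T}" "\<eta> \<in> Omega"
  and e: "AE w in Pc s \<eta>. AE r in \<nu>. r \<in> {s..T} \<longrightarrow> g r w = g' r w"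
 shows "Yg g s \<eta> = Yg g' s \<eta>"
proof -
 interpret F: filtered_clock W T \<nu> "Pc s \<eta>" "Fc (P s \<eta>)" s by (rule filtered[OF s])
 have s0: "0 <= s" using s by simp
 have "AE w in Pc s \<eta>. Xi g s w = Xi g' s w"
  using F.nI_AE_cong[OF Luni_D(3)[OF g s] Luni_D(3)[OF g' s] e] by eventually_elim (auto simp: Xi_def F.nI_def)
 then have "AE w in P s \<eta>. Xi g s w = Xi g' s w" by (simp add: AE_completion_iff)
 then show ?thesis unfolding Yg_def
  by (intro integral_cong_AE) (use Xi_meas[OF g s(1)] Xi_meas[OF g' s(1)] s0 s(2) in \<open>auto simp: meas_P\<close>)
qed

text \<open>Under each law the distance of two solutions is finite and at most a quarter of itself,
  hence zero. The drivers then agree a.e., and \<open>Yg_AE_cong\<close> gives equality of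
  \<open>Y\<close> everywhere.\<close>

theorem IP_unique:
 assumes 1: "IP P T V A \<Psi> f \<xi> Y Z" and 2: "IP P T V A \<Psi> f \<xi> Y' Z'"
 shows "\<And>s \<eta>. s \<in> {0..T} ==> \<eta> \<in> Omega ==> Y s \<eta> = Y' s \<eta>" "qs_eq P T V (Z i) (Z' i)"
proof -
 have L: "Luni P T V Y" "\<And>i. Luni P T V (Z i)" "Luni P T V Y'" "\<And>i. Luni P T V (Z' i)"
  and e: "\<And>s \<eta>. s \<in> {0..T} ==> \<eta> \<in> Omega ==> Y s \<eta> = Yg (Fd Y Z) s \<eta>" "\<And>s \<eta>. s \<in> {0..T} ==> \<eta> \<in> Omega ==> Y' s \<eta> = Yg (Fd Y' Z') s \<eta>"
  using 1 2 unfolding IP_iff by blast+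
 have key: "(AE w in Pc s \<eta>. AE r in \<nu>. r \<in> {s..T} \<longrightarrow> Z i r w = Z' i r w) \<and> Yg (Fd Y Z) s \<eta> = Yg (Fd Y' Z') s \<eta>"
  if s: "s \<in> {0..T}" "\<eta> \<in> Omega" for s \<eta> i
 proof -
  interpret F: filtered_clock W T \<nu> "Pc s \<eta>" "Fc (P s \<eta>)" s by (rule filtered[OF s])
  have sp: "space (Pc s \<eta>) = Omega" using P_prob(2)[of s \<eta>] s by simp
  note j = F.jm_arith(2)[OF Luni_D(3)[OF L(1) s] Luni_D(3)[OF L(3) s]] F.jm_arith(2)[OF Luni_D(3)[OF L(2) s] Luni_D(3)[OF L(4) s]]
  have lip: "(Fd Y Z r w - Fd Y' Z' r w)^2 <= 2 * K^2 * ((Y r w - Y' r w)^2 + (\<Sum>j\<in>UNIV. (Z j r w - Z' j r w)^2))"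
   if "r \<in> {s..T}" "w \<in> Omega" for r w by (rule Fd_lipschitz) (use that s in auto)
  note q = dist2_quarter[OF s IP_bs[OF 1 s] IP_bs[OF 2 s] j lip]
  have fin: "dist2 s \<eta> Y Z Y' Z' < \<infinity>" by (rule dist2_finite[OF s]) (use Luni_D[OF _ s] L in auto)
  have z: "dist2 s \<eta> Y Z Y' Z' = 0" by (rule ennreal_zero_of_quarter[OF fin q(1)])
  have gz: "F.wn \<gamma> (%r w. Fd Y Z r w - Fd Y' Z' r w) = 0" using q(2) z by simp
  have gL: "Luni P T V (Fd Y Z)" "Luni P T V (Fd Y' Z')" by (intro Fd_Luni L)+
  have "AE w in Pc s \<eta>. AE r in \<nu>. r \<in> {s..T} \<longrightarrow> Fd Y Z r w = Fd Y' Z' r w"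
   using F.wn_zero[OF F.jm_arith(2)[OF Luni_D(3)[OF gL(1) s] Luni_D(3)[OF gL(2) s]] gz] by simp
  from Yg_AE_cong[OF gL s this] dist2_zero(2)[OF s z j, of i] show ?thesis by blast
 qed
 show "\<And>s \<eta>. s \<in> {0..T} ==> \<eta> \<in> Omega ==> Y s \<eta> = Y' s \<eta>" using key e by simp
 \<comment> \<open>One exceptional set for all laws; it is progressive since both processes
   are.\<close>
 define C where "C = {p. fst p \<in> {0..T} \<and> snd p \<in> Omega \<and> Z i (fst p) (snd p) \<noteq> Z' i (fst p) (snd p)}"
 have C: "C \<in> sets ProO"
 proof -
  have "C \<inter> {0..t} \<times> Omega \<in> sets (restrict_space borel {0..t} \<Otimes>\<^sub>M Fo t)" if t: "0 <= t" for t
  proof -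
   let ?N = "restrict_space (borel :: real measure) {0..t} \<Otimes>\<^sub>M (Fo t :: 'e path measure)"
   \<comment> \<open>\<open>C\<close> contains no time after \<open>T\<close>, so its part up to
     \<open>t\<close> is already decided at \<open>min t T\<close>.\<close>
   define u where "u = min t T"
   have u: "u \<in> {0..T}" "u <= t" using t T0 by (auto simp: u_def)
   have "progressive_on {0..T} Fo (%r w. Z i r w - Z' i r w)" by (intro progressive_on_arith Luni_progressive L)
   then have m: "(%p. indicator {0..u} (fst p) * (Z i (fst p) (snd p) - Z' i (fst p) (snd p))) \<in> borel_measurable (borel \<Otimes>\<^sub>M Fo u)"
    using u(1) unfolding progressive_on_Icc_iff by blast
   have id: "(%w. w) \<in> measurable (Fo t) (Fo u :: 'e path measure)"
   proof (rule measurableI)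
    fix B assume B: "B \<in> sets (Fo u :: 'e path measure)"
    then have "(%w. w) -` B \<inter> space (Fo t) = B" using sets.sets_into_space[OF B] by auto
    then show "(%w. w) -` B \<inter> space (Fo t) \<in> sets (Fo t)" using subsetD[OF Fo_mono[OF u(2)] B] by simp
   qed simp
   have "(%p. (fst p, snd p)) \<in> measurable ?N (borel \<Otimes>\<^sub>M Fo u)"
    by (intro measurable_Pair measurable_compose[OF measurable_snd id] measurable_compose[OF measurable_fst])
     (auto intro: measurable_restrict_space1)
   from measurable_compose[OF this m]
   have [measurable]: "(%p. indicator {0..u} (fst p) * (Z i (fst p) (snd p) - Z' i (fst p) (snd p))) \<in> borel_measurable ?N" by simp
   have "{p \<in> space ?N. indicator {0..u} (fst p) * (Z i (fst p) (snd p) - Z' i (fst p) (snd p)) \<noteq> 0} \<in> sets ?N" by measurable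
   also have "{p \<in> space ?N. indicator {0..u} (fst p) * (Z i (fst p) (snd p) - Z' i (fst p) (snd p)) \<noteq> 0} = C \<inter> {0..t} \<times> Omega"
    by (auto simp: space_pair_measure space_restrict_space C_def u_def indicator_def split: if_splits)
   finally show ?thesis .
  qed
  moreover have "C \<subseteq> {0..} \<times> Omega" by (auto simp: C_def)
  ultimately show ?thesis unfolding ProO_def by (subst sets_measure_of) (auto intro!: sigma_sets.Basic)
 qed
 have "(\<integral>\<^sup>+w. (\<integral>\<^sup>+r\<in>{s..T}. indicator C (r, w) \<partial>\<nu>) \<partial>P s \<eta>) = 0" if s: "s \<in> {0..T}" "\<eta> \<in> Omega" for s \<eta>
 proof -
  have "AE w in Pc s \<eta>. AE r in \<nu>. r \<in> {s..T} \<longrightarrow> Z i r w = Z' i r w" using key[OF s] by blast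
  then have "AE w in Pc s \<eta>. (\<integral>\<^sup>+r\<in>{s..T}. indicator C (r, w) \<partial>\<nu>) = 0"
  proof eventually_elim
   case (elim w)
   have "(\<integral>\<^sup>+r\<in>{s..T}. indicator C (r, w) \<partial>\<nu>) = (\<integral>\<^sup>+r. 0 \<partial>\<nu>)"
    by (rule nn_integral_cong_AE, rule AE_mp[OF elim]) (auto intro!: AE_I2 simp: C_def indicator_def)
   then show ?case by simp
  qed
  then have "(\<integral>\<^sup>+w. (\<integral>\<^sup>+r\<in>{s..T}. indicator C (r, w) \<partial>\<nu>) \<partial>Pc s \<eta>) = (\<integral>\<^sup>+w. 0 \<partial>Pc s \<eta>)" by (rule nn_integral_cong_AE)
  then show ?thesis by (simp add: nn_integral_completion)
 qed
 then have "zero_potential P T V C" unfolding zero_potential_def using C by blast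
 then show "qs_eq P T V (Z i) (Z' i)" unfolding qs_eq_def by (intro exI[of _ C]) (auto simp: C_def)
qed

primrec U :: "nat => 'e proc \<times> ('d => 'e proc)" where
 "U 0 = ((%r w. 0), (%i r w. 0))"
| "U (Suc n) = (Yg (Fd (fst (U n)) (snd (U n))), sel (Fd (fst (U n)) (snd (U n))))"

lemma U_Luni: "Luni P T V (fst (U n)) \<and> (\<forall>i. Luni P T V (snd (U n) i))"
proof (induction n)
 case 0
 then show ?case using Luni_zero by simp
next
 case (Suc n)
 then have "Luni P T V (Fd (fst (U n)) (snd (U n)))" by (intro Fd_Luni) auto
 then show ?case using Yg_Luni sel(1) by simp
qed

text \<open>The constant \<open>D\<close> may vary with \<open>(s, \<eta>)\<close>, whereas the
  pointwise \<open>lim\<close> is the same for all of them; it therefore lies in the space for every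
  initial condition at once.\<close>

lemma Luni_lim:
 assumes X: "\<And>n. Luni P T V (X n)"
  and d: "\<And>s \<eta>. s \<in> {0..T} ==> \<eta> \<in> Omega ==> \<exists>D<\<infinity>. \<forall>n. filtered_clock.wn W T \<nu> (Pc s \<eta>) s \<gamma> (%r w. X (Suc n) r w - X n r w) <= ennreal ((1/4) ^ n) * D"
 shows "Luni P T V (%r w. lim (%n. X n r w))"
proof (rule Luni_I[OF progressive_on_lim[OF Luni_progressive[OF X]]])
 fix s and \<eta> :: "'e path" assume s: "s \<in> {0..T}" "\<eta> \<in> Omega"
 interpret F: filtered_clock W T \<nu> "Pc s \<eta>" "Fc (P s \<eta>)" s by (rule filtered[OF s])
 obtain D where D: "D < \<infinity>" "\<And>n. F.wn \<gamma> (%r w. X (Suc n) r w - X n r w) <= ennreal ((1/4) ^ n) * D" using d[OF s] by blast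
 note Xj = Luni_D(3)[OF X s]
 have lj: "F.jm (%r w. lim (%n. X n r w))"
  by (rule F.jm_prog[OF progressive_prog[OF s progressive_on_lim[OF Luni_progressive[OF X]]]])
 have "F.wn \<gamma> (%r w. lim (%n. X n r w) - X 0 r w) <= ennreal ((1/4) ^ 0) * (4 * D)" by (rule F.wn_lim[OF Xj lj D(2)])
 also have "\<dots> < \<infinity>" using D(1) by (simp add: ennreal_mult_less_top)
 finally have n: "F.N2 (%r w. lim (%n. X n r w) - X 0 r w) < \<infinity>"
  using F.wn_finite_iff[OF F.jm_arith(2)[OF lj Xj]] gamma(1) by simp
 show "F.N2 (%r w. lim (%n. X n r w)) < \<infinity>"
  by (rule F.N2_lincomb_finite[OF F.jm_arith(2)[OF lj Xj] n Luni_D(3,2)[OF X s], of _ 1 0]) auto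
qed

text \<open>The limit of the iterates satisfies the equations only a.e. under each law. The solution
  map is therefore applied once more: \<open>Y = Yg gl\<close> has a definite value everywhere, its
  own driver \<open>g\<close> equals \<open>gl\<close> a.e. under every law, and so
  \<open>Y = Yg g\<close> holds at each point.\<close>

theorem IP_exists: "\<exists>Y Z. IP P T V A \<Psi> f \<xi> Y Z"
proof -
 have UY: "Luni P T V (fst (U n))" and UZ: "Luni P T V (snd (U n) i)" for n i using U_Luni by auto
 have gL: "Luni P T V (Fd (fst (U n)) (snd (U n)))" for n by (intro Fd_Luni UY UZ)
 have step: "\<exists>D<\<infinity>. (\<forall>n. filtered_clock.wn W T \<nu> (Pc s \<eta>) s \<gamma> (%r w. fst (U (Suc n)) r w - fst (U n) r w) <= ennreal ((1/4) ^ n) * D) \<and>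
   (\<forall>n i. filtered_clock.wn W T \<nu> (Pc s \<eta>) s \<gamma> (%r w. snd (U (Suc n)) i r w - snd (U n) i r w) <= ennreal ((1/4) ^ n) * D)"
  if s: "s \<in> {0..T}" "\<eta> \<in> Omega" for s \<eta>
 proof -
  interpret F: filtered_clock W T \<nu> "Pc s \<eta>" "Fc (P s \<eta>)" s by (rule filtered[OF s])
  define D where "D n = dist2 s \<eta> (fst (U (Suc n))) (snd (U (Suc n))) (fst (U n)) (snd (U n))" for n
  have "D (Suc n) <= ennreal (1/4) * D n" for n
  proof -
   note b1 = sel_bs[OF gL s, of "Suc n"] and b0 = sel_bs[OF gL s, of n]
   have "dist2 s \<eta> (Yg (Fd (fst (U (Suc n))) (snd (U (Suc n))))) (sel (Fd (fst (U (Suc n))) (snd (U (Suc n)))))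
     (Yg (Fd (fst (U n)) (snd (U n)))) (sel (Fd (fst (U n)) (snd (U n)))) <= ennreal (1/4) * dist2 s \<eta> (fst (U (Suc n))) (snd (U (Suc n))) (fst (U n)) (snd (U n))"
    by (rule dist2_quarter(1)[OF s b1 b0 F.jm_arith(2)[OF Luni_D(3)[OF UY s] Luni_D(3)[OF UY s]] F.jm_arith(2)[OF Luni_D(3)[OF UZ s] Luni_D(3)[OF UZ s]]])
     (rule Fd_lipschitz, use s in auto)
   then show ?thesis by (simp add: D_def)
  qed
  then have Dn: "D n <= ennreal ((1/4) ^ n) * D 0" for n
  proof (induction n)
   case (Suc n)
   have "D (Suc n) <= ennreal (1/4) * (ennreal ((1/4) ^ n) * D 0)" by (rule order_trans[OF Suc.prems mult_left_mono[OF Suc.IH[OF Suc.prems]]]) simp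
   also have "\<dots> = ennreal ((1/4) ^ Suc n) * D 0" by (rule ennreal_quarter_Suc)
   finally show ?case .
  qed simp
  have "D 0 < \<infinity>" unfolding D_def by (rule dist2_finite[OF s]) (use Luni_D[OF _ s] UY UZ in blast)+
  moreover have "F.wn \<gamma> (%r w. fst (U (Suc n)) r w - fst (U n) r w) <= D n" for n unfolding D_def dist2_def by simp
  moreover have "F.wn \<gamma> (%r w. snd (U (Suc n)) i r w - snd (U n) i r w) <= D n" for n i
   unfolding D_def dist2_def by (rule order_trans[OF member_le_sum[of i UNIV] add_increasing]) auto
  ultimately show ?thesis using Dn order_trans by (intro exI[of _ "D 0"]) blast
 qed
 define Yl where "Yl r w = lim (%n. fst (U n) r w)" for r w
 define Zl where "Zl i r w = lim (%n. snd (U n) i r w)" for i r w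
 have YlL: "Luni P T V Yl" unfolding Yl_def[abs_def] by (rule Luni_lim[OF UY]) (use step in blast)
 have ZlL: "Luni P T V (Zl i)" for i unfolding Zl_def[abs_def] by (rule Luni_lim[OF UZ]) (use step in blast)
 define gl where "gl = Fd Yl Zl"
 have glL: "Luni P T V gl" unfolding gl_def by (intro Fd_Luni YlL ZlL)
 define Y where "Y = Yg gl"
 define Z where "Z = sel gl"
 have YL: "Luni P T V Y" and ZL: "Luni P T V (Z i)" for i unfolding Y_def Z_def by (rule Yg_Luni[OF glL], rule sel(1)[OF glL])
 define g where "g = Fd Y Z"
 have gL': "Luni P T V g" unfolding g_def by (intro Fd_Luni YL ZL)
 have ae: "AE w in Pc s \<eta>. AE r in \<nu>. r \<in> {s..T} \<longrightarrow> g r w = gl r w" if s: "s \<in> {0..T}" "\<eta> \<in> Omega" for s \<eta>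
 proof -
  interpret F: filtered_clock W T \<nu> "Pc s \<eta>" "Fc (P s \<eta>)" s by (rule filtered[OF s])
  have sp: "space (Pc s \<eta>) = Omega" using P_prob(2)[of s \<eta>] s by simp
  note j = Luni_D(3)[OF _ s]
  obtain D where D: "D < \<infinity>" "\<And>n. F.wn \<gamma> (%r w. fst (U (Suc n)) r w - fst (U n) r w) <= ennreal ((1/4) ^ n) * D"
   "\<And>n i. F.wn \<gamma> (%r w. snd (U (Suc n)) i r w - snd (U n) i r w) <= ennreal ((1/4) ^ n) * D" using step[OF s] by blast
  define E where "E = 4 * D + (\<Sum>i\<in>(UNIV::'d set). 4 * D)"
  have Ef: "E < \<infinity>" unfolding E_def using D(1) by (simp add: ennreal_mult_less_top of_nat_less_top)
  have lY: "F.wn \<gamma> (%r w. Yl r w - fst (U n) r w) <= ennreal ((1/4) ^ n) * (4 * D)" for n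
   unfolding Yl_def by (rule F.wn_lim[OF j[OF UY] j[OF YlL, unfolded Yl_def[abs_def]] D(2)])
  have lZ: "F.wn \<gamma> (%r w. Zl i r w - snd (U n) i r w) <= ennreal ((1/4) ^ n) * (4 * D)" for n i
   unfolding Zl_def by (rule F.wn_lim[OF j[OF UZ] j[OF ZlL, unfolded Zl_def[abs_def]] D(3)])
  have l: "dist2 s \<eta> Yl Zl (fst (U n)) (snd (U n)) <= ennreal ((1/4) ^ n) * E" for n
   unfolding dist2_def E_def distrib_left sum_distrib_left by (intro add_mono sum_mono lY lZ)
  have u: "dist2 s \<eta> Y Z (fst (U (Suc n))) (snd (U (Suc n))) <= ennreal ((1/4) ^ Suc n) * E" for n
  proof -
   have "dist2 s \<eta> Y Z (fst (U (Suc n))) (snd (U (Suc n))) <= ennreal (1/4) * dist2 s \<eta> Yl Zl (fst (U n)) (snd (U n))"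
    unfolding Y_def Z_def U.simps(2) fst_conv snd_conv
    by (rule dist2_quarter(1)[OF s sel_bs[OF glL s] sel_bs[OF gL s] F.jm_arith(2)[OF j[OF YlL] j[OF UY]] F.jm_arith(2)[OF j[OF ZlL] j[OF UZ]]])
     (unfold gl_def, rule Fd_lipschitz, use s in auto)
   also have "\<dots> <= ennreal (1/4) * (ennreal ((1/4) ^ n) * E)" by (intro mult_left_mono l) simp
   also have "\<dots> = ennreal ((1/4) ^ Suc n) * E" by (rule ennreal_quarter_Suc)
   finally show ?thesis .
  qed
  \<comment> \<open>Both pairs are close to the iterate \<open>Suc n\<close>, the first as the image
    of the limit under a contraction, the second by convergence. Two terms and the factor 2 make 4,
    which turns the power \<open>Suc n\<close> into \<open>n\<close>.\<close>
  have "dist2 s \<eta> Y Z Yl Zl <= ennreal ((1/4) ^ n) * E" for n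
  proof -
   have "dist2 s \<eta> Y Z Yl Zl <= 2 * (dist2 s \<eta> Y Z (fst (U (Suc n))) (snd (U (Suc n))) + dist2 s \<eta> Yl Zl (fst (U (Suc n))) (snd (U (Suc n))))"
   proof -
    have "dist2 s \<eta> Y Z Yl Zl <= 2 * (F.wn \<gamma> (%r w. Y r w - fst (U (Suc n)) r w) + F.wn \<gamma> (%r w. Yl r w - fst (U (Suc n)) r w))
     + (\<Sum>i\<in>UNIV. 2 * (F.wn \<gamma> (%r w. Z i r w - snd (U (Suc n)) i r w) + F.wn \<gamma> (%r w. Zl i r w - snd (U (Suc n)) i r w)))"
     unfolding dist2_def by (intro add_mono sum_mono F.wn_triangle j YL UY YlL ZL UZ ZlL)
    also have "\<dots> = 2 * (dist2 s \<eta> Y Z (fst (U (Suc n))) (snd (U (Suc n))) + dist2 s \<eta> Yl Zl (fst (U (Suc n))) (snd (U (Suc n))))"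
     unfolding dist2_def sum_distrib_left[symmetric] sum.distrib by (simp only: distrib_left ac_simps)
    finally show ?thesis .
   qed
   also have "\<dots> <= 2 * (ennreal ((1/4) ^ Suc n) * E + ennreal ((1/4) ^ Suc n) * E)" by (intro mult_left_mono add_mono u l) simp
   also have "\<dots> = (4 * ennreal ((1/4) ^ Suc n)) * E" by (simp add: mult_2[symmetric] mult.assoc[symmetric])
   also have "4 * ennreal ((1/4) ^ Suc n) = ennreal ((1/4) ^ n)"
    using ennreal_mult[of 4 "(1/4) ^ Suc n"] by simp
   finally show ?thesis .
  qed
  then have z: "dist2 s \<eta> Y Z Yl Zl = 0" by (rule ennreal_zero_of_geometric[OF Ef])
  have gj: "F.jm (%r w. g r w - gl r w)" by (rule F.jm_arith(2)[OF j[OF gL'] j[OF glL]])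
  have "F.wn \<gamma> (%r w. g r w - gl r w) <= ennreal (2 * K^2) * dist2 s \<eta> Y Z Yl Zl"
   unfolding dist2_def
  proof (rule F.wn_lipschitz[OF finite gj F.jm_arith(2)[OF j[OF YL] j[OF YlL]] F.jm_arith(2)[OF j[OF ZL] j[OF ZlL]]])
   fix r w assume "r \<in> {s..T}" "w \<in> space (Pc s \<eta>)"
   then show "(g r w - gl r w)^2 <= 2 * K^2 * ((Y r w - Yl r w)^2 + (\<Sum>i\<in>UNIV. (Z i r w - Zl i r w)^2))"
    unfolding g_def gl_def by (intro Fd_lipschitz) (use s sp in auto)
  qed simp
  then have "F.wn \<gamma> (%r w. g r w - gl r w) = 0" using z by simp
  from F.wn_zero[OF gj this] show ?thesis by simp
 qed
 have Ye: "Y s \<eta> = Yg g s \<eta>" if "s \<in> {0..T}" "\<eta> \<in> Omega" for s \<eta>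
  unfolding Y_def by (rule Yg_AE_cong[OF gL' glL that ae[OF that], symmetric])
 have m: "mp Y gl" "mp Y g" using mp_Yg[OF glL] mp_cong[OF mp_Yg[OF gL'] Ye] by (auto simp: Y_def)
 have "rep s \<eta> (Mm s Y g) (Mm s (\<Psi> i) (h i)) (Z i)" if s: "s \<in> {0..T}" "\<eta> \<in> Omega" for s \<eta> i
 proof -
  interpret F: filtered_clock W T \<nu> "Pc s \<eta>" "Fc (P s \<eta>)" s by (rule filtered[OF s])
  show ?thesis
  proof (rule F.repr_cong[OF mp_l2m[OF m(1) s] mp_l2m[OF Psi_mp s] mp_l2m[OF m(2) s] mp_l2m[OF Psi_mp s]])
   show "F.repr (Mm s Y gl) (Mm s (\<Psi> i) (h i)) (Z i)" unfolding Y_def Z_def by (rule sel(2)[OF glL s])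
   show "AE w in Pc s \<eta>. Mm s Y gl T w - Mm s Y gl t w = Mm s Y g T w - Mm s Y g t w" if "t \<in> {s..T}" for t
    using F.nI_AE_cong[OF Luni_D(3)[OF gL' s] Luni_D(3)[OF glL s] ae[OF s]]
    by eventually_elim (use that in \<open>auto simp: Mm_def F.nI_def\<close>)
  qed simp
 qed
 then have "IP P T V A \<Psi> f \<xi> Y Z" unfolding IP_iff using YL ZL Ye unfolding g_def by blast
 then show ?thesis by blast
qed

section \<open>Comparison with a given solution of the BSDE\<close>

lemma is_mart_set_integral:
 assumes s: "s \<in> {0..T}" "\<eta> \<in> Omega" and X: "is_mart (P s \<eta>) I X" and t: "t \<in> I" "u \<in> I" "t <= u" and B: "B \<in> sets (Fc (P s \<eta>) t)"
 shows "(LINT w:B|Pc s \<eta>. X u w) = (LINT w:B|Pc s \<eta>. X t w)"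
proof -
 interpret F: filtered_clock W T \<nu> "Pc s \<eta>" "Fc (P s \<eta>)" s by (rule filtered[OF s])
 interpret S: finite_measure_subalgebra "Pc s \<eta>" "Fc (P s \<eta>) t" by unfold_locales (rule F.subG)
 have i: "integrable (Pc s \<eta>) (X u)" "integrable (Pc s \<eta>) (X t)"
  and e: "AE w in Pc s \<eta>. real_cond_exp (Pc s \<eta>) (Fc (P s \<eta>) t) (X u) w = X t w"
  using X t unfolding is_mart_def by blast+
 have "(LINT w:B|Pc s \<eta>. X u w) = (LINT w:B|Pc s \<eta>. real_cond_exp (Pc s \<eta>) (Fc (P s \<eta>) t) (X u) w)"
  by (rule S.real_cond_exp_intA[OF i(1) B])
 also have "\<dots> = (LINT w:B|Pc s \<eta>. X t w)"
  unfolding set_lebesgue_integral_def by (rule integral_cong_AE) (use i e F.G_sets[OF B] in auto)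
 finally show ?thesis .
qed

lemma is_mart_l2m:
 assumes s: "s \<in> {0..T}" "\<eta> \<in> Omega" and X: "is_mart (P s \<eta>) I X" and I: "{s..T} \<subseteq> I"
  and L2: "\<And>t. t \<in> {s..T} ==> integrable (Pc s \<eta>) (%w. (X t w)^2)"
 shows "filtered_clock.l2m T (Pc s \<eta>) (Fc (P s \<eta>)) s X"
proof -
 interpret F: filtered_clock W T \<nu> "Pc s \<eta>" "Fc (P s \<eta>)" s by (rule filtered[OF s])
 show ?thesis unfolding F.l2m_def
 proof (intro conjI ballI allI impI L2)
  show "X t \<in> borel_measurable (Fc (P s \<eta>) t)" if "t \<in> {s..T}" for t using X I that unfolding is_mart_def by blast
  show "(LINT w:B|Pc s \<eta>. X u w) = (LINT w:B|Pc s \<eta>. X t w)"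
   if "s <= t" "t <= u" "u <= T" "B \<in> sets (Fc (P s \<eta>) t)" for t u B
   by (rule is_mart_set_integral[OF s X _ _ that(2,4)]) (use that I in auto)
 qed
qed

lemma maf_version_incr:
 assumes s: "s \<in> {0..T}" "\<eta> \<in> Omega" and N: "maf_version (P s \<eta>) s (MA A T V (\<Psi> i)) N" and t: "s <= t" "t <= u" "u <= T"
 shows "AE w in Pc s \<eta>. N u w - N t w = Mm s (\<Psi> i) (h i) u w - Mm s (\<Psi> i) (h i) t w"
proof -
 have "AE w in Pc s \<eta>. MA A T V (\<Psi> i) t u w = N u w - N t w"
  using N t unfolding maf_version_def by blast
 then show ?thesis using Mm_incr_AE[OF Psi_mp s t, of i]
  by eventually_elim (simp add: MA_def dM_def h_def set_lebesgue_integral_def)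
qed

text \<open>Square integrability is inherited from \<open>Mm s (\<Psi> i) (h i)\<close>, whose
  increments from \<open>s\<close> agree almost surely with those of \<open>N\<close>; the latter
  starts at zero.\<close>

lemma maf_version_l2m:
 assumes s: "s \<in> {0..T}" "\<eta> \<in> Omega" and N: "maf_version (P s \<eta>) s (MA A T V (\<Psi> i)) N"
 shows "filtered_clock.l2m T (Pc s \<eta>) (Fc (P s \<eta>)) s N"
proof (rule is_mart_l2m[OF s])
 interpret F: filtered_clock W T \<nu> "Pc s \<eta>" "Fc (P s \<eta>)" s by (rule filtered[OF s])
 show m: "is_mart (P s \<eta>) {0..} N" using N unfolding maf_version_def by blast
 show "{s..T} \<subseteq> {0..}" using s by auto
 fix t assume t: "t \<in> {s..T}"
 then have t': "s <= s" "s <= t" "t <= T" by auto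
 have "AE w in Pc s \<eta>. \<forall>t\<in>{0..s}. N t w = 0" using N unfolding maf_version_def by auto
 then have ae: "AE w in Pc s \<eta>. (Mm s (\<Psi> i) (h i) t w - Mm s (\<Psi> i) (h i) s w)^2 = (N t w)^2"
  using maf_version_incr[OF s N t'] by eventually_elim (use s in auto)
 note l = F.l2m_incr(2,3)[OF mp_l2m[OF Psi_mp[of i] s] t']
 have "N t \<in> borel_measurable (Pc s \<eta>)" using m t s unfolding is_mart_def by auto
 then show "integrable (Pc s \<eta>) (%w. (N t w)^2)"
  using integrable_cong_AE[OF _ _ ae] l by auto
qed

text \<open>Because \<open>M N - B\<close> is a martingale, \<open>B T - B t\<close> and the product
  of the increments of \<open>M\<close> and \<open>N\<close> have the same integral over events
  known at \<open>t\<close>. The cross terms \<open>M t (N T - N t)\<close> and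
  \<open>N t (M T - M t)\<close> integrate to zero over such events.\<close>

lemma bracket_density_rep:
 assumes s: "s \<in> {0..T}" "\<eta> \<in> Omega"
  and M: "filtered_clock.l2m T (Pc s \<eta>) (Fc (P s \<eta>)) s M" and N: "filtered_clock.l2m T (Pc s \<eta>) (Fc (P s \<eta>)) s N"
  and k: "filtered_clock.prog T (Fc (P s \<eta>)) s k" and br: "is_bracket_density (P s \<eta>) s T V M N k"
 shows "rep s \<eta> M N k"
proof -
 interpret F: filtered_clock W T \<nu> "Pc s \<eta>" "Fc (P s \<eta>)" s by (rule filtered[OF s])
 let ?Q = "Pc s \<eta>"
 obtain B where B: "is_angle_bracket (P s \<eta>) s T M N B"
  and ae: "AE w in ?Q. set_integrable \<nu> {s..T} (%r. k r w) \<and> (\<forall>t\<in>{s..T}. B t w = (LINT r:{s..t}|\<nu>. k r w))"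
  using br unfolding is_bracket_density_def by blast
 define X where "X t w = M t w * N t w - B t w" for t w
 have X: "is_mart (P s \<eta>) {s..T} X" using B unfolding is_angle_bracket_def X_def by blast
 have Xi: "integrable ?Q (X t)" if "t \<in> {s..T}" for t using X that unfolding is_mart_def by blast
 have main: "integrable ?Q (F.nI t T k) \<and> (\<forall>D\<in>sets (Fc (P s \<eta>) t). (LINT w:D|?Q. F.nI t T k w) = F.cov M N t T D)" if t: "t \<in> {s..T}" for t
 proof -
  have tt: "s <= t" "t <= T" "T <= T" "T \<in> {s..T}" using t by auto
  have aen: "AE w in ?Q. F.nI t T k w = B T w - B t w"
   using ae
  proof eventually_elim
   case (elim w)
   from F.nI_split[of k w t] elim tt(1,2) t tt(4) show ?case by (simp add: F.nI_def)
  qed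
  note a = F.l2m_D[OF M t] F.l2m_D[OF N t] F.l2m_D[OF M tt(4)] F.l2m_D[OF N tt(4)]
  have MN: "integrable ?Q (%w. M t w * N t w)" "integrable ?Q (%w. M T w * N T w)"
   by (rule integrable_mult_L2[OF a(2,6,3,7)], rule integrable_mult_L2[OF a(10,14,11,15)])
  have "integrable ?Q (%w. M u w * N u w - X u w)" if "u = t \<or> u = T" for u
   using that MN Xi[OF t] Xi[OF tt(4)] by auto
  then have Bi: "integrable ?Q (B t)" "integrable ?Q (B T)" unfolding X_def by auto
  have nm: "F.nI t T k \<in> borel_measurable ?Q" by (rule F.jm_nI_meas[OF F.jm_prog[OF k] tt(1,3)])
  have i: "integrable ?Q (F.nI t T k)"
   using integrable_cong_AE[OF nm _ aen] Bi by auto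
  moreover have "(LINT w:D|?Q. F.nI t T k w) = F.cov M N t T D" if D: "D \<in> sets (Fc (P s \<eta>) t)" for D
  proof -
   have z: "(LINT w|?Q. (indicator D w * Y t w) * (Y' T w - Y' t w)) = 0" "integrable ?Q (%w. (indicator D w * Y t w) * (Y' T w - Y' t w))"
    if Y: "F.l2m Y" "F.l2m Y'" for Y Y'
   proof -
    have m: "(%w. indicator D w * Y t w) \<in> borel_measurable (Fc (P s \<eta>) t)" using F.l2m_D(1)[OF Y(1) t] D by auto
    have "integrable ?Q (%w. indicator D w *\<^sub>R (Y t w)^2)" by (rule integrable_mult_indicator[OF F.G_sets[OF D] F.l2m_D(3)[OF Y(1) t]])
    also have "(%w. indicator D w *\<^sub>R (Y t w)^2) = (%w. (indicator D w * Y t w)^2)" by (auto simp: indicator_def)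
    finally have q: "integrable ?Q (%w. (indicator D w * Y t w)^2)" .
    from F.l2m_test[OF Y(2) tt(1-3) m q] show "(LINT w|?Q. (indicator D w * Y t w) * (Y' T w - Y' t w)) = 0" "integrable ?Q (%w. (indicator D w * Y t w) * (Y' T w - Y' t w))" .
   qed
   have c: "integrable ?Q (%w. indicator D w * ((M T w - M t w) * (N T w - N t w)))"
    using integrable_mult_indicator[OF F.G_sets[OF D] F.cov_integrable[OF M N tt(1-3)]] by simp
   have x: "integrable ?Q (%w. indicator D w * X T w)" "integrable ?Q (%w. indicator D w * X t w)"
    using integrable_mult_indicator[OF F.G_sets[OF D] Xi[OF tt(4)]] integrable_mult_indicator[OF F.G_sets[OF D] Xi[OF t]] by auto
   have xe: "(LINT w|?Q. indicator D w * X T w) = (LINT w|?Q. indicator D w * X t w)"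
    using is_mart_set_integral[OF s X t tt(4,2) D] by (simp add: set_lebesgue_integral_def)
   have "(LINT w:D|?Q. F.nI t T k w) = (LINT w|?Q. indicator D w * (B T w - B t w))"
    unfolding set_lebesgue_integral_def
   proof (rule integral_cong_AE)
    show "AE w in ?Q. indicator D w *\<^sub>R F.nI t T k w = indicator D w * (B T w - B t w)" using aen by eventually_elim simp
   qed (use nm Bi F.G_sets[OF D] in auto)
   also have "\<dots> = (LINT w|?Q. indicator D w * ((M T w - M t w) * (N T w - N t w)) + (indicator D w * M t w) * (N T w - N t w)
     + (indicator D w * N t w) * (M T w - M t w) - (indicator D w * X T w - indicator D w * X t w))"
    by (rule arg_cong[where f="integral\<^sup>L ?Q"]) (auto simp: X_def algebra_simps)
   also have "\<dots> = (LINT w|?Q. indicator D w * ((M T w - M t w) * (N T w - N t w)))"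
    by (simp only: Bochner_Integration.integral_diff Bochner_Integration.integral_add Bochner_Integration.integrable_add Bochner_Integration.integrable_diff
     c x z[OF M N] z[OF N M] xe)
   finally show ?thesis by (simp add: F.cov_def set_lebesgue_integral_def)
  qed
  ultimately show ?thesis by blast
 qed
 have "AE w in ?Q. set_integrable \<nu> {s..T} (%r. k r w)" using ae by auto
 then show ?thesis unfolding F.repr_def using k main by blast
qed

text \<open>Once its bracket condition has the form \<open>rep\<close>, the given solution and
  \<open>(Y, Z)\<close> are two instances of \<open>bs\<close> with drivers frozen at themselves, so
  their finite distance must vanish. The estimate at fixed time in \<open>bs_contraction\<close>
  then compares the values at \<open>s\<close>.\<close>

theorem bsde_representation:
 assumes IP: "IP P T V A \<Psi> f \<xi> Y Z" and s: "s \<in> {0..T}" "\<eta> \<in> Omega"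
  and N: "\<And>i. maf_version (P s \<eta>) s (MA A T V (\<Psi> i)) (N i)" and sol: "bsde_sol (P s \<eta>) s T V f \<xi> N Ys Ms"
 shows "AE w in Pc s \<eta>. Ys s w = Y s \<eta>" "is_bracket_density (P s \<eta>) s T V Ms (N i) (Z i)" (is ?g1)
proof -
 interpret F: filtered_clock W T \<nu> "Pc s \<eta>" "Fc (P s \<eta>)" s by (rule filtered[OF s])
 let ?Q = "Pc s \<eta>"
 have s0: "0 <= s" "s \<in> {s..T}" "s <= T" using s by auto
 have sp: "space ?Q = Omega" using P_prob(2)[OF s0(1) s(2)] by simp
 have L: "Luni P T V Y" "\<And>i. Luni P T V (Z i)" using IP unfolding IP_iff by blast+
 note LY = Luni_D[OF L(1) s] and LZ = Luni_D[OF L(2) s]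
 have prog_iff: "F.prog X \<longleftrightarrow> progressive_on {s..T} (Fc (P s \<eta>)) X" for X
  unfolding F.prog_def progressive_on_Icc_iff by (simp add: split_beta')
 obtain k where k: "\<And>i. progressive_on {s..T} (Fc (P s \<eta>)) (k i)" "\<And>i. is_bracket_density (P s \<eta>) s T V Ms (N i) (k i)"
  and eq: "AE w in ?Q. \<forall>t\<in>{s..T}. Ys t w = \<xi> w + (LINT r:{t..T}|\<nu>. f r w (Ys r w) (\<chi> j. k j r w)) - (Ms T w - Ms t w)"
  using sol unfolding bsde_sol_def by blast
 have Ysp: "F.prog Ys" and YsN: "F.N2 Ys < \<infinity>" using sol unfolding bsde_sol_def L2_st_def prog_iff F.N2_def by blast+
 have kp: "F.prog (k i)" for i using k(1) prog_iff by blast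
 have H: "is_H20 (P s \<eta>) s T Ms" using sol unfolding bsde_sol_def by blast
 have lM: "F.l2m Ms" by (rule is_mart_l2m[OF s, of "{0..T}"]) (use H s0 in \<open>auto simp: is_H20_def\<close>)
 have lN: "F.l2m (N i)" for i by (rule maf_version_l2m[OF s N])
 have lP: "F.l2m (Mm s (\<Psi> i) (h i))" for i by (rule mp_l2m[OF Psi_mp s])
 have rk: "F.repr Ms (Mm s (\<Psi> i) (h i)) (k i)" for i
 proof (rule F.repr_cong[OF lM lN lM lP])
  show "F.repr Ms (N i) (k i)" by (rule bracket_density_rep[OF s lM lN kp k(2)])
  show "AE w in ?Q. N i T w - N i t w = Mm s (\<Psi> i) (h i) T w - Mm s (\<Psi> i) (h i) t w" if "t \<in> {s..T}" for t
   by (rule maf_version_incr[OF s N]) (use that in auto)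
 qed simp
 \<comment> \<open>Finite distance requires a square integrable \<open>k\<close>, which
   \<open>bsde_sol\<close> does not state; the bracket bound provides it.\<close>
 have kN: "F.N2 (k i) < \<infinity>" for i
  unfolding F.N2_def by (rule le_less_trans[OF F.repr_sq_bound[OF lM lP mp_brk[OF Psi_mp C0(2) s] C0(1) rk s0(2)]]; (assumption | metis ennreal_less_top infinity_ennreal_def))
 define gs where "gs r w = f r w (Ys r w) (\<chi> j. k j r w)" for r w
 have jm_iff: "F.jm X \<longleftrightarrow> (%(r, w). X r w) \<in> borel_measurable (restrict_space borel {s..T} \<Otimes>\<^sub>M ?Q)" for X
 proof -
  have "sets (\<nu> \<Otimes>\<^sub>M ?Q) = sets (borel \<Otimes>\<^sub>M ?Q)" by (intro sets_pair_measure_cong) auto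
  then have "borel_measurable (\<nu> \<Otimes>\<^sub>M ?Q) = (borel_measurable (borel \<Otimes>\<^sub>M ?Q) :: ((real \<times> 'e path) => real) set)" by (rule measurable_cong_sets) simp
  then show ?thesis unfolding F.jm_def by (subst measurable_indicator_restrict) auto
 qed
 have FoQ: "sets (Fo T) \<subseteq> sets ?Q" using Fo_FF P_prob(3)[OF s0(1) s(2)] by auto
 have gsj: "F.jm gs"
  unfolding jm_iff gs_def by (rule f_measurable[OF sp FoQ s0(1,3) order_refl]) (use F.jm_prog[OF Ysp] F.jm_prog[OF kp] jm_iff in auto)
 define g where "g = Fd Y Z"
 have gL: "Luni P T V g" unfolding g_def by (intro Fd_Luni L)
 note Lg = Luni_D[OF gL s]
 have jY: "F.jm (%r w. Ys r w - Y r w)" by (rule F.jm_arith(2)[OF F.jm_prog[OF Ysp] LY(3)])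
 have jZ: "F.jm (%r w. k i r w - Z i r w)" for i by (rule F.jm_arith(2)[OF F.jm_prog[OF kp] LZ(3)])
 have jg: "F.jm (%r w. gs r w - g r w)" by (rule F.jm_arith(2)[OF gsj Lg(3)])
 have lip: "(gs r w - g r w)^2 <= 2 * K^2 * ((Ys r w - Y r w)^2 + (\<Sum>j\<in>UNIV. (k j r w - Z j r w)^2))"
  if "r \<in> {s..T}" "w \<in> Omega" for r w
 proof -
  have "r \<in> {0..T}" using that s0 by auto
  from Fd_lipschitz[OF this that(2), of Ys k Y Z] show ?thesis by (simp add: gs_def g_def Fd_def)
 qed
 have fin: "dist2 s \<eta> Ys k Y Z < \<infinity>"
  by (rule dist2_finite[OF s F.jm_prog[OF Ysp] YsN LY(3,2) F.jm_prog[OF kp] kN LZ(3,2)])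
 have "F.wn \<gamma> (%r w. gs r w - g r w) <= ennreal (2 * K^2) * dist2 s \<eta> Ys k Y Z"
  unfolding dist2_def by (rule F.wn_lipschitz[OF finite jg jY jZ]) (use lip sp in auto)
 also have "\<dots> < \<infinity>" using fin by (simp add: ennreal_mult_less_top)
 finally have "F.N2 (%r w. gs r w - g r w) < \<infinity>" using F.wn_finite_iff[OF jg] gamma(1) by simp
 from F.N2_lincomb_finite[OF jg this Lg(3,2), of gs 1] have gsN: "F.N2 gs < \<infinity>" by auto
 have "AE w in ?Q. Ys t w = \<xi> w + (LINT r:{t..T}|\<nu>. gs r w) - (Ms T w - Ms t w)" if "t \<in> {s..T}" for t
  using eq by eventually_elim (use that in \<open>simp add: gs_def\<close>)
 then have "bs s \<eta> Ys Ms gs k" unfolding bs_def using Ysp lM gsj gsN rk by blast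
 note b = this IP_bs[OF IP s, folded g_def]
 note q = dist2_quarter[OF s b jY jZ lip]
 have z: "dist2 s \<eta> Ys k Y Z = 0" by (rule ennreal_zero_of_quarter[OF fin q(1)])
 have "F.wn \<gamma> (%r w. gs r w - g r w) = 0" using q(2) z by simp
 then have "F.N2 (%r w. gs r w - g r w) = 0" using F.wn_le_cmult[OF jg order_refl less_imp_le[OF gamma(1)]] by (simp add: F.N2_wn)
 then have n0: "(\<integral>\<^sup>+w. ennreal ((Ys s w - Y s w)^2) \<partial>?Q) = 0" using bs_contraction(2)[OF s b gamma(1) s0(2)] by simp
 have "(%w. Ys s w - Y s w) \<in> borel_measurable ?Q" by (rule F.jm_section[OF jY s0(2)])
 then have "AE w in ?Q. ennreal ((Ys s w - Y s w)^2) = 0" using n0 by (subst (asm) nn_integral_0_iff_AE) auto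
 moreover have "AE w in P s \<eta>. Y s w = Y s \<eta>" by (rule AE_determined[OF s0(1) s(2) Luni_sec[OF L(1) s(1)]])
 then have "AE w in ?Q. Y s w = Y s \<eta>" by (rule AE_completion)
 ultimately show "AE w in ?Q. Ys s w = Y s \<eta>" by eventually_elim auto
 \<comment> \<open>The bracket process of the given solution is kept, and only its density is
   exchanged: \<open>k i\<close> and \<open>Z i\<close> have the same time integrals almost
   surely.\<close>
 obtain B where B: "is_angle_bracket (P s \<eta>) s T Ms (N i) B"
  and ae: "AE w in ?Q. set_integrable \<nu> {s..T} (%r. k i r w) \<and> (\<forall>t\<in>{s..T}. B t w = (LINT r:{s..t}|\<nu>. k i r w))"
  using k(2)[of i] unfolding is_bracket_density_def by blast
 have "AE w in ?Q. set_integrable \<nu> {s..T} (%r. Z i r w) \<and> (\<forall>t\<in>{s..T}. B t w = (LINT r:{s..t}|\<nu>. Z i r w))"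
  using ae F.nI_AE_cong[OF F.jm_prog[OF kp] LZ(3) dist2_zero(2)[OF s z jY jZ], of i]
  by eventually_elim (auto simp: F.nI_def)
 then show ?g1 unfolding is_bracket_density_def using B by blast
qed

end

theorem theorem4p19:
  fixes P :: "real \<Rightarrow> ('e::polish_space) path \<Rightarrow> 'e path measure"
    and T :: real and V :: "real \<Rightarrow> real"
    and DA :: "'e proc set" and A :: "'e proc \<Rightarrow> 'e proc"
    and \<Psi> :: "'d::finite \<Rightarrow> 'e proc"
    and f :: "real \<Rightarrow> 'e path \<Rightarrow> real \<Rightarrow> real^'d \<Rightarrow> real"
    and \<xi> :: "'e path \<Rightarrow> real" and K :: real
  assumes "T > 0"
    and "continuous_on {0..T} V" and "mono_on {0..T} V" and "\<forall>t\<in>{0..T}. V t \<ge> 0"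
    and "canonical_class P" and "progressive_class P" and "right_cont_cond_class P"
    and "weak_generator P T V DA A"
    and "\<forall>i. \<Psi> i \<in> DA \<and> Luni P T V (\<Psi> i) \<and> Luni P T V (A (\<Psi> i)) \<and>
             (\<lambda>t \<omega>. \<Psi> i t \<omega> * \<Psi> i t \<omega>) \<in> DA \<and>
             (\<exists>C. \<forall>t\<ge>0. \<forall>\<omega>\<in>Omega. \<bar>Gamma A (\<Psi> i) (\<Psi> i) t \<omega>\<bar> \<le> C)"
    and "hypB P T V f \<xi> K"
  shows "(\<exists>Y Z. IP P T V A \<Psi> f \<xi> Y Z) \<and>
         (\<forall>Y Z Y' Z'. IP P T V A \<Psi> f \<xi> Y Z \<longrightarrow> IP P T V A \<Psi> f \<xi> Y' Z' \<longrightarrow>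
            (\<forall>t\<in>{0..T}. \<forall>\<omega>\<in>Omega. Y t \<omega> = Y' t \<omega>) \<and> (\<forall>i. qs_eq P T V (Z i) (Z' i))) \<and>
         (\<exists>Y. decoupled_mild P T V A \<Psi> f \<xi> Y) \<and>
         (\<forall>Y Y'. decoupled_mild P T V A \<Psi> f \<xi> Y \<longrightarrow> decoupled_mild P T V A \<Psi> f \<xi> Y' \<longrightarrow>
            (\<forall>t\<in>{0..T}. \<forall>\<omega>\<in>Omega. Y t \<omega> = Y' t \<omega>)) \<and>
         (\<forall>Y Z. IP P T V A \<Psi> f \<xi> Y Z \<longrightarrow>
            (\<forall>s\<in>{0..T}. \<forall>\<eta>\<in>Omega. \<forall>N Ys Ms.
               (\<forall>i. maf_version (P s \<eta>) s (MA A T V (\<Psi> i)) (N i)) \<longrightarrow>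
               bsde_sol (P s \<eta>) s T V f \<xi> N Ys Ms \<longrightarrow>
               (AE \<omega> in completion (P s \<eta>). Ys s \<omega> = Y s \<eta>) \<and>
               (\<forall>i. is_bracket_density (P s \<eta>) s T V Ms (N i) (Z i))))"
proof -
  interpret pd_class P T V by unfold_locales (use assms in auto)
  interpret pd_bsde P T V \<xi> DA A \<Psi> f K
    by unfold_locales (use assms in \<open>auto simp: hypB_def\<close>)
  show ?thesis
  proof (intro conjI allI impI ballI)
    show "\<exists>Y Z. IP P T V A \<Psi> f \<xi> Y Z" by (rule IP_exists)
    then show "\<exists>Y. decoupled_mild P T V A \<Psi> f \<xi> Y" unfolding decoupled_mild_def .
  next
    fix Y Z Y' Z' t and \<omega> :: "'e path" assume "IP P T V A \<Psi> f \<xi> Y Z" "IP P T V A \<Psi> f \<xi> Y' Z'" "t \<in> {0..T}" "\<omega> \<in> Omega"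
    then show "Y t \<omega> = Y' t \<omega>" by (rule IP_unique(1))
  next
    fix Y Z Y' Z' i assume "IP P T V A \<Psi> f \<xi> Y Z" "IP P T V A \<Psi> f \<xi> Y' Z'"
    then show "qs_eq P T V (Z i) (Z' i)" by (rule IP_unique(2))
  next
    fix Y Y' t and \<omega> :: "'e path" assume "decoupled_mild P T V A \<Psi> f \<xi> Y" "decoupled_mild P T V A \<Psi> f \<xi> Y'" "t \<in> {0..T}" "\<omega> \<in> Omega"
    then show "Y t \<omega> = Y' t \<omega>" unfolding decoupled_mild_def using IP_unique(1) by blast
  next
    fix Y Z s and \<eta> :: "'e path" and N Ys Ms
    assume a: "IP P T V A \<Psi> f \<xi> Y Z" "s \<in> {0..T}" "\<eta> \<in> Omega" "\<forall>i. maf_version (P s \<eta>) s (MA A T V (\<Psi> i)) (N i)"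
      "bsde_sol (P s \<eta>) s T V f \<xi> N Ys Ms"
    show "AE \<omega> in completion (P s \<eta>). Ys s \<omega> = Y s \<eta>" by (rule bsde_representation(1)[OF a(1-3) _ a(5)]) (use a(4) in blast)
    show "is_bracket_density (P s \<eta>) s T V Ms (N i) (Z i)" for i by (rule bsde_representation(2)[OF a(1-3) _ a(5)]) (use a(4) in blast)
  qed
qed

end
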